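(* Let $n\ge2$, $\mathbf t=(t_0,u_0,t,t_n,u_n)\in\mathbb C^5$, and put $$\mu(\mathbf t)=(\mu_0,\mu_1,\mu_2,\mu_3,\mu_4)=\big(\tfrac12-t_0-u_0-t_n-u_n,\ 2t_0,\ 2u_0,\ 2t_n,\ 2u_n\big).$$ Let $\gamma_1,\dots,\gamma_4\in\mathbb C$ with $\gamma_1+\gamma_2+\gamma_3+\gamma_4=\mu_0$, and let $B(\mu(\mathbf t),-t)$ be the rational generalized double affine Hecke algebra of rank $n$ of type $\widetilde D_4$ (defined in the context, with these $\gamma_k$ and $\nu=-t$). Write $V_l=V_{1,l}$ ($l\in[1,4]$) and $s_i=s_{i,i+1}$ ($i\in[1,n-1]$); these elements generate $B(\mu(\mathbf t),-t)$. Then the assignments $$\varphi(s_i)=T_i\ (i\in[1,n-1]),\quad \varphi(V_1)=T_0+\gamma_1+t_0,\quad \varphi(V_2)=T_0^\vee+\gamma_2+u_0,$$ $$\varphi(V_3)=\Xi_{1,n}+\gamma_3+t_n,\quad \varphi(V_4)=\Xi_{1,n}^\vee+\gamma_4+u_n$$ extend uniquely to an algebra isomorphism $\varphi:B(\mu(\mathbf t),-t)\to\mathcal H(\mathbf t)$.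
   Context: Notation: $[m,n]=\{m,m+1,\dots,n\}$. The algebra $B(\mu,\nu)$: let $\nu\in\mathbb C$, $\mu=(\mu_0,\mu_1,\mu_2,\mu_3,\mu_4)\in\mathbb C^5$ and $\gamma_1,\dots,\gamma_4\in\mathbb C$ with $\sum_{k=1}^4\gamma_k=\mu_0$. $B(\mu,\nu)$ is the unital associative complex algebra generated by $V_{i,k}$ ($i\in[1,n]$, $k\in[1,4]$) and the symmetric group $\mathcal S_n$ (with its group relations; $s_{ij}$ is the transposition $i\leftrightarrow j$) with the relations, for $i,j,k\in[1,n]$, $i\ne j$, $l,m\in[1,4]$: $s_{ij}V_{i,l}=V_{j,l}s_{ij}$; $s_{ij}V_{k,l}=V_{k,l}s_{ij}$ if $k\ne i,j$; $(V_{k,l}-\gamma_l)(V_{k,l}-\gamma_l-\mu_l)=0$; $V_{i,1}+V_{i,2}+V_{i,3}+V_{i,4}=\nu\sum_{j\ne i}s_{ij}$; $[V_{i,l},V_{j,l}]=\nu(V_{i,l}-V_{j,l})s_{ij}$; $[V_{i,l},V_{j,m}]=0$ if $l\ne m$. The algebra $\mathcal H(\mathbf t)$: $W$ is the affine Weyl group of type $\widetilde C_n$: the Coxeter group with generators $s_0,\dots,s_n$ and relations $s_i^2=1$; $s_is_{i+1}s_is_{i+1}=s_{i+1}s_is_{i+1}s_i$ for $i=0,n-1$; $s_is_{i+1}s_i=s_{i+1}s_is_{i+1}$ for $i\in[1,n-2]$; $s_is_j=s_js_i$ for $|i-j|\ge2$. $W$ acts on $\mathbb C^n$ by $s_0x=(1-x_1,x_2,\dots,x_n)$,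 $s_i$ interchanges $x_i$ and $x_{i+1}$ ($i\in[1,n-1]$), $s_nx=(x_1,\dots,x_{n-1},-x_n)$, and on $\mathcal P=\mathbb C[x_1,\dots,x_n]$ by $(wp)(x)=p(w^{-1}x)$. Put $a_0(x)=1-2x_1$, $a_i(x)=x_i-x_{i+1}$ ($i\in[1,n-1]$), $a_n(x)=2x_n$, $a_0^\vee(x)=\tfrac12-x_1$, $a_n^\vee(x)=x_n$; $k_0=2t_0+2u_0$, $k_i=t$ for $i\in[1,n-1]$, $k_n=2t_n+2u_n$. The degenerate (trigonometric) double affine Hecke algebra $\mathfrak H(\mathbf k)$ is the unital associative complex algebra generated by the group algebra $\mathbb C[W]$ (with generators $r_0,\dots,r_n$ corresponding to $s_0,\dots,s_n$) and $\mathbb C[X_1,\dots,X_n]$, such that $\mathfrak H(\mathbf k)\simeq\mathbb C[W]\otimes\mathbb C[X_1,\dots,X_n]$ as a vector space via multiplication, with cross-relations $r_ip(X)-(s_ip)(X)r_i=\frac{k_i}{a_i(X)}\big((s_ip)(X)-p(X)\big)$ for $i\in[0,n]$, $p\in\mathcal P$. $\mathcal H(\mathbf t)$ is the subalgebra of $\mathfrak H(\mathbf k)$ generated by $X_1,\dots,X_n$, $T_i=r_i$ ($i\in[1,n-1]$) and $T_i=t_i+\tfrac12\big(t_i-u_i+a_i^\vee(X)\big)(r_i-1)$ for $i=0,n$. In $\mathcal H(\mathbf t)$ put $T_0^\vee=X_1-\tfrac12-T_0$, $T_n^\vee=-X_n-T_n$, $\Xi_{1,n}=T_1\cdots T_{n-1}T_nT_{n-1}\cdots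 T_1$, $\Xi_{1,n}^\vee=T_1\cdots T_{n-1}T_n^\vee T_{n-1}\cdots T_1$. *)

theory Defs
  imports
    Complex_Main
    "HOL-Combinatorics.Permutations"
    "HOL-Library.Poly_Mapping"
    "HOL-Algebra.Module"
    "HOL-Algebra.QuotRing"
begin

section \<open>Unital associative complex algebras\<close>

definition complex_field :: "complex ring" where
  "complex_field = \<lparr>carrier = UNIV, mult = (*), one = 1, zero = 0, add = (+)\<rparr>"

text \<open>The library locale \<open>algebra\<close> requires commutativity; this is the noncommutative analogue.\<close>

locale calgebra = module complex_field A + ring A for A :: "(complex, 'a) module" (structure) +
  assumes smult_mult_left:
      "\<lbrakk>x \<in> carrier A; y \<in> carrier A\<rbrakk> \<Longrightarrow> (c \<odot> x) \<otimes> y = c \<odot> (x \<otimes> y)"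
    and smult_mult_right:
      "\<lbrakk>x \<in> carrier A; y \<in> carrier A\<rbrakk> \<Longrightarrow> x \<otimes> (c \<odot> y) = c \<odot> (x \<otimes> y)"

definition alg_hom :: "(complex, 'a) module \<Rightarrow> (complex, 'b) module \<Rightarrow> ('a \<Rightarrow> 'b) set" where
  "alg_hom A B = {h \<in> ring_hom A B. \<forall>c. \<forall>x\<in>carrier A. h (c \<odot>\<^bsub>A\<^esub> x) = c \<odot>\<^bsub>B\<^esub> h x}"

definition alg_iso :: "(complex, 'a) module \<Rightarrow> (complex, 'b) module \<Rightarrow> ('a \<Rightarrow> 'b) set" where
  "alg_iso A B = {h \<in> alg_hom A B. bij_betw h (carrier A) (carrier B)}"

text \<open>Carrier of the unital subalgebra generated by \<open>S\<close>.\<close>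

inductive_set alg_gen :: "(complex, 'a) module \<Rightarrow> 'a set \<Rightarrow> 'a set"
  for A :: "(complex, 'a) module" and S :: "'a set" where
  one: "\<one>\<^bsub>A\<^esub> \<in> alg_gen A S"
| incl: "x \<in> S \<Longrightarrow> x \<in> alg_gen A S"
| add: "\<lbrakk>x \<in> alg_gen A S; y \<in> alg_gen A S\<rbrakk> \<Longrightarrow> x \<oplus>\<^bsub>A\<^esub> y \<in> alg_gen A S"
| mult: "\<lbrakk>x \<in> alg_gen A S; y \<in> alg_gen A S\<rbrakk> \<Longrightarrow> x \<otimes>\<^bsub>A\<^esub> y \<in> alg_gen A S"
| smult: "x \<in> alg_gen A S \<Longrightarrow> c \<odot>\<^bsub>A\<^esub> x \<in> alg_gen A S"

text \<open>Product of a list of elements, from left to right.\<close>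

definition mprod :: "(complex, 'a) module \<Rightarrow> 'a list \<Rightarrow> 'a" where
  "mprod A xs = foldr (\<lambda>x y. x \<otimes>\<^bsub>A\<^esub> y) xs \<one>\<^bsub>A\<^esub>"

text \<open>The complex vector space with basis \<open>S\<close>.\<close>

definition finsupp :: "'b set \<Rightarrow> ('b \<Rightarrow> complex) set" where
  "finsupp S = {f. finite {x. f x \<noteq> 0} \<and> {x. f x \<noteq> 0} \<subseteq> S}"


section \<open>Algebras given by generators and relations\<close>

text \<open>The free algebra on \<open>S\<close>: its basis are the words in \<open>S\<close>, multiplied by concatenation.\<close>

definition free_alg :: "'g set \<Rightarrow> (complex, 'g list \<Rightarrow> complex) module" where
  "free_alg S =
    \<lparr>carrier = finsupp (lists S),
     mult = (\<lambda>f g w. \<Sum>k\<le>length w. f (take k w) * g (drop k w)),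
     one = (\<lambda>w. if w = [] then 1 else 0),
     zero = (\<lambda>w. 0),
     add = (\<lambda>f g w. f w + g w),
     smult = (\<lambda>c f w. c * f w)\<rparr>"

definition fgen :: "'g \<Rightarrow> 'g list \<Rightarrow> complex" where
  "fgen x = (\<lambda>w. if w = [x] then 1 else 0)"

definition quot_alg :: "(complex, 'a) module \<Rightarrow> 'a set \<Rightarrow> (complex, 'a set) module" where
  "quot_alg A I = ring.extend (A Quot I)
     (module.fields (\<lambda>c X. \<Union>x\<in>X. I +>\<^bsub>A\<^esub> (c \<odot>\<^bsub>A\<^esub> x)))"

text \<open>A relation \<open>a = b\<close> is given as the pair \<open>(a, b)\<close>.\<close>

definition rel_ideal :: "'g set \<Rightarrow> (('g list \<Rightarrow> complex) \<times> ('g list \<Rightarrow> complex)) set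
    \<Rightarrow> ('g list \<Rightarrow> complex) set" where
  "rel_ideal S R = Idl\<^bsub>free_alg S\<^esub> {a \<ominus>\<^bsub>free_alg S\<^esub> b | a b. (a, b) \<in> R}"

definition presented_alg :: "'g set \<Rightarrow> (('g list \<Rightarrow> complex) \<times> ('g list \<Rightarrow> complex)) set
    \<Rightarrow> (complex, ('g list \<Rightarrow> complex) set) module" where
  "presented_alg S R = quot_alg (free_alg S) (rel_ideal S R)"

definition presented_gen :: "'g set \<Rightarrow> (('g list \<Rightarrow> complex) \<times> ('g list \<Rightarrow> complex)) set
    \<Rightarrow> 'g \<Rightarrow> ('g list \<Rightarrow> complex) set" where
  "presented_gen S R x = rel_ideal S R +>\<^bsub>free_alg S\<^esub> fgen x"


section \<open>The algebra \<open>B(\<mu>,\<nu>)\<close>\<close>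

text \<open>\<open>GV i k\<close> is the generator \<open>V\<^sub>i\<^sub>,\<^sub>k\<close>; \<open>GS \<sigma>\<close> is the group element \<open>\<sigma>\<close> of the symmetric group.\<close>

datatype Bgen = GV nat nat | GS "nat \<Rightarrow> nat"

definition B_gens :: "nat \<Rightarrow> Bgen set" where
  "B_gens n = {GV i k | i k. i \<in> {1..n} \<and> k \<in> {1..4}} \<union> {GS \<sigma> | \<sigma>. \<sigma> permutes {1..n}}"

text \<open>The entry \<open>\<mu> 0\<close> is not used: it enters only through the condition \<open>\<gamma> 1 + \<dots> + \<gamma> 4 = \<mu> 0\<close>.\<close>

definition B_rels :: "nat \<Rightarrow> (nat \<Rightarrow> complex) \<Rightarrow> complex \<Rightarrow> (nat \<Rightarrow> complex)
    \<Rightarrow> ((Bgen list \<Rightarrow> complex) \<times> (Bgen list \<Rightarrow> complex)) set" where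
  "B_rels n \<mu> \<nu> \<gamma> =
    (let F = free_alg (B_gens n);
         V = (\<lambda>i l. fgen (GV i l));
         s = (\<lambda>i j. fgen (GS (transpose i j)));
         comm = (\<lambda>x y. x \<otimes>\<^bsub>F\<^esub> y \<ominus>\<^bsub>F\<^esub> y \<otimes>\<^bsub>F\<^esub> x)
     in {(fgen (GS id), \<one>\<^bsub>F\<^esub>)}
      \<union> {(fgen (GS \<sigma>) \<otimes>\<^bsub>F\<^esub> fgen (GS \<tau>), fgen (GS (\<sigma> \<circ> \<tau>))) | \<sigma> \<tau>.
           \<sigma> permutes {1..n} \<and> \<tau> permutes {1..n}}
      \<union> {(s i j \<otimes>\<^bsub>F\<^esub> V i l, V j l \<otimes>\<^bsub>F\<^esub> s i j) | i j l.
           i \<in> {1..n} \<and> j \<in> {1..n} \<and> i \<noteq> j \<and> l \<in> {1..4}}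
      \<union> {(s i j \<otimes>\<^bsub>F\<^esub> V k l, V k l \<otimes>\<^bsub>F\<^esub> s i j) | i j k l.
           i \<in> {1..n} \<and> j \<in> {1..n} \<and> k \<in> {1..n} \<and> i \<noteq> j \<and> k \<noteq> i \<and> k \<noteq> j \<and> l \<in> {1..4}}
      \<union> {((V k l \<ominus>\<^bsub>F\<^esub> \<gamma> l \<odot>\<^bsub>F\<^esub> \<one>\<^bsub>F\<^esub>) \<otimes>\<^bsub>F\<^esub> (V k l \<ominus>\<^bsub>F\<^esub> (\<gamma> l + \<mu> l) \<odot>\<^bsub>F\<^esub> \<one>\<^bsub>F\<^esub>), \<zero>\<^bsub>F\<^esub>) | k l.
           k \<in> {1..n} \<and> l \<in> {1..4}}
      \<union> {(V i 1 \<oplus>\<^bsub>F\<^esub> V i 2 \<oplus>\<^bsub>F\<^esub> V i 3 \<oplus>\<^bsub>F\<^esub> V i 4, \<nu> \<odot>\<^bsub>F\<^esub> (\<Oplus>\<^bsub>F\<^esub>j\<in>{1..n} - {i}. s i j)) | i.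
           i \<in> {1..n}}
      \<union> {(comm (V i l) (V j l), \<nu> \<odot>\<^bsub>F\<^esub> ((V i l \<ominus>\<^bsub>F\<^esub> V j l) \<otimes>\<^bsub>F\<^esub> s i j)) | i j l.
           i \<in> {1..n} \<and> j \<in> {1..n} \<and> i \<noteq> j \<and> l \<in> {1..4}}
      \<union> {(comm (V i l) (V j m), \<zero>\<^bsub>F\<^esub>) | i j l m.
           i \<in> {1..n} \<and> j \<in> {1..n} \<and> i \<noteq> j \<and> l \<in> {1..4} \<and> m \<in> {1..4} \<and> l \<noteq> m})"

definition B_alg :: "nat \<Rightarrow> (nat \<Rightarrow> complex) \<Rightarrow> complex \<Rightarrow> (nat \<Rightarrow> complex)
    \<Rightarrow> (complex, (Bgen list \<Rightarrow> complex) set) module" where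
  "B_alg n \<mu> \<nu> \<gamma> = presented_alg (B_gens n) (B_rels n \<mu> \<nu> \<gamma>)"

definition B_V :: "nat \<Rightarrow> (nat \<Rightarrow> complex) \<Rightarrow> complex \<Rightarrow> (nat \<Rightarrow> complex)
    \<Rightarrow> nat \<Rightarrow> nat \<Rightarrow> (Bgen list \<Rightarrow> complex) set" where
  "B_V n \<mu> \<nu> \<gamma> i l = presented_gen (B_gens n) (B_rels n \<mu> \<nu> \<gamma>) (GV i l)"

definition B_s :: "nat \<Rightarrow> (nat \<Rightarrow> complex) \<Rightarrow> complex \<Rightarrow> (nat \<Rightarrow> complex)
    \<Rightarrow> nat \<Rightarrow> nat \<Rightarrow> (Bgen list \<Rightarrow> complex) set" where
  "B_s n \<mu> \<nu> \<gamma> i j = presented_gen (B_gens n) (B_rels n \<mu> \<nu> \<gamma>) (GS (transpose i j))"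


section \<open>The affine Weyl group and its action on polynomials\<close>

text \<open>
  \<open>W\<close> as a quotient of the monoid of words in \<open>0, \<dots>, n\<close>; because of the relations
  \<open>s\<^sub>i\<^sup>2 = 1\<close> the monoid and the group with this presentation coincide.
\<close>

definition coxeter_rels :: "nat \<Rightarrow> (nat list \<times> nat list) set" where
  "coxeter_rels n =
      {([i, i], []) | i. i \<le> n}
    \<union> {([i, i+1, i, i+1], [i+1, i, i+1, i]) | i. i = 0 \<or> i = n - 1}
    \<union> {([i, i+1, i], [i+1, i, i+1]) | i. 1 \<le> i \<and> i + 2 \<le> n}
    \<union> {([i, j], [j, i]) | i j. i \<le> n \<and> j \<le> n \<and> (i + 2 \<le> j \<or> j + 2 \<le> i)}"

definition word_step :: "nat \<Rightarrow> (nat list \<times> nat list) set" where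
  "word_step n = {(a @ u @ b, a @ v @ b) | a b u v.
     a \<in> lists {0..n} \<and> b \<in> lists {0..n} \<and> (u, v) \<in> coxeter_rels n}"

definition W_group :: "nat \<Rightarrow> nat list set set" where
  "W_group n = lists {0..n} // (word_step n \<union> (word_step n)\<inverse>)\<^sup>*"

text \<open>Polynomials in the indeterminates with indices \<open>1, \<dots>, n\<close>; monomials are exponent maps.\<close>

type_synonym cpoly = "(nat \<Rightarrow>\<^sub>0 nat) \<Rightarrow>\<^sub>0 complex"

definition monoms :: "nat \<Rightarrow> (nat \<Rightarrow>\<^sub>0 nat) set" where
  "monoms n = {m. Poly_Mapping.keys m \<subseteq> {1..n}}"

definition polys :: "nat \<Rightarrow> cpoly set" where
  "polys n = {p. Poly_Mapping.keys p \<subseteq> monoms n}"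

definition pconst :: "complex \<Rightarrow> cpoly" where
  "pconst c = Poly_Mapping.single 0 c"

definition pvar :: "nat \<Rightarrow> cpoly" where
  "pvar j = Poly_Mapping.single (Poly_Mapping.single j 1) 1"

definition psubst :: "(nat \<Rightarrow> cpoly) \<Rightarrow> cpoly \<Rightarrow> cpoly" where
  "psubst f p = (\<Sum>m\<in>Poly_Mapping.keys p. pconst (Poly_Mapping.lookup p m) *
     (\<Prod>j\<in>Poly_Mapping.keys m. f j ^ Poly_Mapping.lookup m j))"

text \<open>The action of \<open>s\<^sub>i\<close> on coordinates; used for points (over \<open>complex\<close>) and for the
  tuple of coordinate functions (over \<open>cpoly\<close>).\<close>

definition W_refl :: "nat \<Rightarrow> nat \<Rightarrow> (nat \<Rightarrow> 'b::comm_ring_1) \<Rightarrow> (nat \<Rightarrow> 'b)" where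
  "W_refl n i x =
    (if i = 0 then x(1 := 1 - x 1)
     else if i < n then x(i := x (i+1), i+1 := x i)
     else x(n := - x n))"

text \<open>\<open>(s\<^sub>i p)(x) = p(s\<^sub>i\<inverse> x) = p(s\<^sub>i x)\<close>, since \<open>s\<^sub>i\<close> is an involution.\<close>

definition W_act :: "nat \<Rightarrow> nat \<Rightarrow> cpoly \<Rightarrow> cpoly" where
  "W_act n i p = psubst (W_refl n i pvar) p"

definition aff_root :: "nat \<Rightarrow> nat \<Rightarrow> cpoly" where
  "aff_root n i =
    (if i = 0 then 1 - 2 * pvar 1
     else if i < n then pvar i - pvar (i+1)
     else 2 * pvar n)"

text \<open>Only the cases \<open>i = 0\<close> and \<open>i = n\<close> are used.\<close>

definition coroot :: "nat \<Rightarrow> nat \<Rightarrow> cpoly" where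
  "coroot n i = (if i = 0 then pconst (1/2) - pvar 1 else pvar n)"


section \<open>The trigonometric double affine Hecke algebra\<close>

definition meval :: "nat \<Rightarrow> (complex, 'a) module \<Rightarrow> (nat \<Rightarrow> 'a) \<Rightarrow> (nat \<Rightarrow>\<^sub>0 nat) \<Rightarrow> 'a" where
  "meval n A X m = mprod A (map (\<lambda>j. X j [^]\<^bsub>A\<^esub> Poly_Mapping.lookup m j) [1..<Suc n])"

text \<open>\<open>peval n A X p\<close> is \<open>p(X)\<close>, for commuting \<open>X\<^sub>1, \<dots>, X\<^sub>n\<close>.\<close>

definition peval :: "nat \<Rightarrow> (complex, 'a) module \<Rightarrow> (nat \<Rightarrow> 'a) \<Rightarrow> cpoly \<Rightarrow> 'a" where
  "peval n A X p =
    (\<Oplus>\<^bsub>A\<^esub>m\<in>Poly_Mapping.keys p. Poly_Mapping.lookup p m \<odot>\<^bsub>A\<^esub> meval n A X m)"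

text \<open>The image of a group element; the choice of the word is immaterial if \<open>r\<close> satisfies the
  Coxeter relations.\<close>

definition weval :: "(complex, 'a) module \<Rightarrow> (nat \<Rightarrow> 'a) \<Rightarrow> nat list set \<Rightarrow> 'a" where
  "weval A r w = mprod A (map r (SOME u. u \<in> w))"

text \<open>
  The multiplication map from \<open>\<complex>[W] \<otimes> \<complex>[X\<^sub>1, \<dots>, X\<^sub>n]\<close> to \<open>A\<close>, the tensor product being the
  vector space with basis the pairs of a group element and a monomial.
\<close>

definition mult_map :: "nat \<Rightarrow> (complex, 'a) module \<Rightarrow> (nat \<Rightarrow> 'a) \<Rightarrow> (nat \<Rightarrow> 'a)
    \<Rightarrow> (nat list set \<times> (nat \<Rightarrow>\<^sub>0 nat) \<Rightarrow> complex) \<Rightarrow> 'a" where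
  "mult_map n A r X c =
    (\<Oplus>\<^bsub>A\<^esub>z\<in>{z. c z \<noteq> 0}. c z \<odot>\<^bsub>A\<^esub> (weval A r (fst z) \<otimes>\<^bsub>A\<^esub> meval n A X (snd z)))"

text \<open>
  \<open>A\<close>, with the elements \<open>r\<^sub>0, \<dots>, r\<^sub>n\<close> and \<open>X\<^sub>1, \<dots>, X\<^sub>n\<close>, is the trigonometric double affine
  Hecke algebra with parameters \<open>k\<close>. These axioms determine \<open>A\<close> up to unique isomorphism;
  generation by \<open>\<complex>[W]\<close> and \<open>\<complex>[X]\<close> is contained in the surjectivity of the multiplication map.
  In the cross relation, \<open>q\<close> is the polynomial \<open>((s\<^sub>i p) - p) / a\<^sub>i\<close>.
\<close>

locale trig_daha = calgebra A for A :: "(complex, 'a) module" (structure) +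
  fixes n :: nat and k :: "nat \<Rightarrow> complex" and r :: "nat \<Rightarrow> 'a" and X :: "nat \<Rightarrow> 'a"
  assumes r_closed: "i \<le> n \<Longrightarrow> r i \<in> carrier A"
    and X_closed: "j \<in> {1..n} \<Longrightarrow> X j \<in> carrier A"
    and coxeter: "(u, v) \<in> coxeter_rels n \<Longrightarrow> mprod A (map r u) = mprod A (map r v)"
    and X_comm: "\<lbrakk>i \<in> {1..n}; j \<in> {1..n}\<rbrakk> \<Longrightarrow> X i \<otimes> X j = X j \<otimes> X i"
    and pbw: "bij_betw (mult_map n A r X) (finsupp (W_group n \<times> monoms n)) (carrier A)"
    and cross: "\<lbrakk>i \<le> n; p \<in> polys n; q \<in> polys n; aff_root n i * q = W_act n i p - p\<rbrakk> \<Longrightarrow>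
      r i \<otimes> peval n A X p \<ominus> peval n A X (W_act n i p) \<otimes> r i = k i \<odot> peval n A X q"


section \<open>The algebra \<open>\<H>(t)\<close>\<close>

definition k_par :: "nat \<Rightarrow> complex \<Rightarrow> complex \<Rightarrow> complex \<Rightarrow> complex \<Rightarrow> complex \<Rightarrow> nat \<Rightarrow> complex" where
  "k_par n t0 u0 t tn un i =
    (if i = 0 then 2 * t0 + 2 * u0 else if i < n then t else 2 * tn + 2 * un)"

definition T_elt :: "nat \<Rightarrow> complex \<Rightarrow> complex \<Rightarrow> complex \<Rightarrow> complex
    \<Rightarrow> (complex, 'a) module \<Rightarrow> (nat \<Rightarrow> 'a) \<Rightarrow> (nat \<Rightarrow> 'a) \<Rightarrow> nat \<Rightarrow> 'a" where
  "T_elt n t0 u0 tn un A r X i =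
    (if 0 < i \<and> i < n then r i
     else let ti = (if i = 0 then t0 else tn); ui = (if i = 0 then u0 else un) in
       ti \<odot>\<^bsub>A\<^esub> \<one>\<^bsub>A\<^esub> \<oplus>\<^bsub>A\<^esub>
       (1/2) \<odot>\<^bsub>A\<^esub> (((ti - ui) \<odot>\<^bsub>A\<^esub> \<one>\<^bsub>A\<^esub> \<oplus>\<^bsub>A\<^esub> peval n A X (coroot n i)) \<otimes>\<^bsub>A\<^esub> (r i \<ominus>\<^bsub>A\<^esub> \<one>\<^bsub>A\<^esub>)))"

definition H_alg :: "nat \<Rightarrow> complex \<Rightarrow> complex \<Rightarrow> complex \<Rightarrow> complex
    \<Rightarrow> (complex, 'a) module \<Rightarrow> (nat \<Rightarrow> 'a) \<Rightarrow> (nat \<Rightarrow> 'a) \<Rightarrow> (complex, 'a) module" where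
  "H_alg n t0 u0 tn un A r X =
    A\<lparr>carrier := alg_gen A (X ` {1..n} \<union> T_elt n t0 u0 tn un A r X ` {0..n})\<rparr>"

definition T0_dual :: "nat \<Rightarrow> complex \<Rightarrow> complex \<Rightarrow> complex \<Rightarrow> complex
    \<Rightarrow> (complex, 'a) module \<Rightarrow> (nat \<Rightarrow> 'a) \<Rightarrow> (nat \<Rightarrow> 'a) \<Rightarrow> 'a" where
  "T0_dual n t0 u0 tn un A r X =
    X 1 \<ominus>\<^bsub>A\<^esub> (1/2) \<odot>\<^bsub>A\<^esub> \<one>\<^bsub>A\<^esub> \<ominus>\<^bsub>A\<^esub> T_elt n t0 u0 tn un A r X 0"

definition Tn_dual :: "nat \<Rightarrow> complex \<Rightarrow> complex \<Rightarrow> complex \<Rightarrow> complex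
    \<Rightarrow> (complex, 'a) module \<Rightarrow> (nat \<Rightarrow> 'a) \<Rightarrow> (nat \<Rightarrow> 'a) \<Rightarrow> 'a" where
  "Tn_dual n t0 u0 tn un A r X =
    (\<ominus>\<^bsub>A\<^esub> X n) \<ominus>\<^bsub>A\<^esub> T_elt n t0 u0 tn un A r X n"

text \<open>\<open>T\<^sub>1 \<cdots> T\<^sub>n\<^sub>-\<^sub>1 y T\<^sub>n\<^sub>-\<^sub>1 \<cdots> T\<^sub>1\<close>\<close>

definition T_sandwich :: "nat \<Rightarrow> (complex, 'a) module \<Rightarrow> (nat \<Rightarrow> 'a) \<Rightarrow> 'a \<Rightarrow> 'a" where
  "T_sandwich n A T y = mprod A (map T [1..<n] @ [y] @ map T (rev [1..<n]))"

definition Xi :: "nat \<Rightarrow> complex \<Rightarrow> complex \<Rightarrow> complex \<Rightarrow> complex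
    \<Rightarrow> (complex, 'a) module \<Rightarrow> (nat \<Rightarrow> 'a) \<Rightarrow> (nat \<Rightarrow> 'a) \<Rightarrow> 'a" where
  "Xi n t0 u0 tn un A r X =
    T_sandwich n A (T_elt n t0 u0 tn un A r X) (T_elt n t0 u0 tn un A r X n)"

definition Xi_dual :: "nat \<Rightarrow> complex \<Rightarrow> complex \<Rightarrow> complex \<Rightarrow> complex
    \<Rightarrow> (complex, 'a) module \<Rightarrow> (nat \<Rightarrow> 'a) \<Rightarrow> (nat \<Rightarrow> 'a) \<Rightarrow> 'a" where
  "Xi_dual n t0 u0 tn un A r X =
    T_sandwich n A (T_elt n t0 u0 tn un A r X) (Tn_dual n t0 u0 tn un A r X)"

definition mu_par :: "complex \<Rightarrow> complex \<Rightarrow> complex \<Rightarrow> complex \<Rightarrow> nat \<Rightarrow> complex" where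
  "mu_par t0 u0 tn un l = [1/2 - t0 - u0 - tn - un, 2 * t0, 2 * u0, 2 * tn, 2 * un] ! l"

end

theory Submission
  imports Defs "HOL-Library.Countable_Set"
begin

text \<open>
  The images of the \<open>V\<^sub>i\<^sub>,\<^sub>l\<close> are conjugates under \<open>S\<^sub>n\<close> of \<open>T\<^sub>0\<close>, \<open>T\<^sub>0\<^sup>\<or>\<close>, \<open>T\<^sub>n\<close>, \<open>T\<^sub>n\<^sup>\<or>\<close>, shifted by constants,
  and the relations of \<open>B\<close> reduce to identities involving at most two adjacent nodes at one end of the
  affine diagram, or one node at each end. For injectivity, put \<open>x\<^sub>i = V\<^sub>i\<^sub>,\<^sub>1 + V\<^sub>i\<^sub>,\<^sub>2\<close>. Modulo lower degree in the \<open>V\<close>'s one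
  has \<open>V\<^sub>i\<^sub>,\<^sub>2 = x\<^sub>i - V\<^sub>i\<^sub>,\<^sub>1\<close>, \<open>V\<^sub>i\<^sub>,\<^sub>4 = - x\<^sub>i - V\<^sub>i\<^sub>,\<^sub>3\<close>, all squares \<open>V\<^sub>i\<^sub>,\<^sub>l\<^sup>2\<close> vanish and different particles commute,
  so \<open>B\<close> is spanned by the products of words alternating in \<open>V\<^sub>i\<^sub>,\<^sub>1\<close> and \<open>V\<^sub>i\<^sub>,\<^sub>3\<close> (one for each \<open>i\<close>,
  indexed by an integer \<open>y\<^sub>i\<close>), a permutation, and a monomial in the \<open>x\<^sub>i\<close>. The image of \<open>x\<^sub>i\<close> is \<open>X\<^sub>i\<close> up to
  \<open>\<complex>[W]\<close>, and the image of a spanning element has a leading term \<open>w X\<^sup>p\<close> with respect to the degree in \<open>X\<close> and the number of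
  letters \<open>s\<^sub>0\<close>, \<open>s\<^sub>n\<close>. Letting \<open>s\<^sub>0\<close> and \<open>s\<^sub>n\<close> act on \<open>\<int>\<^sup>n \<times> S\<^sub>n\<close> by \<open>y\<^sub>1 \<mapsto> 1 - y\<^sub>1\<close> and \<open>y\<^sub>n \<mapsto> - 1 - y\<^sub>n\<close> shows
  that \<open>w\<close> recovers the integers \<open>y\<^sub>i\<close> and the permutation, so the Poincare-Birkhoff-Witt property makes the images
  independent. Surjectivity holds since \<open>X\<^sub>1 = T\<^sub>0 + T\<^sub>0\<^sup>\<or> + 1/2\<close>.
\<close>

section \<open>Rank one relations at an end of the affine diagram\<close>

text \<open>The degree in \<open>X\<close> alone does not single out a leading term: the image of a
  letter contains \<open>X_i\<close> times a reflection, but also \<open>X_i\<close> itself. The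
  reflection costs one letter s_0 or s_n, so counting these letters breaks the tie. The degree in
  \<open>X\<close> is compared first, because moving an \<open>X\<close> past a word loses a
  variable but leaves arbitrary words behind. The leading exponent belonging to (a, y, pi) is not
  \<open>a\<close> but \<open>a + q\<close> with a shift \<open>q\<close> of degree |y_1| + ... +
  |y_n|; its value is never computed, it only matters that it depends on y and pi alone. The
  integers y_i are the coordinates y = 2x - 1/2 on the orbit of (1/4, ..., 1/4): this point lies on
  no mirror conjugate to those of s_0 and s_n, and each letter s_0 or s_n changes |y_1| + ... +
  |y_n| by at most 1, so the words in the basis use as few of them as possible. All computations run
  in rings that are types: the given algebra enters through its left regular representation, the
  free algebra as finitely supported functions on words.\<close>

locale complex_alg = vector_space scl for scl :: "complex \<Rightarrow> 'e::ring_1 \<Rightarrow> 'e" +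
  assumes scl_left: "scl c x * y = scl c (x * y)"
    and scl_right: "x * scl c y = scl c (x * y)"
begin

abbreviation sc :: "complex \<Rightarrow> 'e" where "sc c \<equiv> scl c 1"

lemma sc_left: "sc c * x = scl c x"
  by (simp add: scl_left)

lemma sc_right: "x * sc c = scl c x"
  by (simp add: scl_right)

lemma scl_two: "scl 2 x = x + x"
  using scale_left_distrib[of 1 1 x] by simp

lemma scl_half_double: "scl (1/2) x + scl (1/2) x = x"
  by (simp flip: scale_left_distrib)

end

text \<open>Both products start with \<open>p * p'\<close> times a word in \<open>r - 1\<close> and
  \<open>s\<close>, and these two words agree by the braid relation and \<open>s * s = 1\<close>.
  The difference comes from the constant \<tau> left behind when \<open>s\<close> crosses
  \<open>p\<close>, together with \<open>(r - 1)^2 = - 2 (r - 1)\<close>.\<close>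

lemma (in complex_alg) end_commutator_aux:
  assumes rr: "r * r = 1" and ss: "s * s = 1" and br: "r * s * r * s = s * r * s * r"
    and rp: "r * p' = p' * r"
    and sp: "s * p = p' * s + sc \<tau>" "s * p' = p * s - sc \<tau>" and pp: "p' * p = p * p'"
    and E: "E = p * (r - 1)"
  shows "E * s * E * s - s * E * s * E = scl (- 2 * \<tau>) (E * s - s * E)"
proof -
  have r1: "(r - 1) * (r - 1) = scl (- 2) (r - 1)"
    by (simp add: algebra_simps rr scl_two)
  have sE: "s * E = (p' * s + sc \<tau>) * (r - 1)"
    by (simp add: E sp(1) flip: mult.assoc)
  have rp1: "(r - 1) * p' = p' * (r - 1)" using rp by (simp add: algebra_simps)
  have "E * s * E * s = p * (r - 1) * (s * E) * s"
    by (simp add: E mult.assoc)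
  also have "\<dots> = p * ((r - 1) * p') * s * (r - 1) * s + scl \<tau> (p * ((r - 1) * (r - 1)) * s)"
    by (simp add: sE distrib_left distrib_right mult.assoc scl_left scl_right)
  also have "\<dots> = p * p' * ((r - 1) * s * (r - 1) * s) + scl (- 2 * \<tau>) (E * s)"
    by (simp add: rp1 r1 E mult.assoc scl_left scl_right mult.commute)
  finally have 1: "E * s * E * s = p * p' * ((r - 1) * s * (r - 1) * s) + scl (- 2 * \<tau>) (E * s)" .
  have "s * E * s * E = (s * E) * (s * E)" by (simp add: mult.assoc)
  also have "\<dots> = p' * s * ((r - 1) * p') * s * (r - 1) + scl \<tau> (p' * s * ((r - 1) * (r - 1)))
      + scl \<tau> ((r - 1) * p' * s * (r - 1)) + scl \<tau> (scl \<tau> ((r - 1) * (r - 1)))"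
    unfolding sE by (simp add: distrib_left distrib_right mult.assoc scl_left scl_right add.assoc scale_right_distrib)
  also have "p' * s * ((r - 1) * p') * s * (r - 1) = p' * (s * p') * (r - 1) * s * (r - 1)"
    by (simp add: rp1 mult.assoc)
  also have "\<dots> = p' * p * (s * (r - 1) * s * (r - 1)) - scl \<tau> (p' * (r - 1) * s * (r - 1))"
  proof -
    have "p' * (p * s - sc \<tau>) * z = p' * p * (s * z) - scl \<tau> (p' * z)" for z
      by (simp add: left_diff_distrib right_diff_distrib mult.assoc scl_left scl_right)
    from this[of "(r - 1) * s * (r - 1)"] show ?thesis by (simp add: sp(2) mult.assoc)
  qed
  \<comment> \<open>In this form the term cancels against the one that arose just above when
    \<open>s\<close> was moved past \<open>p'\<close>.\<close>
  also have "(r - 1) * p' * s * (r - 1) = p' * (r - 1) * s * (r - 1)"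
    by (simp only: rp1)
  also have "p' * s * ((r - 1) * (r - 1)) = scl (- 2) (p' * s * (r - 1))"
    by (simp only: r1 scl_right)
  finally have 2: "s * E * s * E = p * p' * (s * (r - 1) * s * (r - 1)) + scl (- 2 * \<tau>) (s * E)"
    unfolding sE r1 pp by (simp only: distrib_right scale_right_distrib sc_left scale_scale) (simp add: mult.commute)
  have "(r - 1) * s * (r - 1) * s = s * (r - 1) * s * (r - 1)"
    using br by (simp add: left_diff_distrib right_diff_distrib ss mult.assoc)
  then show ?thesis
    unfolding 1 2 by (simp add: scale_right_diff_distrib)
qed

text \<open>Both ends of the affine diagram have the same local structure: \<open>r = r\<^sub>0\<close>, \<open>s = r\<^sub>1\<close>,
  \<open>x = X\<^sub>1 - 1/2\<close>, \<open>x' = X\<^sub>2 - 1/2\<close> at one end, and \<open>r = r\<^sub>n\<close>, \<open>s = r\<^sub>n\<^sub>-\<^sub>1\<close>, \<open>x = - X\<^sub>n\<close>,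
  \<open>x' = - X\<^sub>n\<^sub>-\<^sub>1\<close> at the other.\<close>

locale daha_end = complex_alg scl for scl :: "complex \<Rightarrow> 'e::ring_1 \<Rightarrow> 'e" +
  fixes a b \<tau> :: complex and r s x x' T Tv :: 'e
  assumes rr: "r * r = 1" and ss: "s * s = 1" and br: "r * s * r * s = s * r * s * r"
    and rx: "r * x = sc (2 * a + 2 * b) - x * r" and rx': "r * x' = x' * r"
    and sx: "s * x = x' * s - sc \<tau>" and xx: "x' * x = x * x'"
    and T: "T = sc a + scl (1/2) ((sc (a - b) - x) * (r - 1))"
    and Tv: "Tv = x - T"
begin

lemma sx': "s * x' = x * s + sc \<tau>"
proof -
  have "s * (s * x) * s = s * (x' * s - sc \<tau>) * s" by (simp add: sx)
  then have "x * s = s * x' - sc \<tau>"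
    by (simp add: algebra_simps ss scl_left scl_right flip: mult.assoc)
      (simp add: mult.assoc ss)
  then show ?thesis by simp
qed

definition p :: 'e where "p = sc (a - b) - x"
definition D :: 'e where "D = p * (r - 1)"

lemma T_D: "T = sc a + scl (1/2) D"
  by (simp add: T D_def p_def)

lemma xp: "x * p = p * x"
  by (simp add: p_def left_diff_distrib right_diff_distrib scl_left scl_right)

text \<open>Moving \<open>r\<close> past \<open>p\<close> changes \<open>p\<close> into
  \<open>- p\<close> up to constants. The part \<open>- p * r - p\<close> is killed by
  \<open>(r + 1) * (r - 1) = 0\<close>, and in the remaining constants \<open>b\<close> cancels:
  \<open>- 2 (a - b) - (2 a + 2 b) = - 4 a\<close>.\<close>

lemma rm1_D: "(r - 1) * D = scl (- 4 * a) (r - 1)"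
proof -
  have "r * p = scl (2 * (a - b)) r - sc (2 * a + 2 * b) - p * r"
    using scale_left_distrib[of "a - b" "a - b" r]
    by (simp add: p_def algebra_simps rx scl_left scl_right)
  then have "(r - 1) * D = (scl (2 * (a - b)) r - sc (2 * a + 2 * b) - p * r - p) * (r - 1)"
    by (simp add: D_def left_diff_distrib flip: mult.assoc)
  also have "\<dots> = scl (2 * (a - b)) (1 - r) - scl (2 * a + 2 * b) (r - 1)"
    by (simp add: left_diff_distrib right_diff_distrib rr scl_left mult.assoc scale_right_diff_distrib)
  also have "\<dots> = scl (- 2 * (a - b)) (r - 1) - scl (2 * a + 2 * b) (r - 1)"
    by (simp only: mult_minus_left scale_minus_left scale_right_diff_distrib) simp
  also have "\<dots> = scl (- 4 * a) (r - 1)"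
  proof -
    have "- 2 * (a - b) - (2 * a + 2 * b) = - 4 * a" by (simp add: algebra_simps)
    then show ?thesis by (simp only: flip: scale_left_diff_distrib)
  qed
  finally show ?thesis .
qed

lemma D_sq: "D * D = scl (- 4 * a) D"
proof -
  have "D * D = p * ((r - 1) * D)" by (simp add: D_def mult.assoc)
  also have "\<dots> = scl (- 4 * a) D" unfolding rm1_D scl_right by (simp add: D_def)
  finally show ?thesis .
qed

text \<open>Since \<open>D^2 = - 4 a D\<close>, the element \<open>a + D/2\<close> squares to
  \<open>a^2\<close>.\<close>

lemma T_quad: "(T - sc a) * (T + sc a) = 0"
proof -
  have "(T - sc a) * (T + sc a) = scl a D + scl (1/4) (D * D)"
    using scl_half_double[of "scl a D"]
    by (simp add: T_D distrib_left scl_left scl_right)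
  then show ?thesis by (simp add: D_sq)
qed

text \<open>As \<open>r * x + x * r\<close> is a constant, the anticommutator of \<open>x\<close>
  and \<open>D\<close> contains no \<open>r\<close>. Half of it is
  \<open>(a - b - x) (a + b - x)\<close>, so with \<open>T^2 = a^2\<close> the square of
  \<open>x - T\<close> becomes a polynomial in \<open>x\<close> that collapses to
  \<open>b^2\<close>.\<close>

lemma Tv_quad: "(Tv - sc b) * (Tv + sc b) = 0"
proof -
  have "x * D + D * x = p * (x * (r - 1) + (r - 1) * x)"
    by (simp add: D_def distrib_left xp flip: mult.assoc)
  also have "\<dots> = p * (sc (2 * a + 2 * b) - scl 2 x)"
    by (simp add: right_diff_distrib left_diff_distrib distrib_left rx scl_two)
  also have "\<dots> = scl (2 * ((a - b) * (a + b))) 1 - scl (4 * a) x + scl 2 (x * x)"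
  proof -
    have "scl (4 * a) x = scl (2 * a + 2 * b) x + scl (2 * (a - b)) x"
      by (simp add: algebra_simps flip: scale_left_distrib)
    then show ?thesis
      by (simp add: p_def left_diff_distrib right_diff_distrib scl_left scl_right algebra_simps)
  qed
  finally have 1: "scl (1/2) (x * D + D * x) = scl ((a - b) * (a + b)) 1 - scl (2 * a) x + x * x"
    by (simp add: scale_right_distrib scale_right_diff_distrib)
  have 2: "T * T = scl (a * a) 1"
    using T_quad by (simp add: left_diff_distrib distrib_left scl_left scl_right scale_right_diff_distrib)
  have 3: "x * T + T * x = scl ((a - b) * (a + b)) 1 + x * x"
    using 1 scale_left_distrib[of a a x]
    by (simp add: T_D distrib_left distrib_right scl_left scl_right scale_right_distrib algebra_simps)
  have "Tv * Tv = x * x - (x * T + T * x) + T * T"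
    by (simp add: Tv left_diff_distrib right_diff_distrib)
  also have "\<dots> = scl (a * a - (a - b) * (a + b)) 1"
    unfolding 2 3 by (simp add: scale_left_diff_distrib)
  also have "\<dots> = scl (b * b) 1" by (simp add: algebra_simps)
  finally show ?thesis
    by (simp add: left_diff_distrib distrib_left scl_left scl_right scale_right_diff_distrib)
qed

lemma T_comm_x': "T * x' = x' * T"
  using rx' xx by (simp add: T algebra_simps scl_left scl_right flip: mult.assoc) (simp add: mult.assoc rx' xx)

text \<open>The constant \<open>a\<close> in \<open>T\<close> drops out of both sides, and each
  remaining factor \<open>T\<close> contributes \<open>D/2\<close>; the identity is therefore a
  quarter of the one for \<open>E = D\<close>, with \<open>p'\<close> the analogue of
  \<open>p\<close> for the neighbouring variable \<open>x'\<close>.\<close>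

lemma T_comm: "T * (s * T * s) - (s * T * s) * T = scl (- \<tau>) (T * s - s * T)"
proof -
  have "D * s * D * s - s * D * s * D = scl (- 2 * \<tau>) (D * s - s * D)"
  proof (rule end_commutator_aux[OF rr ss br _ _ _ _ D_def])
    let ?p' = "sc (a - b) - x'"
    show "r * ?p' = ?p' * r" "s * p = ?p' * s + sc \<tau>" "s * ?p' = p * s - sc \<tau>" "?p' * p = p * ?p'"
      by (simp_all add: p_def left_diff_distrib right_diff_distrib scl_left scl_right rx' sx sx' xx algebra_simps)
  qed
  moreover have "T * (s * T * s) - (s * T * s) * T = scl (1/4) (D * s * D * s - s * D * s * D)"
    by (simp add: T_D distrib_left distrib_right scl_left scl_right mult.assoc scale_right_diff_distrib scale_right_distrib)
      (simp add: ss flip: mult.assoc)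
  moreover have "T * s - s * T = scl (1/2) (D * s - s * D)"
    by (simp add: T_D distrib_left distrib_right scl_left scl_right scale_right_diff_distrib)
  ultimately show ?thesis by simp
qed

lemma sTvs: "s * Tv * s = x' - scl \<tau> s - s * T * s"
  by (simp add: Tv left_diff_distrib right_diff_distrib sx) (simp add: mult.assoc ss scl_left)

text \<open>In \<open>s * Tv * s = x' - \<tau> s - s * T * s\<close> the first term commutes with
  \<open>T\<close>. The commutators of \<open>T\<close> with the other two cancel, which is exactly
  what \<open>T_comm\<close> says.\<close>

lemma T_Tv_comm: "T * (s * Tv * s) = (s * Tv * s) * T"
proof -
  have "T * (s * Tv * s) - (s * Tv * s) * T
      = scl (- \<tau>) (T * s - s * T) - (T * (s * T * s) - (s * T * s) * T)"
    by (simp add: sTvs left_diff_distrib right_diff_distrib T_comm_x' scl_left scl_right scale_right_diff_distrib)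
  then show ?thesis by (simp add: T_comm)
qed

text \<open>Conjugation by \<open>s\<close> exchanges the two particles in
  \<open>T_Tv_comm\<close>.\<close>

lemma Tv_T_comm: "Tv * (s * T * s) = (s * T * s) * Tv"
proof -
  have "s * (T * (s * Tv * s)) * s = s * ((s * Tv * s) * T) * s" using T_Tv_comm by simp
  then show ?thesis by (simp add: mult.assoc ss) (metis mult.assoc ss mult_1_left)
qed

text \<open>Writing one factor \<open>Tv\<close> as \<open>x - T\<close> removes the
  \<open>T\<close> part, as \<open>T\<close> commutes with \<open>s * Tv * s\<close>. Expanding
  \<open>s * Tv * s\<close> in the rest leaves a commutator of \<open>x\<close> with
  \<open>s * T * s\<close>, which the second mixed relation turns into that of \<open>T\<close> with
  \<open>s * T * s\<close>.\<close>

lemma Tv_comm: "Tv * (s * Tv * s) - (s * Tv * s) * Tv = scl (- \<tau>) (Tv * s - s * Tv)"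
proof -
  have split: "Tv * z - z * Tv = x * z - z * x - (T * z - z * T)" for z
    by (simp add: Tv left_diff_distrib right_diff_distrib)
  have "Tv * (s * Tv * s) - (s * Tv * s) * Tv = x * (s * Tv * s) - (s * Tv * s) * x"
    by (simp only: split[of "s * Tv * s"] T_Tv_comm) simp
  also have "\<dots> = (x * x' - x' * x) - scl \<tau> (x * s - s * x) - (x * (s * T * s) - (s * T * s) * x)"
    by (simp add: sTvs left_diff_distrib right_diff_distrib scl_left scl_right scale_right_diff_distrib)
  also have "x * (s * T * s) - (s * T * s) * x
      = Tv * (s * T * s) - (s * T * s) * Tv + (T * (s * T * s) - (s * T * s) * T)"
    by (simp add: split)
  also have "\<dots> = T * (s * T * s) - (s * T * s) * T"
    by (simp add: Tv_T_comm)
  finally show ?thesis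
    by (simp add: T_comm xx Tv left_diff_distrib right_diff_distrib scale_right_diff_distrib)
qed

end

section \<open>Words for permutations\<close>

definition wperm :: "nat list \<Rightarrow> nat \<Rightarrow> nat" where
  "wperm u = foldr (\<lambda>i f. transpose i (Suc i) \<circ> f) u id"

lemma wperm_simps [simp]: "wperm [] = id" "wperm (i # u) = transpose i (Suc i) \<circ> wperm u"
  by (simp_all add: wperm_def)

lemma wperm_append: "wperm (u @ v) = wperm u \<circ> wperm v"
  by (induction u) (simp_all add: o_assoc)

lemma wperm_permutes: "set u \<subseteq> {1..<n} \<Longrightarrow> wperm u permutes {1..n}"
  by (induction u) (auto intro!: permutes_compose permutes_swap_id simp: permutes_id)

text \<open>The inverse of the cycle \<open>s\<^sub>k \<cdots> s\<^sub>m\<close>, which sends \<open>m + 1\<close> to \<open>k\<close>.\<close>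

definition cyc_inv :: "nat \<Rightarrow> nat \<Rightarrow> nat \<Rightarrow> nat" where
  "cyc_inv k m j = (if j = k then Suc m else if k < j \<and> j \<le> Suc m then j - 1 else j)"

text \<open>Normal form along the cosets of S_m in S_(m+1): the cycle s_k ... s_m with k = \<pi>
  (m+1) represents the coset, and what remains fixes m + 1. Fixing one word for every permutation
  turns the passage from permutations to products of generators into a function.\<close>

fun perm_word :: "nat \<Rightarrow> (nat \<Rightarrow> nat) \<Rightarrow> nat list" where
  "perm_word 0 \<pi> = []"
| "perm_word (Suc m) \<pi> = [\<pi> (Suc m)..<Suc m] @ perm_word m (cyc_inv (\<pi> (Suc m)) m \<circ> \<pi>)"

lemma cyc_inv_Suc: "k \<le> m \<Longrightarrow> cyc_inv k m = cyc_inv (Suc k) m \<circ> transpose k (Suc k)"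
  by (auto simp: fun_eq_iff cyc_inv_def transpose_def)

lemma cyc_inv_top: "cyc_inv (Suc m) m = id"
  by (auto simp: fun_eq_iff cyc_inv_def)

lemma wperm_cyc_inv: "k \<le> Suc m \<Longrightarrow> wperm [k..<Suc m] \<circ> cyc_inv k m = id"
proof (induction "Suc m - k" arbitrary: k)
  case 0
  then have "k = Suc m" by simp
  then show ?case by (simp add: cyc_inv_top)
next
  case (Suc d)
  then have k: "k \<le> m" by simp
  have IH: "wperm [Suc k..<Suc m] \<circ> cyc_inv (Suc k) m = id" using Suc k by auto
  have "wperm [k..<Suc m] \<circ> cyc_inv k m
      = transpose k (Suc k) \<circ> (wperm [Suc k..<Suc m] \<circ> cyc_inv (Suc k) m) \<circ> transpose k (Suc k)"
    using k by (simp add: upt_conv_Cons cyc_inv_Suc o_assoc del: upt_Suc)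
  then show ?case by (simp add: IH del: upt_Suc)
qed

lemma cyc_inv_permutes: "1 \<le> k \<Longrightarrow> k \<le> Suc m \<Longrightarrow> cyc_inv k m permutes {1..Suc m}"
proof (induction "Suc m - k" arbitrary: k)
  case 0
  then have "k = Suc m" by simp
  then show ?case by (simp only: cyc_inv_top permutes_id)
next
  case (Suc d)
  then have k: "k \<le> m" by simp
  show ?case unfolding cyc_inv_Suc[OF k]
    using Suc k by (intro permutes_compose permutes_swap_id) auto
qed

lemma cyc_inv_comp_permutes:
  assumes "\<pi> permutes {1..Suc m}"
  shows "cyc_inv (\<pi> (Suc m)) m \<circ> \<pi> permutes {1..m}"
proof -
  have "\<pi> (Suc m) \<in> {1..Suc m}" using assms by (simp add: permutes_in_image del: atLeastAtMost_iff) simp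
  then have "cyc_inv (\<pi> (Suc m)) m \<circ> \<pi> permutes {1..Suc m}"
    using assms by (intro permutes_compose cyc_inv_permutes) auto
  moreover have "(cyc_inv (\<pi> (Suc m)) m \<circ> \<pi>) (Suc m) = Suc m" by (simp add: cyc_inv_def)
  ultimately show ?thesis
    by (elim permutes_superset) (auto simp: le_Suc_eq)
qed

lemma perm_word:
  "\<pi> permutes {1..m} \<Longrightarrow> wperm (perm_word m \<pi>) = \<pi> \<and> set (perm_word m \<pi>) \<subseteq> {1..<m}"
proof (induction m arbitrary: \<pi>)
  case 0
  then show ?case by simp
next
  case (Suc m)
  let ?k = "\<pi> (Suc m)"
  have k: "?k \<in> {1..Suc m}" using Suc.prems by (simp add: permutes_in_image del: atLeastAtMost_iff) simp
  note IH = Suc.IH[OF cyc_inv_comp_permutes[OF Suc.prems]]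
  have "wperm (perm_word (Suc m) \<pi>) = (wperm [?k..<Suc m] \<circ> cyc_inv ?k m) \<circ> \<pi>"
    unfolding perm_word.simps wperm_append conjunct1[OF IH] by (rule o_assoc)
  moreover have "set (perm_word (Suc m) \<pi>) \<subseteq> {1..<Suc m}"
  proof -
    have "set [?k..<Suc m] \<subseteq> {1..<Suc m}" using k by auto
    moreover have "set (perm_word m (cyc_inv ?k m \<circ> \<pi>)) \<subseteq> {1..<Suc m}"
      by (rule order_trans[OF conjunct2[OF IH]]) auto
    ultimately show ?thesis by (simp del: upt_Suc)
  qed
  ultimately show ?case using wperm_cyc_inv[of ?k m] k by simp
qed

lemma perm_word_id: "perm_word m id = []"
  by (induction m) (simp_all add: cyc_inv_top)

locale sym_word =
  fixes r :: "nat \<Rightarrow> 'm::monoid_mult" and n :: nat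
  assumes r_sq: "1 \<le> i \<Longrightarrow> i < n \<Longrightarrow> r i * r i = 1"
    and r_braid: "1 \<le> i \<Longrightarrow> Suc i < n \<Longrightarrow> r i * r (Suc i) * r i = r (Suc i) * r i * r (Suc i)"
    and r_comm: "1 \<le> i \<Longrightarrow> i + 2 \<le> j \<Longrightarrow> j < n \<Longrightarrow> r i * r j = r j * r i"
begin

definition rw :: "nat list \<Rightarrow> 'm" where "rw u = prod_list (map r u)"

definition P :: "(nat \<Rightarrow> nat) \<Rightarrow> 'm" where "P \<pi> = rw (perm_word n \<pi>)"

lemma rw_simps [simp]: "rw [] = 1" "rw (i # u) = r i * rw u" "rw (u @ v) = rw u * rw v"
  by (simp_all add: rw_def)

lemma rw_comm_below: "1 \<le> i \<Longrightarrow> \<forall>j\<in>set u. i + 2 \<le> j \<and> j < n \<Longrightarrow> r i * rw u = rw u * r i"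
proof (induction u)
  case (Cons j u)
  have "r i * (r j * rw u) = r j * (r i * rw u)"
    using Cons.prems r_comm[of i j] by (simp flip: mult.assoc)
  then show ?case using Cons by (simp add: mult.assoc)
qed simp

lemma rw_comm_above: "i < n \<Longrightarrow> \<forall>j\<in>set u. 1 \<le> j \<and> j + 2 \<le> i \<Longrightarrow> r i * rw u = rw u * r i"
proof (induction u)
  case (Cons j u)
  have "r i * (r j * rw u) = r j * (r i * rw u)"
    using Cons.prems r_comm[of j i] by (simp flip: mult.assoc)
  then show ?case using Cons by (simp add: mult.assoc)
qed simp

text \<open>The letter \<open>r i\<close> commutes with everything below \<open>i - 1\<close>, the
  braid relation turns \<open>r i * r (i - 1) * r i\<close> around, and the freed
  \<open>r (i - 1)\<close> commutes with the rest of the cycle.\<close>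

lemma rw_shift:
  assumes "1 \<le> k" "k < i" "i \<le> m" "m < n"
  shows "r i * rw [k..<Suc m] = rw [k..<Suc m] * r (i - 1)"
proof -
  define j where "j = i - 1"
  have i: "i = Suc j" and j: "1 \<le> j" "k \<le> j" "Suc j \<le> m" using assms by (auto simp: j_def)
  have split: "[k..<Suc m] = [k..<j] @ [j, Suc j] @ [Suc (Suc j)..<Suc m]"
    using j upt_add_eq_append[of k j "Suc m - j"] by (simp add: upt_conv_Cons del: upt_Suc)
  have 1: "r (Suc j) * rw [k..<j] = rw [k..<j] * r (Suc j)"
    using assms j by (intro rw_comm_above) auto
  have 2: "r j * rw [Suc (Suc j)..<Suc m] = rw [Suc (Suc j)..<Suc m] * r j"
    using assms j by (intro rw_comm_below) auto
  have "r i * rw [k..<Suc m] = rw [k..<j] * (r (Suc j) * r j * r (Suc j)) * rw [Suc (Suc j)..<Suc m]"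
    unfolding split i using 1 by (simp add: mult.assoc del: upt_Suc) (simp flip: mult.assoc)
  also have "\<dots> = rw [k..<j] * r j * r (Suc j) * (r j * rw [Suc (Suc j)..<Suc m])"
  proof -
    have "r (Suc j) * r j * r (Suc j) = r j * r (Suc j) * r j" using r_braid[of j] assms j by simp
    then show ?thesis by (simp only: mult.assoc)
  qed
  also have "\<dots> = rw [k..<Suc m] * r (i - 1)"
    unfolding split 2 by (simp add: mult.assoc i del: upt_Suc)
  finally show ?thesis .
qed

text \<open>Left multiplication by a simple reflection permutes the cosets of S_m. With k = \<pi>
  (m+1), either it lengthens or shortens the cycle s_k ... s_m (i + 1 = k or i = k), or it passes
  through the cycle and acts on the S_m part, as s_i if i + 1 < k and as s_(i-1) if k < i. So the
  Coxeter relations alone make \<open>P\<close> multiplicative, that is, the \<open>r i\<close>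
  define a representation of the symmetric group.\<close>

lemma r_rw_perm_word:
  "\<pi> permutes {1..m} \<Longrightarrow> m \<le> n \<Longrightarrow> 1 \<le> i \<Longrightarrow> i < m \<Longrightarrow>
    r i * rw (perm_word m \<pi>) = rw (perm_word m (transpose i (Suc i) \<circ> \<pi>))"
proof (induction m arbitrary: \<pi> i)
  case (Suc m)
  define k where "k = \<pi> (Suc m)"
  define \<pi>' where "\<pi>' = cyc_inv k m \<circ> \<pi>"
  let ?t = "transpose i (Suc i)"
  have k: "1 \<le> k" "k \<le> Suc m" using Suc.prems(1) permutes_in_image[of \<pi> "{1..Suc m}" "Suc m"]
    by (simp_all add: k_def)
  have \<pi>': "\<pi>' permutes {1..m}" unfolding \<pi>'_def k_def by (rule cyc_inv_comp_permutes[OF Suc.prems(1)])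
  have lhs: "rw (perm_word (Suc m) \<pi>) = rw [k..<Suc m] * rw (perm_word m \<pi>')"
    by (simp add: k_def \<pi>'_def del: upt_Suc)
  have rhs: "rw (perm_word (Suc m) (?t \<circ> \<pi>))
      = rw [?t k..<Suc m] * rw (perm_word m (cyc_inv (?t k) m \<circ> ?t \<circ> \<pi>))"
    by (simp add: k_def o_assoc del: upt_Suc)
  consider "Suc i < k" | "Suc i = k" | "i = k" | "k < i" by linarith
  then show ?case
  proof cases
    case 1
    then have t: "?t k = k" by (simp add: transpose_def)
    have c: "cyc_inv k m \<circ> ?t = ?t \<circ> cyc_inv k m"
      using 1 k by (auto simp: fun_eq_iff cyc_inv_def transpose_def)
    have "r i * rw [k..<Suc m] = rw [k..<Suc m] * r i"
      using 1 k Suc.prems by (intro rw_comm_below) auto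
    then have "r i * rw (perm_word (Suc m) \<pi>) = rw [k..<Suc m] * (r i * rw (perm_word m \<pi>'))"
      unfolding lhs by (simp flip: mult.assoc)
    also have "r i * rw (perm_word m \<pi>') = rw (perm_word m (?t \<circ> \<pi>'))"
      using 1 k Suc.prems by (intro Suc.IH[OF \<pi>']) auto
    finally show ?thesis unfolding rhs t c by (simp add: \<pi>'_def o_assoc)
  next
    case 2
    then have t: "?t k = i" by (simp add: transpose_def)
    have c: "cyc_inv i m \<circ> ?t = cyc_inv k m"
      using cyc_inv_Suc[of i m] 2 k by (simp add: o_assoc[symmetric])
    have "[i..<Suc m] = i # [k..<Suc m]" using 2 k by (simp add: upt_conv_Cons del: upt_Suc)
    then show ?thesis unfolding rhs t c lhs by (simp add: \<pi>'_def mult.assoc)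
  next
    case 3
    then have t: "?t k = Suc i" by (simp add: transpose_def)
    have c: "cyc_inv (Suc i) m \<circ> ?t = cyc_inv k m"
      using cyc_inv_Suc[of i m] 3 Suc.prems by simp
    have "[k..<Suc m] = i # [Suc i..<Suc m]" using 3 Suc.prems by (simp add: upt_conv_Cons del: upt_Suc)
    then show ?thesis unfolding rhs t c lhs using r_sq[of i] Suc.prems
      by (simp add: \<pi>'_def flip: mult.assoc)
  next
    case 4
    then have t: "?t k = k" by (simp add: transpose_def)
    have c: "cyc_inv k m \<circ> ?t = transpose (i - 1) (Suc (i - 1)) \<circ> cyc_inv k m"
      using 4 k Suc.prems by (auto simp: fun_eq_iff cyc_inv_def transpose_def)
    have "r i * rw (perm_word (Suc m) \<pi>) = rw [k..<Suc m] * (r (i - 1) * rw (perm_word m \<pi>'))"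
      unfolding lhs using rw_shift[of k i m] 4 k Suc.prems by (simp flip: mult.assoc)
    also have "r (i - 1) * rw (perm_word m \<pi>') = rw (perm_word m (transpose (i - 1) (Suc (i - 1)) \<circ> \<pi>'))"
      using 4 k Suc.prems by (intro Suc.IH[OF \<pi>']) auto
    finally show ?thesis unfolding rhs t c by (simp add: \<pi>'_def o_assoc)
  qed
qed simp

lemma P_id [simp]: "P id = 1"
  by (simp add: P_def perm_word_id)

lemma rw_P: "set u \<subseteq> {1..<n} \<Longrightarrow> \<pi> permutes {1..n} \<Longrightarrow> rw u * P \<pi> = P (wperm u \<circ> \<pi>)"
proof (induction u)
  case (Cons i u)
  have "rw u * P \<pi> = P (wperm u \<circ> \<pi>)" by (rule Cons.IH) (use Cons.prems in simp_all)
  then have "rw (i # u) * P \<pi> = r i * P (wperm u \<circ> \<pi>)" by (simp only: rw_simps mult.assoc)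
  also have "\<dots> = P (transpose i (Suc i) \<circ> (wperm u \<circ> \<pi>))"
    unfolding P_def using Cons.prems
    by (intro r_rw_perm_word permutes_compose wperm_permutes) auto
  finally show ?case by (simp only: wperm_simps o_assoc)
qed simp

lemma P_mult: "\<sigma> permutes {1..n} \<Longrightarrow> \<pi> permutes {1..n} \<Longrightarrow> P \<sigma> * P \<pi> = P (\<sigma> \<circ> \<pi>)"
  using rw_P[of "perm_word n \<sigma>" \<pi>] perm_word[of \<sigma> n] by (simp add: P_def)

lemma rw_eq_P: "set u \<subseteq> {1..<n} \<Longrightarrow> rw u = P (wperm u)"
  using rw_P[of u id] by (simp add: permutes_id)

lemma P_adj: "1 \<le> i \<Longrightarrow> i < n \<Longrightarrow> P (transpose i (Suc i)) = r i"
  using rw_eq_P[of "[i]"] by simp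

end

section \<open>Conjugation by permutations and the copies of an element at all particles\<close>

abbreviation finv :: "('a \<Rightarrow> 'b) \<Rightarrow> 'b \<Rightarrow> 'a" where "finv \<equiv> Hilbert_Choice.inv"

text \<open>A transposition over distance d + 2 is conjugate to one over distance d + 1 by the
  adjacent transposition at its upper end. The interval is general because the stabilisers of 1 and
  of n in S_n are the symmetric groups of \<open>{2..n}\<close> and of
  \<open>{1..n-1}\<close>.\<close>

lemma permutes_adjacent_induct [consumes 1, case_names id swap]:
  assumes "\<pi> permutes {lo..hi::nat}" "Q id"
    and step: "\<And>i \<sigma>. lo \<le> i \<Longrightarrow> i < hi \<Longrightarrow> \<sigma> permutes {lo..hi} \<Longrightarrow> Q \<sigma> \<Longrightarrow> Q (transpose i (Suc i) \<circ> \<sigma>)"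
  shows "Q \<pi>"
proof -
  have tr: "Q (transpose i (i + Suc d) \<circ> \<sigma>)"
    if "lo \<le> i" "i + Suc d \<le> hi" "\<sigma> permutes {lo..hi}" "Q \<sigma>" for i d \<sigma>
    using that
  proof (induction d arbitrary: \<sigma>)
    case 0
    have "Q (transpose i (Suc i) \<circ> \<sigma>)"
      by (rule step) (use 0 in simp_all)
    then show ?case by (simp only: add_Suc_right add_0_right)
  next
    case (Suc d)
    let ?s = "transpose (i + Suc d) (Suc (i + Suc d))" and ?t = "transpose i (i + Suc d)"
    have eq: "transpose i (i + Suc (Suc d)) \<circ> \<sigma> = ?s \<circ> (?t \<circ> (?s \<circ> \<sigma>))"
      by (auto simp: fun_eq_iff transpose_def)
    have 1: "?s permutes {lo..hi}" "?t permutes {lo..hi}"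
      using Suc.prems by (auto intro!: permutes_swap_id)
    have 2: "?s \<circ> \<sigma> permutes {lo..hi}"
      by (rule permutes_compose[OF Suc.prems(3) 1(1)])
    have 3: "Q (?s \<circ> \<sigma>)"
      by (rule step[OF _ _ Suc.prems(3,4)]) (use Suc.prems(1,2) in simp_all)
    have 4: "Q (?t \<circ> (?s \<circ> \<sigma>))"
      by (rule Suc.IH[OF _ _ 2 3]) (use Suc.prems(1,2) in simp_all)
    show ?case unfolding eq
      by (rule step[OF _ _ permutes_compose[OF 2 1(2)] 4]) (use Suc.prems(1,2) in simp_all)
  qed
  show ?thesis
  proof (rule permutes_induct[where P = Q, OF assms(1) finite_atLeastAtMost assms(2)])
    fix a b \<sigma>
    assume *: "a \<in> {lo..hi}" "b \<in> {lo..hi}" "a \<noteq> b" "Q \<sigma>" "\<sigma> permutes {lo..hi}"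
    show "Q (transpose a b \<circ> \<sigma>)"
    proof (cases "a < b")
      case True
      then obtain d where d: "b = a + Suc d" using less_imp_Suc_add by auto
      show ?thesis unfolding d by (rule tr[OF _ _ *(5,4)]) (use * d in simp_all)
    next
      case False
      with *(3) obtain d where d: "a = b + Suc d" using less_imp_Suc_add[of b a] by auto
      show ?thesis unfolding d transpose_commute[of "b + Suc d"]
        by (rule tr[OF _ _ *(5,4)]) (use * d in simp_all)
    qed
  qed
qed

lemma transpose_conj: "\<pi> permutes S \<Longrightarrow> \<pi> \<circ> transpose a b \<circ> finv \<pi> = transpose (\<pi> a) (\<pi> b)"
  by (auto simp: fun_eq_iff transpose_def permutes_inverses)

text \<open>Double transitivity: a relation verified for one pair of particles is carried by
  conjugation to every pair.\<close>

lemma ex_permutes_two: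
  assumes "a \<in> S" "b \<in> S" "i \<in> S" "j \<in> S" "a \<noteq> b" "i \<noteq> j"
  obtains \<pi> where "\<pi> permutes S" "\<pi> a = i" "\<pi> b = j"
proof -
  \<comment> \<open>The place of \<open>b\<close> after \<open>a\<close> has been moved to
    \<open>i\<close>; as it differs from \<open>i\<close>, moving it on to \<open>j\<close> does not
    disturb \<open>i\<close>.\<close>
  define b' where "b' = transpose a i b"
  have b': "b' \<in> S" "b' \<noteq> i" using assms by (auto simp: b'_def transpose_def)
  let ?\<pi> = "transpose b' j \<circ> transpose a i"
  have "?\<pi> permutes S" using assms b' by (intro permutes_compose permutes_swap_id)
  moreover have "?\<pi> a = i" "?\<pi> b = j" using assms b' by (auto simp: b'_def[symmetric])
  ultimately show ?thesis using that by blast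
qed

context sym_word
begin

lemma P_inv: "\<pi> permutes {1..n} \<Longrightarrow> P \<pi> * P (finv \<pi>) = 1" "\<pi> permutes {1..n} \<Longrightarrow> P (finv \<pi>) * P \<pi> = 1"
  by (simp_all add: P_mult permutes_inv permutes_inv_o)

definition conjP :: "(nat \<Rightarrow> nat) \<Rightarrow> 'm \<Rightarrow> 'm" where "conjP \<pi> y = P \<pi> * y * P (finv \<pi>)"

lemma conjP_mult:
  assumes "\<pi> permutes {1..n}"
  shows "conjP \<pi> (y * z) = conjP \<pi> y * conjP \<pi> z"
proof -
  have "conjP \<pi> y * conjP \<pi> z = P \<pi> * y * (P (finv \<pi>) * P \<pi>) * z * P (finv \<pi>)"
    by (simp only: conjP_def mult.assoc)
  then show ?thesis by (simp only: conjP_def P_inv[OF assms] mult.assoc mult_1_right mult_1_left)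
qed

lemma conjP_conjP:
  assumes "\<pi> permutes {1..n}" "\<sigma> permutes {1..n}"
  shows "conjP \<pi> (conjP \<sigma> y) = conjP (\<pi> \<circ> \<sigma>) y"
proof -
  have "finv (\<pi> \<circ> \<sigma>) = finv \<sigma> \<circ> finv \<pi>"
    using assms by (simp add: o_inv_distrib permutes_bij)
  then show ?thesis
    by (simp only: conjP_def P_mult[symmetric] permutes_inv assms mult.assoc)
qed

lemma conjP_P: "\<pi> permutes {1..n} \<Longrightarrow> \<sigma> permutes {1..n} \<Longrightarrow> conjP \<pi> (P \<sigma>) = P (\<pi> \<circ> \<sigma> \<circ> finv \<pi>)"
  by (simp add: conjP_def P_mult permutes_inv permutes_compose)

lemma conjP_one: "\<pi> permutes {1..n} \<Longrightarrow> conjP \<pi> 1 = 1"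
  by (simp add: conjP_def P_inv)

lemma P_conjP: "\<pi> permutes {1..n} \<Longrightarrow> P \<pi> * y = conjP \<pi> y * P \<pi>"
  by (simp add: conjP_def mult.assoc P_inv)

definition stab_comm :: "nat \<Rightarrow> 'm \<Rightarrow> bool" where
  "stab_comm a y \<longleftrightarrow> (\<forall>\<pi>. \<pi> permutes {1..n} \<longrightarrow> \<pi> a = a \<longrightarrow> P \<pi> * y = y * P \<pi>)"

definition copy :: "nat \<Rightarrow> 'm \<Rightarrow> nat \<Rightarrow> 'm" where "copy a y i = conjP (transpose a i) y"

lemma stab_commD: "stab_comm a y \<Longrightarrow> \<pi> permutes {1..n} \<Longrightarrow> \<pi> a = a \<Longrightarrow> conjP \<pi> y = y"
  unfolding stab_comm_def conjP_def by (simp add: mult.assoc P_inv)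

text \<open>\<pi> differs from the transposition of \<open>a\<close> and \<open>\<pi> a\<close> by a
  permutation fixing \<open>a\<close>, under which \<open>y\<close> is invariant. The conjugates of
  \<open>y\<close> are thus indexed by particles.\<close>

lemma conjP_eq_copy:
  assumes "stab_comm a y" "\<pi> permutes {1..n}" "a \<in> {1..n}"
  shows "conjP \<pi> y = copy a y (\<pi> a)"
proof -
  let ?\<tau> = "transpose a (\<pi> a)"
  have \<tau>: "?\<tau> permutes {1..n}" using assms permutes_in_image[OF assms(2)] by (intro permutes_swap_id) auto
  have "\<pi> = ?\<tau> \<circ> (?\<tau> \<circ> \<pi>)" by (simp add: o_assoc)
  then have "conjP \<pi> y = conjP ?\<tau> (conjP (?\<tau> \<circ> \<pi>) y)"
    using \<tau> assms(2) by (simp only: conjP_conjP permutes_compose)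
  also have "conjP (?\<tau> \<circ> \<pi>) y = y" using assms \<tau> by (intro stab_commD) (auto intro: permutes_compose)
  finally show ?thesis by (simp add: copy_def)
qed

lemma copy_self: "copy a y a = y"
  by (simp add: copy_def conjP_def)

lemma conjP_copy:
  assumes "stab_comm a y" "\<pi> permutes {1..n}" "a \<in> {1..n}" "i \<in> {1..n}"
  shows "conjP \<pi> (copy a y i) = copy a y (\<pi> i)"
proof -
  have \<tau>: "transpose a i permutes {1..n}" using assms by (intro permutes_swap_id)
  have "conjP \<pi> (copy a y i) = conjP (\<pi> \<circ> transpose a i) y"
    unfolding copy_def using \<tau> assms(2) by (simp add: conjP_conjP)
  also have "\<dots> = copy a y (\<pi> i)"
    using conjP_eq_copy[OF assms(1) permutes_compose[OF \<tau> assms(2)] assms(3)] by simp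
  finally show ?thesis .
qed

lemma P_comm_range:
  assumes "1 \<le> lo" "hi \<le> n" "\<pi> permutes {lo..hi}" "\<And>i. lo \<le> i \<Longrightarrow> i < hi \<Longrightarrow> r i * y = y * r i"
  shows "P \<pi> * y = y * P \<pi>"
  using assms(3)
proof (induction rule: permutes_adjacent_induct)
  case id
  show ?case by (simp only: P_id mult_1_left mult_1_right)
next
  case (swap i \<sigma>)
  have "\<sigma> permutes {1..n}" using swap.hyps assms(1,2) by (auto intro: permutes_subset)
  then have "P (transpose i (Suc i) \<circ> \<sigma>) = r i * P \<sigma>"
    using swap.hyps assms(1,2) by (simp flip: P_mult P_adj add: permutes_swap_id)
  then show ?case using swap.IH assms(4)[of i] swap.hyps by (metis mult.assoc)
qed

lemma stab_comm_first:
  assumes "\<And>i. 2 \<le> i \<Longrightarrow> i < n \<Longrightarrow> r i * y = y * r i"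
  shows "stab_comm 1 y"
  unfolding stab_comm_def
proof (intro allI impI)
  fix \<pi> assume "\<pi> permutes {1..n}" "\<pi> 1 = 1"
  moreover have "{1..n} - {2..n} \<subseteq> {1}" by auto
  ultimately have "\<pi> permutes {2..n}" by (elim permutes_superset) (metis singletonD subsetD)
  then show "P \<pi> * y = y * P \<pi>" using assms by (intro P_comm_range) auto
qed

lemma stab_comm_last:
  assumes "\<And>i. 1 \<le> i \<Longrightarrow> Suc i < n \<Longrightarrow> r i * y = y * r i"
  shows "stab_comm n y"
  unfolding stab_comm_def
proof (intro allI impI)
  fix \<pi> assume "\<pi> permutes {1..n}" "\<pi> n = n"
  moreover have "{1..n} - {1..n-1} \<subseteq> {n}" by auto
  ultimately have "\<pi> permutes {1..n-1}" by (elim permutes_superset) (metis singletonD subsetD)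
  then show "P \<pi> * y = y * P \<pi>" using assms by (intro P_comm_range) auto
qed

end

section \<open>Relations between the images of the generators\<close>

lemma (in sym_word) P_ident [simp]: "P (\<lambda>a. a) = 1"
  using P_id unfolding id_def .

context complex_alg
begin

definition commutes :: "'e \<Rightarrow> 'e \<Rightarrow> bool" where "commutes a b \<longleftrightarrow> a * b = b * a"

lemma commutes_intros:
  "commutes a b \<Longrightarrow> commutes a c \<Longrightarrow> commutes a (b + c)"
  "commutes a b \<Longrightarrow> commutes a c \<Longrightarrow> commutes a (b - c)"
  "commutes a b \<Longrightarrow> commutes a c \<Longrightarrow> commutes a (b * c)"
  "commutes a b \<Longrightarrow> commutes a (- b)" "commutes a b \<Longrightarrow> commutes a (scl z b)" "commutes a 1"
  "commutes b a \<Longrightarrow> commutes c a \<Longrightarrow> commutes (b + c) a"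
  "commutes b a \<Longrightarrow> commutes c a \<Longrightarrow> commutes (b - c) a"
  "commutes b a \<Longrightarrow> commutes c a \<Longrightarrow> commutes (b * c) a"
  "commutes b a \<Longrightarrow> commutes (- b) a" "commutes b a \<Longrightarrow> commutes (scl z b) a" "commutes 1 a"
  unfolding commutes_def
  by (simp_all add: distrib_left distrib_right left_diff_distrib right_diff_distrib scl_left scl_right)
    (metis mult.assoc)+

lemma commutesD: "commutes a b \<Longrightarrow> a * b = b * a"
  by (simp add: commutes_def)

end

text \<open>The cross-relations for single variables only. Then \<open>((s_i p) - p) / a_i\<close>
  is a constant: 1 for \<open>r 0\<close> with \<open>X 1\<close>, -1 for \<open>r i\<close> with
  \<open>X i\<close> and for \<open>r n\<close> with \<open>X n\<close>, and 0 for a variable fixed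
  by the reflection. This is where the signs of the constant terms come from.\<close>

locale daha_ring = complex_alg scl for scl :: "complex \<Rightarrow> 'e::ring_1 \<Rightarrow> 'e" +
  fixes n :: nat and r X :: "nat \<Rightarrow> 'e" and t0 u0 t tn un :: complex
  assumes n2: "2 \<le> n"
    and coxeter_rel: "(u, v) \<in> coxeter_rels n \<Longrightarrow> prod_list (map r u) = prod_list (map r v)"
    and X_comm: "i \<in> {1..n} \<Longrightarrow> j \<in> {1..n} \<Longrightarrow> X i * X j = X j * X i"
    and r0_X1: "r 0 * X 1 = (1 - X 1) * r 0 + sc (2 * t0 + 2 * u0)"
    and r0_X: "j \<in> {2..n} \<Longrightarrow> r 0 * X j = X j * r 0"
    and ri_Xi: "1 \<le> i \<Longrightarrow> i < n \<Longrightarrow> r i * X i = X (Suc i) * r i - sc t"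
    and ri_X: "1 \<le> i \<Longrightarrow> i < n \<Longrightarrow> j \<in> {1..n} \<Longrightarrow> j \<noteq> i \<Longrightarrow> j \<noteq> Suc i \<Longrightarrow> r i * X j = X j * r i"
    and rn_Xn: "r n * X n = - X n * r n - sc (2 * tn + 2 * un)"
    and rn_X: "1 \<le> j \<Longrightarrow> j < n \<Longrightarrow> r n * X j = X j * r n"
begin

lemma rel_sq: "i \<le> n \<Longrightarrow> r i * r i = 1"
  using coxeter_rel[of "[i, i]" "[]"] by (auto simp: coxeter_rels_def)

lemma rel_comm: "i \<le> n \<Longrightarrow> j \<le> n \<Longrightarrow> i + 2 \<le> j \<Longrightarrow> r i * r j = r j * r i"
  using coxeter_rel[of "[i, j]" "[j, i]"] by (auto simp: coxeter_rels_def)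

lemma rel_braid: "1 \<le> i \<Longrightarrow> Suc i < n \<Longrightarrow> r i * r (Suc i) * r i = r (Suc i) * r i * r (Suc i)"
  using coxeter_rel[of "[i, i+1, i]" "[i+1, i, i+1]"] by (auto simp: coxeter_rels_def mult.assoc)

lemma rel_braid4: "i = 0 \<or> i = n - 1 \<Longrightarrow> r i * r (Suc i) * r i * r (Suc i) = r (Suc i) * r i * r (Suc i) * r i"
  using coxeter_rel[of "[i, i+1, i, i+1]" "[i+1, i, i+1, i]"] by (auto simp: coxeter_rels_def mult.assoc)

sublocale sym_word r n
  proof unfold_locales
  fix i assume "1 \<le> i" "i < n"
  then show "r i * r i = 1" by (intro rel_sq) simp
next
  fix i assume "1 \<le> i" "Suc i < n"
  then show "r i * r (Suc i) * r i = r (Suc i) * r i * r (Suc i)" by (rule rel_braid)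
next
  fix i j assume "1 \<le> i" "i + 2 \<le> j" "j < n"
  then show "r i * r j = r j * r i" by (intro rel_comm) simp_all
qed

definition T0 :: 'e where "T0 = sc t0 + scl (1/2) ((sc (t0 - u0) - (X 1 - sc (1/2))) * (r 0 - 1))"
definition T0v :: 'e where "T0v = X 1 - sc (1/2) - T0"
definition Tn :: 'e where "Tn = sc tn + scl (1/2) ((sc (tn - un) - (- X n)) * (r n - 1))"
definition Tnv :: 'e where "Tnv = - X n - Tn"

lemma ri_XSi: "1 \<le> i \<Longrightarrow> i < n \<Longrightarrow> r i * X (Suc i) = X i * r i + sc t"
proof -
  assume i: "1 \<le> i" "i < n"
  have "r i * (r i * X i) * r i = r i * (X (Suc i) * r i - sc t) * r i" by (simp only: ri_Xi[OF i])
  moreover have "r i * (r i * X i) * r i = X i * r i"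
    using rel_sq[of i] i by (simp flip: mult.assoc)
  moreover have "r i * (X (Suc i) * r i - sc t) * r i = r i * X (Suc i) - sc t"
    using rel_sq[of i] i by (simp add: left_diff_distrib right_diff_distrib mult.assoc scl_left scl_right)
  ultimately have "X i * r i = r i * X (Suc i) - sc t" by metis
  then show ?thesis by simp
qed

sublocale left: daha_end scl t0 u0 t "r 0" "r 1" "X 1 - sc (1/2)" "X 2 - sc (1/2)" T0 T0v
proof unfold_locales
  show "r 0 * r 0 = 1" "r 1 * r 1 = 1" using rel_sq n2 by simp_all
  show "r 0 * r 1 * r 0 * r 1 = r 1 * r 0 * r 1 * r 0" using rel_braid4[of 0] by simp
  show "r 0 * (X 1 - sc (1/2)) = sc (2 * t0 + 2 * u0) - (X 1 - sc (1/2)) * r 0"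
    using scl_half_double[of "r 0"]
    by (simp add: right_diff_distrib left_diff_distrib r0_X1[unfolded One_nat_def] scl_left scl_right algebra_simps)
  show "r 0 * (X 2 - sc (1/2)) = (X 2 - sc (1/2)) * r 0"
    using r0_X[of 2] n2 by (simp add: right_diff_distrib left_diff_distrib scl_left scl_right)
  show "r 1 * (X 1 - sc (1/2)) = (X 2 - sc (1/2)) * r 1 - sc t"
    using ri_Xi[of 1] n2 by (simp add: right_diff_distrib left_diff_distrib scl_left scl_right numeral_2_eq_2)
  show "(X 2 - sc (1/2)) * (X 1 - sc (1/2)) = (X 1 - sc (1/2)) * (X 2 - sc (1/2))"
    using X_comm[of 1 2] n2
    by (simp add: right_diff_distrib left_diff_distrib scl_left scl_right algebra_simps)
qed (simp_all add: T0_def T0v_def)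

sublocale right: daha_end scl tn un t "r n" "r (n - 1)" "- X n" "- X (n - 1)" Tn Tnv
proof unfold_locales
  have n: "Suc (n - 1) = n" "1 \<le> n - 1" "n - 1 < n" using n2 by auto
  show "r n * r n = 1" "r (n - 1) * r (n - 1) = 1" using rel_sq by simp_all
  show "r n * r (n - 1) * r n * r (n - 1) = r (n - 1) * r n * r (n - 1) * r n"
    using rel_braid4[of "n - 1"] n by simp
  show "r n * - X n = sc (2 * tn + 2 * un) - - X n * r n"
    using rn_Xn by simp
  show "r n * - X (n - 1) = - X (n - 1) * r n" using rn_X[of "n - 1"] n by simp
  show "r (n - 1) * - X n = - X (n - 1) * r (n - 1) - sc t"
    using ri_XSi[of "n - 1"] n by simp
  show "- X (n - 1) * - X n = - X n * - X (n - 1)" using X_comm[of n "n - 1"] n2 by simp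
qed (simp_all add: Tn_def Tnv_def)

lemma conjP_add: "conjP \<pi> (y + z) = conjP \<pi> y + conjP \<pi> z"
  by (simp add: conjP_def algebra_simps)

lemma conjP_diff: "conjP \<pi> (y - z) = conjP \<pi> y - conjP \<pi> z"
  by (simp add: conjP_def algebra_simps)

lemma conjP_uminus: "conjP \<pi> (- y) = - conjP \<pi> y"
  by (simp add: conjP_def)

lemma conjP_scl: "conjP \<pi> (scl c y) = scl c (conjP \<pi> y)"
  by (simp add: conjP_def scl_left scl_right)

lemma conjP_sum: "conjP \<pi> (sum f I) = (\<Sum>i\<in>I. conjP \<pi> (f i))"
  by (simp add: conjP_def sum_distrib_left sum_distrib_right)

lemma stab_X1: "stab_comm 1 (X 1)"
  by (rule stab_comm_first) (use ri_X n2 in auto)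

lemma stab_T0: "stab_comm 1 T0"
proof (rule stab_comm_first)
  fix i assume i: "2 \<le> i" "i < n"
  have 1: "commutes (r i) (X 1)" using ri_X[of i 1] i n2 unfolding commutes_def by auto
  have 2: "commutes (r i) (r 0)" using rel_comm[of 0 i] i unfolding commutes_def by auto
  show "r i * T0 = T0 * r i"
    unfolding T0_def by (rule commutesD) (intro commutes_intros 1 2)
qed

lemma stab_diff: "stab_comm a y \<Longrightarrow> stab_comm a z \<Longrightarrow> stab_comm a (y - z)"
  by (simp add: stab_comm_def algebra_simps)

lemma stab_sc: "stab_comm a (sc c)"
  by (simp add: stab_comm_def scl_left scl_right)

lemma stab_uminus: "stab_comm a y \<Longrightarrow> stab_comm a (- y)"
  by (simp add: stab_comm_def)

lemma stab_T0v: "stab_comm 1 T0v"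
  unfolding T0v_def by (intro stab_diff stab_X1 stab_T0 stab_sc)

lemma stab_Xn: "stab_comm n (X n)"
  by (rule stab_comm_last) (use ri_X n2 in auto)

lemma stab_Tn: "stab_comm n Tn"
proof (rule stab_comm_last)
  fix i assume i: "1 \<le> i" "Suc i < n"
  have 1: "commutes (r i) (X n)" using ri_X[of i n] i n2 unfolding commutes_def by auto
  have 2: "commutes (r i) (r n)" using rel_comm[of i n] i unfolding commutes_def by auto
  show "r i * Tn = Tn * r i"
    unfolding Tn_def by (rule commutesD) (intro commutes_intros 1 2)
qed

lemma stab_Tnv: "stab_comm n Tnv"
  unfolding Tnv_def by (intro stab_diff stab_uminus stab_Xn stab_Tn)

text \<open>The reversed word represents the inverse cycle, so the product T_1 ... T_(n-1) y T_(n-1)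
  ... T_1 in the definition of \<Xi> is conjugation by the cycle that carries n to 1.\<close>

lemma cycle_word:
  assumes "1 \<le> m" "m \<le> n"
  shows "wperm [1..<m] permutes {1..n}" "wperm [1..<m] m = 1" "m < i \<Longrightarrow> wperm [1..<m] i = i"
    "finv (wperm [1..<m]) = wperm (rev [1..<m])"
    "rw [1..<m] * y * rw (rev [1..<m]) = conjP (wperm [1..<m]) y"
proof -
  show p: "wperm [1..<m] permutes {1..n}" using assms by (intro wperm_permutes) auto
  show "wperm [1..<m] m = 1" using assms
  proof (induction m rule: dec_induct)
    case (step m)
    then show ?case by (simp add: wperm_append)
  qed simp
  have "set u \<subseteq> {1..<m} \<Longrightarrow> m < i \<Longrightarrow> wperm u i = i" for u
    by (induction u) (auto simp: transpose_def)
  then show "m < i \<Longrightarrow> wperm [1..<m] i = i" by auto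
  have "wperm (rev u) \<circ> wperm u = id" for u
    by (induction u) (auto simp: wperm_append fun_eq_iff)
  then have inv: "wperm u \<circ> wperm (rev u) = id" "wperm (rev u) \<circ> wperm u = id" for u
    by (metis rev_rev_ident)+
  show i: "finv (wperm [1..<m]) = wperm (rev [1..<m])"
    using inv[of "[1..<m]"] by (metis inv_unique_comp)
  show "rw [1..<m] * y * rw (rev [1..<m]) = conjP (wperm [1..<m]) y"
    unfolding conjP_def i using assms by (subst (1 2) rw_eq_P) auto
qed

lemma sandwich: "stab_comm n y \<Longrightarrow> rw [1..<n] * y * rw (rev [1..<n]) = copy n y 1"
  using cycle_word[of n] conjP_eq_copy[of n y "wperm [1..<n]"] n2 by auto

text \<open>One step is \<open>r m * X (m+1) * r m = X m + t * r m\<close>, and the cycle reached so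
  far conjugates \<open>r m\<close> into the transposition of 1 and m + 1. These transpositions are
  the origin of the right-hand side of the relation for V_(i,1) + ... + V_(i,4).\<close>

lemma conj_X:
  assumes "1 \<le> m" "m \<le> n"
  shows "conjP (wperm [1..<m]) (X m) = X 1 + scl t (\<Sum>j\<in>{2..m}. P (transpose 1 j))"
  using assms
proof (induction m rule: dec_induct)
  case base
  then show ?case by (simp add: conjP_def)
next
  case (step m)
  have m: "1 \<le> m" "m < n" using step by auto
  let ?c = "wperm [1..<m]" and ?s = "transpose m (Suc m)"
  note c = cycle_word(1-3)[of m]
  have s: "?s permutes {1..n}" using m by (intro permutes_swap_id) auto
  have "conjP ?s (X (Suc m)) = r m * X (Suc m) * r m"
    using m by (simp add: conjP_def P_adj)
  also have "\<dots> = X m + scl t (r m)"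
    using m rel_sq[of m] by (simp add: ri_XSi distrib_right mult.assoc scl_left)
  finally have 1: "conjP ?s (X (Suc m)) = X m + scl t (P ?s)" using m by (simp add: P_adj)
  have "wperm [1..<Suc m] = ?c \<circ> ?s" using m by (simp add: wperm_append)
  then have "conjP (wperm [1..<Suc m]) (X (Suc m)) = conjP ?c (X m) + scl t (conjP ?c (P ?s))"
    using c(1) s m 1 by (simp add: conjP_add conjP_scl flip: conjP_conjP)
  also have "conjP ?c (P ?s) = P (transpose 1 (Suc m))"
    using c s m transpose_conj[OF c(1)] by (simp add: conjP_P)
  finally show ?case using step m by (simp add: scale_right_distrib add.assoc)
qed

text \<open>At the left end the two elements add up to \<open>X 1 - 1/2\<close>, at the right end to
  \<open>- X n\<close>. After copying to particle \<open>i\<close>, the sum is the difference of two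
  conjugates of variables, and by \<open>conj_X\<close> these differ only by transpositions.\<close>

lemma copy_sum:
  assumes i: "i \<in> {1..n}"
  shows "copy 1 T0 i + copy 1 T0v i + copy n Tn i + copy n Tnv i
    = sc (- (1/2)) + scl (- t) (\<Sum>j\<in>{1..n} - {i}. P (transpose i j))"
proof -
  have 1: "copy 1 T0 i + copy 1 T0v i = copy 1 (X 1) i - sc (1/2)"
    using i by (simp add: copy_def T0v_def conjP_one conjP_scl permutes_swap_id flip: conjP_add)
      (simp add: conjP_diff conjP_one conjP_scl permutes_swap_id)
  have 2: "copy n Tn i + copy n Tnv i = - copy n (X n) i"
    by (simp add: copy_def Tnv_def conjP_uminus flip: conjP_add)
  have "X 1 + scl t (\<Sum>j\<in>{2..n}. P (transpose 1 j)) = copy n (X n) 1"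
    using conj_X[of n] conjP_eq_copy[OF stab_Xn cycle_word(1)[of n]] cycle_word(2)[of n] n2 by auto
  then have "conjP (transpose 1 i) (X 1 + scl t (\<Sum>j\<in>{2..n}. P (transpose 1 j))) = conjP (transpose 1 i) (copy n (X n) 1)"
    by simp
  moreover have tr: "transpose 1 i permutes {1..n}" using i by (intro permutes_swap_id) auto
  ultimately have 3: "copy 1 (X 1) i + scl t (conjP (transpose 1 i) (\<Sum>j\<in>{2..n}. P (transpose 1 j))) = copy n (X n) i"
    using conjP_copy[OF stab_Xn tr, of 1] conjP_copy[OF stab_X1 tr, of 1] n2
    by (simp add: conjP_add conjP_scl copy_self)
  have "conjP (transpose 1 i) (\<Sum>j\<in>{2..n}. P (transpose 1 j)) = (\<Sum>j\<in>{2..n}. P (transpose i (transpose 1 i j)))"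
    unfolding conjP_sum
  proof (rule sum.cong[OF refl])
    fix j assume "j \<in> {2..n}"
    then have "transpose 1 j permutes {1..n}" by (intro permutes_swap_id) auto
    then show "conjP (transpose 1 i) (P (transpose 1 j)) = P (transpose i (transpose 1 i j))"
      using transpose_conj[OF tr, of 1 j] tr by (simp add: conjP_P)
  qed
  also have "\<dots> = (\<Sum>j\<in>{1..n} - {i}. P (transpose i j))"
    using i by (intro sum.reindex_bij_witness[of _ "transpose 1 i" "transpose 1 i"]) (auto simp: transpose_def split: if_splits)
  finally show ?thesis using 1 2 3 by (simp add: add.assoc[symmetric]) (simp add: algebra_simps)
qed

lemma conjP_quad:
  assumes "\<pi> permutes {1..n}" "(y - sc c) * (y + sc c) = 0"
  shows "(conjP \<pi> y + sc c) * (conjP \<pi> y - sc c) = 0"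
proof -
  have "(y + sc c) * (y - sc c) = 0" using assms(2) by (simp add: algebra_simps scl_left scl_right)
  then have "conjP \<pi> ((y + sc c) * (y - sc c)) = 0" by (simp add: conjP_def)
  then show ?thesis using assms(1) by (simp add: conjP_mult conjP_add conjP_diff conjP_scl conjP_one)
qed

text \<open>Rewriting \<open>y * s - s * y\<close> as \<open>(y - s * y * s) * s\<close> turns the
  relation at the end of the diagram into the wanted one for the pair (a, b); a permutation taking
  (a, b) to (i, j) does the rest.\<close>

lemma copy_same_comm:
  assumes y: "stab_comm a y" and ab: "a \<in> {1..n}" "b \<in> {1..n}" "a \<noteq> b" and ij: "i \<in> {1..n}" "j \<in> {1..n}" "i \<noteq> j"
    and s: "s = P (transpose a b)"
    and rel: "y * (s * y * s) - (s * y * s) * y = scl (- t) (y * s - s * y)"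
  shows "copy a y i * copy a y j - copy a y j * copy a y i = scl (- t) ((copy a y i - copy a y j) * P (transpose i j))"
proof -
  obtain \<pi> where \<pi>: "\<pi> permutes {1..n}" "\<pi> a = i" "\<pi> b = j"
    using ex_permutes_two[OF ab(1,2) ij(1,2) ab(3) ij(3)] by metis
  have tr: "transpose a b permutes {1..n}" using ab by (intro permutes_swap_id)
  have ss: "s * s = 1" using P_mult[OF tr tr] s by simp
  have yb: "s * y * s = copy a y b" by (simp add: copy_def conjP_def s)
  have "scl (- t) (y * s - s * y) = scl (- t) ((y - copy a y b) * s)"
    unfolding yb[symmetric] using ss by (simp add: left_diff_distrib mult.assoc)
  with rel have "conjP \<pi> (y * copy a y b - copy a y b * y) = conjP \<pi> (scl (- t) ((y - copy a y b) * s))"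
    unfolding yb by (simp only:)
  moreover have "conjP \<pi> s = P (transpose i j)"
    using transpose_conj[OF \<pi>(1), of a b] \<pi> tr s by (simp add: conjP_P)
  ultimately show ?thesis
    using conjP_copy[OF y \<pi>(1) ab(1) ab(1)] conjP_copy[OF y \<pi>(1) ab(1) ab(2)] \<pi>
    by (simp add: conjP_diff conjP_mult conjP_scl conjP_uminus copy_self)
qed

lemma copy_diff_comm:
  assumes y: "stab_comm a y" and z: "stab_comm c z" and ab: "a \<in> {1..n}" "c \<in> {1..n}" "b \<in> {1..n}" "a \<noteq> b" and ij: "i \<in> {1..n}" "j \<in> {1..n}" "i \<noteq> j"
    and rel: "y * copy c z b = copy c z b * y"
  shows "copy a y i * copy c z j = copy c z j * copy a y i"
proof -
  obtain \<pi> where \<pi>: "\<pi> permutes {1..n}" "\<pi> a = i" "\<pi> b = j"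
    using ex_permutes_two[OF ab(1,3) ij(1,2) ab(4) ij(3)] by metis
  have "conjP \<pi> (y * copy c z b) = conjP \<pi> (copy c z b * y)" by (simp add: rel)
  then show ?thesis
    using conjP_copy[OF y \<pi>(1) ab(1) ab(1)] conjP_copy[OF z \<pi>(1) ab(2) ab(3)] \<pi>
    by (simp add: conjP_mult copy_self)
qed

text \<open>T_0 and its dual live at particle 1, T_n and its dual at particle n. Copying each of
  them to all particles puts the four families on an equal footing; at particle 1 the last two
  become the elements \<Xi>.\<close>

definition base :: "nat \<Rightarrow> nat" where "base l = (if l \<le> 2 then 1 else n)"
definition TT :: "nat \<Rightarrow> 'e" where "TT l = [T0, T0v, Tn, Tnv] ! (l - 1)"
definition par :: "nat \<Rightarrow> complex" where "par l = [t0, u0, tn, un] ! (l - 1)"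
definition Vc :: "nat \<Rightarrow> nat \<Rightarrow> 'e" where "Vc i l = copy (base l) (TT l) i"

lemma idx: "l \<in> {1..4::nat} \<longleftrightarrow> l = 1 \<or> l = 2 \<or> l = 3 \<or> l = 4" by auto

lemma base_in: "base l \<in> {1..n}" using n2 by (auto simp: base_def)

lemma stab_TT: "l \<in> {1..4} \<Longrightarrow> stab_comm (base l) (TT l)"
  unfolding idx using stab_T0 stab_T0v stab_Tn stab_Tnv by (auto simp: base_def TT_def)

lemma P_Vc: "\<pi> permutes {1..n} \<Longrightarrow> i \<in> {1..n} \<Longrightarrow> l \<in> {1..4} \<Longrightarrow> P \<pi> * Vc i l = Vc (\<pi> i) l * P \<pi>"
  using P_conjP[of \<pi> "Vc i l"] conjP_copy[OF stab_TT[of l] _ base_in, of \<pi> i] by (simp add: Vc_def)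

text \<open>The order of the factors matches the defining relation: after the shift by
  \<open>\<gamma> l + par l\<close>, subtracting \<open>\<gamma> l\<close> leaves
  \<open>Vc + par\<close>, and subtracting \<open>\<gamma> l + \<mu> l\<close> with
  \<open>\<mu> l = 2 * par l\<close> leaves \<open>Vc - par\<close>.\<close>

lemma Vc_quad:
  assumes "i \<in> {1..n}" "l \<in> {1..4}"
  shows "(Vc i l + sc (par l)) * (Vc i l - sc (par l)) = 0"
proof -
  have "(TT l - sc (par l)) * (TT l + sc (par l)) = 0"
    using assms(2) left.T_quad left.Tv_quad right.T_quad right.Tv_quad unfolding idx
    by (auto simp: TT_def par_def)
  moreover have "transpose (base l) i permutes {1..n}" using assms base_in by (intro permutes_swap_id)
  ultimately show ?thesis unfolding Vc_def copy_def by (intro conjP_quad)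
qed

lemma Vc_sum: "i \<in> {1..n} \<Longrightarrow> Vc i 1 + Vc i 2 + Vc i 3 + Vc i 4 = sc (- (1/2)) + scl (- t) (\<Sum>j\<in>{1..n} - {i}. P (transpose i j))"
  using copy_sum[of i] by (simp add: Vc_def TT_def base_def)

lemma P_tr_last: "P (transpose n (n - 1)) = r (n - 1)"
  using P_adj[of "n - 1"] n2 by (simp add: transpose_commute)

lemma Vc_same:
  assumes "i \<in> {1..n}" "j \<in> {1..n}" "i \<noteq> j" "l \<in> {1..4}"
  shows "Vc i l * Vc j l - Vc j l * Vc i l = scl (- t) ((Vc i l - Vc j l) * P (transpose i j))"
proof -
  have 1: "P (transpose 1 2) = r 1" using P_adj[of 1] n2 by (simp add: numeral_2_eq_2)
  define b where "b = (if l \<le> 2 then 2 else n - 1)"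
  define s where "s = (if l \<le> 2 then r 1 else r (n - 1))"
  have "s = P (transpose (base l) b)" using 1 P_tr_last by (simp add: s_def b_def base_def)
  moreover have "TT l * (s * TT l * s) - (s * TT l * s) * TT l = scl (- t) (TT l * s - s * TT l)"
    using assms(4) left.T_comm left.Tv_comm right.T_comm right.Tv_comm unfolding idx
    by (auto simp: TT_def s_def)
  moreover have "b \<in> {1..n}" "base l \<noteq> b" using n2 by (auto simp: b_def base_def)
  ultimately show ?thesis
    unfolding Vc_def by (intro copy_same_comm[OF stab_TT base_in] assms) 
qed

text \<open>For \<open>2 \<le> n\<close> the nodes 0 and n are not adjacent, and each of the
  reflections \<open>r 0\<close>, \<open>r n\<close> fixes the variable at the opposite end.\<close>

lemma ends_commute:
  assumes "y = T0 \<or> y = T0v" "z = Tn \<or> z = Tnv"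
  shows "y * z = z * y"
proof -
  have 1: "commutes (r 0) (r n)" using rel_comm[of 0 n] n2 unfolding commutes_def by simp
  have 2: "commutes (r 0) (X n)" using r0_X[of n] n2 unfolding commutes_def by simp
  have 3: "commutes (X 1) (r n)" using rn_X[of 1] n2 unfolding commutes_def by auto
  have 4: "commutes (X 1) (X n)" using X_comm[of 1 n] n2 unfolding commutes_def by auto
  have T0: "commutes T0 (X n)" "commutes T0 (r n)"
    unfolding T0_def by (intro commutes_intros 1 2 3 4)+
  then have T0v: "commutes T0v (X n)" "commutes T0v (r n)"
    unfolding T0v_def by (intro commutes_intros 3 4; simp)+
  have y: "commutes y (X n)" "commutes y (r n)" using assms(1) T0 T0v by auto
  have "commutes y Tn" unfolding Tn_def by (intro commutes_intros y)
  moreover from this have "commutes y Tnv" unfolding Tnv_def by (intro commutes_intros y; simp)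
  ultimately show ?thesis using assms(2) commutesD by auto
qed

lemma Vc_diff:
  assumes "i \<in> {1..n}" "j \<in> {1..n}" "i \<noteq> j" "l \<in> {1..4}" "m \<in> {1..4}" "l \<noteq> m"
  shows "Vc i l * Vc j m = Vc j m * Vc i l"
proof -
  have 1: "P (transpose 1 2) = r 1" using P_adj[of 1] n2 by (simp add: numeral_2_eq_2)
  have main: "Vc i l * Vc j m = Vc j m * Vc i l"
    if "i \<in> {1..n}" "j \<in> {1..n}" "i \<noteq> j" "l \<in> {1..4}" "m \<in> {1..4}" "l < m" for i j l m
  proof -
    note lm = that(4,5,6)
    \<comment> \<open>The second particle is the one at which the copy is explicit: the neighbour of
      the end if both elements sit at the same end, and n itself, where the copy is
      \<open>TT m\<close>, if they sit at opposite ends.\<close>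
    define b where "b = (if l \<le> 2 then if m \<le> 2 then 2 else n else n - 1)"
    have b: "b \<in> {1..n}" "base l \<noteq> b" using n2 by (auto simp: b_def base_def)
    have c: "copy 1 y 2 = r 1 * y * r 1" "copy n y (n - 1) = r (n - 1) * y * r (n - 1)" for y
      using 1 P_tr_last by (simp_all add: copy_def conjP_def)
    have e: "y * z = z * y" if "y \<in> {T0, T0v}" "z \<in> {Tn, Tnv}" for y z
      using that by (intro ends_commute) auto
    have "TT l * copy (base m) (TT m) b = copy (base m) (TT m) b * TT l"
    proof -
      have l: "copy 1 T0v 2 = r 1 * T0v * r 1" "copy n Tnv (n - 1) = r (n - 1) * Tnv * r (n - 1)"
        by (rule c)+
      consider "l = 1" "m = 2" | "l = 1" "m = 3" | "l = 1" "m = 4" | "l = 2" "m = 3" | "l = 2" "m = 4" | "l = 3" "m = 4"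
        using lm unfolding idx by auto
      then show ?thesis
      proof cases
        case 1
        then have "TT l = T0" "TT m = T0v" "base m = 1" "b = 2" by (simp_all add: TT_def base_def b_def)
        then show ?thesis using left.T_Tv_comm by (simp only: l)
      next
        case 6
        then have "TT l = Tn" "TT m = Tnv" "base m = n" "b = n - 1" by (simp_all add: TT_def base_def b_def)
        then show ?thesis using right.T_Tv_comm by (simp only: l)
      qed (auto simp: TT_def base_def b_def copy_self intro: e)
    qed
    then show ?thesis
      unfolding Vc_def by (intro copy_diff_comm[OF stab_TT stab_TT base_in base_in b] that)
  qed
  show ?thesis
  proof (cases "l < m")
    case True
    with assms show ?thesis by (intro main)
  next
    case False
    with assms(6) have "m < l" by simp
    then show ?thesis
      using main[OF assms(2,1) assms(3)[symmetric] assms(5,4)] by metis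
  qed
qed

end

section \<open>Leading terms\<close>

text \<open>In the coordinates y = 2x - 1/2 the first component is the geometric action: x -> 1 - x
  becomes y -> 1 - y, and x -> - x becomes y -> - 1 - y. The origin is then the point (1/4, ...,
  1/4), whose stabiliser is just S_n. The second component is the homomorphism from W to S_n that
  sends s_0 and s_n to the identity.\<close>

definition st_act :: "nat \<Rightarrow> nat \<Rightarrow> (nat \<Rightarrow> int) \<times> (nat \<Rightarrow> nat) \<Rightarrow> (nat \<Rightarrow> int) \<times> (nat \<Rightarrow> nat)" where
  "st_act n i = (\<lambda>(y, \<pi>). if i = 0 then (y(1 := 1 - y 1), \<pi>)
     else if i < n then (y \<circ> transpose i (Suc i), transpose i (Suc i) \<circ> \<pi>)
     else (y(n := - 1 - y n), \<pi>))"

definition st :: "nat \<Rightarrow> nat list \<Rightarrow> (nat \<Rightarrow> int) \<times> (nat \<Rightarrow> nat) \<Rightarrow> (nat \<Rightarrow> int) \<times> (nat \<Rightarrow> nat)" where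
  "st n u = foldr (st_act n) u"

text \<open>Only the letters at the two ends count: permutations get degree 0, and the reflection in
  the leading term of each V_(i,1) or V_(i,3) gets degree 1.\<close>

definition deg :: "nat \<Rightarrow> nat list \<Rightarrow> nat" where
  "deg n u = length (filter (\<lambda>i. i = 0 \<or> i = n) u)"

lemma st_simps [simp]: "st n [] s = s" "st n (i # u) s = st_act n i (st n u s)" "st n (u @ v) s = st n u (st n v s)"
  by (simp_all add: st_def)

lemma deg_simps [simp]: "deg n [] = 0" "deg n (u @ v) = deg n u + deg n v"
  "deg n (i # u) = (if i = 0 \<or> i = n then 1 else 0) + deg n u"
  by (simp_all add: deg_def)

lemma st_coxeter: "2 \<le> n \<Longrightarrow> (u, v) \<in> coxeter_rels n \<Longrightarrow> st n u s = st n v s"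
  unfolding coxeter_rels_def
  by (cases s) (auto simp: st_act_def fun_eq_iff transpose_def)

abbreviation cox_eq :: "nat \<Rightarrow> (nat list \<times> nat list) set" where
  "cox_eq n \<equiv> (word_step n \<union> (word_step n)\<inverse>)\<^sup>*"

lemma st_cox_eq: "(u, v) \<in> cox_eq n \<Longrightarrow> 2 \<le> n \<Longrightarrow> st n u s = st n v s"
  by (induction rule: rtrancl_induct) (auto simp: word_step_def st_coxeter)

lemma sum_abs_upd:
  fixes y :: "nat \<Rightarrow> int"
  assumes "k \<in> {1..n}" "\<bar>c\<bar> \<le> \<bar>y k\<bar> + 1"
  shows "(\<Sum>i\<in>{1..n}. \<bar>(y(k := c)) i\<bar>) \<le> (\<Sum>i\<in>{1..n}. \<bar>y i\<bar>) + 1"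
proof -
  have "(\<Sum>i\<in>{1..n} - {k}. \<bar>(y(k := c)) i\<bar>) = (\<Sum>i\<in>{1..n} - {k}. \<bar>y i\<bar>)"
    by (intro sum.cong) auto
  then show ?thesis
    using assms sum.remove[OF _ assms(1), of "\<lambda>i. \<bar>(y(k := c)) i\<bar>"] sum.remove[OF _ assms(1), of "\<lambda>i. \<bar>y i\<bar>"] by simp
qed

text \<open>An end letter reflects one coordinate in 1/2 or in - 1/2 and so changes its absolute
  value by at most 1; the other letters permute the coordinates. Hence a word that carries the
  origin to y contains at least |y_1| + ... + |y_n| end letters.\<close>

lemma st_deg_bound:
  "1 \<le> n \<Longrightarrow> set u \<subseteq> {0..n} \<Longrightarrow> (\<Sum>i\<in>{1..n}. \<bar>fst (st n u (y, \<pi>)) i\<bar>) \<le> (\<Sum>i\<in>{1..n}. \<bar>y i\<bar>) + int (deg n u)"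
proof (induction u)
  case (Cons i u)
  define y' where "y' = fst (st n u (y, \<pi>))"
  have f: "fst (st n (i # u) (y, \<pi>)) = (if i = 0 then y'(1 := 1 - y' 1) else if i < n then y' \<circ> transpose i (Suc i) else y'(n := - 1 - y' n))"
    by (simp add: st_act_def y'_def split: prod.split)
  have IH: "(\<Sum>i\<in>{1..n}. \<bar>y' i\<bar>) \<le> (\<Sum>i\<in>{1..n}. \<bar>y i\<bar>) + int (deg n u)"
    unfolding y'_def by (rule Cons.IH) (use Cons.prems in auto)
  consider "i = 0" | "0 < i" "i < n" | "i = n" "i \<noteq> 0" using Cons.prems by force
  then show ?case
  proof cases
    case 1
    have "\<bar>1 - y' 1\<bar> \<le> \<bar>y' 1\<bar> + 1" by linarith
    then show ?thesis using 1 IH sum_abs_upd[of 1 n "1 - y' 1" y'] Cons.prems unfolding f by simp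
  next
    case 2
    have "(\<Sum>j\<in>{1..n}. \<bar>y' (transpose i (Suc i) j)\<bar>) = (\<Sum>j\<in>{1..n}. \<bar>y' j\<bar>)"
      using 2 by (intro sum.reindex_bij_witness[of _ "transpose i (Suc i)" "transpose i (Suc i)"]) (auto simp: transpose_def)
    then show ?thesis using IH 2 unfolding f by simp
  next
    case 3
    have "\<bar>- 1 - y' n\<bar> \<le> \<bar>y' n\<bar> + 1" by linarith
    then show ?thesis using 3 IH sum_abs_upd[of n n "- 1 - y' n" y'] Cons.prems unfolding f by simp
  qed
qed simp

lemma st_act_mid: "0 < i \<Longrightarrow> i < n \<Longrightarrow> st_act n i (y, \<pi>) = (y \<circ> transpose i (Suc i), transpose i (Suc i) \<circ> \<pi>)"
  by (simp add: st_act_def)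

lemma st_perm: "set u \<subseteq> {1..<n} \<Longrightarrow> st n u (y, \<pi>) = (y \<circ> finv (wperm u), wperm u \<circ> \<pi>)"
proof (induction u)
  case (Cons i u)
  have "wperm u permutes {1..n}" using Cons.prems by (intro wperm_permutes) auto
  then have "finv (transpose i (Suc i) \<circ> wperm u) = finv (wperm u) \<circ> transpose i (Suc i)"
    by (simp add: o_inv_distrib permutes_bij)
  moreover have "st n u (y, \<pi>) = (y \<circ> finv (wperm u), wperm u \<circ> \<pi>)"
    by (rule Cons.IH) (use Cons.prems in simp)
  moreover have "0 < i" "i < n" using Cons.prems by auto
  ultimately show ?case by (simp only: st_simps st_act_mid wperm_simps o_assoc)
qed (auto simp: fun_eq_iff)

definition letter_word :: "nat \<Rightarrow> nat \<Rightarrow> nat \<Rightarrow> nat list" where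
  "letter_word n i l = (if l = 1 then perm_word n (transpose 1 i) @ [0] @ perm_word n (transpose 1 i)
     else perm_word n (transpose n i) @ [n] @ perm_word n (transpose n i))"

lemma perm_word_st:
  "\<pi> permutes {1..n} \<Longrightarrow> st n (perm_word n \<pi>) (y, \<rho>) = (y \<circ> finv \<pi>, \<pi> \<circ> \<rho>)"
  using st_perm[of "perm_word n \<pi>" n y \<rho>] perm_word[of \<pi> n] by simp

lemma deg_perm: "set u \<subseteq> {1..<n} \<Longrightarrow> deg n u = 0"
  by (induction u) auto

lemma letter_word:
  assumes "2 \<le> n" "i \<in> {1..n}"
  shows "set (letter_word n i l) \<subseteq> {0..n}" "deg n (letter_word n i l) = 1"
    "st n (letter_word n i 1) (y, \<pi>) = (y(i := 1 - y i), \<pi>)"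
    "st n (letter_word n i 3) (y, \<pi>) = (y(i := - 1 - y i), \<pi>)"
proof -
  have t: "transpose 1 i permutes {1..n}" "transpose n i permutes {1..n}"
    using assms by (auto intro!: permutes_swap_id)
  note w = perm_word[OF t(1)] perm_word[OF t(2)]
  then have d: "deg n (perm_word n (transpose 1 i)) = 0" "deg n (perm_word n (transpose n i)) = 0"
    by (auto intro!: deg_perm)
  have s: "set (perm_word n (transpose 1 i)) \<subseteq> {0..n}" "set (perm_word n (transpose n i)) \<subseteq> {0..n}"
    using w by auto
  show "set (letter_word n i l) \<subseteq> {0..n}" using s by (auto simp: letter_word_def)
  show "deg n (letter_word n i l) = 1" using d by (simp add: letter_word_def)
  show "st n (letter_word n i 1) (y, \<pi>) = (y(i := 1 - y i), \<pi>)"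
    by (simp add: letter_word_def perm_word_st[OF t(1)] st_act_def del: One_nat_def)
      (auto simp: fun_eq_iff transpose_def)
  show "st n (letter_word n i 3) (y, \<pi>) = (y(i := - 1 - y i), \<pi>)"
    using assms by (simp add: letter_word_def perm_word_st[OF t(2)] st_act_def)
      (auto simp: fun_eq_iff transpose_def)
qed

definition mdeg :: "nat \<Rightarrow> (nat \<Rightarrow>\<^sub>0 nat) \<Rightarrow> nat" where
  "mdeg n a = (\<Sum>j\<in>{1..n}. Poly_Mapping.lookup a j)"

lemma mdeg_add: "mdeg n (a + b) = mdeg n a + mdeg n b"
  by (simp add: mdeg_def lookup_add sum.distrib)

lemma mdeg_single: "j \<in> {1..n} \<Longrightarrow> mdeg n (Poly_Mapping.single j k) = k"
  by (simp add: mdeg_def lookup_single when_def)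

lemma monoms_add_single: "a \<in> monoms n \<Longrightarrow> j \<in> {1..n} \<Longrightarrow> a + Poly_Mapping.single j k \<in> monoms n"
  using keys_add[of a "Poly_Mapping.single j k"] unfolding monoms_def by (fastforce split: if_splits)

lemma prod_list_insert_power:
  fixes x :: "nat \<Rightarrow> 'm::monoid_mult"
  assumes "distinct js" "j \<in> set js" "\<And>i. i \<in> set js \<Longrightarrow> x j * x i = x i * x j"
  shows "x j * prod_list (map (\<lambda>i. x i ^ e i) js) = prod_list (map (\<lambda>i. x i ^ (e i + (if i = j then 1 else 0))) js)"
  using assms
proof (induction js)
  case (Cons k js)
  show ?case
  proof (cases "k = j")
    case True
    then have "map (\<lambda>i. x i ^ (e i + (if i = j then 1 else 0))) js = map (\<lambda>i. x i ^ e i) js"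
      using Cons.prems by (intro map_cong refl) auto
    with True show ?thesis by (simp only: list.map prod_list.Cons) (simp add: mult.assoc)
  next
    case False
    have "x j * x k ^ m = x k ^ m * x j" for m
    proof (induction m)
      case (Suc m)
      have "x j * x k ^ Suc m = (x j * x k) * x k ^ m" by (simp add: mult.assoc)
      also have "\<dots> = x k * (x j * x k ^ m)" using Cons.prems(3)[of k] by (simp add: mult.assoc)
      finally show ?case using Suc by (simp add: mult.assoc)
    qed simp
    then have "x j * (x k ^ e k * z) = x k ^ e k * (x j * z)" for z by (simp flip: mult.assoc)
    with False Cons show ?thesis by simp
  qed
qed simp

context complex_alg
begin

lemma span_image_mult:
  assumes "z \<in> span S" "\<And>b. b \<in> S \<Longrightarrow> y * b \<in> span T"
  shows "y * z \<in> span T"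
  using assms(1)
  by (induction rule: span_induct_alt) (auto simp: distrib_left scl_right span_zero assms(2) intro!: span_add span_scale)

lemma span_mult_image:
  assumes "z \<in> span S" "\<And>b. b \<in> S \<Longrightarrow> b * y \<in> span T"
  shows "z * y \<in> span T"
  using assms(1)
  by (induction rule: span_induct_alt) (auto simp: distrib_right scl_left span_zero assms(2) intro!: span_add span_scale)

end

section \<open>The filtration by degree in X and number of end letters\<close>

context daha_ring
begin

definition Xm :: "(nat \<Rightarrow>\<^sub>0 nat) \<Rightarrow> 'e" where
  "Xm a = prod_list (map (\<lambda>j. X j ^ Poly_Mapping.lookup a j) [1..<Suc n])"

lemma X_Xm: "j \<in> {1..n} \<Longrightarrow> X j * Xm a = Xm (a + Poly_Mapping.single j 1)"
proof -
  assume j: "j \<in> {1..n}"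
  have "Xm (a + Poly_Mapping.single j 1) = prod_list (map (\<lambda>i. X i ^ (Poly_Mapping.lookup a i + (if i = j then 1 else 0))) [1..<Suc n])"
    unfolding Xm_def by (intro arg_cong[of _ _ prod_list] map_cong refl) (auto simp: lookup_add lookup_single)
  also have "\<dots> = X j * Xm a"
    unfolding Xm_def using j by (intro prod_list_insert_power[symmetric] X_comm) auto
  finally show ?thesis by simp
qed

definition words :: "nat list set" where "words = {u. set u \<subseteq> {0..n}}"

lemma words_simps [simp]: "[] \<in> words" "i # u \<in> words \<longleftrightarrow> i \<le> n \<and> u \<in> words"
  "u @ v \<in> words \<longleftrightarrow> u \<in> words \<and> v \<in> words"
  by (auto simp: words_def)

text \<open>The image of \<complex>[W]: the error terms of all commutations of variables with words
  lie here.\<close>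

definition Rsp :: "'e set" where "Rsp = span (rw ` words)"

lemma rw_Rsp: "u \<in> words \<Longrightarrow> rw u \<in> Rsp"
  unfolding Rsp_def by (intro span_base) auto

lemma Rsp_rw_left: "u \<in> words \<Longrightarrow> z \<in> Rsp \<Longrightarrow> rw u * z \<in> Rsp"
  unfolding Rsp_def
proof (erule span_image_mult)
  fix b assume "u \<in> words" "b \<in> rw ` words"
  then show "rw u * b \<in> span (rw ` words)"
    by (auto intro!: span_base image_eqI[of _ rw "u @ _"])
qed

lemma Rsp_rw_right: "u \<in> words \<Longrightarrow> z \<in> Rsp \<Longrightarrow> z * rw u \<in> Rsp"
  unfolding Rsp_def
proof (erule span_mult_image)
  fix b assume "u \<in> words" "b \<in> rw ` words"
  then show "b * rw u \<in> span (rw ` words)"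
    by (auto intro!: span_base image_eqI[of _ rw "_ @ u"])
qed

lemma Rsp_one: "1 \<in> Rsp"
  using rw_Rsp[of "[]"] by (simp add: words_def)

lemma Rsp_intros: "a \<in> Rsp \<Longrightarrow> b \<in> Rsp \<Longrightarrow> a + b \<in> Rsp" "a \<in> Rsp \<Longrightarrow> b \<in> Rsp \<Longrightarrow> a - b \<in> Rsp"
  "a \<in> Rsp \<Longrightarrow> - a \<in> Rsp" "a \<in> Rsp \<Longrightarrow> scl c a \<in> Rsp" "0 \<in> Rsp"
  unfolding Rsp_def by (simp_all add: span_add span_diff span_neg span_scale span_zero)

lemma X_r_shape:
  assumes "i \<in> {1..n}" "k \<le> n"
  shows "\<exists>j e. j \<in> {1..n} \<and> e \<noteq> 0 \<and> X i * r k - scl e (r k * X j) \<in> Rsp"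
proof -
  have r: "r k \<in> Rsp" if "k \<le> n" for k using rw_Rsp[of "[k]"] that by (simp add: words_def)
  have same: ?thesis if "X i * r k = r k * X i"
    using that assms by (intro exI[of _ i] exI[of _ 1]) (auto simp: Rsp_intros)
  consider "k = 0" "i = 1" | "k = 0" "i \<noteq> 1" | "k = n" "i = n" | "k = n" "i \<noteq> n"
    | "0 < k" "k < n" "i = k" | "0 < k" "k < n" "i = Suc k" | "0 < k" "k < n" "i \<noteq> k" "i \<noteq> Suc k"
    using assms(2) by (metis gr0I le_neq_implies_less)
  then show ?thesis
  proof cases
    case 1
    have "X i * r k - scl (- 1) (r k * X 1) = r 0 + sc (2 * t0 + 2 * u0)"
      using r0_X1 1 by (simp add: algebra_simps)
    then have "X i * r k - scl (- 1) (r k * X 1) \<in> Rsp" using r[of 0] by (simp only: Rsp_intros Rsp_one)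
    then show ?thesis using assms 1 by (intro exI[of _ 1] exI[of _ "- 1"]) auto
  next
    case 2
    then show ?thesis using r0_X[of i] assms by (intro same) auto
  next
    case 3
    have "X i * r k - scl (- 1) (r k * X n) = - sc (2 * tn + 2 * un)"
      unfolding 3 rn_Xn by simp
    then have "X i * r k - scl (- 1) (r k * X n) \<in> Rsp" by (simp only: Rsp_intros Rsp_one)
    then show ?thesis using n2 by (intro exI[of _ n] exI[of _ "- 1"]) auto
  next
    case 4
    then show ?thesis using rn_X[of i] assms by (intro same) auto
  next
    case 5
    have "X i * r k - scl 1 (r k * X (Suc k)) = - sc t"
      using ri_XSi[of k] 5 by simp
    then have "X i * r k - scl 1 (r k * X (Suc k)) \<in> Rsp" by (simp only: Rsp_intros Rsp_one)
    then show ?thesis using 5 by (intro exI[of _ "Suc k"] exI[of _ 1]) auto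
  next
    case 6
    have "X i * r k - scl 1 (r k * X k) = sc t"
      using ri_Xi[of k] 6 by simp
    then have "X i * r k - scl 1 (r k * X k) \<in> Rsp" by (simp only: Rsp_intros Rsp_one)
    then show ?thesis using 6 by (intro exI[of _ k] exI[of _ 1]) auto
  next
    case 7
    then show ?thesis using ri_X[of k i] assms by (intro same) auto
  qed
qed

text \<open>Every cross-relation moves a variable past one letter up to a sign, a change of index
  and an element of \<complex>[W]. The new index depends on the word and on \<open>i\<close> only,
  and \<open>e \<noteq> 0\<close> keeps leading coefficients from vanishing.\<close>

lemma X_rw_shape:
  "u \<in> words \<Longrightarrow> i \<in> {1..n} \<Longrightarrow> \<exists>j e. j \<in> {1..n} \<and> e \<noteq> 0 \<and> X i * rw u - scl e (rw u * X j) \<in> Rsp"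
proof (induction u arbitrary: i)
  case Nil
  then show ?case by (intro exI[of _ i] exI[of _ 1]) (auto simp: Rsp_intros)
next
  case (Cons k u)
  then have k: "k \<le> n" and u: "u \<in> words" by (auto simp: words_def)
  obtain j e where j: "j \<in> {1..n}" "e \<noteq> 0" "X i * r k - scl e (r k * X j) \<in> Rsp"
    using X_r_shape[OF Cons.prems(2) k] by auto
  obtain j' e' where j': "j' \<in> {1..n}" "e' \<noteq> 0" "X j * rw u - scl e' (rw u * X j') \<in> Rsp"
    using Cons.IH[OF u j(1)] by auto
  have "X i * rw (k # u) - scl (e * e') (rw (k # u) * X j')
      = (X i * r k - scl e (r k * X j)) * rw u + scl e (rw [k] * (X j * rw u - scl e' (rw u * X j')))"
    by (simp add: left_diff_distrib right_diff_distrib scale_right_diff_distrib scl_left scl_right mult.assoc)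
  also have "\<dots> \<in> Rsp"
    using u k by (intro Rsp_intros(1,4) Rsp_rw_left[OF _ j'(3)] Rsp_rw_right[OF _ j(3)]) (auto simp: words_def)
  finally show ?case using j(2) j' by (intro exI[of _ j'] exI[of _ "e * e'"]) auto
qed

lemma rw_X_perm:
  "set u \<subseteq> {1..<n} \<Longrightarrow> j \<in> {1..n} \<Longrightarrow> rw u * X j - X (wperm u j) * rw u \<in> Rsp"
proof (induction u)
  case (Cons k u)
  then have k: "1 \<le> k" "k < n" and u: "set u \<subseteq> {1..<n}" by auto
  let ?i = "wperm u j"
  have i: "?i \<in> {1..n}" using wperm_permutes[OF u] Cons.prems(2) by (simp only: permutes_in_image)
  have 1: "r k * X ?i - X (transpose k (Suc k) ?i) * r k \<in> Rsp"
  proof -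
    consider "?i = k" | "?i = Suc k" | "?i \<noteq> k" "?i \<noteq> Suc k" by blast
    then show ?thesis
      using ri_Xi[OF k] ri_XSi[OF k] ri_X[OF k i] by cases (auto simp: Rsp_intros Rsp_one)
  qed
  have "rw (k # u) * X j - X (wperm (k # u) j) * rw (k # u)
      = rw [k] * (rw u * X j - X ?i * rw u) + (r k * X ?i - X (transpose k (Suc k) ?i) * r k) * rw u"
    by (simp add: left_diff_distrib right_diff_distrib mult.assoc)
  also have "\<dots> \<in> Rsp"
    using u k by (intro Rsp_intros(1) Rsp_rw_left[OF _ Cons.IH[OF u Cons.prems(2)]] Rsp_rw_right[OF _ 1]) (auto simp: words_def)
  finally show ?case .
qed (simp add: Rsp_intros)

lemma P_words: "\<pi> permutes {1..n} \<Longrightarrow> perm_word n \<pi> \<in> words"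
  using perm_word[of \<pi> n] by (auto simp: words_def)

text \<open>Modulo \<complex>[W] the symmetric group simply permutes the variables; this lets the
  shapes of T_0 and T_n be copied to every particle.\<close>

lemma conjP_X:
  assumes "\<pi> permutes {1..n}" "j \<in> {1..n}"
  shows "conjP \<pi> (X j) - X (\<pi> j) \<in> Rsp"
proof -
  have "P \<pi> * X j - X (\<pi> j) * P \<pi> \<in> Rsp"
    using rw_X_perm[of "perm_word n \<pi>" j] perm_word[OF assms(1)] assms(2) by (simp add: P_def)
  then have "(P \<pi> * X j - X (\<pi> j) * P \<pi>) * P (finv \<pi>) \<in> Rsp"
    unfolding P_def[of "finv \<pi>"] using assms by (intro Rsp_rw_right P_words permutes_inv)
  also have "(P \<pi> * X j - X (\<pi> j) * P \<pi>) * P (finv \<pi>) = conjP \<pi> (X j) - X (\<pi> j)"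
    using P_inv(1)[OF assms(1)] by (simp add: conjP_def left_diff_distrib mult.assoc)
  finally show ?thesis .
qed

text \<open>In \<open>T0\<close> the variable occurs through
  \<open>- (1/2) * X 1 * (r 0 - 1)\<close>, everything else lies in \<complex>[W], and conjugation
  turns \<open>r 0\<close> into the letter word. Of the two terms with \<open>X i\<close>, the one
  with the letter word dominates, having one end letter more.\<close>

lemma Vc1_shape:
  assumes "i \<in> {1..n}"
  shows "Vc i 1 - (scl (- (1/2)) (X i * rw (letter_word n i 1)) + scl (1/2) (X i)) \<in> Rsp" (is "?A \<in> _")
proof -
  let ?\<tau> = "transpose 1 i"
  have \<tau>: "?\<tau> permutes {1..n}" using assms by (intro permutes_swap_id) auto
  have w: "rw (letter_word n i 1) = conjP ?\<tau> (r 0)"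
    by (simp add: letter_word_def conjP_def P_def mult.assoc)
  have x: "conjP ?\<tau> (X 1) - X i \<in> Rsp" using conjP_X[OF \<tau>, of 1] n2 by simp
  have T: "T0 = scl (- (1/2)) (X 1 * r 0) + scl (1/2) (X 1) + (scl (1/2) (scl (t0 - u0 + 1/2) (r 0 - 1)) + sc t0)"
    by (simp add: T0_def left_diff_distrib right_diff_distrib scl_left scale_right_diff_distrib scale_right_distrib scale_left_diff_distrib scale_left_distrib)
  have "Vc i 1 = conjP ?\<tau> T0" by (simp add: Vc_def TT_def base_def copy_def)
  also have "\<dots> = scl (- (1/2)) (conjP ?\<tau> (X 1) * conjP ?\<tau> (r 0)) + scl (1/2) (conjP ?\<tau> (X 1))
      + (scl (1/2) (scl (t0 - u0 + 1/2) (conjP ?\<tau> (r 0) - 1)) + sc t0)"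
    unfolding T by (simp only: conjP_add conjP_scl conjP_mult[OF \<tau>] conjP_one[OF \<tau>] conjP_diff)
  finally have "?A = scl (- (1/2)) ((conjP ?\<tau> (X 1) - X i) * rw (letter_word n i 1)) + scl (1/2) (conjP ?\<tau> (X 1) - X i)
      + (scl (1/2) (scl (t0 - u0 + 1/2) (rw (letter_word n i 1) - 1)) + sc t0)"
    unfolding w by (simp add: left_diff_distrib scale_right_diff_distrib)
  also have "\<dots> \<in> Rsp"
    using x letter_word(1)[OF n2 assms]
    by (intro Rsp_intros(1,4) Rsp_rw_right[OF _ x] x Rsp_intros(2)[OF rw_Rsp Rsp_one] Rsp_one)
      (auto simp: words_def)
  finally show ?thesis .
qed

lemma Vc3_shape:
  assumes "i \<in> {1..n}"
  shows "Vc i 3 - (scl (1/2) (X i * rw (letter_word n i 3)) + scl (- (1/2)) (X i)) \<in> Rsp" (is "?A \<in> _")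
proof -
  let ?\<tau> = "transpose n i"
  have \<tau>: "?\<tau> permutes {1..n}" using assms by (intro permutes_swap_id) auto
  have w: "rw (letter_word n i 3) = conjP ?\<tau> (r n)"
    by (simp add: letter_word_def conjP_def P_def mult.assoc)
  have x: "conjP ?\<tau> (X n) - X i \<in> Rsp" using conjP_X[OF \<tau>, of n] n2 by simp
  have T: "Tn = scl (1/2) (X n * r n) + scl (- (1/2)) (X n) + (scl (1/2) (scl (tn - un) (r n - 1)) + sc tn)"
    by (simp add: Tn_def left_diff_distrib right_diff_distrib distrib_left distrib_right scl_left scale_right_diff_distrib scale_left_diff_distrib scale_right_distrib)
  have "Vc i 3 = conjP ?\<tau> Tn" by (simp add: Vc_def TT_def base_def copy_def)
  also have "\<dots> = scl (1/2) (conjP ?\<tau> (X n) * conjP ?\<tau> (r n)) + scl (- (1/2)) (conjP ?\<tau> (X n))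
      + (scl (1/2) (scl (tn - un) (conjP ?\<tau> (r n) - 1)) + sc tn)"
    unfolding T by (simp only: conjP_add conjP_scl conjP_mult[OF \<tau>] conjP_one[OF \<tau>] conjP_diff)
  finally have "?A = scl (1/2) ((conjP ?\<tau> (X n) - X i) * rw (letter_word n i 3)) + scl (- (1/2)) (conjP ?\<tau> (X n) - X i)
      + (scl (1/2) (scl (tn - un) (rw (letter_word n i 3) - 1)) + sc tn)"
    unfolding w by (simp add: left_diff_distrib scale_right_diff_distrib)
  also have "\<dots> \<in> Rsp"
    using x letter_word(1)[OF n2 assms]
    by (intro Rsp_intros(1,4) Rsp_rw_right[OF _ x] x Rsp_intros(2)[OF rw_Rsp Rsp_one] Rsp_one)
      (auto simp: words_def)
  finally show ?thesis .
qed

lemma Vc12_shape: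
  assumes "i \<in> {1..n}"
  shows "Vc i 1 + Vc i 2 - X i \<in> Rsp"
proof -
  let ?\<tau> = "transpose 1 i"
  have \<tau>: "?\<tau> permutes {1..n}" using assms by (intro permutes_swap_id) auto
  have "Vc i 1 + Vc i 2 = conjP ?\<tau> (X 1) - sc (1/2)"
    by (simp add: Vc_def TT_def base_def copy_def T0v_def conjP_diff conjP_scl conjP_one[OF \<tau>] del: One_nat_def)
  then have "Vc i 1 + Vc i 2 - X i = (conjP ?\<tau> (X 1) - X i) - sc (1/2)" by simp
  also have "\<dots> \<in> Rsp"
    using Rsp_intros(2)[OF conjP_X[OF \<tau>, of 1] Rsp_intros(4)[OF Rsp_one, of "1/2"]] n2 by simp
  finally show ?thesis .
qed

text \<open>Everything strictly below the bidegree (D, L) in the lexicographic order. The number of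
  end letters is bounded only in top degree, since the elements of \<complex>[W] that arise as
  errors may involve words of any length.\<close>

definition G :: "nat \<Rightarrow> nat \<Rightarrow> 'e set" where
  "G D L = span {rw u * Xm a | u a. u \<in> words \<and> a \<in> monoms n \<and> (mdeg n a < D \<or> mdeg n a = D \<and> deg n u < L)}"

lemma G_intros: "a \<in> G D L \<Longrightarrow> b \<in> G D L \<Longrightarrow> a + b \<in> G D L" "a \<in> G D L \<Longrightarrow> b \<in> G D L \<Longrightarrow> a - b \<in> G D L"
  "a \<in> G D L \<Longrightarrow> scl c a \<in> G D L" "0 \<in> G D L"
  unfolding G_def by (simp_all add: span_add span_diff span_neg span_scale span_zero)

lemma G_base: "u \<in> words \<Longrightarrow> a \<in> monoms n \<Longrightarrow> mdeg n a < D \<or> mdeg n a = D \<and> deg n u < L \<Longrightarrow> rw u * Xm a \<in> G D L"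
  unfolding G_def by (intro span_base) auto

lemma G_mono: "D < D' \<or> D = D' \<and> L \<le> L' \<Longrightarrow> G D L \<subseteq> G D' L'"
  unfolding G_def by (intro span_mono) (fastforce intro: less_le_trans)

lemma Rsp_Xm: "z \<in> Rsp \<Longrightarrow> a \<in> monoms n \<Longrightarrow> mdeg n a < D \<Longrightarrow> z * Xm a \<in> G D L"
  unfolding Rsp_def G_def by (erule span_mult_image) (auto intro!: span_base)

lemma G_X:
  assumes "i \<in> {1..n}" "z \<in> G D L"
  shows "X i * z \<in> G (Suc D) L"
  using assms(2) unfolding G_def
proof (rule span_image_mult, fold G_def)
  fix b assume "b \<in> {rw u * Xm a | u a. u \<in> words \<and> a \<in> monoms n \<and> (mdeg n a < D \<or> mdeg n a = D \<and> deg n u < L)}"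
  then obtain u a where b: "b = rw u * Xm a" "u \<in> words" "a \<in> monoms n" "mdeg n a < D \<or> mdeg n a = D \<and> deg n u < L"
    by auto
  obtain j e where j: "j \<in> {1..n}" "X i * rw u - scl e (rw u * X j) \<in> Rsp"
    using X_rw_shape[OF b(2) assms(1)] by auto
  have "X i * b = (X i * rw u - scl e (rw u * X j)) * Xm a + scl e (rw u * Xm (a + Poly_Mapping.single j 1))"
    unfolding b(1) X_Xm[OF j(1), symmetric] by (simp add: left_diff_distrib scl_left mult.assoc)
  also have "\<dots> \<in> G (Suc D) L"
    using b j by (intro G_intros Rsp_Xm G_base monoms_add_single) (auto simp: mdeg_add mdeg_single)
  finally show "X i * b \<in> G (Suc D) L" .
qed

lemma G_rw:
  assumes "v \<in> words" "z \<in> G D L"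
  shows "rw v * z \<in> G D (deg n v + L)"
  using assms(2) unfolding G_def
proof (rule span_image_mult, fold G_def)
  fix b assume "b \<in> {rw u * Xm a | u a. u \<in> words \<and> a \<in> monoms n \<and> (mdeg n a < D \<or> mdeg n a = D \<and> deg n u < L)}"
  then obtain u a where b: "b = rw u * Xm a" "u \<in> words" "a \<in> monoms n" "mdeg n a < D \<or> mdeg n a = D \<and> deg n u < L"
    by auto
  have "rw v * b = rw (v @ u) * Xm a" by (simp add: b mult.assoc)
  also have "\<dots> \<in> G D (deg n v + L)" using b assms(1) by (intro G_base) (auto simp: words_def)
  finally show "rw v * b \<in> G D (deg n v + L)" .
qed

text \<open>Left multiplication by \<complex>[W] does not raise the degree in X, so one extra degree
  of room absorbs any number of end letters.\<close>

lemma G_Rsp: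
  assumes "y \<in> Rsp" "z \<in> G D L"
  shows "y * z \<in> G (Suc D) L'"
  using assms(1) unfolding Rsp_def
proof (induction rule: span_induct_alt)
  case base
  then show ?case by (simp add: G_intros)
next
  case (step c x y)
  then obtain v where v: "v \<in> words" "x = rw v" by auto
  have "x * z \<in> G (Suc D) L'"
    using G_rw[OF v(1) assms(2)] G_mono[of D "Suc D"] v(2) by blast
  then show ?case using step by (simp add: distrib_right scl_left G_intros)
qed

definition lead :: "'e \<Rightarrow> nat list \<Rightarrow> (nat \<Rightarrow>\<^sub>0 nat) \<Rightarrow> bool" where
  "lead z u p \<longleftrightarrow> u \<in> words \<and> p \<in> monoms n \<and> (\<exists>c. c \<noteq> 0 \<and> z - scl c (rw u * Xm p) \<in> G (mdeg n p) (deg n u))"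

lemma lead_in_G: "lead z u p \<Longrightarrow> z \<in> G (mdeg n p) (Suc (deg n u))"
proof -
  assume "lead z u p"
  then obtain c where u: "u \<in> words" "p \<in> monoms n" "z - scl c (rw u * Xm p) \<in> G (mdeg n p) (deg n u)"
    unfolding lead_def by auto
  have "z - scl c (rw u * Xm p) \<in> G (mdeg n p) (Suc (deg n u))"
    using u(3) G_mono[of "mdeg n p" "mdeg n p" "deg n u" "Suc (deg n u)"] by auto
  moreover have "rw u * Xm p \<in> G (mdeg n p) (Suc (deg n u))"
    using u by (intro G_base) auto
  ultimately have "(z - scl c (rw u * Xm p)) + scl c (rw u * Xm p) \<in> G (mdeg n p) (Suc (deg n u))"
    by (intro G_intros(1,3))
  then show ?thesis by simp
qed

text \<open>Of the three parts of \<open>y\<close>, the first gains a variable and an end letter,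
  the second only a variable, and the third, from \<complex>[W], no variable at all; so the first
  one leads. The variable \<open>X j\<close> into which \<open>X i\<close> turns while passing
  \<open>v @ u\<close> depends on the words alone, which is why \<open>j\<close> is quantified
  before \<open>z\<close> and \<open>p\<close>: the exponent is shifted by the same amount for every
  \<open>z\<close>.\<close>

lemma lead_letter:
  assumes i: "i \<in> {1..n}" and v: "v \<in> words" "deg n v = 1" and \<kappa>: "\<kappa> \<noteq> 0" and u: "u \<in> words"
    and y: "y - (scl \<kappa> (X i * rw v) + scl \<kappa>' (X i)) \<in> Rsp"
  shows "\<exists>j\<in>{1..n}. \<forall>z p. lead z u p \<longrightarrow> lead (y * z) (v @ u) (p + Poly_Mapping.single j 1)"
proof -
  define \<rho> where "\<rho> = y - (scl \<kappa> (X i * rw v) + scl \<kappa>' (X i))"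
  have vu: "v @ u \<in> words" using v u by (auto simp: words_def)
  obtain j e where j: "j \<in> {1..n}" "e \<noteq> 0" "X i * rw (v @ u) - scl e (rw (v @ u) * X j) \<in> Rsp"
    using X_rw_shape[OF vu i] by auto
  have "lead (y * z) (v @ u) (p + Poly_Mapping.single j 1)" if z_lead: "lead z u p" for z p
  proof -
    obtain c where c: "c \<noteq> 0" "p \<in> monoms n" "z - scl c (rw u * Xm p) \<in> G (mdeg n p) (deg n u)"
      using z_lead unfolding lead_def by auto
    define g where "g = z - scl c (rw u * Xm p)"
    let ?D = "mdeg n p" and ?L = "deg n u"
    have z: "z = scl c (rw u * Xm p) + g" by (simp add: g_def)
    have yz: "y * z = scl \<kappa> (X i * rw v * z) + scl \<kappa>' (X i * z) + \<rho> * z"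
      by (simp add: \<rho>_def algebra_simps scl_left)
    have "X i * rw v * z = scl c (X i * rw (v @ u) * Xm p) + X i * (rw v * g)"
      unfolding z by (simp add: distrib_left mult.assoc scl_right)
    then have "y * z - scl (\<kappa> * c * e) (rw (v @ u) * Xm (p + Poly_Mapping.single j 1))
        = scl (\<kappa> * c) ((X i * rw (v @ u) - scl e (rw (v @ u) * X j)) * Xm p)
          + scl \<kappa> (X i * (rw v * g)) + scl \<kappa>' (X i * z) + \<rho> * z"
      unfolding yz X_Xm[OF j(1), symmetric]
      by (simp add: left_diff_distrib scl_left scale_right_distrib scale_right_diff_distrib mult.assoc)
    also have "\<dots> \<in> G (Suc ?D) (Suc ?L)"
    proof (intro G_intros)
      show "(X i * rw (v @ u) - scl e (rw (v @ u) * X j)) * Xm p \<in> G (Suc ?D) (Suc ?L)"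
        by (rule Rsp_Xm[OF j(3) c(2)]) simp
      show "X i * (rw v * g) \<in> G (Suc ?D) (Suc ?L)"
        using G_X[OF i G_rw[OF v(1) c(3)]] v(2) by (simp add: g_def)
      show "X i * z \<in> G (Suc ?D) (Suc ?L)"
        by (rule G_X[OF i lead_in_G[OF z_lead]])
      show "\<rho> * z \<in> G (Suc ?D) (Suc ?L)"
        by (rule G_Rsp[OF _ lead_in_G[OF z_lead]]) (use y in \<open>simp add: \<rho>_def\<close>)
    qed
    finally show ?thesis
      unfolding lead_def using \<kappa> c j vu v(2)
      by (intro conjI exI[of _ "\<kappa> * c * e"] monoms_add_single) (auto simp: mdeg_add mdeg_single)
  qed
  then show ?thesis using j(1) by blast
qed

text \<open>With the empty word nothing is permuted, so the exponent grows at the index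
  \<open>i\<close> itself. Monomials in the x_i therefore keep their own exponent as leading
  exponent.\<close>

lemma lead_x:
  assumes i: "i \<in> {1..n}" and y: "y - X i \<in> Rsp" and z: "lead z [] p"
  shows "lead (y * z) [] (p + Poly_Mapping.single i 1)"
proof -
  obtain c where c: "c \<noteq> 0" "p \<in> monoms n" "z - scl c (Xm p) \<in> G (mdeg n p) 0"
  proof -
    from z have "p \<in> monoms n" "\<exists>c. c \<noteq> 0 \<and> z - scl c (Xm p) \<in> G (mdeg n p) 0"
      unfolding lead_def by simp_all
    then show ?thesis using that by blast
  qed
  have "y * z - scl c (Xm (p + Poly_Mapping.single i 1)) = X i * (z - scl c (Xm p)) + (y - X i) * z"
    unfolding X_Xm[OF i, symmetric] by (simp add: algebra_simps scl_right)
  also have "\<dots> \<in> G (Suc (mdeg n p)) 0"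
    using G_X[OF i c(3)] G_Rsp[OF y lead_in_G[OF z]] by (intro G_intros)
  finally show ?thesis
    unfolding lead_def using c i by (intro conjI exI[of _ c] monoms_add_single) (auto simp: mdeg_add mdeg_single words_def)
qed

lemma lead_rw:
  assumes "v \<in> words" "lead z u p"
  shows "lead (rw v * z) (v @ u) p"
proof -
  obtain c where c: "c \<noteq> 0" "u \<in> words" "p \<in> monoms n" "z - scl c (rw u * Xm p) \<in> G (mdeg n p) (deg n u)"
    using assms(2) unfolding lead_def by auto
  have "rw v * z - scl c (rw (v @ u) * Xm p) = rw v * (z - scl c (rw u * Xm p))"
    by (simp add: right_diff_distrib scl_right mult.assoc)
  also have "\<dots> \<in> G (mdeg n p) (deg n (v @ u))" using G_rw[OF assms(1) c(4)] by simp
  finally show ?thesis unfolding lead_def using c assms(1) by (auto simp: words_def)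
qed

lemma lead_one: "lead 1 [] 0"
  unfolding lead_def by (auto simp: words_def monoms_def Xm_def G_intros map_replicate_const intro!: exI[of _ 1])

end

section \<open>Spanning modulo the defining relations\<close>

text \<open>The alternating word that carries \<open>0\<close> to \<open>y\<close> when \<open>1\<close> acts as \<open>y \<mapsto> 1 - y\<close> and \<open>3\<close> as \<open>y \<mapsto> - 1 - y\<close>.\<close>

function alt :: "int \<Rightarrow> nat list" where
  "alt y = (if y = 0 then [] else if 0 < y then 1 # alt (1 - y) else 3 # alt (- 1 - y))"
  by auto
termination by (relation "measure (\<lambda>y. nat \<bar>y\<bar>)") auto

declare alt.simps [simp del]

lemma alt_simps:
  "alt 0 = []" "0 < y \<Longrightarrow> alt y = 1 # alt (1 - y)" "y < 0 \<Longrightarrow> alt y = 3 # alt (- 1 - y)"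
  by (simp_all add: alt.simps[of y] alt.simps[of 0])

lemma length_alt: "length (alt y) = nat \<bar>y\<bar>"
proof (induction y rule: alt.induct)
  case (1 y)
  consider "y = 0" | "0 < y" | "y < 0" by linarith
  then show ?case
  proof cases
    case 2
    then show ?thesis using 1 by (simp add: alt_simps(2)[OF 2])
  next
    case 3
    then show ?thesis using 1 by (simp add: alt_simps(3)[OF 3])
  qed (simp add: alt_simps)
qed

lemma set_alt: "set (alt y) \<subseteq> {1, 3}"
proof (induction y rule: alt.induct)
  case (1 y)
  consider "y = 0" | "0 < y" | "y < 0" by linarith
  then show ?case
  proof cases
    case 2
    then show ?thesis using 1 by (simp add: alt_simps(2)[OF 2])
  next
    case 3
    then show ?thesis using 1 by (simp add: alt_simps(3)[OF 3])
  qed (simp add: alt_simps)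
qed

definition vdeg :: "Bgen list \<Rightarrow> nat" where
  "vdeg w = length (filter (\<lambda>h. \<exists>i l. h = GV i l) w)"

lemma vdeg_simps [simp]: "vdeg [] = 0" "vdeg (u @ v) = vdeg u + vdeg v"
  "vdeg (GV i l # w) = Suc (vdeg w)" "vdeg (GS \<sigma> # w) = vdeg w"
  by (simp_all add: vdeg_def)

text \<open>Since \<open>y\<close> vanishes outside \<open>{1..n}\<close>, an index is determined by
  its exponents, n integers and a permutation, and the action on states can recover \<open>y\<close>
  as a function.\<close>

definition bas_idx :: "nat \<Rightarrow> ((nat \<Rightarrow>\<^sub>0 nat) \<times> (nat \<Rightarrow> int) \<times> (nat \<Rightarrow> nat)) set" where
  "bas_idx n = {(a, y, \<pi>). a \<in> monoms n \<and> (\<forall>i. i \<notin> {1..n} \<longrightarrow> y i = 0) \<and> \<pi> permutes {1..n}}"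

definition ydeg :: "nat \<Rightarrow> (nat \<Rightarrow> int) \<Rightarrow> nat" where
  "ydeg n y = (\<Sum>i\<in>{1..n}. nat \<bar>y i\<bar>)"

text \<open>Here \<open>'f\<close> is a free algebra and \<open>I\<close> the ideal of relations; the spanning argument for the
  quotient is carried out modulo \<open>I\<close>.\<close>

locale gdaha_rel = complex_alg scl for scl :: "complex \<Rightarrow> 'f::ring_1 \<Rightarrow> 'f" +
  fixes n :: nat and \<mu> \<gamma> :: "nat \<Rightarrow> complex" and \<nu> :: complex
    and V :: "nat \<Rightarrow> nat \<Rightarrow> 'f" and g :: "(nat \<Rightarrow> nat) \<Rightarrow> 'f" and I :: "'f set"
  assumes I_subspace: "subspace I"
    and I_I: "a \<in> I \<Longrightarrow> b \<in> I \<Longrightarrow> a * b \<in> I"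
    and V_I: "i \<in> {1..n} \<Longrightarrow> l \<in> {1..4} \<Longrightarrow> a \<in> I \<Longrightarrow> V i l * a \<in> I"
    and I_V: "i \<in> {1..n} \<Longrightarrow> l \<in> {1..4} \<Longrightarrow> a \<in> I \<Longrightarrow> a * V i l \<in> I"
    and g_I: "\<sigma> permutes {1..n} \<Longrightarrow> a \<in> I \<Longrightarrow> g \<sigma> * a \<in> I"
    and I_g: "\<sigma> permutes {1..n} \<Longrightarrow> a \<in> I \<Longrightarrow> a * g \<sigma> \<in> I"
    and rel_id: "g id - 1 \<in> I"
    and rel_mult: "\<sigma> permutes {1..n} \<Longrightarrow> \<tau> permutes {1..n} \<Longrightarrow> g \<sigma> * g \<tau> - g (\<sigma> \<circ> \<tau>) \<in> I"
    and rel_sV: "i \<in> {1..n} \<Longrightarrow> j \<in> {1..n} \<Longrightarrow> i \<noteq> j \<Longrightarrow> l \<in> {1..4} \<Longrightarrow>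
      g (transpose i j) * V i l - V j l * g (transpose i j) \<in> I"
    and rel_sV': "i \<in> {1..n} \<Longrightarrow> j \<in> {1..n} \<Longrightarrow> k \<in> {1..n} \<Longrightarrow> i \<noteq> j \<Longrightarrow> k \<noteq> i \<Longrightarrow> k \<noteq> j \<Longrightarrow> l \<in> {1..4} \<Longrightarrow>
      g (transpose i j) * V k l - V k l * g (transpose i j) \<in> I"
    and rel_quad: "k \<in> {1..n} \<Longrightarrow> l \<in> {1..4} \<Longrightarrow> (V k l - sc (\<gamma> l)) * (V k l - sc (\<gamma> l + \<mu> l)) \<in> I"
    and rel_sum: "i \<in> {1..n} \<Longrightarrow>
      V i 1 + V i 2 + V i 3 + V i 4 - scl \<nu> (\<Sum>j\<in>{1..n} - {i}. g (transpose i j)) \<in> I"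
    and rel_same: "i \<in> {1..n} \<Longrightarrow> j \<in> {1..n} \<Longrightarrow> i \<noteq> j \<Longrightarrow> l \<in> {1..4} \<Longrightarrow>
      V i l * V j l - V j l * V i l - scl \<nu> ((V i l - V j l) * g (transpose i j)) \<in> I"
    and rel_diff: "i \<in> {1..n} \<Longrightarrow> j \<in> {1..n} \<Longrightarrow> i \<noteq> j \<Longrightarrow> l \<in> {1..4} \<Longrightarrow> m \<in> {1..4} \<Longrightarrow> l \<noteq> m \<Longrightarrow>
      V i l * V j m - V j m * V i l \<in> I"
begin

primrec gen_val :: "Bgen \<Rightarrow> 'f" where
  "gen_val (GV i l) = V i l" | "gen_val (GS \<sigma>) = g \<sigma>"

definition ev :: "Bgen list \<Rightarrow> 'f" where "ev w = prod_list (map gen_val w)"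

lemma ev_simps [simp]: "ev [] = 1" "ev (h # w) = gen_val h * ev w" "ev (u @ w) = ev u * ev w"
  by (simp_all add: ev_def)

lemma B_gens_iff [simp]: "GV i l \<in> B_gens n \<longleftrightarrow> i \<in> {1..n} \<and> l \<in> {1..4}" "GS \<sigma> \<in> B_gens n \<longleftrightarrow> \<sigma> permutes {1..n}"
  by (auto simp: B_gens_def)

lemma I_ops: "a \<in> I \<Longrightarrow> b \<in> I \<Longrightarrow> a + b \<in> I" "a \<in> I \<Longrightarrow> b \<in> I \<Longrightarrow> a - b \<in> I" "a \<in> I \<Longrightarrow> scl c a \<in> I" "0 \<in> I"
  using I_subspace by (auto intro: subspace_add subspace_diff subspace_scale subspace_0)

lemma ev_I: "w \<in> lists (B_gens n) \<Longrightarrow> a \<in> I \<Longrightarrow> ev w * a \<in> I"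
proof (induction w)
  case (Cons h w)
  then have "ev w * a \<in> I" "h \<in> B_gens n" by auto
  then show ?case by (cases h) (auto simp: mult.assoc V_I g_I)
qed simp

lemma I_ev: "w \<in> lists (B_gens n) \<Longrightarrow> a \<in> I \<Longrightarrow> a * ev w \<in> I"
proof (induction w arbitrary: a)
  case (Cons h w)
  then have "a * gen_val h \<in> I" by (cases h) (auto simp: I_V I_g)
  then have "a * gen_val h * ev w \<in> I" using Cons by auto
  then show ?case by (simp add: mult.assoc)
qed simp

section \<open>The filtration of the free algebra, modulo the relations, by the number of letters
  V\<close>

definition M :: "nat \<Rightarrow> 'f set" where
  "M d = span ({ev w | w. w \<in> lists (B_gens n) \<and> vdeg w \<le> d} \<union> I)"

lemma M_ops: "a \<in> M d \<Longrightarrow> b \<in> M d \<Longrightarrow> a + b \<in> M d" "a \<in> M d \<Longrightarrow> b \<in> M d \<Longrightarrow> a - b \<in> M d"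
  "a \<in> M d \<Longrightarrow> - a \<in> M d" "a \<in> M d \<Longrightarrow> scl c a \<in> M d" "0 \<in> M d"
  unfolding M_def by (simp_all add: span_add span_diff span_neg span_scale span_zero)

lemma M_mono: "c \<le> d \<Longrightarrow> a \<in> M c \<Longrightarrow> a \<in> M d"
proof -
  assume "c \<le> d" "a \<in> M c"
  moreover have "M c \<subseteq> M d" unfolding M_def using \<open>c \<le> d\<close> by (intro span_mono) auto
  ultimately show ?thesis by auto
qed

lemma I_M: "a \<in> I \<Longrightarrow> a \<in> M d"
  unfolding M_def by (intro span_base) auto

lemma ev_M: "w \<in> lists (B_gens n) \<Longrightarrow> vdeg w \<le> d \<Longrightarrow> ev w \<in> M d"
  unfolding M_def by (intro span_base) auto

lemma M_sum: "(\<And>i. i \<in> J \<Longrightarrow> f i \<in> M d) \<Longrightarrow> sum f J \<in> M d"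
  unfolding M_def by (intro span_sum)

lemma M_mult:
  assumes "a \<in> M c" "b \<in> M d"
  shows "a * b \<in> M (c + d)"
  using assms(1) unfolding M_def
proof (rule span_mult_image, fold M_def)
  fix x assume x: "x \<in> {ev w |w. w \<in> lists (B_gens n) \<and> vdeg w \<le> c} \<union> I"
  show "x * b \<in> M (c + d)"
    using assms(2) unfolding M_def
  proof (rule span_image_mult, fold M_def)
    fix y assume y: "y \<in> {ev w |w. w \<in> lists (B_gens n) \<and> vdeg w \<le> d} \<union> I"
    show "x * y \<in> M (c + d)"
      using x
    proof
      assume "x \<in> {ev w |w. w \<in> lists (B_gens n) \<and> vdeg w \<le> c}"
      then obtain u where u: "x = ev u" "u \<in> lists (B_gens n)" "vdeg u \<le> c" by auto
      show ?thesis using y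
      proof
        assume "y \<in> {ev w |w. w \<in> lists (B_gens n) \<and> vdeg w \<le> d}"
        then obtain w where w: "y = ev w" "w \<in> lists (B_gens n)" "vdeg w \<le> d" by auto
        have "ev (u @ w) \<in> M (c + d)" using u w by (intro ev_M) auto
        then show ?thesis using u w by simp
      qed (use u in \<open>auto intro: I_M ev_I\<close>)
    next
      assume "x \<in> I"
      then show ?thesis using y by (auto intro: I_M I_ev I_I)
    qed
  qed
qed

lemma V_M: "i \<in> {1..n} \<Longrightarrow> l \<in> {1..4} \<Longrightarrow> V i l \<in> M 1"
  using ev_M[of "[GV i l]" 1] by simp

lemma g_M: "\<sigma> permutes {1..n} \<Longrightarrow> g \<sigma> \<in> M 0"
  using ev_M[of "[GS \<sigma>]" 0] by simp

lemma one_M: "1 \<in> M d"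
  using ev_M[of "[]" d] by simp

lemma prod_list_M:
  "(\<And>i. i \<in> set js \<Longrightarrow> f i \<in> M (e i)) \<Longrightarrow> prod_list (map f js) \<in> M (sum_list (map e js))"
  by (induction js) (auto intro: M_mult one_M)

lemma power_M: "a \<in> M d \<Longrightarrow> a ^ k \<in> M (k * d)"
  by (induction k) (auto intro: M_mult one_M)

lemma comm_mult:
  assumes "h * a - a * h \<in> M c" "h * b - b * h \<in> M d" "a \<in> M c" "b \<in> M d"
  shows "h * (a * b) - (a * b) * h \<in> M (c + d)"
proof -
  have "h * (a * b) - (a * b) * h = (h * a - a * h) * b + a * (h * b - b * h)"
    by (simp add: algebra_simps)
  then show ?thesis using assms by (auto intro: M_ops M_mult)
qed

lemma comm_power: "a \<in> M 1 \<Longrightarrow> h * a - a * h \<in> M 1 \<Longrightarrow> h * a ^ k - a ^ k * h \<in> M k"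
proof (induction k)
  case (Suc k)
  show ?case using comm_mult[OF Suc.prems(2) Suc.IH[OF Suc.prems] Suc.prems(1)] power_M[OF Suc.prems(1), of k]
    by simp
qed (simp add: M_ops)

lemma comm_prod_list:
  assumes "\<And>i. i \<in> set js \<Longrightarrow> h * f i - f i * h \<in> M (e i)" "\<And>i. i \<in> set js \<Longrightarrow> f i \<in> M (e i)"
  shows "h * prod_list (map f js) - prod_list (map f js) * h \<in> M (sum_list (map e js))"
  using assms
proof (induction js)
  case (Cons j js)
  show ?case
    unfolding list.map prod_list.Cons sum_list.Cons
    using Cons by (intro comm_mult prod_list_M) auto
qed (simp add: M_ops)

text \<open>Passing \<open>h\<close> across a factor of degree \<open>e k\<close> leaves a
  commutator of the same degree \<open>e k\<close> instead of \<open>e k + 1\<close>, so bringing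
  \<open>h\<close> to its place in the product costs an error of one degree less than the
  product.\<close>

lemma insert_prod_list:
  assumes "distinct js" "i \<in> set js" "h \<in> M 1" "\<And>k. k \<in> set js \<Longrightarrow> f k \<in> M (e k)"
    and "\<And>k. k \<in> set js \<Longrightarrow> k \<noteq> i \<Longrightarrow> h * f k - f k * h \<in> M (e k)"
  shows "h * prod_list (map f js) - prod_list (map (f(i := h * f i)) js) \<in> M (sum_list (map e js))"
  using assms
proof (induction js)
  case (Cons j js)
  show ?case
  proof (cases "j = i")
    case True
    then have "map (f(i := h * f i)) js = map f js" using Cons.prems by (intro map_cong refl) auto
    with True show ?thesis
      by (simp only: list.map prod_list.Cons sum_list.Cons fun_upd_same mult.assoc) (simp add: M_ops)
  next
    case False
    let ?R = "prod_list (map f js)" and ?R' = "prod_list (map (f(i := h * f i)) js)"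
    have "h * (f j * ?R) - f j * ?R' = (h * f j - f j * h) * ?R + f j * (h * ?R - ?R')"
      by (simp add: algebra_simps)
    also have "\<dots> \<in> M (e j + sum_list (map e js))"
    proof (intro M_ops(1) M_mult prod_list_M)
      show "h * ?R - ?R' \<in> M (sum_list (map e js))"
        by (rule Cons.IH) (use False Cons.prems in auto)
    qed (use False Cons.prems in auto)
    finally show ?thesis
      by (simp only: list.map prod_list.Cons sum_list.Cons fun_upd_other[OF False])
  qed
qed simp

lemma g_V:
  assumes "\<sigma> permutes {1..n}" "i \<in> {1..n}" "l \<in> {1..4}"
  shows "g \<sigma> * V i l - V (\<sigma> i) l * g \<sigma> \<in> I"
proof -
  have "\<forall>i\<in>{1..n}. g \<sigma> * V i l - V (\<sigma> i) l * g \<sigma> \<in> I"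
  proof (rule permutes_induct[where P = "\<lambda>\<sigma>. \<forall>i\<in>{1..n}. g \<sigma> * V i l - V (\<sigma> i) l * g \<sigma> \<in> I", OF assms(1)])
    show "\<forall>i\<in>{1..n}. g id * V i l - V (id i) l * g id \<in> I"
    proof
      fix i assume i: "i \<in> {1..n}"
      have "g id * V i l - V (id i) l * g id = (g id - 1) * V i l - V i l * (g id - 1)"
        by (simp add: algebra_simps)
      then show "g id * V i l - V (id i) l * g id \<in> I"
        using I_ops(2)[OF I_V[OF i assms(3) rel_id] V_I[OF i assms(3) rel_id]] by (simp only:)
    qed
  next
    fix a b \<sigma>
    assume ab: "a \<in> {1..n}" "b \<in> {1..n}" "a \<noteq> b" and IH: "\<forall>i\<in>{1..n}. g \<sigma> * V i l - V (\<sigma> i) l * g \<sigma> \<in> I"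
      and \<sigma>: "\<sigma> permutes {1..n}"
    let ?s = "transpose a b"
    have s: "?s permutes {1..n}" using ab by (intro permutes_swap_id)
    have rs: "g ?s * V j l - V (?s j) l * g ?s \<in> I" if j: "j \<in> {1..n}" for j
    proof -
      consider "j = a" | "j = b" | "j \<noteq> a" "j \<noteq> b" by blast
      then show ?thesis
        using rel_sV[OF ab assms(3)] rel_sV[OF ab(2,1) ab(3)[symmetric] assms(3)]
          rel_sV'[OF ab(1,2) j ab(3) _ _ assms(3)]
        by cases (simp_all add: transpose_commute)
    qed
    show "\<forall>i\<in>{1..n}. g (?s \<circ> \<sigma>) * V i l - V ((?s \<circ> \<sigma>) i) l * g (?s \<circ> \<sigma>) \<in> I"
    proof
      fix i assume i: "i \<in> {1..n}"
      have \<sigma>i: "\<sigma> i \<in> {1..n}" using \<sigma> i by (simp only: permutes_in_image)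
      have s\<sigma>i: "?s (\<sigma> i) \<in> {1..n}" using s \<sigma>i by (simp only: permutes_in_image)
      have "g (?s \<circ> \<sigma>) * V i l - V ((?s \<circ> \<sigma>) i) l * g (?s \<circ> \<sigma>)
        = (g ?s * (g \<sigma> * V i l - V (\<sigma> i) l * g \<sigma>) + (g ?s * V (\<sigma> i) l - V (?s (\<sigma> i)) l * g ?s) * g \<sigma>)
          - (g ?s * g \<sigma> - g (?s \<circ> \<sigma>)) * V i l + V (?s (\<sigma> i)) l * (g ?s * g \<sigma> - g (?s \<circ> \<sigma>))"
        by (simp add: algebra_simps)
      also have "\<dots> \<in> I"
        using IH i s \<sigma> \<sigma>i s\<sigma>i assms(3)
        by (intro I_ops(1) I_ops(2)[of "_ + _"] g_I I_g I_V V_I rs rel_mult) auto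
      finally show "g (?s \<circ> \<sigma>) * V i l - V ((?s \<circ> \<sigma>) i) l * g (?s \<circ> \<sigma>) \<in> I" .
    qed
  qed simp
  then show ?thesis using assms(2) by auto
qed

lemma V_comm:
  assumes "i \<in> {1..n}" "j \<in> {1..n}" "i \<noteq> j" "l \<in> {1..4}" "m \<in> {1..4}"
  shows "V i l * V j m - V j m * V i l \<in> M 1"
proof (cases "l = m")
  case True
  let ?q = "scl \<nu> ((V i l - V j l) * g (transpose i j))"
  have "(V i l - V j l) * g (transpose i j) \<in> M (1 + 0)"
    using assms by (intro M_mult M_ops V_M g_M permutes_swap_id)
  then have "(V i l * V j l - V j l * V i l - ?q) + ?q \<in> M 1"
    using assms by (intro M_ops(1)[OF I_M[OF rel_same]] M_ops(4)) auto
  then show ?thesis using True by simp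
next
  case False
  then show ?thesis using assms rel_diff by (intro I_M) auto
qed

lemma V_sq:
  assumes "i \<in> {1..n}" "l \<in> {1..4}"
  shows "V i l * V i l \<in> M 1"
proof -
  let ?a = "\<gamma> l" and ?b = "\<gamma> l + \<mu> l"
  have "V i l * V i l = (V i l - sc ?a) * (V i l - sc ?b) + (scl ?a (V i l) + scl ?b (V i l) - sc (?a * ?b))"
    by (simp add: left_diff_distrib right_diff_distrib scl_left scl_right scale_right_diff_distrib)
  also have "\<dots> \<in> M 1"
    using assms by (intro M_ops I_M[OF rel_quad] V_M one_M)
  finally show ?thesis .
qed

definition x :: "nat \<Rightarrow> 'f" where "x i = V i 1 + V i 2"

lemma x_M: "i \<in> {1..n} \<Longrightarrow> x i \<in> M 1"
  unfolding x_def by (intro M_ops V_M) auto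

lemma V4_M:
  assumes "i \<in> {1..n}"
  shows "V i 4 + x i + V i 3 \<in> M 0"
proof -
  let ?q = "scl \<nu> (\<Sum>j\<in>{1..n} - {i}. g (transpose i j))"
  have "?q \<in> M 0" using assms by (intro M_ops M_sum g_M permutes_swap_id) auto
  then have "(V i 1 + V i 2 + V i 3 + V i 4 - ?q) + ?q \<in> M 0"
    using assms by (intro M_ops(1)[OF I_M[OF rel_sum]])
  then show ?thesis by (simp add: x_def algebra_simps)
qed

lemma x_comm_V:
  assumes "i \<in> {1..n}" "j \<in> {1..n}" "i \<noteq> j" "l \<in> {1..4}"
  shows "x i * V j l - V j l * x i \<in> M 1"
proof -
  have "x i * V j l - V j l * x i = (V i 1 * V j l - V j l * V i 1) + (V i 2 * V j l - V j l * V i 2)"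
    by (simp add: x_def algebra_simps)
  also have "\<dots> \<in> M 1" using assms by (intro M_ops V_comm) auto
  finally show ?thesis .
qed

lemma x_comm_x:
  assumes "i \<in> {1..n}" "j \<in> {1..n}" "i \<noteq> j"
  shows "x i * x j - x j * x i \<in> M 1"
proof -
  have "x i * x j - x j * x i = (x i * V j 1 - V j 1 * x i) + (x i * V j 2 - V j 2 * x i)"
    by (simp add: x_def[of j] algebra_simps)
  also have "\<dots> \<in> M 1" using assms by (intro M_ops x_comm_V) auto
  finally show ?thesis .
qed

text \<open>Completing the square: x V_1 + V_1 x - x^2 = V_1^2 - V_2^2, and x V_3 + V_3 x + x^2 = (x
  + V_3)^2 - V_3^2, where x + V_3 is - V_4 up to degree 0. The squares of the V have degree 1 by the
  quadratic relations.\<close>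

lemma x_V:
  assumes i: "i \<in> {1..n}" and l: "l = 1 \<or> l = 3"
  shows "x i * V i l + V i l * x i - scl (if l = 1 then 1 else - 1) (x i * x i) \<in> M 1"
proof (cases "l = 1")
  case True
  have "x i * V i 1 + V i 1 * x i - x i * x i = V i 1 * V i 1 - V i 2 * V i 2"
    by (simp add: x_def algebra_simps)
  also have "\<dots> \<in> M 1" using i by (intro M_ops V_sq) auto
  finally show ?thesis using True by simp
next
  case False
  \<comment> \<open>By the sum relation \<open>m\<close> has degree 0, so each of its products with
    a letter stays in degree 1.\<close>
  define m where "m = V i 4 + x i + V i 3"
  have m: "m \<in> M 0" unfolding m_def by (rule V4_M[OF i])
  have "x i * V i 3 + V i 3 * x i + x i * x i
    = V i 4 * V i 4 - V i 3 * V i 3 + (x i * m + m * x i + V i 3 * m + m * V i 3 - m * m)"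
    by (simp add: m_def algebra_simps)
  also have "\<dots> \<in> M 1"
    using M_mult[OF x_M[OF i] m] M_mult[OF m x_M[OF i]] M_mult[OF V_M[OF i, of 3] m]
      M_mult[OF m V_M[OF i, of 3]] M_mono[OF _ M_mult[OF m m], of 1] i
    by (intro M_ops(1) M_ops(2)[of "_ + _"] M_ops(2)[of "_ * _" _ "_ * _"] V_sq) auto
  finally show ?thesis using False l by simp
qed

text \<open>The term \<open>x i ^ Suc k\<close> has the same degree as the product itself and cannot
  be discarded. What makes later inductions end is that one letter V has been traded for it.\<close>

lemma x_power_V:
  assumes i: "i \<in> {1..n}" and l: "l = 1 \<or> l = 3"
  shows "\<exists>c. x i ^ k * V i l - scl ((- 1) ^ k) (V i l * x i ^ k) - scl c (x i ^ Suc k) \<in> M k"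
proof (induction k)
  case 0
  show ?case by (intro exI[of _ 0]) (simp add: M_ops)
next
  case (Suc k)
  then obtain c where c: "x i ^ k * V i l - scl ((- 1) ^ k) (V i l * x i ^ k) - scl c (x i ^ Suc k) \<in> M k"
    by auto
  define e :: complex where "e = (if l = 1 then 1 else - 1)"
  have e: "x i * V i l + V i l * x i - scl e (x i * x i) \<in> M 1"
    unfolding e_def by (rule x_V[OF i l])
  have "x i ^ Suc k * V i l - scl ((- 1) ^ Suc k) (V i l * x i ^ Suc k) - scl (c + (- 1) ^ k * e) (x i ^ Suc (Suc k))
    = x i * (x i ^ k * V i l - scl ((- 1) ^ k) (V i l * x i ^ k) - scl c (x i ^ Suc k))
      + scl ((- 1) ^ k) ((x i * V i l + V i l * x i - scl e (x i * x i)) * x i ^ k)"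
    by (simp add: left_diff_distrib right_diff_distrib distrib_left distrib_right scl_left scl_right mult.assoc
      scale_right_distrib scale_right_diff_distrib scale_left_distrib)
  also have "\<dots> \<in> M (Suc k)"
    using M_mult[OF x_M[OF i] c] M_mult[OF e power_M[OF x_M[OF i], of k]] by (intro M_ops) auto
  finally show ?case by blast
qed

section \<open>Normal forms and their span\<close>

definition Yy :: "(nat \<Rightarrow> int) \<Rightarrow> 'f" where
  "Yy y = prod_list (map (\<lambda>i. prod_list (map (V i) (alt (y i)))) [1..<Suc n])"

definition Xx :: "(nat \<Rightarrow>\<^sub>0 nat) \<Rightarrow> 'f" where
  "Xx a = prod_list (map (\<lambda>j. x j ^ Poly_Mapping.lookup a j) [1..<Suc n])"

definition bas :: "(nat \<Rightarrow>\<^sub>0 nat) \<times> (nat \<Rightarrow> int) \<times> (nat \<Rightarrow> nat) \<Rightarrow> 'f" where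
  "bas = (\<lambda>(a, y, \<pi>). Yy y * g \<pi> * Xx a)"

definition bdeg :: "(nat \<Rightarrow>\<^sub>0 nat) \<times> (nat \<Rightarrow> int) \<times> (nat \<Rightarrow> nat) \<Rightarrow> nat" where
  "bdeg = (\<lambda>(a, y, \<pi>). mdeg n a + ydeg n y)"

definition N :: "nat \<Rightarrow> 'f set" where
  "N d = span (bas ` {b \<in> bas_idx n. bdeg b \<le> d} \<union> I)"

lemma N_ops: "a \<in> N d \<Longrightarrow> b \<in> N d \<Longrightarrow> a + b \<in> N d" "a \<in> N d \<Longrightarrow> b \<in> N d \<Longrightarrow> a - b \<in> N d"
  "a \<in> N d \<Longrightarrow> - a \<in> N d" "a \<in> N d \<Longrightarrow> scl c a \<in> N d" "0 \<in> N d"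
  unfolding N_def by (simp_all add: span_add span_diff span_neg span_scale span_zero)

lemma N_mono: "c \<le> d \<Longrightarrow> a \<in> N c \<Longrightarrow> a \<in> N d"
proof -
  assume "c \<le> d" "a \<in> N c"
  moreover have "N c \<subseteq> N d" unfolding N_def using \<open>c \<le> d\<close> by (intro span_mono) auto
  ultimately show ?thesis by auto
qed

lemma I_N: "a \<in> I \<Longrightarrow> a \<in> N d"
  unfolding N_def by (intro span_base) auto

lemma bas_N: "b \<in> bas_idx n \<Longrightarrow> bdeg b \<le> d \<Longrightarrow> bas b \<in> N d"
  unfolding N_def by (intro span_base) auto

lemma sum_list_upt: "sum_list (map f [1..<Suc n]) = (\<Sum>i\<in>{1..n}. f i)" for f :: "nat \<Rightarrow> nat"
  by (simp add: interv_sum_list_conv_sum_set_nat atLeastLessThanSuc_atLeastAtMost del: upt_Suc)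

lemma altV_M: "i \<in> {1..n} \<Longrightarrow> prod_list (map (V i) (alt y)) \<in> M (nat \<bar>y\<bar>)"
proof -
  assume i: "i \<in> {1..n}"
  have "prod_list (map (V i) (alt y)) \<in> M (sum_list (map (\<lambda>_. 1) (alt y)))"
    using set_alt[of y] i by (intro prod_list_M V_M) auto
  then show ?thesis by (simp add: sum_list_triv length_alt)
qed

lemma Yy_M: "Yy y \<in> M (ydeg n y)"
  unfolding Yy_def ydeg_def sum_list_upt[symmetric] by (intro prod_list_M altV_M) auto

lemma Xx_M: "Xx a \<in> M (mdeg n a)"
  unfolding Xx_def mdeg_def sum_list_upt[symmetric]
proof (intro prod_list_M)
  fix i assume "i \<in> set [1..<Suc n]"
  then show "x i ^ Poly_Mapping.lookup a i \<in> M (Poly_Mapping.lookup a i)"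
    using power_M[OF x_M[of i], of "Poly_Mapping.lookup a i"] by auto
qed

lemma gX_M: "\<pi> permutes {1..n} \<Longrightarrow> g \<pi> * Xx a \<in> M (mdeg n a)"
  using M_mult[OF g_M Xx_M] by simp

lemma bas_M: "b \<in> bas_idx n \<Longrightarrow> bas b \<in> M (bdeg b)"
proof -
  assume "b \<in> bas_idx n"
  then obtain a y \<pi> where b: "b = (a, y, \<pi>)" "\<pi> permutes {1..n}" by (auto simp: bas_idx_def)
  show ?thesis using M_mult[OF Yy_M[of y] gX_M[OF b(2), of a]]
    by (simp add: b(1) bas_def bdeg_def mult.assoc add.commute)
qed

lemma N_M: "a \<in> N d \<Longrightarrow> a \<in> M d"
proof -
  have "N d \<subseteq> M d"
    unfolding N_def
  proof (rule span_minimal)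
    show "subspace (M d)" unfolding M_def by (rule subspace_span)
  qed (auto intro: I_M M_mono bas_M)
  then show "a \<in> N d \<Longrightarrow> a \<in> M d" by auto
qed

lemma V_comm_alt:
  assumes "i \<in> {1..n}" "j \<in> {1..n}" "i \<noteq> j" "l \<in> {1..4}"
  shows "V i l * prod_list (map (V j) (alt y)) - prod_list (map (V j) (alt y)) * V i l \<in> M (nat \<bar>y\<bar>)"
proof -
  have "V i l * prod_list (map (V j) (alt y)) - prod_list (map (V j) (alt y)) * V i l \<in> M (sum_list (map (\<lambda>_. 1) (alt y)))"
    using set_alt[of y] assms by (intro comm_prod_list V_comm V_M) auto
  then show ?thesis by (simp add: sum_list_triv length_alt)
qed

section \<open>Induction step for the spanning property, from degree d to degree d + 1\<close>

context
  fixes d assumes IH: "\<And>z. z \<in> M d \<Longrightarrow> z \<in> N d"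
begin

lemma M_N_Suc: "z \<in> M d \<Longrightarrow> z \<in> N (Suc d)"
  using IH N_mono[of d "Suc d"] by simp

lemma V_bas:
  assumes i: "i \<in> {1..n}" and l: "l = 1 \<or> l = 3" and b: "b \<in> bas_idx n" "bdeg b \<le> d"
  shows "V i l * bas b \<in> N (Suc d)"
proof -
  obtain a y \<pi> where b': "b = (a, y, \<pi>)" and a: "a \<in> monoms n" and y: "\<And>i. i \<notin> {1..n} \<Longrightarrow> y i = 0" and \<pi>: "\<pi> permutes {1..n}"
    using b(1) by (auto simp: bas_idx_def)
  have l4: "l \<in> {1..4}" using l by auto
  let ?f = "\<lambda>i. prod_list (map (V i) (alt (y i)))"
  let ?Y' = "prod_list (map (?f(i := V i l * ?f i)) [1..<Suc n])"
  have "V i l * Yy y - ?Y' \<in> M (ydeg n y)"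
    unfolding Yy_def ydeg_def sum_list_upt[symmetric]
    using i l4 by (intro insert_prod_list V_M altV_M V_comm_alt) auto
  from M_mult[OF this gX_M[OF \<pi>, of a]]
  have diff: "V i l * bas b - ?Y' * g \<pi> * Xx a \<in> M (bdeg b)"
    by (simp add: b' bas_def bdeg_def left_diff_distrib mult.assoc add.commute)
  \<comment> \<open>Either the letter extends the alternating word of \<open>y i\<close>, giving the
    word of \<open>c\<close>, or that word already begins with the letter, and then
    \<open>alt (y i) = l # alt c\<close>. In the second case a square appears and the degree does
    not grow. Both times \<open>c\<close> is the reflection of \<open>y i\<close> that belongs to
    \<open>l\<close>.\<close>
  define new where "new = (if l = 1 then y i \<le> 0 else 0 \<le> y i)"
  define c where "c = (if l = 1 then 1 - y i else - 1 - y i)"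
  have main: "?Y' * g \<pi> * Xx a \<in> N (Suc d)"
  proof (cases new)
    case True
    have "alt c = l # alt (y i)"
      using True l by (auto simp: new_def c_def alt_simps)
    then have "(?f(i := V i l * ?f i)) = (\<lambda>j. prod_list (map (V j) (alt ((y(i := c)) j))))"
      by (auto simp: fun_eq_iff)
    then have "?Y' * g \<pi> * Xx a = bas (a, y(i := c), \<pi>)"
      by (simp add: bas_def Yy_def del: upt_Suc)
    moreover have "(a, y(i := c), \<pi>) \<in> bas_idx n" using a y \<pi> i by (auto simp: bas_idx_def)
    moreover have "bdeg (a, y(i := c), \<pi>) = Suc (bdeg b)"
    proof -
      have "nat \<bar>c\<bar> = Suc (nat \<bar>y i\<bar>)" using True l by (auto simp: new_def c_def)
      moreover have "(\<Sum>j\<in>{1..n} - {i}. nat \<bar>(y(i := c)) j\<bar>) = (\<Sum>j\<in>{1..n} - {i}. nat \<bar>y j\<bar>)"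
        by (intro sum.cong) auto
      ultimately have "ydeg n (y(i := c)) = Suc (ydeg n y)"
        unfolding ydeg_def using sum.remove[OF _ i, of "\<lambda>j. nat \<bar>(y(i := c)) j\<bar>"] sum.remove[OF _ i, of "\<lambda>j. nat \<bar>y j\<bar>"]
        by simp
      then show ?thesis by (simp add: bdeg_def b')
    qed
    ultimately show ?thesis using b(2) bas_N by auto
  next
    case False
    have "alt (y i) = l # alt c" using False l by (auto simp: new_def c_def alt_simps)
    then have eq: "V i l * ?f i = (V i l * V i l) * prod_list (map (V i) (alt c))" by (simp add: mult.assoc)
    have "nat \<bar>y i\<bar> = 1 + nat \<bar>c\<bar>" using False l by (auto simp: new_def c_def)
    then have "V i l * ?f i \<in> M (nat \<bar>y i\<bar>)"
      unfolding eq using M_mult[OF V_sq[OF i l4] altV_M[OF i, of c]] by simp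
    then have "?Y' \<in> M (ydeg n y)"
      unfolding ydeg_def sum_list_upt[symmetric] using altV_M by (intro prod_list_M) auto
    from M_mult[OF this gX_M[OF \<pi>, of a]] have "?Y' * g \<pi> * Xx a \<in> M (bdeg b)"
      by (simp add: b' bdeg_def mult.assoc add.commute)
    then show ?thesis using b(2) M_mono M_N_Suc by blast
  qed
  have "V i l * bas b - ?Y' * g \<pi> * Xx a \<in> N (Suc d)"
    using diff b(2) M_mono M_N_Suc by blast
  from N_ops(1)[OF this main] show ?thesis by simp
qed

lemma V13_N:
  assumes i: "i \<in> {1..n}" and l: "l = 1 \<or> l = 3" and z: "z \<in> N d"
  shows "V i l * z \<in> N (Suc d)"
proof -
  have l4: "l \<in> {1..4}" using l by auto
  show ?thesis
    using z unfolding N_def[of d]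
  proof (unfold N_def[of "Suc d"], rule span_image_mult, fold N_def)
    fix b assume "b \<in> bas ` {b \<in> bas_idx n. bdeg b \<le> d} \<union> I"
    then show "V i l * b \<in> N (Suc d)"
      using V_bas[OF i l] V_I[OF i l4] I_N by blast
  qed
qed

definition Vw :: "(nat \<times> nat) list \<Rightarrow> 'f" where "Vw v = prod_list (map (\<lambda>(j, l). V j l) v)"

definition vletters :: "(nat \<times> nat) list set" where "vletters = lists ({1..n} \<times> {1, 3})"

lemma Vw_M: "v \<in> vletters \<Longrightarrow> Vw v \<in> M (length v)"
proof -
  assume v: "v \<in> vletters"
  have "Vw v \<in> M (sum_list (map (\<lambda>_. 1) v))"
    unfolding Vw_def using v by (intro prod_list_M) (auto simp: vletters_def simp del: One_nat_def intro!: V_M)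
  then show ?thesis by (simp add: sum_list_triv)
qed

lemma x_Xx:
  assumes j: "j \<in> {1..n}"
  shows "x j * Xx a - Xx (a + Poly_Mapping.single j 1) \<in> M (mdeg n a)"
proof -
  let ?f = "\<lambda>j. x j ^ Poly_Mapping.lookup a j"
  have "Xx (a + Poly_Mapping.single j 1) = prod_list (map (?f(j := x j * ?f j)) [1..<Suc n])"
    unfolding Xx_def by (intro arg_cong[of _ _ prod_list] map_cong refl) (auto simp: lookup_add lookup_single when_def)
  moreover have "x j * Xx a - prod_list (map (?f(j := x j * ?f j)) [1..<Suc n]) \<in> M (mdeg n a)"
    unfolding Xx_def mdeg_def sum_list_upt[symmetric]
  proof (intro insert_prod_list x_M j)
    fix k assume k: "k \<in> set [1..<Suc n]"
    then show "x k ^ Poly_Mapping.lookup a k \<in> M (Poly_Mapping.lookup a k)"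
      using power_M[OF x_M[of k], of "Poly_Mapping.lookup a k"] by auto
    assume "k \<noteq> j"
    then show "x j * x k ^ Poly_Mapping.lookup a k - x k ^ Poly_Mapping.lookup a k * x j \<in> M (Poly_Mapping.lookup a k)"
      using k j by (intro comm_power x_M x_comm_x) auto
  qed (use j in auto)
  ultimately show ?thesis by simp
qed

lemma x_g:
  assumes "\<pi> permutes {1..n}" "i \<in> {1..n}"
  shows "x (\<pi> i) * g \<pi> - g \<pi> * x i \<in> I"
proof -
  have "x (\<pi> i) * g \<pi> - g \<pi> * x i = scl (- 1) ((g \<pi> * V i 1 - V (\<pi> i) 1 * g \<pi>) + (g \<pi> * V i 2 - V (\<pi> i) 2 * g \<pi>))"
    by (simp add: x_def algebra_simps)
  also have "\<dots> \<in> I" using assms by (intro I_ops g_V) auto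
  finally show ?thesis .
qed

lemma Xx_ev: "a \<in> I \<Longrightarrow> a * Xx b \<in> I"
proof -
  have pw: "a * x j ^ k \<in> I" if "a \<in> I" "j \<in> {1..n}" for a j k
    using that(1)
  proof (induction k arbitrary: a)
    case (Suc k)
    have "a * x j \<in> I" unfolding x_def distrib_left using Suc.prems that(2) by (intro I_ops I_V) auto
    then show ?case using Suc.IH by (simp add: mult.assoc[symmetric])
  qed simp
  have *: "a * prod_list (map (\<lambda>j. x j ^ Poly_Mapping.lookup b j) js) \<in> I" if "a \<in> I" "set js \<subseteq> {1..n}" for a js
    using that by (induction js arbitrary: a) (auto simp: pw simp flip: mult.assoc)
  show "a \<in> I \<Longrightarrow> a * Xx b \<in> I" unfolding Xx_def by (rule *) auto
qed

lemma x_gX: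
  assumes "\<pi> permutes {1..n}" "j \<in> {1..n}"
  shows "x (\<pi> j) * (g \<pi> * Xx a) - g \<pi> * Xx (a + Poly_Mapping.single j 1) \<in> M (mdeg n a)"
proof -
  have "x (\<pi> j) * (g \<pi> * Xx a) - g \<pi> * Xx (a + Poly_Mapping.single j 1)
      = (x (\<pi> j) * g \<pi> - g \<pi> * x j) * Xx a + g \<pi> * (x j * Xx a - Xx (a + Poly_Mapping.single j 1))"
    by (simp add: algebra_simps)
  also have "\<dots> \<in> M (mdeg n a)"
    using M_mult[OF g_M[OF assms(1)] x_Xx[OF assms(2)]]
    by (intro M_ops(1)[OF I_M[OF Xx_ev[OF x_g[OF assms]]]]) simp
  finally show ?thesis .
qed

lemma x_power_gX:
  assumes "\<pi> permutes {1..n}" "j \<in> {1..n}"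
  shows "x (\<pi> j) ^ Suc k * (g \<pi> * Xx a) - g \<pi> * Xx (a + Poly_Mapping.single j (Suc k)) \<in> M (k + mdeg n a)"
proof (induction k)
  case 0
  then show ?case using x_gX[OF assms, of a] by simp
next
  case (Suc k)
  let ?a = "a + Poly_Mapping.single j (Suc k)"
  have \<pi>j: "\<pi> j \<in> {1..n}" using assms by (simp only: permutes_in_image)
  have "x (\<pi> j) * (x (\<pi> j) ^ Suc k * (g \<pi> * Xx a) - g \<pi> * Xx ?a) \<in> M (1 + (k + mdeg n a))"
    by (rule M_mult[OF x_M[OF \<pi>j] Suc])
  moreover have "x (\<pi> j) * (g \<pi> * Xx ?a) - g \<pi> * Xx (?a + Poly_Mapping.single j 1) \<in> M (1 + (k + mdeg n a))"
    using x_gX[OF assms, of ?a] assms(2) by (simp add: mdeg_add mdeg_single add.commute add.left_commute)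
  moreover have "?a + Poly_Mapping.single j 1 = a + Poly_Mapping.single j (Suc (Suc k))"
    by (simp add: add.assoc flip: single_add)
  ultimately have "x (\<pi> j) * (x (\<pi> j) ^ Suc k * (g \<pi> * Xx a) - g \<pi> * Xx ?a)
     + (x (\<pi> j) * (g \<pi> * Xx ?a) - g \<pi> * Xx (a + Poly_Mapping.single j (Suc (Suc k)))) \<in> M (1 + (k + mdeg n a))"
    by (intro M_ops(1)) simp_all
  then show ?case by (simp add: right_diff_distrib mult.assoc)
qed

lemma gX_bas: "\<pi> permutes {1..n} \<Longrightarrow> a \<in> monoms n \<Longrightarrow> mdeg n a \<le> e \<Longrightarrow> g \<pi> * Xx a \<in> N e"
proof -
  assume *: "\<pi> permutes {1..n}" "a \<in> monoms n" "mdeg n a \<le> e"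
  have "Yy (\<lambda>_. 0) = 1" by (simp add: Yy_def alt_simps map_replicate_const del: upt_Suc)
  moreover have "ydeg n (\<lambda>_. 0) = 0" by (simp add: ydeg_def)
  ultimately show ?thesis
    using bas_N[of "(a, \<lambda>_. 0, \<pi>)" e] * by (simp add: bas_def bas_idx_def bdeg_def)
qed

text \<open>The power of \<open>x i\<close> is pushed through the word letter by letter. When a
  letter V comes to the front, the rest has degree at most d, is spanned by normal forms by
  hypothesis, and takes the letter back through \<open>V13_N\<close>. Passing a letter of the same
  particle also creates \<open>x i ^ Suc k\<close> on a shorter word; hence the induction runs over
  the word with \<open>k\<close> arbitrary.\<close>

lemma x_word_N:
  assumes "v \<in> vletters" "i \<in> {1..n}" "\<pi> permutes {1..n}" "a \<in> monoms n" "k + length v + mdeg n a \<le> Suc d"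
  shows "x i ^ k * (Vw v * (g \<pi> * Xx a)) \<in> N (Suc d)"
  using assms
proof (induction v arbitrary: k)
  case Nil
  show ?case
  proof (cases k)
    case 0
    then show ?thesis using Nil gX_bas[of \<pi> a "Suc d"] by (simp add: Vw_def)
  next
    case (Suc k')
    \<comment> \<open>Passing the power of \<open>x i\<close> to the right of \<open>g \<pi>\<close>
      changes the index by the inverse of \<pi>.\<close>
    let ?j = "finv \<pi> i"
    have j: "?j \<in> {1..n}" "\<pi> ?j = i"
      using permutes_in_image[OF permutes_inv[OF Nil.prems(3)], of i] Nil.prems(2) permutes_inverses[OF Nil.prems(3)] by auto
    let ?R = "g \<pi> * Xx (a + Poly_Mapping.single ?j (Suc k'))"
    have "x i ^ k * (g \<pi> * Xx a) - ?R \<in> M (k' + mdeg n a)"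
      using x_power_gX[OF Nil.prems(3) j(1), of k' a] j(2) Suc by simp
    then have 1: "x i ^ k * (g \<pi> * Xx a) - ?R \<in> N (Suc d)"
      using Nil.prems(5) Suc by (intro M_N_Suc) (auto intro: M_mono)
    have "?R \<in> N (Suc d)"
      using Nil.prems j Suc by (intro gX_bas monoms_add_single) (auto simp: mdeg_add mdeg_single)
    from N_ops(1)[OF 1 this] show ?thesis by (simp add: Vw_def)
  qed
next
  case (Cons jl v)
  obtain j l where jl: "jl = (j, l)" "j \<in> {1..n}" "l = 1 \<or> l = 3" and v: "v \<in> vletters"
    using Cons.prems(1) by (cases jl) (auto simp: vletters_def)
  then have l4: "l \<in> {1..4}" by auto
  define R where "R = Vw v * (g \<pi> * Xx a)"
  have R: "R \<in> M (length v + mdeg n a)"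
    unfolding R_def by (rule M_mult[OF Vw_M[OF v] gX_M[OF Cons.prems(3)]])
  have xR: "x i ^ k * R \<in> M d"
    using M_mult[OF power_M[OF x_M[OF Cons.prems(2)], of k] R] Cons.prems(5) by (auto elim!: M_mono[rotated])
  have VxR: "V j l * (x i ^ k * R) \<in> N (Suc d)"
    by (rule V13_N[OF jl(2,3) IH[OF xR]])
  \<comment> \<open>If \<open>x i ^ k\<close> and the letter are replaced by an element of degree
    \<open>k\<close> only, the total drops to d and the hypothesis on degree d applies.\<close>
  have low: "z * R \<in> N (Suc d)" if "z \<in> M k" for z
    using M_mult[OF that R] Cons.prems(5) by (intro M_N_Suc) (auto elim!: M_mono[rotated])
  have goal: "x i ^ k * (Vw (jl # v) * (g \<pi> * Xx a)) = x i ^ k * (V j l * R)"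
    by (simp add: R_def jl(1) Vw_def mult.assoc)
  show ?case
  proof (cases "j = i")
    case False
    have "V j l * x i ^ k - x i ^ k * V j l \<in> M k"
    proof (rule comm_power[OF x_M[OF Cons.prems(2)]])
      have "- (x i * V j l - V j l * x i) \<in> M 1"
        using x_comm_V[OF Cons.prems(2) jl(2) _ l4] False by (intro M_ops(3)) auto
      then show "V j l * x i - x i * V j l \<in> M 1" by simp
    qed
    from N_ops(2)[OF VxR low[OF this]] show ?thesis
      unfolding goal by (simp add: left_diff_distrib mult.assoc)
  next
    case True
    obtain c where c: "x i ^ k * V i l - scl ((- 1) ^ k) (V i l * x i ^ k) - scl c (x i ^ Suc k) \<in> M k"
      using x_power_V[OF Cons.prems(2) jl(3)] by blast
    have "x i ^ Suc k * R \<in> N (Suc d)"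
      unfolding R_def using Cons.prems v by (intro Cons.IH) auto
    then have "(x i ^ k * V i l - scl ((- 1) ^ k) (V i l * x i ^ k) - scl c (x i ^ Suc k)) * R
        + scl ((- 1) ^ k) (V j l * (x i ^ k * R)) + scl c (x i ^ Suc k * R) \<in> N (Suc d)"
      by (intro N_ops(1,4) low[OF c] VxR)
    then show ?thesis
      unfolding goal using True by (simp add: left_diff_distrib scl_left mult.assoc)
  qed
qed

definition yword :: "(nat \<Rightarrow> int) \<Rightarrow> (nat \<times> nat) list" where
  "yword y = concat (map (\<lambda>i. map (Pair i) (alt (y i))) [1..<Suc n])"

lemma yword: "yword y \<in> vletters" "length (yword y) = ydeg n y" "Yy y = Vw (yword y)"
proof -
  show "yword y \<in> vletters" using set_alt by (fastforce simp: yword_def vletters_def)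
  show "length (yword y) = ydeg n y"
    unfolding yword_def ydeg_def sum_list_upt[symmetric]
    by (simp add: length_concat length_alt o_def del: upt_Suc)
  have "Vw (concat (map (\<lambda>i. map (Pair i) (alt (y i))) js)) = prod_list (map (\<lambda>i. prod_list (map (V i) (alt (y i)))) js)" for js
    by (induction js) (simp_all add: Vw_def o_def)
  then show "Yy y = Vw (yword y)" by (simp add: yword_def Yy_def)
qed

lemma x_N:
  assumes i: "i \<in> {1..n}" and z: "z \<in> N d"
  shows "x i * z \<in> N (Suc d)"
  using z unfolding N_def[of d]
proof (unfold N_def[of "Suc d"], rule span_image_mult, fold N_def)
  fix z assume "z \<in> bas ` {b \<in> bas_idx n. bdeg b \<le> d} \<union> I"
  then show "x i * z \<in> N (Suc d)"
  proof
    assume "z \<in> I"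
    then show ?thesis using i by (auto simp: x_def distrib_right intro!: I_N I_ops V_I)
  next
    assume "z \<in> bas ` {b \<in> bas_idx n. bdeg b \<le> d}"
    then obtain a y \<pi> where b: "z = bas (a, y, \<pi>)" "(a, y, \<pi>) \<in> bas_idx n" "bdeg (a, y, \<pi>) \<le> d" by auto
    then have "x i ^ 1 * (Vw (yword y) * (g \<pi> * Xx a)) \<in> N (Suc d)"
      using i yword[of y] by (intro x_word_N) (auto simp: bas_idx_def bdeg_def)
    then show ?thesis by (simp add: b(1) bas_def yword(3) mult.assoc)
  qed
qed

lemma V_N:
  assumes i: "i \<in> {1..n}" and l: "l \<in> {1..4}" and z: "z \<in> N d"
  shows "V i l * z \<in> N (Suc d)"
proof -
  consider "l = 1 \<or> l = 3" | "l = 2" | "l = 4" using l by fastforce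
  then show ?thesis
  proof cases
    case 1
    then show ?thesis using V13_N[OF i _ z] by simp
  next
    case 2
    have "x i * z - V i 1 * z \<in> N (Suc d)" by (intro N_ops x_N V13_N i z) simp
    then show ?thesis using 2 by (simp add: x_def algebra_simps)
  next
    case 3
    have "(V i 4 + x i + V i 3) * z \<in> N (Suc d)"
      using M_mult[OF V4_M[OF i] N_M[OF z]] by (intro M_N_Suc) simp
    then have "(V i 4 + x i + V i 3) * z - (x i * z + V i 3 * z) \<in> N (Suc d)"
      by (intro N_ops x_N V13_N i z) simp_all
    then show ?thesis using 3 by (simp add: algebra_simps)
  qed
qed

lemma g_Vw:
  assumes "\<sigma> permutes {1..n}"
  shows "v \<in> vletters \<Longrightarrow> g \<sigma> * Vw v - Vw (map (\<lambda>(j, l). (\<sigma> j, l)) v) * g \<sigma> \<in> I \<and> map (\<lambda>(j, l). (\<sigma> j, l)) v \<in> vletters"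
proof (induction v)
  case Nil
  then show ?case by (simp add: Vw_def I_ops vletters_def)
next
  case (Cons jl v)
  obtain j l where jl: "jl = (j, l)" "j \<in> {1..n}" "l = 1 \<or> l = 3" and v: "v \<in> vletters"
    using Cons.prems by (cases jl) (auto simp: vletters_def)
  have l4: "l \<in> {1..4}" using jl by auto
  have \<sigma>j: "\<sigma> j \<in> {1..n}" using assms jl(2) by (simp only: permutes_in_image)
  let ?v = "map (\<lambda>(j, l). (\<sigma> j, l)) v"
  note IHv = Cons.IH[OF v]
  have VwI: "v' \<in> vletters \<Longrightarrow> b \<in> I \<Longrightarrow> b * Vw v' \<in> I" for v' b
  proof (induction v' arbitrary: b)
    case (Cons kl v')
    obtain k m where kl: "kl = (k, m)" "k \<in> {1..n}" "m \<in> {1..4}"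
      using Cons.prems by (cases kl) (auto simp: vletters_def)
    have "b * V k m * Vw v' \<in> I"
      using Cons kl by (intro Cons.IH I_V) (auto simp: vletters_def)
    then show ?case by (simp add: Vw_def kl(1) mult.assoc)
  qed (simp add: Vw_def)
  have "g \<sigma> * Vw (jl # v) - Vw (map (\<lambda>(j, l). (\<sigma> j, l)) (jl # v)) * g \<sigma>
      = (g \<sigma> * V j l - V (\<sigma> j) l * g \<sigma>) * Vw v + V (\<sigma> j) l * (g \<sigma> * Vw v - Vw ?v * g \<sigma>)"
    by (simp add: Vw_def jl(1) algebra_simps)
  also have "\<dots> \<in> I"
    using IHv by (intro I_ops(1) VwI[OF v] V_I[OF \<sigma>j l4] g_V assms jl(2) l4) auto
  finally show ?case using IHv jl \<sigma>j by (auto simp: vletters_def)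
qed

text \<open>Relabelling the particles by \<sigma> destroys the order of the factors in a normal
  form. Stripping the first letter leaves degree at most d, where any order is allowed by
  hypothesis, and \<open>V13_N\<close> puts the letter back.\<close>

lemma g_N_Suc:
  assumes \<sigma>: "\<sigma> permutes {1..n}" and z: "z \<in> N (Suc d)"
  shows "g \<sigma> * z \<in> N (Suc d)"
  using z unfolding N_def
proof (rule span_image_mult, fold N_def)
  fix z assume "z \<in> bas ` {b \<in> bas_idx n. bdeg b \<le> Suc d} \<union> I"
  then show "g \<sigma> * z \<in> N (Suc d)"
  proof
    assume "z \<in> I"
    then show ?thesis using g_I[OF \<sigma>] by (intro I_N)
  next
    assume "z \<in> bas ` {b \<in> bas_idx n. bdeg b \<le> Suc d}"
    then obtain a y \<pi> where b: "z = bas (a, y, \<pi>)" and a: "a \<in> monoms n" and \<pi>: "\<pi> permutes {1..n}"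
      and deg: "mdeg n a + ydeg n y \<le> Suc d" by (auto simp: bas_idx_def bdeg_def)
    define v where "v = map (\<lambda>(j, l). (\<sigma> j, l)) (yword y)"
    have v: "g \<sigma> * Vw (yword y) - Vw v * g \<sigma> \<in> I" "v \<in> vletters" "length v = ydeg n y"
      using g_Vw[OF \<sigma> yword(1)] yword(2) by (simp_all add: v_def)
    have "(g \<sigma> * Vw (yword y) - Vw v * g \<sigma>) * g \<pi> * Xx a + Vw v * (g \<sigma> * g \<pi> - g (\<sigma> \<circ> \<pi>)) * Xx a \<in> I"
    proof (intro I_ops(1) Xx_ev I_g v \<pi>)
      have "v' \<in> vletters \<Longrightarrow> c \<in> I \<Longrightarrow> Vw v' * c \<in> I" for v' c
        by (induction v') (auto simp: Vw_def vletters_def mult.assoc intro!: V_I)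
      then show "Vw v * (g \<sigma> * g \<pi> - g (\<sigma> \<circ> \<pi>)) \<in> I" using rel_mult[OF \<sigma> \<pi>] v(2) by simp
    qed
    moreover have "g \<sigma> * z - Vw v * (g (\<sigma> \<circ> \<pi>) * Xx a)
        = (g \<sigma> * Vw (yword y) - Vw v * g \<sigma>) * g \<pi> * Xx a + Vw v * (g \<sigma> * g \<pi> - g (\<sigma> \<circ> \<pi>)) * Xx a"
      by (simp add: b bas_def yword(3) algebra_simps)
    ultimately have 1: "g \<sigma> * z - Vw v * (g (\<sigma> \<circ> \<pi>) * Xx a) \<in> N (Suc d)" by (intro I_N) simp
    have \<sigma>\<pi>: "\<sigma> \<circ> \<pi> permutes {1..n}" using \<sigma> \<pi> by (intro permutes_compose)
    have "Vw v * (g (\<sigma> \<circ> \<pi>) * Xx a) \<in> N (Suc d)"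
    proof (cases v)
      case Nil
      then show ?thesis using gX_bas[OF \<sigma>\<pi> a, of "Suc d"] deg by (simp add: Vw_def)
    next
      case (Cons jl v')
      then obtain j l where jl: "jl = (j, l)" "j \<in> {1..n}" "l = 1 \<or> l = 3" and v': "v' \<in> vletters"
        using v(2) by (cases jl) (auto simp: vletters_def)
      have "Vw v' * (g (\<sigma> \<circ> \<pi>) * Xx a) \<in> M (length v' + mdeg n a)"
        by (rule M_mult[OF Vw_M[OF v'] gX_M[OF \<sigma>\<pi>]])
      then have "Vw v' * (g (\<sigma> \<circ> \<pi>) * Xx a) \<in> N d"
        using Cons v(3) deg by (intro IH) (auto elim!: M_mono[rotated])
      from V13_N[OF jl(2,3) this] show ?thesis by (simp add: Cons Vw_def jl(1) mult.assoc)
    qed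
    from N_ops(1)[OF 1 this] show ?thesis by simp
  qed
qed

end

lemma ev_perm: "w \<in> lists (B_gens n) \<Longrightarrow> vdeg w = 0 \<Longrightarrow> \<exists>\<pi>. \<pi> permutes {1..n} \<and> ev w - g \<pi> \<in> I"
proof (induction w)
  case Nil
  have "1 - g id = scl (- 1) (g id - 1)" by simp
  also have "\<dots> \<in> I" by (intro I_ops rel_id)
  finally show ?case by (intro exI[of _ id] conjI permutes_id) (simp only: ev_simps)
next
  case (Cons h w)
  then obtain \<sigma> where h: "h = GS \<sigma>" "\<sigma> permutes {1..n}" by (cases h) auto
  then obtain \<pi> where \<pi>: "\<pi> permutes {1..n}" "ev w - g \<pi> \<in> I" using Cons by auto
  have "ev (h # w) - g (\<sigma> \<circ> \<pi>) = g \<sigma> * (ev w - g \<pi>) + (g \<sigma> * g \<pi> - g (\<sigma> \<circ> \<pi>))"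
    by (simp add: h(1) algebra_simps)
  also have "\<dots> \<in> I" using h \<pi> by (intro I_ops(1) g_I rel_mult)
  finally show ?case using permutes_compose[OF \<pi>(1) h(2)] by blast
qed

text \<open>In degree 0 every word is a permutation modulo the relations. In degree d + 1 a word is
  read from the left: a permutation in front preserves the span of normal forms, and a letter V in
  front leaves a word of degree d.\<close>

lemma M_sub_N: "z \<in> M d \<Longrightarrow> z \<in> N d"
proof (induction d arbitrary: z)
  case 0
  have "M 0 \<subseteq> N 0"
    unfolding M_def
  proof (rule span_minimal)
    show "subspace (N 0)" unfolding N_def by (rule subspace_span)
    show "{ev w |w. w \<in> lists (B_gens n) \<and> vdeg w \<le> 0} \<union> I \<subseteq> N 0"
    proof
      fix z assume "z \<in> {ev w |w. w \<in> lists (B_gens n) \<and> vdeg w \<le> 0} \<union> I"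
      then show "z \<in> N 0"
      proof
        assume "z \<in> {ev w |w. w \<in> lists (B_gens n) \<and> vdeg w \<le> 0}"
        then obtain \<pi> where \<pi>: "\<pi> permutes {1..n}" "z - g \<pi> \<in> I" using ev_perm by auto
        have "Yy (\<lambda>_. 0) = 1" by (simp add: Yy_def alt_simps map_replicate_const del: upt_Suc)
        moreover have "Xx 0 = 1" by (simp add: Xx_def map_replicate_const del: upt_Suc)
        ultimately have "g \<pi> \<in> N 0"
          using bas_N[of "(0, \<lambda>_. 0, \<pi>)" 0] \<pi>(1)
          by (simp add: bas_def bas_idx_def bdeg_def mdeg_def ydeg_def monoms_def)
        from N_ops(1)[OF I_N[OF \<pi>(2)] this] show ?thesis by simp
      qed (rule I_N)
    qed
  qed
  with 0 show ?case by auto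
next
  case (Suc d)
  have IH: "\<And>z. z \<in> M d \<Longrightarrow> z \<in> N d" by (rule Suc.IH)
  have words: "w \<in> lists (B_gens n) \<Longrightarrow> vdeg w \<le> Suc d \<Longrightarrow> ev w \<in> N (Suc d)" for w
  proof (induction w)
    case Nil
    then show ?case using M_N_Suc[OF IH one_M] by simp
  next
    case (Cons h w)
    show ?case
    proof (cases h)
      case (GV i l)
      then have "ev w \<in> N d" using Cons.prems by (intro IH ev_M) auto
      then show ?thesis using V_N[OF IH _ _ \<open>ev w \<in> N d\<close>, of i l] Cons.prems GV by auto
    next
      case (GS \<sigma>)
      then show ?thesis using g_N_Suc[OF IH, of \<sigma> "ev w"] Cons by auto
    qed
  qed
  have "M (Suc d) \<subseteq> N (Suc d)"
    unfolding M_def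
  proof (rule span_minimal)
    show "subspace (N (Suc d))" unfolding N_def by (rule subspace_span)
  qed (use words in \<open>auto intro: I_N\<close>)
  with Suc.prems show ?case by auto
qed

theorem bas_span: "z \<in> span (ev ` lists (B_gens n)) \<Longrightarrow> z \<in> span (bas ` bas_idx n \<union> I)"
proof -
  have "span (ev ` lists (B_gens n)) \<subseteq> span (bas ` bas_idx n \<union> I)"
  proof (rule span_minimal[OF _ subspace_span], rule)
    fix z assume "z \<in> ev ` lists (B_gens n)"
    then obtain w where "z = ev w" "w \<in> lists (B_gens n)" by auto
    then have "z \<in> N (vdeg w)" using M_sub_N[OF ev_M[OF _ order_refl]] by blast
    moreover have "N (vdeg w) \<subseteq> span (bas ` bas_idx n \<union> I)"
      unfolding N_def by (intro span_mono) auto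
    ultimately show "z \<in> span (bas ` bas_idx n \<union> I)" by auto
  qed
  then show "z \<in> span (ev ` lists (B_gens n)) \<Longrightarrow> z \<in> span (bas ` bas_idx n \<union> I)" by auto
qed

end

section \<open>Linear independence of the images\<close>

definition coord_word :: "nat \<Rightarrow> nat \<Rightarrow> nat list \<Rightarrow> nat list" where
  "coord_word n i ls = concat (map (letter_word n i) ls)"

definition bas_word :: "nat \<Rightarrow> (nat \<Rightarrow> int) \<Rightarrow> nat list \<Rightarrow> nat list" where
  "bas_word n y js = concat (map (\<lambda>i. coord_word n i (alt (y i))) js)"

lemma st_coord_word:
  assumes "2 \<le> n" "i \<in> {1..n}"
  shows "y i = 0 \<Longrightarrow> st n (coord_word n i (alt c)) (y, \<pi>) = (y(i := c), \<pi>)"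
proof (induction c rule: alt.induct)
  case (1 c)
  note letter = letter_word(3,4)[OF assms]
  consider "c = 0" | "0 < c" | "c < 0" by linarith
  then show ?case
  proof cases
    case 1
    then show ?thesis using "1.prems" by (auto simp: alt_simps coord_word_def)
  next
    case 2
    have h: "st n (coord_word n i (alt (1 - c))) (y, \<pi>) = (y(i := 1 - c), \<pi>)"
      by (rule 1(1)) (use 2 "1.prems" in simp_all)
    have "coord_word n i (alt c) = letter_word n i 1 @ coord_word n i (alt (1 - c))"
      by (simp add: alt_simps(2)[OF 2] coord_word_def)
    then show ?thesis by (simp only: letter st_simps h) (auto simp: fun_eq_iff)
  next
    case 3
    have h: "st n (coord_word n i (alt (- 1 - c))) (y, \<pi>) = (y(i := - 1 - c), \<pi>)"
      by (rule 1(2)) (use 3 "1.prems" in simp_all)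
    have "coord_word n i (alt c) = letter_word n i 3 @ coord_word n i (alt (- 1 - c))"
      by (simp add: alt_simps(3)[OF 3] coord_word_def)
    then show ?thesis by (simp only: letter st_simps h) (auto simp: fun_eq_iff)
  qed
qed

lemma st_bas_word:
  assumes "2 \<le> n" "set js \<subseteq> {1..n}" "distinct js" "\<And>i. i \<in> set js \<Longrightarrow> y0 i = 0"
  shows "st n (bas_word n y js) (y0, \<pi>) = ((\<lambda>i. if i \<in> set js then y i else y0 i), \<pi>)"
  using assms
proof (induction js)
  case (Cons j js)
  have "st n (bas_word n y js) (y0, \<pi>) = ((\<lambda>i. if i \<in> set js then y i else y0 i), \<pi>)"
    using Cons by auto
  moreover have "st n (coord_word n j (alt (y j))) ((\<lambda>i. if i \<in> set js then y i else y0 i), \<pi>)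
      = ((\<lambda>i. if i \<in> set js then y i else y0 i)(j := y j), \<pi>)"
    using Cons.prems by (intro st_coord_word) auto
  ultimately show ?case by (auto simp: bas_word_def fun_eq_iff)
qed (simp add: bas_word_def)

context complex_alg
begin

text \<open>One preimage is chosen for each vector that occurs, so that coefficients can be indexed
  by \<open>S\<close> even where \<open>f\<close> is not injective.\<close>

lemma span_image_finite_sum:
  assumes "x \<in> span (f ` S)"
  obtains T c where "finite T" "T \<subseteq> S" "x = (\<Sum>i\<in>T. scl (c i) (f i))"
proof -
  obtain t r where t: "finite t" "t \<subseteq> f ` S" "x = (\<Sum>a\<in>t. scl (r a) a)"
    using assms unfolding span_explicit by auto
  then obtain T where T: "T \<subseteq> S" "inj_on f T" "t = f ` T" by (meson subset_image_inj)
  have "finite T" using t(1) T finite_imageD by blast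
  moreover have "x = (\<Sum>i\<in>T. scl (r (f i)) (f i))"
    using t(3) T by (simp add: sum.reindex)
  ultimately show ?thesis using that[of T "r \<circ> f"] T by simp
qed

end

locale daha_pbw = daha_ring scl n r X t0 u0 t tn un
  for scl :: "complex \<Rightarrow> 'e::ring_1 \<Rightarrow> 'e" and n r X t0 u0 t tn un +
  fixes \<gamma> :: "nat \<Rightarrow> complex"
  assumes pbw: "finite T \<Longrightarrow> T \<subseteq> W_group n \<times> monoms n \<Longrightarrow>
    (\<Sum>z\<in>T. scl (c z) (prod_list (map r (SOME u. u \<in> fst z)) *
      prod_list (map (\<lambda>j. X j ^ Poly_Mapping.lookup (snd z) j) [1..<Suc n]))) = 0 \<Longrightarrow> z \<in> T \<Longrightarrow> c z = 0"
begin

definition pb :: "nat list set \<times> (nat \<Rightarrow>\<^sub>0 nat) \<Rightarrow> 'e" where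
  "pb z = rw (SOME u. u \<in> fst z) * Xm (snd z)"

lemma pb_notin_span:
  assumes "z \<in> W_group n \<times> monoms n"
  shows "pb z \<notin> span (pb ` (W_group n \<times> monoms n - {z}))"
proof
  assume "pb z \<in> span (pb ` (W_group n \<times> monoms n - {z}))"
  then obtain T c where T: "finite T" "T \<subseteq> W_group n \<times> monoms n - {z}" "pb z = (\<Sum>i\<in>T. scl (c i) (pb i))"
    by (rule span_image_finite_sum)
  \<comment> \<open>The coefficient -1 at \<open>z\<close> turns membership in the span into a
    vanishing linear combination.\<close>
  let ?c = "c(z := - 1)"
  have "(\<Sum>i\<in>insert z T. scl (?c i) (pb i)) = scl (- 1) (pb z) + (\<Sum>i\<in>T. scl (?c i) (pb i))"
    using T by (subst sum.insert) auto
  also have "(\<Sum>i\<in>T. scl (?c i) (pb i)) = pb z"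
    unfolding T(3) using T(2) by (intro sum.cong) auto
  finally have "(\<Sum>i\<in>insert z T. scl (?c i) (pb i)) = 0" by simp
  then have "?c z = 0"
    using pbw[of "insert z T" ?c z] T assms unfolding pb_def rw_def Xm_def by auto
  then show False by simp
qed

definition cl :: "nat list \<Rightarrow> nat list set" where "cl u = cox_eq n `` {u}"

lemma cl: "u \<in> words \<Longrightarrow> cl u \<in> W_group n" "cl u = cl v \<Longrightarrow> st n u s = st n v s" "rw (SOME v. v \<in> cl u) = rw u"
proof -
  show "u \<in> words \<Longrightarrow> cl u \<in> W_group n"
    unfolding W_group_def cl_def by (intro quotientI) (auto simp: words_def)
  have in_cl: "u \<in> cl u" for u by (simp add: cl_def)
  show "cl u = cl v \<Longrightarrow> st n u s = st n v s"
  proof -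
    assume "cl u = cl v"
    then have "(u, v) \<in> cox_eq n" using in_cl[of v] unfolding cl_def by blast
    then show "st n u s = st n v s" using st_cox_eq n2 by blast
  qed
  have *: "(u, v) \<in> cox_eq n \<Longrightarrow> rw v = rw u" for v
  proof (induction rule: rtrancl_induct)
    case (step v w)
    have ws: "rw v = rw w" if vw: "(v, w) \<in> word_step n" for v w
    proof -
      obtain a b x y where "v = a @ x @ b" "w = a @ y @ b" "(x, y) \<in> coxeter_rels n"
        using vw unfolding word_step_def by blast
      then show ?thesis using coxeter_rel[of x y] by (simp add: rw_def)
    qed
    have "(v, w) \<in> word_step n \<or> (w, v) \<in> word_step n" using step.hyps(2) by blast
    then show ?case using step.IH ws by metis
  qed simp
  have "(SOME v. v \<in> cl u) \<in> cl u" using in_cl by (rule someI)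
  then have "(u, SOME v. v \<in> cl u) \<in> cox_eq n" unfolding cl_def by blast
  then show "rw (SOME v. v \<in> cl u) = rw u" by (rule *)
qed

definition st0 :: "nat list \<Rightarrow> (nat \<Rightarrow> int) \<times> (nat \<Rightarrow> nat)" where "st0 u = st n u (\<lambda>_. 0, id)"

definition U :: "(nat \<Rightarrow>\<^sub>0 nat) \<Rightarrow> (nat \<Rightarrow> int) \<times> (nat \<Rightarrow> nat) \<Rightarrow> 'e set" where
  "U p s = span {rw u * Xm a | u a. u \<in> words \<and> a \<in> monoms n \<and> (a \<noteq> p \<or> st0 u \<noteq> s)}"

lemma U_ops: "a \<in> U p s \<Longrightarrow> b \<in> U p s \<Longrightarrow> a + b \<in> U p s" "a \<in> U p s \<Longrightarrow> b \<in> U p s \<Longrightarrow> a - b \<in> U p s"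
  "a \<in> U p s \<Longrightarrow> scl c a \<in> U p s" "(\<And>i. i \<in> J \<Longrightarrow> f i \<in> U p s) \<Longrightarrow> sum f J \<in> U p s"
  unfolding U_def by (simp_all add: span_add span_diff span_scale span_sum)

text \<open>The state of a word is an invariant of its class in W. Hence every vector spanning
  \<open>U\<close> is a PBW basis vector other than \<open>rw u * Xm p\<close>, and linear
  independence applies.\<close>

lemma not_in_U:
  assumes "u \<in> words" "p \<in> monoms n"
  shows "rw u * Xm p \<notin> U p (st0 u)"
proof -
  have pb: "rw v * Xm a = pb (cl v, a)" for v a by (simp add: pb_def cl(3))
  have "U p (st0 u) \<subseteq> span (pb ` (W_group n \<times> monoms n - {(cl u, p)}))"
    unfolding U_def
  proof (rule span_mono, rule)
    fix z assume "z \<in> {rw v * Xm a | v a. v \<in> words \<and> a \<in> monoms n \<and> (a \<noteq> p \<or> st0 v \<noteq> st0 u)}"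
    then obtain v a where va: "z = rw v * Xm a" "v \<in> words" "a \<in> monoms n" "a \<noteq> p \<or> st0 v \<noteq> st0 u" by auto
    have "(cl v, a) \<noteq> (cl u, p)"
      using va(4) cl(2)[of v u "(\<lambda>_. 0, id)"] unfolding st0_def by blast
    then show "z \<in> pb ` (W_group n \<times> monoms n - {(cl u, p)})"
      unfolding va(1) pb using va(2,3) cl(1) by (intro imageI) auto
  qed
  moreover have "pb (cl u, p) \<notin> span (pb ` (W_group n \<times> monoms n - {(cl u, p)}))"
    using assms by (intro pb_notin_span) (auto simp: cl(1))
  ultimately show ?thesis unfolding pb by blast
qed

definition VE :: "nat \<Rightarrow> nat \<Rightarrow> 'e" where "VE i l = Vc i l + sc (\<gamma> l + par l)"
definition xE :: "nat \<Rightarrow> 'e" where "xE i = VE i 1 + VE i 2"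

definition imgb :: "(nat \<Rightarrow>\<^sub>0 nat) \<times> (nat \<Rightarrow> int) \<times> (nat \<Rightarrow> nat) \<Rightarrow> 'e" where
  "imgb = (\<lambda>(a, y, \<pi>). prod_list (map (\<lambda>i. prod_list (map (VE i) (alt (y i)))) [1..<Suc n])
     * P \<pi> * prod_list (map (\<lambda>j. xE j ^ Poly_Mapping.lookup a j) [1..<Suc n]))"

lemma xE_shape: "i \<in> {1..n} \<Longrightarrow> xE i - X i \<in> Rsp"
proof -
  assume i: "i \<in> {1..n}"
  have "xE i - X i = (Vc i 1 + Vc i 2 - X i) + (sc (\<gamma> 1 + par 1) + sc (\<gamma> 2 + par 2))"
    by (simp add: xE_def VE_def)
  also have "\<dots> \<in> Rsp" by (intro Rsp_intros(1)[OF Vc12_shape[OF i]] Rsp_intros(1,4) Rsp_one)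
  finally show ?thesis .
qed

lemma lead_xE_power:
  assumes "i \<in> {1..n}" "lead z [] p"
  shows "lead (xE i ^ k * z) [] (p + Poly_Mapping.single i k)"
proof (induction k)
  case 0
  then show ?case using assms by simp
next
  case (Suc k)
  from lead_x[OF assms(1) xE_shape[OF assms(1)] Suc] show ?case
    by (simp add: mult.assoc add.assoc flip: single_add)
qed

lemma lead_XE: "a \<in> monoms n \<Longrightarrow> lead (prod_list (map (\<lambda>j. xE j ^ Poly_Mapping.lookup a j) [1..<Suc n])) [] a"
proof -
  assume a: "a \<in> monoms n"
  have "lead (prod_list (map (\<lambda>j. xE j ^ Poly_Mapping.lookup a j) js)) []
      (\<Sum>j\<leftarrow>js. Poly_Mapping.single j (Poly_Mapping.lookup a j))" if "set js \<subseteq> {1..n}" for js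
    using that
  proof (induction js)
    case (Cons j js)
    have j: "j \<in> {1..n}" and js: "set js \<subseteq> {1..n}" using Cons.prems by auto
    show ?case
      using lead_xE_power[OF j Cons.IH[OF js], of "Poly_Mapping.lookup a j"]
      by (simp only: list.map prod_list.Cons sum_list.Cons add.commute)
  qed (simp add: lead_one)
  moreover have "(\<Sum>j\<leftarrow>[1..<Suc n]. Poly_Mapping.single j (Poly_Mapping.lookup a j)) = a"
  proof (rule poly_mapping_eqI)
    fix k
    have "Poly_Mapping.lookup (\<Sum>j\<leftarrow>[1..<Suc n]. Poly_Mapping.single j (Poly_Mapping.lookup a j)) k
        = (\<Sum>j\<in>{1..n}. Poly_Mapping.lookup a j when j = k)"
      by (simp add: interv_sum_list_conv_sum_set_nat lookup_sum lookup_single atLeastLessThanSuc_atLeastAtMost del: upt_Suc)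
    also have "\<dots> = Poly_Mapping.lookup a k"
      using a in_keys_iff[of k a] by (cases "k \<in> {1..n}") (auto simp: when_def monoms_def)
    finally show "Poly_Mapping.lookup (\<Sum>j\<leftarrow>[1..<Suc n]. Poly_Mapping.single j (Poly_Mapping.lookup a j)) k
        = Poly_Mapping.lookup a k" .
  qed
  ultimately show ?thesis by (metis set_upt atLeastLessThanSuc_atLeastAtMost order_refl)
qed

lemma VE_shape:
  assumes "i \<in> {1..n}" "l = 1 \<or> l = 3"
  shows "\<exists>\<kappa> \<kappa>'. \<kappa> \<noteq> 0 \<and> VE i l - (scl \<kappa> (X i * rw (letter_word n i l)) + scl \<kappa>' (X i)) \<in> Rsp"
proof -
  have "\<exists>\<kappa> \<kappa>'. \<kappa> \<noteq> 0 \<and> Vc i l - (scl \<kappa> (X i * rw (letter_word n i l)) + scl \<kappa>' (X i)) \<in> Rsp"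
  proof (cases "l = 1")
    case True
    show ?thesis unfolding True
      by (rule exI[of _ "- (1/2)"], rule exI[of _ "1/2"]) (use Vc1_shape[OF assms(1)] in simp)
  next
    case False
    with assms(2) have l: "l = 3" by simp
    show ?thesis unfolding l
      by (rule exI[of _ "1/2"], rule exI[of _ "- (1/2)"]) (use Vc3_shape[OF assms(1)] in simp)
  qed
  then obtain \<kappa> \<kappa>' where k: "\<kappa> \<noteq> 0" "Vc i l - (scl \<kappa> (X i * rw (letter_word n i l)) + scl \<kappa>' (X i)) \<in> Rsp" by blast
  have "VE i l - (scl \<kappa> (X i * rw (letter_word n i l)) + scl \<kappa>' (X i))
      = (Vc i l - (scl \<kappa> (X i * rw (letter_word n i l)) + scl \<kappa>' (X i))) + sc (\<gamma> l + par l)"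
    by (simp add: VE_def)
  also have "\<dots> \<in> Rsp" by (intro Rsp_intros(1)[OF k(2)] Rsp_intros(4) Rsp_one)
  finally show ?thesis using k(1) by blast
qed

text \<open>One shift \<open>q\<close> serves all \<open>z\<close> and \<open>p\<close>: it is
  collected from the words passed on the way, one variable for every letter.\<close>

lemma lead_letters:
  assumes "i \<in> {1..n}" "u \<in> words" "set ls \<subseteq> {1, 3}"
  shows "\<exists>q. q \<in> monoms n \<and> mdeg n q = length ls \<and> coord_word n i ls @ u \<in> words \<and> deg n (coord_word n i ls) = length ls \<and>
    (\<forall>z p. lead z u p \<longrightarrow> lead (prod_list (map (VE i) ls) * z) (coord_word n i ls @ u) (p + q))"
  using assms(3)
proof (induction ls)
  case Nil
  show ?case using assms(2) by (intro exI[of _ 0]) (auto simp: coord_word_def monoms_def mdeg_def)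
next
  case (Cons l ls)
  then obtain q where q: "q \<in> monoms n" "mdeg n q = length ls" "coord_word n i ls @ u \<in> words"
      "deg n (coord_word n i ls) = length ls"
      "\<And>z p. lead z u p \<Longrightarrow> lead (prod_list (map (VE i) ls) * z) (coord_word n i ls @ u) (p + q)"
    by auto
  have l: "l = 1 \<or> l = 3" using Cons.prems by auto
  obtain \<kappa> \<kappa>' where k: "\<kappa> \<noteq> 0" "VE i l - (scl \<kappa> (X i * rw (letter_word n i l)) + scl \<kappa>' (X i)) \<in> Rsp"
    using VE_shape[OF assms(1) l] by blast
  have w: "letter_word n i l \<in> words" "deg n (letter_word n i l) = 1"
    using letter_word(1,2)[OF n2 assms(1)] by (auto simp: words_def)
  obtain j where j: "j \<in> {1..n}" "\<And>z p. lead z (coord_word n i ls @ u) p \<Longrightarrow>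
      lead (VE i l * z) (letter_word n i l @ (coord_word n i ls @ u)) (p + Poly_Mapping.single j 1)"
    using lead_letter[OF assms(1) w k(1) q(3) k(2)] by blast
  show ?case
  proof (intro exI[of _ "q + Poly_Mapping.single j 1"] conjI allI impI)
    show "q + Poly_Mapping.single j 1 \<in> monoms n" using q j by (intro monoms_add_single)
    show "mdeg n (q + Poly_Mapping.single j 1) = length (l # ls)" using q j by (simp add: mdeg_add mdeg_single)
    show "coord_word n i (l # ls) @ u \<in> words" using q(3) w(1) by (simp add: coord_word_def)
    show "deg n (coord_word n i (l # ls)) = length (l # ls)" using q(4) w(2) by (simp add: coord_word_def)
    fix z p assume "lead z u p"
    from j(2)[OF q(5)[OF this]]
    show "lead (prod_list (map (VE i) (l # ls)) * z) (coord_word n i (l # ls) @ u) (p + (q + Poly_Mapping.single j 1))"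
      by (simp add: coord_word_def mult.assoc add.assoc)
  qed
qed

lemma lead_coords:
  assumes "u \<in> words" "set js \<subseteq> {1..n}"
  shows "\<exists>q. q \<in> monoms n \<and> mdeg n q = (\<Sum>i\<leftarrow>js. nat \<bar>y i\<bar>) \<and> bas_word n y js @ u \<in> words
    \<and> deg n (bas_word n y js) = (\<Sum>i\<leftarrow>js. nat \<bar>y i\<bar>) \<and>
    (\<forall>z p. lead z u p \<longrightarrow>
      lead (prod_list (map (\<lambda>i. prod_list (map (VE i) (alt (y i)))) js) * z) (bas_word n y js @ u) (p + q))"
  using assms(2)
proof (induction js)
  case Nil
  show ?case using assms(1) by (intro exI[of _ 0]) (auto simp: bas_word_def monoms_def mdeg_def)
next
  case (Cons i js)
  let ?Y = "prod_list (map (\<lambda>i. prod_list (map (VE i) (alt (y i)))) js)"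
  obtain q where q: "q \<in> monoms n" "mdeg n q = (\<Sum>i\<leftarrow>js. nat \<bar>y i\<bar>)" "bas_word n y js @ u \<in> words"
      "deg n (bas_word n y js) = (\<Sum>i\<leftarrow>js. nat \<bar>y i\<bar>)"
      "\<And>z p. lead z u p \<Longrightarrow> lead (?Y * z) (bas_word n y js @ u) (p + q)"
    using Cons by auto
  have i: "i \<in> {1..n}" using Cons.prems by simp
  obtain q' where q': "q' \<in> monoms n" "mdeg n q' = length (alt (y i))" 
      "coord_word n i (alt (y i)) @ (bas_word n y js @ u) \<in> words" "deg n (coord_word n i (alt (y i))) = length (alt (y i))"
      "\<And>z p. lead z (bas_word n y js @ u) p \<Longrightarrow>
        lead (prod_list (map (VE i) (alt (y i))) * z) (coord_word n i (alt (y i)) @ (bas_word n y js @ u)) (p + q')"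
    using lead_letters[OF i q(3) set_alt[of "y i"]] by blast
  show ?case
  proof (intro exI[of _ "q + q'"] conjI allI impI)
    show "q + q' \<in> monoms n"
      using q(1) q'(1) keys_add[of q q'] unfolding monoms_def by blast
    show "mdeg n (q + q') = (\<Sum>i\<leftarrow>i # js. nat \<bar>y i\<bar>)" using q q' by (simp add: mdeg_add length_alt)
    show "bas_word n y (i # js) @ u \<in> words" using q'(3) by (simp add: bas_word_def)
    show "deg n (bas_word n y (i # js)) = (\<Sum>i\<leftarrow>i # js. nat \<bar>y i\<bar>)"
      using q(4) q'(4) by (simp add: bas_word_def length_alt)
    fix z p assume "lead z u p"
    from q'(5)[OF q(5)[OF this]]
    show "lead (prod_list (map (\<lambda>i. prod_list (map (VE i) (alt (y i)))) (i # js)) * z) (bas_word n y (i # js) @ u) (p + (q + q'))"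
      by (simp add: bas_word_def mult.assoc add.assoc)
  qed
qed

definition uw :: "(nat \<Rightarrow> int) \<Rightarrow> (nat \<Rightarrow> nat) \<Rightarrow> nat list" where
  "uw y \<pi> = bas_word n y [1..<Suc n] @ perm_word n \<pi>"

text \<open>The monomial in the x_i stands at the far right and has leading exponent
  \<open>a\<close>; the permutation leaves it alone, and the letters add a shift that depends on the
  words only. So \<open>q\<close> is the same for all \<open>a\<close>, and different
  \<open>a\<close> with the same y and \<pi> give different leading exponents.\<close>

lemma lead_imgb:
  assumes "\<pi> permutes {1..n}"
  shows "\<exists>q. q \<in> monoms n \<and> mdeg n q = ydeg n y \<and> deg n (uw y \<pi>) = ydeg n y \<and>
    (\<forall>a\<in>monoms n. lead (imgb (a, y, \<pi>)) (uw y \<pi>) (a + q))"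
proof -
  have pw: "perm_word n \<pi> \<in> words" "deg n (perm_word n \<pi>) = 0"
    using P_words[OF assms] perm_word[OF assms] deg_perm by auto
  have upt_sub: "set [1..<Suc n] \<subseteq> {1..n}" by auto
  have sl: "(\<Sum>i\<leftarrow>[1..<Suc n]. nat \<bar>y i\<bar>) = ydeg n y"
    unfolding ydeg_def by (simp add: interv_sum_list_conv_sum_set_nat atLeastLessThanSuc_atLeastAtMost del: upt_Suc)
  obtain q where q: "q \<in> monoms n" "mdeg n q = ydeg n y" "deg n (bas_word n y [1..<Suc n]) = ydeg n y"
    "\<And>z p. lead z (perm_word n \<pi>) p \<Longrightarrow>
      lead (prod_list (map (\<lambda>i. prod_list (map (VE i) (alt (y i)))) [1..<Suc n]) * z) (bas_word n y [1..<Suc n] @ perm_word n \<pi>) (p + q)"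
    using lead_coords[OF pw(1) upt_sub, of y] unfolding sl by blast
  have "lead (imgb (a, y, \<pi>)) (uw y \<pi>) (a + q)" if "a \<in> monoms n" for a
  proof -
    have "lead (P \<pi> * prod_list (map (\<lambda>j. xE j ^ Poly_Mapping.lookup a j) [1..<Suc n])) (perm_word n \<pi>) a"
      using lead_rw[OF pw(1) lead_XE[OF that]] by (simp add: P_def)
    from q(4)[OF this] show ?thesis by (simp add: imgb_def uw_def mult.assoc)
  qed
  then show ?thesis using q pw by (intro exI[of _ q]) (simp add: uw_def)
qed

lemma st0_uw:
  assumes "\<pi> permutes {1..n}" "\<And>i. i \<notin> {1..n} \<Longrightarrow> y i = 0"
  shows "st0 (uw y \<pi>) = (y, \<pi>)"
proof -
  have "st n (perm_word n \<pi>) (\<lambda>_. 0, id) = ((\<lambda>_. 0), \<pi>)"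
    using perm_word_st[OF assms(1), of "\<lambda>_. 0" id] by (simp add: o_def)
  moreover have "st n (bas_word n y [1..<Suc n]) ((\<lambda>_. 0), \<pi>) = (y, \<pi>)"
  proof -
    have "st n (bas_word n y [1..<Suc n]) ((\<lambda>_. 0), \<pi>) = ((\<lambda>i. if i \<in> set [1..<Suc n] then y i else 0), \<pi>)"
      by (rule st_bas_word[OF n2]) auto
    also have "(\<lambda>i. if i \<in> set [1..<Suc n] then y i else 0) = y"
      using assms(2) by (auto simp: fun_eq_iff simp del: upt_Suc)
    finally show ?thesis .
  qed
  ultimately show ?thesis by (simp add: st0_def uw_def)
qed

text \<open>A smaller degree in X excludes the exponent \<open>p\<close>. In equal degree there are
  fewer end letters than |y_1| + ... + |y_n| for the state \<open>s\<close>, so by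
  \<open>st_deg_bound\<close> this state is not reached.\<close>

lemma G_sub_U:
  assumes "st0 u = s" "deg n u = (\<Sum>i\<in>{1..n}. nat \<bar>fst s i\<bar>)"
  shows "G (mdeg n p) (deg n u) \<subseteq> U p s"
  unfolding G_def U_def
proof (rule span_mono, rule)
  fix z assume "z \<in> {rw v * Xm a |v a. v \<in> words \<and> a \<in> monoms n \<and> (mdeg n a < mdeg n p \<or> mdeg n a = mdeg n p \<and> deg n v < deg n u)}"
  then obtain v a where v: "z = rw v * Xm a" "v \<in> words" "a \<in> monoms n"
    "mdeg n a < mdeg n p \<or> mdeg n a = mdeg n p \<and> deg n v < deg n u" by auto
  have "st0 v \<noteq> s" if "deg n v < deg n u"
  proof
    assume "st0 v = s"
    then have "(\<Sum>i\<in>{1..n}. \<bar>fst s i\<bar>) \<le> (\<Sum>i\<in>{1..n}. \<bar>(\<lambda>_. 0::int) i\<bar>) + int (deg n v)"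
      using st_deg_bound[of n v "\<lambda>_. 0" id] v(2) n2 unfolding st0_def words_def by auto
    moreover have "int (deg n u) = (\<Sum>i\<in>{1..n}. \<bar>fst s i\<bar>)" unfolding assms(2) by simp
    ultimately show False using that by simp
  qed
  then show "z \<in> {rw v * Xm a |v a. v \<in> words \<and> a \<in> monoms n \<and> (a \<noteq> p \<or> st0 v \<noteq> s)}"
    using v by blast
qed

text \<open>Among the terms with nonzero coefficient, one of maximal degree \<open>D\<close> and
  then of maximal \<open>L\<close> is selected. All other terms lie in \<open>U\<close> for its
  leading exponent and state, so the relation would put its leading term into \<open>U\<close> as
  well.\<close>

theorem imgb_independent:
  assumes "finite T" "T \<subseteq> bas_idx n" "(\<Sum>b\<in>T. scl (c b) (imgb b)) = 0" "b \<in> T"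
  shows "c b = 0"
proof (rule ccontr)
  assume "c b \<noteq> 0"
  define T' where "T' = {b \<in> T. c b \<noteq> 0}"
  have T': "finite T'" "b \<in> T'" "T' \<subseteq> bas_idx n" using assms \<open>c b \<noteq> 0\<close> by (auto simp: T'_def)
  have sum0: "(\<Sum>b\<in>T'. scl (c b) (imgb b)) = 0"
    using assms(1,3) unfolding T'_def by (subst sum.mono_neutral_left[of T]) auto
  \<comment> \<open>A single choice of the shift for each pair of y and \<pi>, so that terms with
    the same pair are compared with the same shift.\<close>
  define q where "q y \<pi> = (SOME q. q \<in> monoms n \<and> mdeg n q = ydeg n y \<and> deg n (uw y \<pi>) = ydeg n y \<and>
    (\<forall>a\<in>monoms n. lead (imgb (a, y, \<pi>)) (uw y \<pi>) (a + q)))" for y \<pi>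
  have q: "q y \<pi> \<in> monoms n" "mdeg n (q y \<pi>) = ydeg n y" "deg n (uw y \<pi>) = ydeg n y"
    "\<And>a. a \<in> monoms n \<Longrightarrow> lead (imgb (a, y, \<pi>)) (uw y \<pi>) (a + q y \<pi>)" if "\<pi> permutes {1..n}" for y \<pi>
    using someI_ex[OF lead_imgb[OF that, of y]] unfolding q_def[symmetric] by auto
  define D where "D = (\<lambda>(a, y, \<pi> :: nat \<Rightarrow> nat). mdeg n a + ydeg n y)"
  define L where "L = (\<lambda>(a :: nat \<Rightarrow>\<^sub>0 nat, y, \<pi> :: nat \<Rightarrow> nat). ydeg n y)"
  define D0 where "D0 = Max (D ` T')"
  define T'' where "T'' = {b \<in> T'. D b = D0}"
  have "D0 \<in> D ` T'" unfolding D0_def using T' by (intro Max_in) auto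
  then have T'': "finite T''" "T'' \<noteq> {}" using T' by (auto simp: T''_def)
  define L0 where "L0 = Max (L ` T'')"
  have "L0 \<in> L ` T''" unfolding L0_def using T'' by (intro Max_in) auto
  then obtain b0 where b0: "b0 \<in> T'" "D b0 = D0" "L b0 = L0" by (auto simp: T''_def)
  have max: "D b < D0 \<or> D b = D0 \<and> L b \<le> L0" if "b \<in> T'" for b
  proof -
    have "D b \<le> D0" unfolding D0_def using that T' by (intro Max_ge) auto
    moreover have "L b \<le> L0" if "D b = D0"
      unfolding L0_def using \<open>b \<in> T'\<close> that T'' by (intro Max_ge) (auto simp: T''_def)
    ultimately show ?thesis by linarith
  qed
  obtain a0 y0 \<pi>0 where b0': "b0 = (a0, y0, \<pi>0)" by (cases b0) auto
  have idx0: "a0 \<in> monoms n" "\<And>i. i \<notin> {1..n} \<Longrightarrow> y0 i = 0" "\<pi>0 permutes {1..n}"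
    using b0(1) T'(3) unfolding b0' bas_idx_def by auto
  define p0 where "p0 = a0 + q y0 \<pi>0"
  define u0 where "u0 = uw y0 \<pi>0"
  have st_u0: "st0 u0 = (y0, \<pi>0)" unfolding u0_def using idx0 by (intro st0_uw)
  have D0: "D0 = mdeg n p0" using b0(2) q(2)[OF idx0(3)] by (simp add: b0' D_def p0_def mdeg_add)
  have L0: "L0 = deg n u0" using b0(3) q(3)[OF idx0(3)] by (simp add: b0' L_def u0_def)
  have GU: "G D0 L0 \<subseteq> U p0 (st0 u0)"
    unfolding D0 L0 using q(3)[OF idx0(3), of y0] by (intro G_sub_U) (simp_all add: st_u0[unfolded u0_def] u0_def ydeg_def)
  have lead0: "lead (imgb b0) u0 p0" unfolding b0' u0_def p0_def by (intro q idx0)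
  have other: "imgb b \<in> U p0 (st0 u0)" if b: "b \<in> T' - {b0}" for b
  proof -
    obtain a y \<pi> where b': "b = (a, y, \<pi>)" by (cases b) auto
    have idx: "a \<in> monoms n" "\<And>i. i \<notin> {1..n} \<Longrightarrow> y i = 0" "\<pi> permutes {1..n}"
      using b T'(3) unfolding b' bas_idx_def by auto
    define p where "p = a + q y \<pi>"
    define u where "u = uw y \<pi>"
    have DL: "D b = mdeg n p" "L b = deg n u"
      using q(2,3)[OF idx(3), of y] by (simp_all add: b' D_def L_def p_def u_def mdeg_add)
    have lead: "lead (imgb b) u p" unfolding b' u_def p_def by (intro q idx)
    show ?thesis
    proof (cases "D b = D0 \<and> L b = L0")
      case False
      then have "G (mdeg n p) (Suc (deg n u)) \<subseteq> G D0 L0"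
        using max[of b] b DL by (intro G_mono) auto
      then show ?thesis using lead_in_G[OF lead] GU by blast
    next
      case True
      obtain c where c: "u \<in> words" "p \<in> monoms n" "imgb b - scl c (rw u * Xm p) \<in> G (mdeg n p) (deg n u)"
        using lead unfolding lead_def by auto
      have "imgb b - scl c (rw u * Xm p) \<in> U p0 (st0 u0)"
        using c(3) GU True DL by auto
      moreover have "rw u * Xm p \<in> U p0 (st0 u0)"
      proof -
        \<comment> \<open>Equal pairs of y and \<pi> share the shift, and the exponents differ
          because \<open>a\<close> and \<open>a0\<close> do; unequal pairs are the states of their
          words, hence distinct.\<close>
        have "p \<noteq> p0 \<or> st0 u \<noteq> st0 u0"
        proof (cases "y = y0 \<and> \<pi> = \<pi>0")
          case True
          then have "a \<noteq> a0" using b b0' b' by auto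
          then show ?thesis using True by (simp add: p_def p0_def)
        next
          case False
          have "st0 u = (y, \<pi>)" unfolding u_def using idx by (intro st0_uw)
          then show ?thesis using False st_u0 by simp
        qed
        then show ?thesis unfolding U_def using c by (intro span_base) blast
      qed
      ultimately have "(imgb b - scl c (rw u * Xm p)) + scl c (rw u * Xm p) \<in> U p0 (st0 u0)"
        by (intro U_ops(1,3))
      then show ?thesis by simp
    qed
  qed
  have "scl (c b0) (imgb b0) + (\<Sum>b\<in>T' - {b0}. scl (c b) (imgb b)) = 0"
    using sum0 sum.remove[OF T'(1) b0(1), of "\<lambda>b. scl (c b) (imgb b)"] by simp
  then have eq: "scl (c b0) (imgb b0) = scl (- 1) (\<Sum>b\<in>T' - {b0}. scl (c b) (imgb b))"
    by (simp add: add_eq_0_iff2)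
  have "scl (c b0) (imgb b0) \<in> U p0 (st0 u0)"
    unfolding eq using other by (intro U_ops(3,4)) auto
  then have "scl (1 / c b0) (scl (c b0) (imgb b0)) \<in> U p0 (st0 u0)" by (rule U_ops(3))
  moreover have "c b0 \<noteq> 0" using b0(1) by (simp add: T'_def)
  ultimately have in_U: "imgb b0 \<in> U p0 (st0 u0)" by simp
  obtain k where k: "k \<noteq> 0" "u0 \<in> words" "p0 \<in> monoms n" "imgb b0 - scl k (rw u0 * Xm p0) \<in> G (mdeg n p0) (deg n u0)"
    using lead0 unfolding lead_def by auto
  then have "imgb b0 - scl k (rw u0 * Xm p0) \<in> U p0 (st0 u0)"
    using GU D0 L0 by auto
  from U_ops(2)[OF in_U this]
  have "scl k (rw u0 * Xm p0) \<in> U p0 (st0 u0)" by simp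
  then have "scl (1 / k) (scl k (rw u0 * Xm p0)) \<in> U p0 (st0 u0)" by (rule U_ops(3))
  then have "rw u0 * Xm p0 \<in> U p0 (st0 u0)" using k(1) by simp
  with not_in_U[OF k(2,3)] show False by blast
qed

end

section \<open>Abstract algebras inside a ring type\<close>

text \<open>A faithful copy of an algebra on a carrier set inside a ring that is a type: equations
  are computed there and pulled back by injectivity.\<close>

locale ring_rep = ring A + complex_alg scl
  for A :: "(complex, 'a) module" (structure) and scl :: "complex \<Rightarrow> 'e::ring_1 \<Rightarrow> 'e" +
  fixes \<iota> :: "'a \<Rightarrow> 'e"
  assumes smult_in: "x \<in> carrier A \<Longrightarrow> c \<odot> x \<in> carrier A"
    and \<iota>_add: "x \<in> carrier A \<Longrightarrow> y \<in> carrier A \<Longrightarrow> \<iota> (x \<oplus> y) = \<iota> x + \<iota> y"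
    and \<iota>_mult: "x \<in> carrier A \<Longrightarrow> y \<in> carrier A \<Longrightarrow> \<iota> (x \<otimes> y) = \<iota> x * \<iota> y"
    and \<iota>_one: "\<iota> \<one> = 1"
    and \<iota>_smult: "x \<in> carrier A \<Longrightarrow> \<iota> (c \<odot> x) = scl c (\<iota> x)"
    and \<iota>_inj: "inj_on \<iota> (carrier A)"
begin

lemma \<iota>_zero: "\<iota> \<zero> = 0"
  using \<iota>_add[of \<zero> \<zero>] by simp

lemma \<iota>_a_inv: "x \<in> carrier A \<Longrightarrow> \<iota> (\<ominus> x) = - \<iota> x"
  using \<iota>_add[of x "\<ominus> x"] by (simp add: r_neg \<iota>_zero eq_neg_iff_add_eq_0 add.commute)

lemma \<iota>_minus: "x \<in> carrier A \<Longrightarrow> y \<in> carrier A \<Longrightarrow> \<iota> (x \<ominus> y) = \<iota> x - \<iota> y"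
  by (simp add: a_minus_def \<iota>_add \<iota>_a_inv)

lemma \<iota>_finsum: "finite J \<Longrightarrow> f \<in> J \<rightarrow> carrier A \<Longrightarrow> \<iota> (\<Oplus>j\<in>J. f j) = (\<Sum>j\<in>J. \<iota> (f j))"
proof (induction J rule: finite_induct)
  case (insert j J)
  then have "f \<in> J \<rightarrow> carrier A" "f j \<in> carrier A" by auto
  then show ?case using insert by (simp add: \<iota>_add finsum_closed)
qed (simp add: \<iota>_zero)

lemma \<iota>_pow: "x \<in> carrier A \<Longrightarrow> \<iota> (x [^] (k::nat)) = \<iota> x ^ k"
  by (induction k) (simp_all add: \<iota>_one \<iota>_mult power_commutes)

lemma mprod_in: "set xs \<subseteq> carrier A \<Longrightarrow> mprod A xs \<in> carrier A"
  by (induction xs) (auto simp: mprod_def)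

lemma \<iota>_mprod: "set xs \<subseteq> carrier A \<Longrightarrow> \<iota> (mprod A xs) = prod_list (map \<iota> xs)"
proof (induction xs)
  case (Cons x xs)
  then show ?case using mprod_in[of xs] by (simp add: \<iota>_mult mprod_def)
qed (simp add: \<iota>_one mprod_def)

lemma \<iota>_eqD: "\<iota> x = \<iota> y \<Longrightarrow> x \<in> carrier A \<Longrightarrow> y \<in> carrier A \<Longrightarrow> x = y"
  using \<iota>_inj by (auto dest: inj_onD)

lemmas \<iota>_simps = \<iota>_zero \<iota>_add \<iota>_mult \<iota>_one \<iota>_smult \<iota>_a_inv \<iota>_minus

end

text \<open>With this addition, finitely supported functions on words (type \<open>\<Rightarrow>\<^sub>0\<close>) multiply as in the free algebra.\<close>

instantiation list :: (type) monoid_add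
begin
definition "0 = []"
definition "(xs :: 'a list) + ys = xs @ ys"
instance by standard (simp_all add: zero_list_def plus_list_def)
end

section \<open>The free algebra as finitely supported functions on words\<close>

definition pscale :: "complex \<Rightarrow> ('k::monoid_add \<Rightarrow>\<^sub>0 complex) \<Rightarrow> 'k \<Rightarrow>\<^sub>0 complex" where
  "pscale c p = Poly_Mapping.single 0 c * p"

lemma lookup_pscale: "Poly_Mapping.lookup (pscale c p) k = c * Poly_Mapping.lookup p k"
  unfolding pscale_def mult_map_scale_conv_mult[symmetric]
  by (simp add: Poly_Mapping.map.rep_eq when_def)

lemma poly_mapping_expand: "p = (\<Sum>k\<in>Poly_Mapping.keys p. Poly_Mapping.single k (Poly_Mapping.lookup p k))"
  by (rule poly_mapping_eqI) (auto simp: lookup_sum lookup_single when_def in_keys_iff)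

interpretation pm: complex_alg "pscale :: complex \<Rightarrow> ('k::monoid_add \<Rightarrow>\<^sub>0 complex) \<Rightarrow> _"
proof
  fix a b c :: complex and p q :: "'k \<Rightarrow>\<^sub>0 complex"
  show "pscale a (p + q) = pscale a p + pscale a q" by (simp add: pscale_def distrib_left)
  show "pscale (a + b) p = pscale a p + pscale b p" by (simp add: pscale_def single_add distrib_right)
  show "pscale a (pscale b p) = pscale (a * b) p" by (simp add: pscale_def mult_single flip: mult.assoc)
  show "pscale 1 p = p" by (simp add: pscale_def)
  show "pscale c p * q = pscale c (p * q)" by (simp add: pscale_def mult.assoc)
  \<comment> \<open>Scalars sit on the neutral exponent, which is neutral on both sides, so they are
    central although the exponents do not commute.\<close>
  have "p * Poly_Mapping.single 0 c = Poly_Mapping.single 0 c * p"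
    by (subst (1 2) poly_mapping_expand[of p])
      (simp add: sum_distrib_left sum_distrib_right mult_single mult.commute)
  then show "p * pscale c q = pscale c (p * q)" by (simp add: pscale_def flip: mult.assoc)
qed

lemma pscale_single: "pscale c (Poly_Mapping.single k d) = Poly_Mapping.single k (c * d)"
  by (simp add: pscale_def mult_single)

lemma poly_mapping_expand': "p = (\<Sum>k\<in>Poly_Mapping.keys p. pscale (Poly_Mapping.lookup p k) (Poly_Mapping.single k 1))"
  unfolding pscale_single by (subst poly_mapping_expand) simp

text \<open>A pair of words u, v contributes to the coefficient of w exactly when u followed by v is
  w, and then at the single cut k = length u. This identifies the convolution product with the
  product of \<open>free_alg\<close>.\<close>

lemma lookup_mult_list:
  fixes p q :: "'g list \<Rightarrow>\<^sub>0 complex"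
  shows "Poly_Mapping.lookup (p * q) w
    = (\<Sum>k\<le>length w. Poly_Mapping.lookup p (take k w) * Poly_Mapping.lookup q (drop k w))"
proof -
  let ?S = "\<lambda>u a. Poly_Mapping.single u (a :: complex)"
  have split: "(\<Sum>k\<le>length w. (if u = take k w then a else 0) * (if v = drop k w then b else 0))
      = (if u @ v = w then a * b else 0)" for u v and a b :: complex
  proof (cases "u @ v = w")
    case True
    have "(\<Sum>k\<le>length w. (if u = take k w then a else 0) * (if v = drop k w then b else 0))
        = (\<Sum>k\<le>length w. if k = length u then a * b else 0)"
    proof (rule sum.cong[OF refl])
      fix k assume k: "k \<in> {..length w}"
      have "u = take k w \<longleftrightarrow> k = length u"
      proof
        assume "u = take k w"
        then have "length u = length (take k w)" by simp
        then show "k = length u" using k by simp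
      next
        assume "k = length u"
        then show "u = take k w" using True by auto
      qed
      then show "(if u = take k w then a else 0) * (if v = drop k w then b else 0) = (if k = length u then a * b else 0)"
        using True by auto
    qed
    also have "\<dots> = a * b" using True by auto
    finally show ?thesis using True by simp
  next
    case False
    then have "\<not> (u = take k w \<and> v = drop k w)" for k using append_take_drop_id[of k w] by auto
    then show ?thesis using False by (auto intro!: sum.neutral)
  qed
  have "p * q = (\<Sum>u\<in>Poly_Mapping.keys p. \<Sum>v\<in>Poly_Mapping.keys q.
      ?S (u @ v) (Poly_Mapping.lookup p u * Poly_Mapping.lookup q v))"
    by (subst poly_mapping_expand[of p], subst poly_mapping_expand[of q])
      (simp add: sum_product mult_single plus_list_def)
  then have "Poly_Mapping.lookup (p * q) w = (\<Sum>u\<in>Poly_Mapping.keys p. \<Sum>v\<in>Poly_Mapping.keys q.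
      \<Sum>k\<le>length w. (if u = take k w then Poly_Mapping.lookup p u else 0) * (if v = drop k w then Poly_Mapping.lookup q v else 0))"
    by (simp add: lookup_sum lookup_single when_def split)
  also have "\<dots> = (\<Sum>k\<le>length w. (\<Sum>u\<in>Poly_Mapping.keys p. if u = take k w then Poly_Mapping.lookup p u else 0)
      * (\<Sum>v\<in>Poly_Mapping.keys q. if v = drop k w then Poly_Mapping.lookup q v else 0))"
    unfolding sum_product by (subst sum.swap, subst (2) sum.swap, rule refl)
  also have "\<dots> = (\<Sum>k\<le>length w. Poly_Mapping.lookup p (take k w) * Poly_Mapping.lookup q (drop k w))"
    by (intro sum.cong refl arg_cong2[of _ _ _ _ "(*)"]) (auto simp: in_keys_iff)
  finally show ?thesis .
qed

definition to_pm :: "('g list \<Rightarrow> complex) \<Rightarrow> 'g list \<Rightarrow>\<^sub>0 complex" where "to_pm = Abs_poly_mapping"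

lemma lookup_to_pm: "f \<in> finsupp S \<Longrightarrow> Poly_Mapping.lookup (to_pm f) = f"
  unfolding to_pm_def finsupp_def by (simp add: Abs_poly_mapping_inverse)

lemma to_pm_lookup [simp]: "to_pm (Poly_Mapping.lookup p) = p"
  by (simp add: to_pm_def)

lemma lookup_finsupp_iff: "Poly_Mapping.lookup p \<in> finsupp S \<longleftrightarrow> Poly_Mapping.keys p \<subseteq> S"
  by (simp add: finsupp_def keys.rep_eq)

lemma free_alg_simps:
  "carrier (free_alg S) = finsupp (lists S)"
  "Poly_Mapping.lookup p \<otimes>\<^bsub>free_alg S\<^esub> Poly_Mapping.lookup q = Poly_Mapping.lookup (p * q)"
  "Poly_Mapping.lookup p \<oplus>\<^bsub>free_alg S\<^esub> Poly_Mapping.lookup q = Poly_Mapping.lookup (p + q)"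
  "\<one>\<^bsub>free_alg S\<^esub> = Poly_Mapping.lookup 1"
  "\<zero>\<^bsub>free_alg S\<^esub> = Poly_Mapping.lookup 0"
  "c \<odot>\<^bsub>free_alg S\<^esub> Poly_Mapping.lookup p = Poly_Mapping.lookup (pscale c p)"
  by (auto simp: free_alg_def fun_eq_iff lookup_mult_list lookup_add lookup_one zero_list_def when_def lookup_pscale)

lemma free_alg_carrier: "f \<in> carrier (free_alg S) \<longleftrightarrow> (\<exists>p. f = Poly_Mapping.lookup p \<and> Poly_Mapping.keys p \<subseteq> lists S)"
  using lookup_to_pm[of f "lists S"] lookup_finsupp_iff[of _ "lists S"] unfolding free_alg_simps by metis

lemma keys_mult_lists:
  fixes p q :: "'g list \<Rightarrow>\<^sub>0 complex"
  shows "Poly_Mapping.keys p \<subseteq> lists S \<Longrightarrow> Poly_Mapping.keys q \<subseteq> lists S \<Longrightarrow> Poly_Mapping.keys (p * q) \<subseteq> lists S"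
  using keys_mult[of p q] by (fastforce simp: plus_list_def)

lemma keys_add_lists: "Poly_Mapping.keys p \<subseteq> T \<Longrightarrow> Poly_Mapping.keys q \<subseteq> T \<Longrightarrow> Poly_Mapping.keys (p + q) \<subseteq> T"
  using keys_add[of p q] by blast

lemma keys_pscale: "Poly_Mapping.keys p \<subseteq> T \<Longrightarrow> Poly_Mapping.keys (pscale c p) \<subseteq> T"
  by (auto simp: in_keys_iff lookup_pscale)

lemma ring_free_alg: "ring (free_alg S)"
proof (rule ringI)
  show "abelian_group (free_alg S)"
  proof (rule abelian_groupI)
    fix x assume "x \<in> carrier (free_alg S)"
    then obtain p where p: "x = Poly_Mapping.lookup p" "Poly_Mapping.keys p \<subseteq> lists S" by (auto simp: free_alg_carrier)
    show "\<exists>y\<in>carrier (free_alg S). y \<oplus>\<^bsub>free_alg S\<^esub> x = \<zero>\<^bsub>free_alg S\<^esub>"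
      using p keys_pscale[OF p(2), of "- 1"]
      by (intro bexI[of _ "Poly_Mapping.lookup (pscale (- 1) p)"])
        (auto simp: free_alg_simps(2-) free_alg_carrier)
  next
    fix x y assume "x \<in> carrier (free_alg S)" "y \<in> carrier (free_alg S)"
    then obtain p q where "x = Poly_Mapping.lookup p" "Poly_Mapping.keys p \<subseteq> lists S"
      "y = Poly_Mapping.lookup q" "Poly_Mapping.keys q \<subseteq> lists S" by (auto simp: free_alg_carrier)
    then show "x \<oplus>\<^bsub>free_alg S\<^esub> y \<in> carrier (free_alg S)"
      unfolding free_alg_carrier using keys_add_lists[of p "lists S" q] by (auto simp only: free_alg_simps)
  qed (auto simp: free_alg_carrier free_alg_simps(2-) add_ac)
  show "Group.monoid (free_alg S)"
  proof (rule monoidI)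
    fix x y assume "x \<in> carrier (free_alg S)" "y \<in> carrier (free_alg S)"
    then obtain p q where "x = Poly_Mapping.lookup p" "Poly_Mapping.keys p \<subseteq> lists S"
      "y = Poly_Mapping.lookup q" "Poly_Mapping.keys q \<subseteq> lists S" by (auto simp: free_alg_carrier)
    then show "x \<otimes>\<^bsub>free_alg S\<^esub> y \<in> carrier (free_alg S)"
      unfolding free_alg_carrier using keys_mult_lists[of p S q] by (auto simp only: free_alg_simps)
  next
    show "\<one>\<^bsub>free_alg S\<^esub> \<in> carrier (free_alg S)"
      unfolding free_alg_carrier free_alg_simps(4)
      by (intro exI[of _ 1]) (auto simp: zero_list_def simp flip: single_one)
  qed (auto simp: free_alg_carrier free_alg_simps(2-) mult.assoc)
qed (auto simp: free_alg_carrier free_alg_simps(2-) distrib_left distrib_right)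

interpretation fa: ring_rep "free_alg S" pscale to_pm for S :: "'g set"
proof -
  interpret ring "free_alg S" by (rule ring_free_alg)
  show "ring_rep (free_alg S) pscale to_pm"
  proof unfold_locales
    fix x y :: "'g list \<Rightarrow> complex" and c assume "x \<in> carrier (free_alg S)"
    then obtain p where p: "x = Poly_Mapping.lookup p" "Poly_Mapping.keys p \<subseteq> lists S" by (auto simp: free_alg_carrier)
    show "c \<odot>\<^bsub>free_alg S\<^esub> x \<in> carrier (free_alg S)"
      unfolding p(1) free_alg_simps(6) free_alg_carrier using keys_pscale[OF p(2)] by blast
    show "to_pm (c \<odot>\<^bsub>free_alg S\<^esub> x) = pscale c (to_pm x)"
      unfolding p(1) free_alg_simps(6) by simp
    assume "y \<in> carrier (free_alg S)"
    then obtain q where q: "y = Poly_Mapping.lookup q" by (auto simp: free_alg_carrier)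
    show "to_pm (x \<oplus>\<^bsub>free_alg S\<^esub> y) = to_pm x + to_pm y"
      "to_pm (x \<otimes>\<^bsub>free_alg S\<^esub> y) = to_pm x * to_pm y"
      unfolding p(1) q free_alg_simps(2,3) by simp_all
  next
    show "to_pm \<one>\<^bsub>free_alg S\<^esub> = 1" unfolding free_alg_simps(4) by simp
    show "inj_on to_pm (carrier (free_alg S))"
      by (rule inj_onI) (auto simp: free_alg_carrier)
  qed
qed

lemma fgen_lookup: "fgen x = Poly_Mapping.lookup (Poly_Mapping.single [x] 1)"
  by (auto simp: fgen_def fun_eq_iff lookup_single when_def)

lemma to_pm_fgen: "to_pm (fgen x) = Poly_Mapping.single [x] 1"
  by (simp add: fgen_lookup)

lemma fgen_carrier: "x \<in> S \<Longrightarrow> fgen x \<in> carrier (free_alg S)"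
  unfolding free_alg_carrier fgen_lookup by (intro exI[of _ "Poly_Mapping.single [x] 1"]) auto

context complex_alg
begin

text \<open>The homomorphism out of the free algebra that is determined by the values
  \<open>v\<close> of the generators.\<close>

definition evalp :: "('g \<Rightarrow> 'e) \<Rightarrow> ('g list \<Rightarrow>\<^sub>0 complex) \<Rightarrow> 'e" where
  "evalp v p = (\<Sum>w\<in>Poly_Mapping.keys p. scl (Poly_Mapping.lookup p w) (prod_list (map v w)))"

lemma evalp_superset:
  "finite T \<Longrightarrow> Poly_Mapping.keys p \<subseteq> T \<Longrightarrow> evalp v p = (\<Sum>w\<in>T. scl (Poly_Mapping.lookup p w) (prod_list (map v w)))"
  unfolding evalp_def by (intro sum.mono_neutral_left) (auto simp: in_keys_iff)

lemma evalp_add: "evalp v (p + q) = evalp v p + evalp v q"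
proof -
  let ?T = "Poly_Mapping.keys p \<union> Poly_Mapping.keys q"
  have "evalp v (p + q) = (\<Sum>w\<in>?T. scl (Poly_Mapping.lookup (p + q) w) (prod_list (map v w)))"
    using keys_add[of p q] by (intro evalp_superset) auto
  also have "\<dots> = evalp v p + evalp v q"
    by (simp add: evalp_superset[of ?T] lookup_add scale_left_distrib sum.distrib)
  finally show ?thesis .
qed

lemma evalp_zero [simp]: "evalp v 0 = 0"
  by (simp add: evalp_def)

lemma evalp_single [simp]: "evalp v (Poly_Mapping.single w c) = scl c (prod_list (map v w))"
  by (simp add: evalp_def)

lemma evalp_sum: "evalp v (sum f J) = (\<Sum>j\<in>J. evalp v (f j))"
  by (induction J rule: infinite_finite_induct) (simp_all add: evalp_add)

lemma evalp_mult: "evalp v (p * q) = evalp v p * evalp v q"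
  by (subst poly_mapping_expand[of p], subst poly_mapping_expand[of q])
    (simp add: evalp_def[of v p] evalp_def[of v q] sum_product mult_single plus_list_def evalp_sum scl_left scl_right mult.commute)

lemma evalp_one [simp]: "evalp v 1 = 1"
  using evalp_single[of v "[]" 1] by (simp add: zero_list_def flip: single_one)

lemma evalp_pscale: "evalp v (pscale c p) = scl c (evalp v p)"
  by (simp add: pscale_def evalp_mult zero_list_def scl_left)

lemma evalp_minus: "evalp v (p - q) = evalp v p - evalp v q"
  using evalp_add[of v "p - q" q] by simp

lemma evalp_prod_list: "evalp v (prod_list ps) = prod_list (map (evalp v) ps)"
  by (induction ps) (simp_all add: evalp_mult)

lemma evalp_power: "evalp v (p ^ k) = evalp v p ^ k"
  by (induction k) (simp_all add: evalp_mult)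

end

text \<open>A type of algebras with room for every algebra of countably infinite dimension; it lets the
  computations inside an abstract \<open>A\<close> run in a type class.\<close>

typedef endo = "{f :: (nat \<Rightarrow>\<^sub>0 complex) \<Rightarrow> nat \<Rightarrow>\<^sub>0 complex.
    (\<forall>x y. f (x + y) = f x + f y) \<and> (\<forall>c x. f (pscale c x) = pscale c (f x))}"
  by (intro exI[of _ id]) simp

setup_lifting type_definition_endo

instantiation endo :: ring_1
begin
lift_definition zero_endo :: endo is "\<lambda>_. 0" by simp
lift_definition one_endo :: endo is "\<lambda>x. x" by simp
lift_definition plus_endo :: "endo \<Rightarrow> endo \<Rightarrow> endo" is "\<lambda>f g x. f x + g x" by (simp add: pm.scale_right_distrib)
lift_definition uminus_endo :: "endo \<Rightarrow> endo" is "\<lambda>f x. - f x" by simp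
lift_definition minus_endo :: "endo \<Rightarrow> endo \<Rightarrow> endo" is "\<lambda>f g x. f x - g x" by (simp add: pm.scale_right_diff_distrib)
lift_definition times_endo :: "endo \<Rightarrow> endo \<Rightarrow> endo" is "\<lambda>f g x. f (g x)" by simp
instance
proof
  show "(0::endo) \<noteq> 1"
  proof
    assume "(0::endo) = 1"
    then have "\<forall>x :: nat \<Rightarrow>\<^sub>0 complex. 0 = x" by transfer (auto simp: fun_eq_iff)
    then show False by (metis one_neq_zero)
  qed
qed (transfer; simp add: fun_eq_iff algebra_simps)+
end

lift_definition escl :: "complex \<Rightarrow> endo \<Rightarrow> endo" is "\<lambda>c f x. pscale c (f x)"
  by (simp add: pm.scale_right_distrib mult.commute)

interpretation en: complex_alg escl
  by unfold_locales (transfer; simp add: fun_eq_iff pm.scale_right_distrib pm.scale_left_distrib)+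

definition left_mult_endo :: "(complex, 'a) module \<Rightarrow> ((nat \<Rightarrow>\<^sub>0 complex) \<Rightarrow> 'a) \<Rightarrow> 'a \<Rightarrow> endo" where
  "left_mult_endo A \<theta> x = Abs_endo (\<lambda>v. the_inv \<theta> (x \<otimes>\<^bsub>A\<^esub> \<theta> v))"

text \<open>The left regular representation, written in the coordinates \<theta>. It is faithful
  because applying it to the coordinates of the unit returns the element.\<close>

lemma (in calgebra) ring_rep_left_mult:
  assumes bij: "bij_betw \<theta> UNIV (carrier A)"
    and add: "\<And>u v. \<theta> (u + v) = \<theta> u \<oplus> \<theta> v" and smult: "\<And>c v. \<theta> (pscale c v) = c \<odot> \<theta> v"
  shows "ring_rep A escl (left_mult_endo A \<theta>)"
proof -
  have in_A [simp]: "\<theta> v \<in> carrier A" for v using bij by (auto simp: bij_betw_def)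
  have inj: "inj \<theta>" using bij by (simp add: bij_betw_def)
  have inv: "\<theta> (the_inv \<theta> y) = y" if "y \<in> carrier A" for y
    using that bij inj by (intro f_the_inv_into_f) (auto simp: bij_betw_def)
  have inv_eq: "the_inv \<theta> y = v" if "y = \<theta> v" for y v using that the_inv_f_f[OF inj] by simp
  have sm: "c \<odot> y \<in> carrier A" if "y \<in> carrier A" for c y
    using that by (intro smult_closed) (auto simp: complex_field_def)
  have rep: "Rep_endo (left_mult_endo A \<theta> x) v = the_inv \<theta> (x \<otimes> \<theta> v)" if x: "x \<in> carrier A" for x v
    unfolding left_mult_endo_def
  proof (subst Abs_endo_inverse)
    show "(\<lambda>v. the_inv \<theta> (x \<otimes> \<theta> v)) \<in> {f. (\<forall>x y. f (x + y) = f x + f y) \<and> (\<forall>c x. f (pscale c x) = pscale c (f x))}"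
      using x by (auto intro!: inv_eq simp: add smult inv r_distr smult_mult_right)
  qed simp
  have \<theta>_rep: "\<theta> (Rep_endo (left_mult_endo A \<theta> x) v) = x \<otimes> \<theta> v" if x: "x \<in> carrier A" for x v
    using x by (simp add: rep inv)
  have eqI: "f = h" if "\<And>v. \<theta> (Rep_endo f v) = \<theta> (Rep_endo h v)" for f h
    using that inj by (auto simp: Rep_endo_inject[symmetric] fun_eq_iff inj_def)
  show ?thesis
  proof unfold_locales
    fix x y c assume x: "x \<in> carrier A"
    show "c \<odot> x \<in> carrier A" by (rule sm[OF x])
    show "left_mult_endo A \<theta> (c \<odot> x) = escl c (left_mult_endo A \<theta> x)"
      by (rule eqI) (simp add: \<theta>_rep x sm escl.rep_eq smult smult_mult_left)
    assume y: "y \<in> carrier A"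
    show "left_mult_endo A \<theta> (x \<oplus> y) = left_mult_endo A \<theta> x + left_mult_endo A \<theta> y"
      by (rule eqI) (simp add: \<theta>_rep x y plus_endo.rep_eq add l_distr)
    show "left_mult_endo A \<theta> (x \<otimes> y) = left_mult_endo A \<theta> x * left_mult_endo A \<theta> y"
      by (rule eqI) (simp add: \<theta>_rep x y times_endo.rep_eq m_assoc)
  next
    show "left_mult_endo A \<theta> \<one> = 1"
      by (rule eqI) (simp add: \<theta>_rep one_endo.rep_eq)
    show "inj_on (left_mult_endo A \<theta>) (carrier A)"
    proof
      fix x y assume xy: "x \<in> carrier A" "y \<in> carrier A" "left_mult_endo A \<theta> x = left_mult_endo A \<theta> y"
      have "x \<otimes> \<theta> (the_inv \<theta> \<one>) = y \<otimes> \<theta> (the_inv \<theta> \<one>)"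
        using xy by (simp flip: \<theta>_rep)
      then show "x = y" using xy by (simp add: inv)
    qed
  qed
qed

section \<open>The index set of the PBW basis is countably infinite\<close>

lemma countable_monoms: "countable (monoms n)"
proof -
  have "inj_on (\<lambda>a. map (Poly_Mapping.lookup a) [1..<Suc n]) (monoms n)"
  proof
    fix a b assume ab: "a \<in> monoms n" "b \<in> monoms n"
      "map (Poly_Mapping.lookup a) [1..<Suc n] = map (Poly_Mapping.lookup b) [1..<Suc n]"
    show "a = b"
    proof (rule poly_mapping_eqI)
      fix k
      show "Poly_Mapping.lookup a k = Poly_Mapping.lookup b k"
      proof (cases "k \<in> {1..n}")
        case True
        then show ?thesis using ab(3) by (auto simp: map_eq_conv simp del: upt_Suc)
      next
        case False
        then have "k \<notin> Poly_Mapping.keys a" "k \<notin> Poly_Mapping.keys b" using ab(1,2) unfolding monoms_def by blast+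
        then show ?thesis by (simp add: in_keys_iff)
      qed
    qed
  qed
  then show ?thesis by (rule countable_image_inj_on[rotated]) (rule countableI_type)
qed

lemma infinite_monoms: "1 \<le> n \<Longrightarrow> infinite (monoms n)"
proof -
  assume n: "1 \<le> n"
  have "inj (\<lambda>k::nat. Poly_Mapping.single (1::nat) k)"
    by (intro injI) (metis lookup_single_eq)
  then have "infinite (range (\<lambda>k::nat. Poly_Mapping.single (1::nat) k))"
    using finite_imageD infinite_UNIV_nat by blast
  moreover have "range (\<lambda>k::nat. Poly_Mapping.single (1::nat) k) \<subseteq> monoms n" using n by (auto simp: monoms_def split: if_splits)
  ultimately show ?thesis using infinite_super by blast
qed

text \<open>\<open>weval\<close> evaluates an arbitrarily chosen word of a class, so all words of
  the class must stay within the letters of the diagram.\<close>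

lemma W_group_words: "1 \<le> n \<Longrightarrow> w \<in> W_group n \<Longrightarrow> u \<in> w \<Longrightarrow> set u \<subseteq> {0..n}"
proof -
  assume n: "1 \<le> n" and w: "w \<in> W_group n" "u \<in> w"
  then obtain x where x: "x \<in> lists {0..n}" "(x, u) \<in> cox_eq n"
    unfolding W_group_def by (auto elim!: quotientE)
  have cr: "set a \<subseteq> {0..n} \<and> set b \<subseteq> {0..n}" if "(a, b) \<in> coxeter_rels n" for a b
    using that n unfolding coxeter_rels_def by auto
  from x(2) show "set u \<subseteq> {0..n}"
  proof (induction rule: rtrancl_induct)
    case base
    then show ?case using x(1) by auto
  next
    case (step y z)
    have "set y \<subseteq> {0..n} \<and> set z \<subseteq> {0..n}" if yz: "(y, z) \<in> word_step n" for y z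
      using yz cr unfolding word_step_def by fastforce
    then show ?case using step.hyps(2) by blast
  qed
qed

lemma W_group_nonempty: "W_group n \<noteq> {}" "w \<in> W_group n \<Longrightarrow> w \<noteq> {}"
proof -
  have "cox_eq n `` {[]} \<in> W_group n" unfolding W_group_def by (intro quotientI) simp
  then show "W_group n \<noteq> {}" by auto
  show "w \<in> W_group n \<Longrightarrow> w \<noteq> {}" unfolding W_group_def by (auto elim!: quotientE)
qed

lemma countable_W_group: "countable (W_group n)"
proof -
  have "W_group n = (\<lambda>x. cox_eq n `` {x}) ` lists {0..n}" unfolding W_group_def quotient_def by auto
  then show ?thesis by (simp only: countable_image countableI_type)
qed

lemma pvar_polys: "j \<in> {1..n} \<Longrightarrow> pvar j \<in> polys n"
  by (simp add: pvar_def polys_def monoms_def)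

lemma polys_const: "0 \<in> polys n" "1 \<in> polys n" "- 1 \<in> polys n"
  by (simp_all add: polys_def monoms_def)

lemma psubst_pvar: "psubst f (pvar j) = f j"
  by (simp add: psubst_def pvar_def pconst_def)

section \<open>The given algebra in coordinates with respect to its PBW basis\<close>

locale gdaha_setup = trig_daha A n "k_par n t0 u0 t tn un" r X
  for A :: "(complex, 'a) module" (structure) and n t0 u0 t tn un r X +
  fixes \<gamma> :: "nat \<Rightarrow> complex"
  assumes n2: "2 \<le> n" and \<gamma>_sum: "\<gamma> 1 + \<gamma> 2 + \<gamma> 3 + \<gamma> 4 = mu_par t0 u0 tn un 0"
begin

lemma smult_in_A: "x \<in> carrier A \<Longrightarrow> c \<odot> x \<in> carrier A"
  by (intro smult_closed) (auto simp: complex_field_def)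

lemma mprod_in_A: "set xs \<subseteq> carrier A \<Longrightarrow> mprod A xs \<in> carrier A"
  by (induction xs) (auto simp: mprod_def)

definition J :: "(nat list set \<times> (nat \<Rightarrow>\<^sub>0 nat)) set" where "J = W_group n \<times> monoms n"

definition eb :: "nat list set \<times> (nat \<Rightarrow>\<^sub>0 nat) \<Rightarrow> 'a" where
  "eb z = weval A r (fst z) \<otimes> meval n A X (snd z)"

lemma some_word: "w \<in> W_group n \<Longrightarrow> set (SOME u. u \<in> w) \<subseteq> {0..n}"
proof -
  assume w: "w \<in> W_group n"
  then have "(SOME u. u \<in> w) \<in> w" using W_group_nonempty(2)[OF w] by (simp add: some_in_eq)
  then show ?thesis using W_group_words[OF _ w] n2 by simp
qed

lemma weval_in: "w \<in> W_group n \<Longrightarrow> weval A r w \<in> carrier A"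
  unfolding weval_def using some_word[of w] r_closed by (intro mprod_in_A) fastforce

lemma meval_in: "meval n A X m \<in> carrier A"
  unfolding meval_def using X_closed by (intro mprod_in_A) auto

lemma eb_in: "z \<in> J \<Longrightarrow> eb z \<in> carrier A"
  unfolding eb_def J_def using weval_in meval_in by auto

lemma mult_map_superset:
  assumes "finite F" "{z. c z \<noteq> 0} \<subseteq> F" "F \<subseteq> J"
  shows "mult_map n A r X c = (\<Oplus>z\<in>F. c z \<odot> eb z)"
  unfolding mult_map_def eb_def[symmetric]
proof (rule add.finprod_mono_neutral_cong_left[OF assms(1,2)])
  fix z assume "z \<in> F - {z. c z \<noteq> 0}"
  then have "c z = 0" "eb z \<in> carrier A" using assms(3) eb_in[of z] by blast+
  then show "c z \<odot> eb z = \<zero>" using smult_l_null[of "eb z"] by (simp add: complex_field_def)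
next
  show "(\<lambda>z. c z \<odot> eb z) \<in> F \<rightarrow> carrier A"
    using smult_in_A[OF eb_in[OF subsetD[OF assms(3)]]] by auto
qed simp

lemma J_countable: "countable J" "infinite J"
proof -
  show "countable J" unfolding J_def by (intro countable_SIGMA countable_W_group countable_monoms)
  show "infinite J"
    using infinite_monoms[of n] W_group_nonempty(1)[of n] n2 unfolding J_def by (auto simp: finite_cartesian_product_iff)
qed

definition enum :: "nat \<Rightarrow> nat list set \<times> (nat \<Rightarrow>\<^sub>0 nat)" where "enum = from_nat_into J"

lemma enum: "bij_betw enum UNIV J"
  unfolding enum_def by (rule bij_betw_from_nat_into[OF J_countable])

lemma eb_enum: "eb (enum k) \<in> carrier A"
  using enum by (intro eb_in) (auto simp: bij_betw_def)

text \<open>Reindexes a finitely supported sequence along the enumeration of the PBW basis; outside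
  the basis the coefficient is 0, as membership in \<open>finsupp J\<close> requires.\<close>

definition coeffs :: "(nat \<Rightarrow>\<^sub>0 complex) \<Rightarrow> nat list set \<times> (nat \<Rightarrow>\<^sub>0 nat) \<Rightarrow> complex" where
  "coeffs v z = (if z \<in> J then Poly_Mapping.lookup v (the_inv enum z) else 0)"

lemma coeffs_enum: "coeffs v (enum k) = Poly_Mapping.lookup v k"
  using enum by (auto simp: coeffs_def bij_betw_def the_inv_f_f)

lemma coeffs_support: "{z. coeffs v z \<noteq> 0} = enum ` Poly_Mapping.keys v"
proof -
  have "z \<in> enum ` Poly_Mapping.keys v" if "coeffs v z \<noteq> 0" for z
  proof -
    have "z \<in> J" using that by (auto simp: coeffs_def split: if_splits)
    then obtain k where "z = enum k" using enum by (auto simp: bij_betw_def)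
    then show ?thesis using that coeffs_enum[of v k] by (simp add: in_keys_iff)
  qed
  then show ?thesis by (auto simp: coeffs_enum in_keys_iff)
qed

lemma coeffs_bij: "bij_betw coeffs UNIV (finsupp J)"
proof (rule bij_betwI')
  fix v w :: "nat \<Rightarrow>\<^sub>0 complex"
  show "(coeffs v = coeffs w) = (v = w)"
    by (metis coeffs_enum poly_mapping_eqI)
next
  fix v :: "nat \<Rightarrow>\<^sub>0 complex"
  have "enum ` Poly_Mapping.keys v \<subseteq> J" using enum by (auto simp: bij_betw_def)
  then show "coeffs v \<in> finsupp J" by (simp add: finsupp_def coeffs_support)
next
  fix c assume c: "c \<in> finsupp J"
  have inj: "inj enum" using enum by (simp add: bij_betw_def)
  have "finite {k. c (enum k) \<noteq> 0}"
    using finite_vimageI[OF _ inj, of "{z. c z \<noteq> 0}"] c by (simp add: finsupp_def vimage_def)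
  then have lk: "Poly_Mapping.lookup (Abs_poly_mapping (\<lambda>k. c (enum k))) = (\<lambda>k. c (enum k))"
    by (simp add: Abs_poly_mapping_inverse)
  have "c z = coeffs (Abs_poly_mapping (\<lambda>k. c (enum k))) z" for z
  proof (cases "z \<in> J")
    case True
    then obtain k where "z = enum k" using enum by (auto simp: bij_betw_def)
    then show ?thesis by (simp add: coeffs_enum lk)
  next
    case False
    then show ?thesis using c by (auto simp: finsupp_def coeffs_def)
  qed
  then show "\<exists>v\<in>UNIV. c = coeffs v" by blast
qed

text \<open>The bijection between sequences and the algebra is the PBW property combined with the
  enumeration of the basis.\<close>

definition \<theta> :: "(nat \<Rightarrow>\<^sub>0 complex) \<Rightarrow> 'a" where "\<theta> v = mult_map n A r X (coeffs v)"

lemma \<theta>_bij: "bij_betw \<theta> UNIV (carrier A)"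
  using bij_betw_trans[OF coeffs_bij pbw[folded J_def]] by (simp add: \<theta>_def[abs_def] o_def)

lemma \<theta>_superset: "finite F \<Longrightarrow> Poly_Mapping.keys v \<subseteq> F \<Longrightarrow> \<theta> v = (\<Oplus>z\<in>enum ` F. coeffs v z \<odot> eb z)"
proof -
  assume F: "finite F" "Poly_Mapping.keys v \<subseteq> F"
  have "enum ` F \<subseteq> J" using enum by (auto simp: bij_betw_def)
  then show ?thesis
    unfolding \<theta>_def using F by (intro mult_map_superset) (auto simp: coeffs_support)
qed

lemma coeffs_eb_in: "(\<lambda>z. coeffs v z \<odot> eb z) \<in> enum ` F \<rightarrow> carrier A"
  using smult_in_A[OF eb_enum] by auto

lemma \<theta>_add: "\<theta> (u + v) = \<theta> u \<oplus> \<theta> v"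
proof -
  let ?F = "Poly_Mapping.keys u \<union> Poly_Mapping.keys v"
  have F: "finite ?F" by simp
  have "\<theta> (u + v) = (\<Oplus>z\<in>enum ` ?F. coeffs (u + v) z \<odot> eb z)"
    using keys_add[of u v] by (intro \<theta>_superset) auto
  also have "\<dots> = (\<Oplus>z\<in>enum ` ?F. coeffs u z \<odot> eb z \<oplus> coeffs v z \<odot> eb z)"
  proof (rule finsum_cong')
    show "(\<lambda>z. coeffs u z \<odot> eb z \<oplus> coeffs v z \<odot> eb z) \<in> enum ` ?F \<rightarrow> carrier A"
      using coeffs_eb_in[of u ?F] coeffs_eb_in[of v ?F] by auto
    fix z assume "z \<in> enum ` ?F"
    then have "eb z \<in> carrier A" using eb_enum by auto
    then show "coeffs (u + v) z \<odot> eb z = coeffs u z \<odot> eb z \<oplus> coeffs v z \<odot> eb z"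
      using smult_l_distr[of "coeffs u z" "coeffs v z" "eb z"] \<open>z \<in> enum ` ?F\<close>
      by (auto simp: coeffs_enum lookup_add complex_field_def)
  qed simp
  also have "\<dots> = \<theta> u \<oplus> \<theta> v"
    using finsum_addf[OF coeffs_eb_in[of u ?F] coeffs_eb_in[of v ?F]] \<theta>_superset[OF F, of u] \<theta>_superset[OF F, of v] by simp
  finally show ?thesis .
qed

lemma \<theta>_smult: "\<theta> (pscale c v) = c \<odot> \<theta> v"
proof -
  let ?F = "Poly_Mapping.keys v"
  have "\<theta> (pscale c v) = (\<Oplus>z\<in>enum ` ?F. coeffs (pscale c v) z \<odot> eb z)"
    by (intro \<theta>_superset keys_pscale) auto
  also have "\<dots> = (\<Oplus>z\<in>enum ` ?F. c \<odot> (coeffs v z \<odot> eb z))"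
  proof (rule finsum_cong')
    show "(\<lambda>z. c \<odot> (coeffs v z \<odot> eb z)) \<in> enum ` ?F \<rightarrow> carrier A"
      using coeffs_eb_in[of v ?F] smult_in_A by auto
    fix z assume "z \<in> enum ` ?F"
    then have "eb z \<in> carrier A" using eb_enum by auto
    then show "coeffs (pscale c v) z \<odot> eb z = c \<odot> (coeffs v z \<odot> eb z)"
      using smult_assoc1[of c "coeffs v z" "eb z"] \<open>z \<in> enum ` ?F\<close>
      by (auto simp: coeffs_enum lookup_pscale complex_field_def)
  qed simp
  also have "\<dots> = c \<odot> \<theta> v"
    using finsum_smult_ldistr[OF _ _ coeffs_eb_in[of v ?F], of c] \<theta>_superset[of ?F v]
    by (simp add: complex_field_def)
  finally show ?thesis .
qed

definition \<iota> :: "'a \<Rightarrow> endo" where "\<iota> = left_mult_endo A \<theta>"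

sublocale rep: ring_rep A escl \<iota>
  unfolding \<iota>_def by (rule ring_rep_left_mult[OF \<theta>_bij \<theta>_add \<theta>_smult])

definition re :: "nat \<Rightarrow> endo" where "re i = \<iota> (r i)"
definition Xe :: "nat \<Rightarrow> endo" where "Xe j = \<iota> (X j)"

definition mon :: "(nat \<Rightarrow>\<^sub>0 nat) \<Rightarrow> endo" where
  "mon m = prod_list (map (\<lambda>j. Xe j ^ Poly_Mapping.lookup m j) [1..<Suc n])"

definition pe :: "cpoly \<Rightarrow> endo" where
  "pe p = (\<Sum>m\<in>Poly_Mapping.keys p. escl (Poly_Mapping.lookup p m) (mon m))"

lemma \<iota>_meval: "\<iota> (meval n A X m) = mon m"
proof -
  have "set (map (\<lambda>j. X j [^] Poly_Mapping.lookup m j) [1..<Suc n]) \<subseteq> carrier A"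
    using X_closed by auto
  then have "\<iota> (meval n A X m) = prod_list (map \<iota> (map (\<lambda>j. X j [^] Poly_Mapping.lookup m j) [1..<Suc n]))"
    unfolding meval_def by (rule rep.\<iota>_mprod)
  also have "map \<iota> (map (\<lambda>j. X j [^] Poly_Mapping.lookup m j) [1..<Suc n])
      = map (\<lambda>j. Xe j ^ Poly_Mapping.lookup m j) [1..<Suc n]"
    using X_closed by (auto simp: Xe_def rep.\<iota>_pow simp del: upt_Suc)
  finally show ?thesis unfolding mon_def .
qed

lemma \<iota>_rword: "set u \<subseteq> {0..n} \<Longrightarrow> \<iota> (mprod A (map r u)) = prod_list (map re u)"
proof -
  assume "set u \<subseteq> {0..n}"
  then have "set (map r u) \<subseteq> carrier A" using r_closed by auto
  then show ?thesis using rep.\<iota>_mprod[of "map r u"] by (simp add: re_def[abs_def] o_def)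
qed

lemma \<iota>_eb: "z \<in> J \<Longrightarrow> \<iota> (eb z) = prod_list (map re (SOME u. u \<in> fst z)) * mon (snd z)"
  using weval_in[of "fst z"] meval_in some_word[of "fst z"] unfolding eb_def J_def
  by (auto simp: rep.\<iota>_mult \<iota>_meval weval_def \<iota>_rword)

lemma peval_in: "peval n A X p \<in> carrier A"
  unfolding peval_def using meval_in smult_in_A by (intro finsum_closed) auto

lemma \<iota>_peval: "\<iota> (peval n A X p) = pe p"
proof -
  have "(\<lambda>m. Poly_Mapping.lookup p m \<odot> meval n A X m) \<in> Poly_Mapping.keys p \<rightarrow> carrier A"
    using meval_in smult_in_A by auto
  then show ?thesis
    unfolding peval_def pe_def by (simp add: rep.\<iota>_finsum rep.\<iota>_smult meval_in \<iota>_meval)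
qed

lemma pe_superset: "finite F \<Longrightarrow> Poly_Mapping.keys p \<subseteq> F \<Longrightarrow> pe p = (\<Sum>m\<in>F. escl (Poly_Mapping.lookup p m) (mon m))"
  unfolding pe_def by (intro sum.mono_neutral_left) (auto simp: in_keys_iff)

lemma pe_add: "pe (p + q) = pe p + pe q"
proof -
  let ?T = "Poly_Mapping.keys p \<union> Poly_Mapping.keys q"
  have "pe (p + q) = (\<Sum>m\<in>?T. escl (Poly_Mapping.lookup (p + q) m) (mon m))"
    using keys_add[of p q] by (intro pe_superset) auto
  also have "\<dots> = pe p + pe q"
    by (simp add: pe_superset[of ?T] lookup_add en.scale_left_distrib sum.distrib)
  finally show ?thesis .
qed

lemma pe_diff: "pe (p - q) = pe p - pe q"
  using pe_add[of "p - q" q] by simp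

lemma pe_zero: "pe 0 = 0"
  by (simp add: pe_def)

lemma pe_single: "pe (Poly_Mapping.single m c) = escl c (mon m)"
  by (simp add: pe_def)

lemma mon_zero: "mon 0 = 1"
  by (simp add: mon_def map_replicate_const del: upt_Suc)

lemma mon_single: "j \<in> {1..n} \<Longrightarrow> mon (Poly_Mapping.single j 1) = Xe j"
proof -
  assume j: "j \<in> {1..n}"
  have "prod_list (map (\<lambda>i. Xe i ^ Poly_Mapping.lookup (Poly_Mapping.single j 1) i) js) = (if j \<in> set js then Xe j else 1)"
    if "distinct js" for js
    using that by (induction js) (auto simp: lookup_single when_def)
  from this[of "[1..<Suc n]"] show ?thesis unfolding mon_def using j by (simp del: upt_Suc)
qed

lemma pe_simps: "j \<in> {1..n} \<Longrightarrow> pe (pvar j) = Xe j" "pe 1 = 1" "pe (- 1) = - 1" "pe (pconst c) = escl c 1"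
proof -
  show "j \<in> {1..n} \<Longrightarrow> pe (pvar j) = Xe j" by (simp add: pvar_def pe_single mon_single del: One_nat_def)
  show 1: "pe 1 = 1" using pe_single[of 0 1] by (simp add: mon_zero)
  show "pe (- 1) = - 1" using pe_diff[of 0 1] by (simp add: pe_zero 1)
  show "pe (pconst c) = escl c 1" by (simp add: pconst_def pe_single mon_zero)
qed

text \<open>For a single variable the substitution in \<open>W_act\<close> is just the reflected
  coordinate, and the quotient \<open>q\<close> is one of the constants 1, 0, -1 in every
  application.\<close>

lemma cross_var:
  assumes "i \<le> n" "j \<in> {1..n}" "q \<in> polys n" "aff_root n i * q = W_refl n i pvar j - pvar j"
  shows "re i * Xe j - pe (W_refl n i pvar j) * re i = escl (k_par n t0 u0 t tn un i) (pe q)"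
proof -
  have "r i \<otimes> peval n A X (pvar j) \<ominus> peval n A X (W_refl n i pvar j) \<otimes> r i = k_par n t0 u0 t tn un i \<odot> peval n A X q"
    using cross[OF assms(1) pvar_polys[OF assms(2)] assms(3)] assms(4) by (simp add: W_act_def psubst_pvar)
  then have "\<iota> (r i \<otimes> peval n A X (pvar j) \<ominus> peval n A X (W_refl n i pvar j) \<otimes> r i) = \<iota> (k_par n t0 u0 t tn un i \<odot> peval n A X q)"
    by simp
  then show ?thesis
    using r_closed[OF assms(1)] assms(2)
    by (simp add: rep.\<iota>_simps peval_in \<iota>_peval re_def pe_simps(1))
qed

lemma in_A [simp]: "i \<le> n \<Longrightarrow> r i \<in> carrier A" "1 \<le> j \<Longrightarrow> j \<le> n \<Longrightarrow> X j \<in> carrier A"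
  using r_closed X_closed by auto

sublocale D: daha_pbw escl n re Xe t0 u0 t tn un \<gamma>
proof unfold_locales
  show "2 \<le> n" by (rule n2)
next
  fix u v assume uv: "(u, v) \<in> coxeter_rels n"
  then have "set u \<subseteq> {0..n}" "set v \<subseteq> {0..n}" using n2 unfolding coxeter_rels_def by auto
  then show "prod_list (map re u) = prod_list (map re v)"
    using coxeter[OF uv] \<iota>_rword by metis
next
  fix i j assume "i \<in> {1..n}" "j \<in> {1..n}"
  then show "Xe i * Xe j = Xe j * Xe i"
    using X_comm[of i j] X_closed unfolding Xe_def by (metis rep.\<iota>_mult)
next
  have w: "W_refl n 0 pvar 1 = 1 - pvar 1" by (simp add: W_refl_def)
  have "re 0 * Xe 1 - pe (W_refl n 0 pvar 1) * re 0 = escl (k_par n t0 u0 t tn un 0) (pe 1)"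
    using n2 by (intro cross_var polys_const) (auto simp: w[unfolded One_nat_def] aff_root_def)
  then show "re 0 * Xe 1 = (1 - Xe 1) * re 0 + escl (2 * t0 + 2 * u0) 1"
    using n2 pe_simps(1)[of 1] unfolding w by (simp add: pe_diff pe_simps(2) k_par_def diff_eq_eq add.commute)
next
  fix j assume j: "j \<in> {2..n}"
  then have w: "W_refl n 0 pvar j = (pvar j :: cpoly)" by (simp add: W_refl_def)
  have "re 0 * Xe j - pe (W_refl n 0 pvar j) * re 0 = escl (k_par n t0 u0 t tn un 0) (pe 0)"
    using j by (intro cross_var polys_const) (auto simp: w)
  then show "re 0 * Xe j = Xe j * re 0"
    using j unfolding w by (simp add: pe_simps pe_zero)
next
  fix i assume i: "1 \<le> i" "i < n"
  then have w: "W_refl n i pvar i = (pvar (Suc i) :: cpoly)" by (simp add: W_refl_def)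
  have "re i * Xe i - pe (W_refl n i pvar i) * re i = escl (k_par n t0 u0 t tn un i) (pe (- 1))"
    using i by (intro cross_var polys_const) (auto simp: w aff_root_def)
  then show "re i * Xe i = Xe (Suc i) * re i - escl t 1"
    using i unfolding w by (simp add: pe_simps pe_zero k_par_def diff_eq_eq)
next
  fix i j assume i: "1 \<le> i" "i < n" "j \<in> {1..n}" "j \<noteq> i" "j \<noteq> Suc i"
  then have w: "W_refl n i pvar j = (pvar j :: cpoly)" by (simp add: W_refl_def)
  have "re i * Xe j - pe (W_refl n i pvar j) * re i = escl (k_par n t0 u0 t tn un i) (pe 0)"
    using i by (intro cross_var polys_const) (auto simp: w)
  then show "re i * Xe j = Xe j * re i"
    using i unfolding w by (simp add: pe_simps pe_zero)
next
  have w: "W_refl n n pvar n = (- pvar n :: cpoly)" using n2 by (simp add: W_refl_def)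
  have "re n * Xe n - pe (W_refl n n pvar n) * re n = escl (k_par n t0 u0 t tn un n) (pe (- 1))"
    using n2 by (intro cross_var polys_const) (auto simp: w aff_root_def)
  moreover have "pe (- pvar n) = - Xe n" using pe_diff[of 0 "pvar n"] n2 by (simp add: pe_zero pe_simps)
  ultimately have sum: "re n * Xe n + Xe n * re n = - escl (2 * tn + 2 * un) 1"
    using n2 unfolding w by (simp add: pe_simps k_par_def)
  have "re n * Xe n = (re n * Xe n + Xe n * re n) - Xe n * re n" by simp
  then show "re n * Xe n = - Xe n * re n - escl (2 * tn + 2 * un) 1" unfolding sum by simp
next
  fix j assume j: "1 \<le> j" "j < n"
  then have w: "W_refl n n pvar j = (pvar j :: cpoly)" using n2 by (simp add: W_refl_def)
  have "re n * Xe j - pe (W_refl n n pvar j) * re n = escl (k_par n t0 u0 t tn un n) (pe 0)"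
    using j by (intro cross_var polys_const) (auto simp: w)
  then show "re n * Xe j = Xe j * re n"
    using j unfolding w by (simp add: pe_simps pe_zero)
next
  fix T c z
  assume T: "finite T" "T \<subseteq> W_group n \<times> monoms n" "z \<in> T"
    and sum: "(\<Sum>z\<in>T. escl (c z) (prod_list (map re (SOME u. u \<in> fst z)) *
      prod_list (map (\<lambda>j. Xe j ^ Poly_Mapping.lookup (snd z) j) [1..<Suc n]))) = 0"
  have TJ: "T \<subseteq> J" using T(2) by (simp add: J_def)
  \<comment> \<open>Extending the coefficients by 0 gives an element of \<open>finsupp J\<close>;
    injectivity of the multiplication map is then applied to it and the zero function.\<close>
  define c' where "c' z = (if z \<in> T then c z else 0)" for z
  have c': "c' \<in> finsupp J" "{z. c' z \<noteq> 0} \<subseteq> T"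
  proof -
    show sub: "{z. c' z \<noteq> 0} \<subseteq> T" by (auto simp: c'_def)
    then show "c' \<in> finsupp J" using finite_subset[OF sub T(1)] TJ by (auto simp: finsupp_def)
  qed
  have fn: "(\<lambda>z. c' z \<odot> eb z) \<in> T \<rightarrow> carrier A" using TJ eb_in smult_in_A by auto
  have "\<iota> (mult_map n A r X c') = (\<Sum>z\<in>T. \<iota> (c' z \<odot> eb z))"
    using mult_map_superset[OF T(1) c'(2) TJ] rep.\<iota>_finsum[OF T(1) fn] by simp
  also have "\<dots> = (\<Sum>z\<in>T. escl (c z) (prod_list (map re (SOME u. u \<in> fst z)) * mon (snd z)))"
    using TJ by (intro sum.cong) (auto simp: rep.\<iota>_smult eb_in \<iota>_eb c'_def)
  finally have "\<iota> (mult_map n A r X c') = 0" using sum by (simp add: mon_def)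
  moreover have "mult_map n A r X (\<lambda>_. 0) = \<zero>" by (simp add: mult_map_def)
  moreover have "mult_map n A r X c' \<in> carrier A"
    using mult_map_superset[OF T(1) c'(2) TJ] finsum_closed[OF fn] by simp
  ultimately have "mult_map n A r X c' = mult_map n A r X (\<lambda>_. 0)"
    using rep.\<iota>_eqD[of "mult_map n A r X c'" \<zero>] by (simp add: rep.\<iota>_zero)
  moreover have "(\<lambda>_. 0) \<in> finsupp J" by (simp add: finsupp_def)
  ultimately have "c' = (\<lambda>_. 0)"
    using pbw c'(1) unfolding J_def bij_betw_def inj_on_def by blast
  then show "c z = 0" using T(3) by (metis c'_def)
qed

end

section \<open>The kernel is the ideal of relations\<close>

definition Vp :: "nat \<Rightarrow> nat \<Rightarrow> Bgen list \<Rightarrow>\<^sub>0 complex" where "Vp i l = Poly_Mapping.single [GV i l] 1"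
definition gp :: "(nat \<Rightarrow> nat) \<Rightarrow> Bgen list \<Rightarrow>\<^sub>0 complex" where "gp \<sigma> = Poly_Mapping.single [GS \<sigma>] 1"

lemma to_pm_gens: "to_pm (fgen (GV i l)) = Vp i l" "to_pm (fgen (GS \<sigma>)) = gp \<sigma>"
  by (simp_all add: to_pm_fgen Vp_def gp_def)

lemma gens_in_B:
  "i \<in> {1..n} \<Longrightarrow> l \<in> {1..4} \<Longrightarrow> fgen (GV i l) \<in> carrier (free_alg (B_gens n))"
  "\<sigma> permutes {1..n} \<Longrightarrow> fgen (GS \<sigma>) \<in> carrier (free_alg (B_gens n))"
  by (auto intro!: fgen_carrier simp: B_gens_def)

lemma transpose_in_B:
  "i \<in> {1..n} \<Longrightarrow> j \<in> {1..n} \<Longrightarrow> fgen (GS (transpose i j)) \<in> carrier (free_alg (B_gens n))"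
  by (intro gens_in_B permutes_swap_id)

lemmas fa_closed = gens_in_B transpose_in_B fa.smult_in fa.m_closed fa.a_closed fa.minus_closed fa.one_closed fa.zero_closed
lemmas fa_push = fa.\<iota>_mult fa.\<iota>_add fa.\<iota>_minus fa.\<iota>_smult fa.\<iota>_one fa.\<iota>_zero to_pm_gens

lemma sum_transpose_B:
  assumes "i \<in> {1..n}"
  shows "(\<Oplus>\<^bsub>free_alg (B_gens n)\<^esub>j\<in>{1..n} - {i}. fgen (GS (transpose i j))) \<in> carrier (free_alg (B_gens n))"
    "to_pm (\<Oplus>\<^bsub>free_alg (B_gens n)\<^esub>j\<in>{1..n} - {i}. fgen (GS (transpose i j))) = (\<Sum>j\<in>{1..n} - {i}. gp (transpose i j))"
proof -
  have f: "(\<lambda>j. fgen (GS (transpose i j))) \<in> {1..n} - {i} \<rightarrow> carrier (free_alg (B_gens n))"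
    using assms by (auto intro!: transpose_in_B)
  show "(\<Oplus>\<^bsub>free_alg (B_gens n)\<^esub>j\<in>{1..n} - {i}. fgen (GS (transpose i j))) \<in> carrier (free_alg (B_gens n))"
    by (rule fa.finsum_closed[OF f])
  show "to_pm (\<Oplus>\<^bsub>free_alg (B_gens n)\<^esub>j\<in>{1..n} - {i}. fgen (GS (transpose i j))) = (\<Sum>j\<in>{1..n} - {i}. gp (transpose i j))"
    using fa.\<iota>_finsum[OF _ f] by (simp add: to_pm_gens)
qed

inductive B_rels_pm :: "nat \<Rightarrow> (nat \<Rightarrow> complex) \<Rightarrow> complex \<Rightarrow> (nat \<Rightarrow> complex)
    \<Rightarrow> (Bgen list \<Rightarrow>\<^sub>0 complex) \<Rightarrow> (Bgen list \<Rightarrow>\<^sub>0 complex) \<Rightarrow> bool" for n \<mu> \<nu> \<gamma> where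
  one: "B_rels_pm n \<mu> \<nu> \<gamma> (gp id) 1"
| mult: "\<sigma> permutes {1..n} \<Longrightarrow> \<tau> permutes {1..n} \<Longrightarrow> B_rels_pm n \<mu> \<nu> \<gamma> (gp \<sigma> * gp \<tau>) (gp (\<sigma> \<circ> \<tau>))"
| swap: "i \<in> {1..n} \<Longrightarrow> j \<in> {1..n} \<Longrightarrow> i \<noteq> j \<Longrightarrow> l \<in> {1..4} \<Longrightarrow>
    B_rels_pm n \<mu> \<nu> \<gamma> (gp (transpose i j) * Vp i l) (Vp j l * gp (transpose i j))"
| far: "i \<in> {1..n} \<Longrightarrow> j \<in> {1..n} \<Longrightarrow> k \<in> {1..n} \<Longrightarrow> i \<noteq> j \<Longrightarrow> k \<noteq> i \<Longrightarrow> k \<noteq> j \<Longrightarrow> l \<in> {1..4} \<Longrightarrow>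
    B_rels_pm n \<mu> \<nu> \<gamma> (gp (transpose i j) * Vp k l) (Vp k l * gp (transpose i j))"
| quad: "k \<in> {1..n} \<Longrightarrow> l \<in> {1..4} \<Longrightarrow>
    B_rels_pm n \<mu> \<nu> \<gamma> ((Vp k l - pscale (\<gamma> l) 1) * (Vp k l - pscale (\<gamma> l + \<mu> l) 1)) 0"
| sum: "i \<in> {1..n} \<Longrightarrow>
    B_rels_pm n \<mu> \<nu> \<gamma> (Vp i 1 + Vp i 2 + Vp i 3 + Vp i 4) (pscale \<nu> (\<Sum>j\<in>{1..n} - {i}. gp (transpose i j)))"
| same: "i \<in> {1..n} \<Longrightarrow> j \<in> {1..n} \<Longrightarrow> i \<noteq> j \<Longrightarrow> l \<in> {1..4} \<Longrightarrow>
    B_rels_pm n \<mu> \<nu> \<gamma> (Vp i l * Vp j l - Vp j l * Vp i l) (pscale \<nu> ((Vp i l - Vp j l) * gp (transpose i j)))"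
| diff: "i \<in> {1..n} \<Longrightarrow> j \<in> {1..n} \<Longrightarrow> i \<noteq> j \<Longrightarrow> l \<in> {1..4} \<Longrightarrow> m \<in> {1..4} \<Longrightarrow> l \<noteq> m \<Longrightarrow>
    B_rels_pm n \<mu> \<nu> \<gamma> (Vp i l * Vp j m - Vp j m * Vp i l) 0"

text \<open>Each side of the eight families of relations lies in the free algebra, and its image
  under \<open>to_pm\<close> is computed once. The converse direction identifies the two sides by
  the injectivity of \<open>to_pm\<close>.\<close>

lemma B_rels_iff: "(a, b) \<in> B_rels n \<mu> \<nu> \<gamma> \<longleftrightarrow>
  a \<in> carrier (free_alg (B_gens n)) \<and> b \<in> carrier (free_alg (B_gens n)) \<and> B_rels_pm n \<mu> \<nu> \<gamma> (to_pm a) (to_pm b)"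
proof -
  let ?F = "free_alg (B_gens n)"
  let ?V = "\<lambda>i l. fgen (GV i l)" and ?s = "\<lambda>i j. fgen (GS (transpose i j))"
  have r1: "fgen (GS id) \<in> carrier ?F \<and> \<one>\<^bsub>?F\<^esub> \<in> carrier ?F \<and> to_pm (fgen (GS id)) = gp id \<and> to_pm \<one>\<^bsub>?F\<^esub> = 1"
    by (simp only: fa_closed permutes_id fa_push simp_thms)
  have r2: "fgen (GS \<sigma>) \<otimes>\<^bsub>?F\<^esub> fgen (GS \<tau>) \<in> carrier ?F \<and> fgen (GS (\<sigma> \<circ> \<tau>)) \<in> carrier ?F \<and>
      to_pm (fgen (GS \<sigma>) \<otimes>\<^bsub>?F\<^esub> fgen (GS \<tau>)) = gp \<sigma> * gp \<tau> \<and> to_pm (fgen (GS (\<sigma> \<circ> \<tau>))) = gp (\<sigma> \<circ> \<tau>)"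
    if "\<sigma> permutes {1..n}" "\<tau> permutes {1..n}" for \<sigma> \<tau>
    by (simp only: fa_closed permutes_compose[OF that(2,1)] that fa_push simp_thms)
  have r3: "?s i j \<otimes>\<^bsub>?F\<^esub> ?V k l \<in> carrier ?F \<and> ?V k' l \<otimes>\<^bsub>?F\<^esub> ?s i j \<in> carrier ?F \<and>
      to_pm (?s i j \<otimes>\<^bsub>?F\<^esub> ?V k l) = gp (transpose i j) * Vp k l \<and> to_pm (?V k' l \<otimes>\<^bsub>?F\<^esub> ?s i j) = Vp k' l * gp (transpose i j)"
    if "i \<in> {1..n}" "j \<in> {1..n}" "k \<in> {1..n}" "k' \<in> {1..n}" "l \<in> {1..4}" for i j k k' l
    by (simp only: fa_closed that fa_push simp_thms)
  have r5: "(?V k l \<ominus>\<^bsub>?F\<^esub> \<gamma> l \<odot>\<^bsub>?F\<^esub> \<one>\<^bsub>?F\<^esub>) \<otimes>\<^bsub>?F\<^esub> (?V k l \<ominus>\<^bsub>?F\<^esub> (\<gamma> l + \<mu> l) \<odot>\<^bsub>?F\<^esub> \<one>\<^bsub>?F\<^esub>) \<in> carrier ?F \<and>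
      to_pm ((?V k l \<ominus>\<^bsub>?F\<^esub> \<gamma> l \<odot>\<^bsub>?F\<^esub> \<one>\<^bsub>?F\<^esub>) \<otimes>\<^bsub>?F\<^esub> (?V k l \<ominus>\<^bsub>?F\<^esub> (\<gamma> l + \<mu> l) \<odot>\<^bsub>?F\<^esub> \<one>\<^bsub>?F\<^esub>))
      = (Vp k l - pscale (\<gamma> l) 1) * (Vp k l - pscale (\<gamma> l + \<mu> l) 1)"
    if "k \<in> {1..n}" "l \<in> {1..4}" for k l
    by (simp only: fa_closed that fa_push simp_thms)
  have l4: "(1::nat) \<in> {1..4}" "(2::nat) \<in> {1..4}" "(3::nat) \<in> {1..4}" "(4::nat) \<in> {1..4}" by auto
  have r6: "?V i 1 \<oplus>\<^bsub>?F\<^esub> ?V i 2 \<oplus>\<^bsub>?F\<^esub> ?V i 3 \<oplus>\<^bsub>?F\<^esub> ?V i 4 \<in> carrier ?F \<and>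
      \<nu> \<odot>\<^bsub>?F\<^esub> (\<Oplus>\<^bsub>?F\<^esub>j\<in>{1..n} - {i}. ?s i j) \<in> carrier ?F \<and>
      to_pm (?V i 1 \<oplus>\<^bsub>?F\<^esub> ?V i 2 \<oplus>\<^bsub>?F\<^esub> ?V i 3 \<oplus>\<^bsub>?F\<^esub> ?V i 4) = Vp i 1 + Vp i 2 + Vp i 3 + Vp i 4 \<and>
      to_pm (\<nu> \<odot>\<^bsub>?F\<^esub> (\<Oplus>\<^bsub>?F\<^esub>j\<in>{1..n} - {i}. ?s i j)) = pscale \<nu> (\<Sum>j\<in>{1..n} - {i}. gp (transpose i j))"
    if "i \<in> {1..n}" for i
    by (simp only: fa_closed that l4 sum_transpose_B[OF that] fa_push simp_thms)
  have r7: "?V i l \<otimes>\<^bsub>?F\<^esub> ?V j m \<ominus>\<^bsub>?F\<^esub> ?V j m \<otimes>\<^bsub>?F\<^esub> ?V i l \<in> carrier ?F \<and>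
      \<nu> \<odot>\<^bsub>?F\<^esub> ((?V i l \<ominus>\<^bsub>?F\<^esub> ?V j l) \<otimes>\<^bsub>?F\<^esub> ?s i j) \<in> carrier ?F \<and>
      to_pm (?V i l \<otimes>\<^bsub>?F\<^esub> ?V j m \<ominus>\<^bsub>?F\<^esub> ?V j m \<otimes>\<^bsub>?F\<^esub> ?V i l) = Vp i l * Vp j m - Vp j m * Vp i l \<and>
      to_pm (\<nu> \<odot>\<^bsub>?F\<^esub> ((?V i l \<ominus>\<^bsub>?F\<^esub> ?V j l) \<otimes>\<^bsub>?F\<^esub> ?s i j)) = pscale \<nu> ((Vp i l - Vp j l) * gp (transpose i j))"
    if "i \<in> {1..n}" "j \<in> {1..n}" "l \<in> {1..4}" "m \<in> {1..4}" for i j l m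
    by (simp only: fa_closed that fa_push simp_thms)
  have z: "\<zero>\<^bsub>?F\<^esub> \<in> carrier ?F \<and> to_pm \<zero>\<^bsub>?F\<^esub> = 0" by (simp only: fa_closed fa_push simp_thms)
  have eq: "f = h" if "f \<in> carrier ?F" "h \<in> carrier ?F" "to_pm f = to_pm h" for f h
    using fa.\<iota>_eqD that by blast
  show ?thesis
  proof
    assume "(a, b) \<in> B_rels n \<mu> \<nu> \<gamma>"
    then show "a \<in> carrier ?F \<and> b \<in> carrier ?F \<and> B_rels_pm n \<mu> \<nu> \<gamma> (to_pm a) (to_pm b)"
      unfolding B_rels_def Let_def Un_iff
    proof (elim disjE)
      assume "(a, b) \<in> {(fgen (GS id), \<one>\<^bsub>?F\<^esub>)}"
      then have *: "a = fgen (GS id)" "b = \<one>\<^bsub>?F\<^esub>" by blast+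
      show ?thesis unfolding * by (simp only: r1 B_rels_pm.one simp_thms)
    next
      assume "(a, b) \<in> {(fgen (GS \<sigma>) \<otimes>\<^bsub>?F\<^esub> fgen (GS \<tau>), fgen (GS (\<sigma> \<circ> \<tau>))) | \<sigma> \<tau>.
           \<sigma> permutes {1..n} \<and> \<tau> permutes {1..n}}"
      then obtain \<sigma> \<tau> where *: "a = fgen (GS \<sigma>) \<otimes>\<^bsub>?F\<^esub> fgen (GS \<tau>)" "b = fgen (GS (\<sigma> \<circ> \<tau>))"
        "\<sigma> permutes {1..n}" "\<tau> permutes {1..n}" by auto
      show ?thesis unfolding *(1,2) by (simp only: r2[OF *(3,4)] B_rels_pm.mult[OF *(3,4)] simp_thms)
    next
      assume "(a, b) \<in> {(?s i j \<otimes>\<^bsub>?F\<^esub> ?V i l, ?V j l \<otimes>\<^bsub>?F\<^esub> ?s i j) | i j l.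
           i \<in> {1..n} \<and> j \<in> {1..n} \<and> i \<noteq> j \<and> l \<in> {1..4}}"
      then obtain i j l where *: "a = ?s i j \<otimes>\<^bsub>?F\<^esub> ?V i l" "b = ?V j l \<otimes>\<^bsub>?F\<^esub> ?s i j"
        "i \<in> {1..n}" "j \<in> {1..n}" "i \<noteq> j" "l \<in> {1..4}" by auto
      show ?thesis unfolding *(1,2) by (simp only: r3[OF *(3,4,3,4,6)] B_rels_pm.swap[OF *(3-)] simp_thms)
    next
      assume "(a, b) \<in> {(?s i j \<otimes>\<^bsub>?F\<^esub> ?V k l, ?V k l \<otimes>\<^bsub>?F\<^esub> ?s i j) | i j k l.
           i \<in> {1..n} \<and> j \<in> {1..n} \<and> k \<in> {1..n} \<and> i \<noteq> j \<and> k \<noteq> i \<and> k \<noteq> j \<and> l \<in> {1..4}}"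
      then obtain i j k l where *: "a = ?s i j \<otimes>\<^bsub>?F\<^esub> ?V k l" "b = ?V k l \<otimes>\<^bsub>?F\<^esub> ?s i j"
        "i \<in> {1..n}" "j \<in> {1..n}" "k \<in> {1..n}" "i \<noteq> j" "k \<noteq> i" "k \<noteq> j" "l \<in> {1..4}" by auto
      show ?thesis unfolding *(1,2) by (simp only: r3[OF *(3,4,5,5,9)] B_rels_pm.far[OF *(3-)] simp_thms)
    next
      assume "(a, b) \<in> {((?V k l \<ominus>\<^bsub>?F\<^esub> \<gamma> l \<odot>\<^bsub>?F\<^esub> \<one>\<^bsub>?F\<^esub>) \<otimes>\<^bsub>?F\<^esub> (?V k l \<ominus>\<^bsub>?F\<^esub> (\<gamma> l + \<mu> l) \<odot>\<^bsub>?F\<^esub> \<one>\<^bsub>?F\<^esub>), \<zero>\<^bsub>?F\<^esub>) | k l.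
           k \<in> {1..n} \<and> l \<in> {1..4}}"
      then obtain k l where *: "a = (?V k l \<ominus>\<^bsub>?F\<^esub> \<gamma> l \<odot>\<^bsub>?F\<^esub> \<one>\<^bsub>?F\<^esub>) \<otimes>\<^bsub>?F\<^esub> (?V k l \<ominus>\<^bsub>?F\<^esub> (\<gamma> l + \<mu> l) \<odot>\<^bsub>?F\<^esub> \<one>\<^bsub>?F\<^esub>)"
        "b = \<zero>\<^bsub>?F\<^esub>" "k \<in> {1..n}" "l \<in> {1..4}" by auto
      show ?thesis unfolding *(1,2) by (simp only: r5[OF *(3,4)] z B_rels_pm.quad[OF *(3-)] simp_thms)
    next
      assume "(a, b) \<in> {(?V i 1 \<oplus>\<^bsub>?F\<^esub> ?V i 2 \<oplus>\<^bsub>?F\<^esub> ?V i 3 \<oplus>\<^bsub>?F\<^esub> ?V i 4, \<nu> \<odot>\<^bsub>?F\<^esub> (\<Oplus>\<^bsub>?F\<^esub>j\<in>{1..n} - {i}. ?s i j)) | i.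
           i \<in> {1..n}}"
      then obtain i where *: "a = ?V i 1 \<oplus>\<^bsub>?F\<^esub> ?V i 2 \<oplus>\<^bsub>?F\<^esub> ?V i 3 \<oplus>\<^bsub>?F\<^esub> ?V i 4"
        "b = \<nu> \<odot>\<^bsub>?F\<^esub> (\<Oplus>\<^bsub>?F\<^esub>j\<in>{1..n} - {i}. ?s i j)" "i \<in> {1..n}" by auto
      show ?thesis unfolding *(1,2) by (simp only: r6[OF *(3)] B_rels_pm.sum[OF *(3-)] simp_thms)
    next
      assume "(a, b) \<in> {(?V i l \<otimes>\<^bsub>?F\<^esub> ?V j l \<ominus>\<^bsub>?F\<^esub> ?V j l \<otimes>\<^bsub>?F\<^esub> ?V i l, \<nu> \<odot>\<^bsub>?F\<^esub> ((?V i l \<ominus>\<^bsub>?F\<^esub> ?V j l) \<otimes>\<^bsub>?F\<^esub> ?s i j)) | i j l.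
           i \<in> {1..n} \<and> j \<in> {1..n} \<and> i \<noteq> j \<and> l \<in> {1..4}}"
      then obtain i j l where *: "a = ?V i l \<otimes>\<^bsub>?F\<^esub> ?V j l \<ominus>\<^bsub>?F\<^esub> ?V j l \<otimes>\<^bsub>?F\<^esub> ?V i l"
        "b = \<nu> \<odot>\<^bsub>?F\<^esub> ((?V i l \<ominus>\<^bsub>?F\<^esub> ?V j l) \<otimes>\<^bsub>?F\<^esub> ?s i j)"
        "i \<in> {1..n}" "j \<in> {1..n}" "i \<noteq> j" "l \<in> {1..4}" by auto
      show ?thesis unfolding *(1,2) by (simp only: r7[OF *(3,4,6,6)] B_rels_pm.same[OF *(3-)] simp_thms)
    next
      assume "(a, b) \<in> {(?V i l \<otimes>\<^bsub>?F\<^esub> ?V j m \<ominus>\<^bsub>?F\<^esub> ?V j m \<otimes>\<^bsub>?F\<^esub> ?V i l, \<zero>\<^bsub>?F\<^esub>) | i j l m.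
           i \<in> {1..n} \<and> j \<in> {1..n} \<and> i \<noteq> j \<and> l \<in> {1..4} \<and> m \<in> {1..4} \<and> l \<noteq> m}"
      then obtain i j l m where *: "a = ?V i l \<otimes>\<^bsub>?F\<^esub> ?V j m \<ominus>\<^bsub>?F\<^esub> ?V j m \<otimes>\<^bsub>?F\<^esub> ?V i l"
        "b = \<zero>\<^bsub>?F\<^esub>"
        "i \<in> {1..n}" "j \<in> {1..n}" "i \<noteq> j" "l \<in> {1..4}" "m \<in> {1..4}" "l \<noteq> m" by auto
      show ?thesis unfolding *(1,2) by (simp only: r7[OF *(3,4,6,7)] z B_rels_pm.diff[OF *(3-)] simp_thms)
    qed
  next
    assume *: "a \<in> carrier ?F \<and> b \<in> carrier ?F \<and> B_rels_pm n \<mu> \<nu> \<gamma> (to_pm a) (to_pm b)"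
    then have ab: "a \<in> carrier ?F" "b \<in> carrier ?F" and R: "B_rels_pm n \<mu> \<nu> \<gamma> (to_pm a) (to_pm b)" by auto
    from R show "(a, b) \<in> B_rels n \<mu> \<nu> \<gamma>"
    proof cases
      case one
      have e: "a = fgen (GS id)" "b = \<one>\<^bsub>?F\<^esub>"
        by (rule eq; simp only: r1 ab one)+
      show ?thesis unfolding e B_rels_def Let_def
        by (rule UnI1, rule UnI1, rule UnI1, rule UnI1, rule UnI1, rule UnI1, rule UnI1, rule singletonI)
    next
      case (mult \<sigma> \<tau>)
      note c = mult(3-)
      have e: "a = fgen (GS \<sigma>) \<otimes>\<^bsub>?F\<^esub> fgen (GS \<tau>)" "b = fgen (GS (\<sigma> \<circ> \<tau>))"
        by (rule eq; simp only: r2[of \<sigma> \<tau>] ab mult(1,2) c)+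
      show ?thesis unfolding e B_rels_def Let_def
        by (rule UnI1, rule UnI1, rule UnI1, rule UnI1, rule UnI1, rule UnI1, rule UnI2, rule CollectI, rule exI[of _ "\<sigma>"], rule exI[of _ "\<tau>"]) (intro conjI refl c)
    next
      case (swap i j l)
      note c = swap(3-)
      have e: "a = ?s i j \<otimes>\<^bsub>?F\<^esub> ?V i l" "b = ?V j l \<otimes>\<^bsub>?F\<^esub> ?s i j"
        by (rule eq; simp only: r3[of i j i j l] ab swap(1,2) c)+
      show ?thesis unfolding e B_rels_def Let_def
        by (rule UnI1, rule UnI1, rule UnI1, rule UnI1, rule UnI1, rule UnI2, rule CollectI, rule exI[of _ "i"], rule exI[of _ "j"], rule exI[of _ "l"]) (intro conjI refl c)
    next
      case (far i j k l)
      note c = far(3-)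
      have e: "a = ?s i j \<otimes>\<^bsub>?F\<^esub> ?V k l" "b = ?V k l \<otimes>\<^bsub>?F\<^esub> ?s i j"
        by (rule eq; simp only: r3[of i j k k l] ab far(1,2) c)+
      show ?thesis unfolding e B_rels_def Let_def
        by (rule UnI1, rule UnI1, rule UnI1, rule UnI1, rule UnI2, rule CollectI, rule exI[of _ "i"], rule exI[of _ "j"], rule exI[of _ "k"], rule exI[of _ "l"]) (intro conjI refl c)
    next
      case (quad k l)
      note c = quad(3-)
      have e: "a = (?V k l \<ominus>\<^bsub>?F\<^esub> \<gamma> l \<odot>\<^bsub>?F\<^esub> \<one>\<^bsub>?F\<^esub>) \<otimes>\<^bsub>?F\<^esub> (?V k l \<ominus>\<^bsub>?F\<^esub> (\<gamma> l + \<mu> l) \<odot>\<^bsub>?F\<^esub> \<one>\<^bsub>?F\<^esub>)" "b = \<zero>\<^bsub>?F\<^esub>"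
        by (rule eq; simp only: r5[of k l] z ab quad(1,2) c)+
      show ?thesis unfolding e B_rels_def Let_def
        by (rule UnI1, rule UnI1, rule UnI1, rule UnI2, rule CollectI, rule exI[of _ "k"], rule exI[of _ "l"]) (intro conjI refl c)
    next
      case (sum i)
      note c = sum(3-)
      have e: "a = ?V i 1 \<oplus>\<^bsub>?F\<^esub> ?V i 2 \<oplus>\<^bsub>?F\<^esub> ?V i 3 \<oplus>\<^bsub>?F\<^esub> ?V i 4" "b = \<nu> \<odot>\<^bsub>?F\<^esub> (\<Oplus>\<^bsub>?F\<^esub>j\<in>{1..n} - {i}. ?s i j)"
        by (rule eq; simp only: r6[of i] ab sum(1,2) c)+
      show ?thesis unfolding e B_rels_def Let_def
        by (rule UnI1, rule UnI1, rule UnI2, rule CollectI, rule exI[of _ "i"]) (intro conjI refl c)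
    next
      case (same i j l)
      note c = same(3-)
      have e: "a = ?V i l \<otimes>\<^bsub>?F\<^esub> ?V j l \<ominus>\<^bsub>?F\<^esub> ?V j l \<otimes>\<^bsub>?F\<^esub> ?V i l" "b = \<nu> \<odot>\<^bsub>?F\<^esub> ((?V i l \<ominus>\<^bsub>?F\<^esub> ?V j l) \<otimes>\<^bsub>?F\<^esub> ?s i j)"
        by (rule eq; simp only: r7[of i j l l] ab same(1,2) c)+
      show ?thesis unfolding e B_rels_def Let_def
        by (rule UnI1, rule UnI2, rule CollectI, rule exI[of _ "i"], rule exI[of _ "j"], rule exI[of _ "l"]) (intro conjI refl c)
    next
      case (diff i j l m)
      note c = diff(3-)
      have e: "a = ?V i l \<otimes>\<^bsub>?F\<^esub> ?V j m \<ominus>\<^bsub>?F\<^esub> ?V j m \<otimes>\<^bsub>?F\<^esub> ?V i l" "b = \<zero>\<^bsub>?F\<^esub>"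
        by (rule eq; simp only: r7[of i j l m] z ab diff(1,2) c)+
      show ?thesis unfolding e B_rels_def Let_def
        by (rule UnI2, rule CollectI, rule exI[of _ "i"], rule exI[of _ "j"], rule exI[of _ "l"], rule exI[of _ "m"]) (intro conjI refl c)
    qed
  qed
qed

context gdaha_setup
begin

abbreviation \<mu> :: "nat \<Rightarrow> complex" where "\<mu> \<equiv> mu_par t0 u0 tn un"
abbreviation F :: "(complex, Bgen list \<Rightarrow> complex) module" where "F \<equiv> free_alg (B_gens n)"
abbreviation Irel :: "(Bgen list \<Rightarrow> complex) set" where "Irel \<equiv> rel_ideal (B_gens n) (B_rels n \<mu> (- t) \<gamma>)"

primrec genE :: "Bgen \<Rightarrow> endo" where
  "genE (GV i l) = D.VE i l" | "genE (GS \<sigma>) = D.P \<sigma>"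

definition \<Phi> :: "(Bgen list \<Rightarrow>\<^sub>0 complex) \<Rightarrow> endo" where "\<Phi> = en.evalp genE"

lemma \<Phi>_simps: "\<Phi> (p + q) = \<Phi> p + \<Phi> q" "\<Phi> (p - q) = \<Phi> p - \<Phi> q" "\<Phi> (p * q) = \<Phi> p * \<Phi> q"
  "\<Phi> 1 = 1" "\<Phi> 0 = 0" "\<Phi> (pscale c p) = escl c (\<Phi> p)" "\<Phi> (Vp i l) = D.VE i l" "\<Phi> (gp \<sigma>) = D.P \<sigma>"
  "\<Phi> (sum f K) = (\<Sum>k\<in>K. \<Phi> (f k))" "\<Phi> (p ^ m) = \<Phi> p ^ m" "\<Phi> (prod_list ps) = prod_list (map \<Phi> ps)"
  by (simp_all add: \<Phi>_def en.evalp_add en.evalp_minus en.evalp_mult en.evalp_pscale Vp_def gp_def en.evalp_sum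
    en.evalp_power en.evalp_prod_list)

lemma \<mu>_par: "l \<in> {1..4} \<Longrightarrow> \<mu> l = 2 * D.par l"
  unfolding D.idx by (auto simp: mu_par_def D.par_def)

lemma P_VE: "\<sigma> permutes {1..n} \<Longrightarrow> i \<in> {1..n} \<Longrightarrow> l \<in> {1..4} \<Longrightarrow> D.P \<sigma> * D.VE i l = D.VE (\<sigma> i) l * D.P \<sigma>"
  by (simp only: D.VE_def distrib_left distrib_right D.P_Vc en.sc_left en.sc_right)

lemma rels_kill: "B_rels_pm n \<mu> (- t) \<gamma> a b \<Longrightarrow> \<Phi> a = \<Phi> b"
proof (induction rule: B_rels_pm.induct)
  case one
  then show ?case by (simp only: \<Phi>_simps D.P_id)
next
  case (mult \<sigma> \<tau>)
  then show ?case by (simp only: \<Phi>_simps D.P_mult)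
next
  case (swap i j l)
  then show ?case using P_VE[of "transpose i j" i l] by (simp add: \<Phi>_simps permutes_swap_id)
next
  case (far i j k l)
  then show ?case using P_VE[of "transpose i j" k l] by (simp add: \<Phi>_simps permutes_swap_id)
next
  case (quad k l)
  have e: "D.VE k l - escl (\<gamma> l) 1 = D.Vc k l + escl (D.par l) 1"
    by (simp add: D.VE_def en.scale_left_distrib)
  have "escl (D.par l) 1 + escl (D.par l) 1 = escl (2 * D.par l) 1" by (simp flip: en.scale_left_distrib)
  then have e': "D.VE k l - escl (\<gamma> l + \<mu> l) 1 = D.Vc k l - escl (D.par l) 1"
    unfolding \<mu>_par[OF quad(2)] D.VE_def en.scale_left_distrib by (simp add: algebra_simps)
  show ?case unfolding \<Phi>_simps e e' by (rule D.Vc_quad[OF quad])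
next
  case (sum i)
  \<comment> \<open>The shifts add up to \<open>\<mu> 0\<close> plus the four parameters, which is
    1/2. This cancels the - 1/2 that comes from \<open>X 1 - 1/2\<close> and explains the value of
    \<open>\<mu> 0\<close>.\<close>
  have "\<gamma> 1 + D.par 1 + (\<gamma> 2 + D.par 2) + (\<gamma> 3 + D.par 3) + (\<gamma> 4 + D.par 4) = 1/2"
    using \<gamma>_sum by (simp add: mu_par_def D.par_def algebra_simps)
  then have c: "escl (\<gamma> 1 + D.par 1) 1 + escl (\<gamma> 2 + D.par 2) 1 + escl (\<gamma> 3 + D.par 3) 1 + escl (\<gamma> 4 + D.par 4) 1 = escl (1/2) 1"
    by (simp only: flip: en.scale_left_distrib)
  have "D.VE i 1 + D.VE i 2 + D.VE i 3 + D.VE i 4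
      = (D.Vc i 1 + D.Vc i 2 + D.Vc i 3 + D.Vc i 4) + escl (1/2) 1"
    unfolding c[symmetric] D.VE_def by (simp only: add_ac)
  also have "\<dots> = escl (- t) (\<Sum>j\<in>{1..n} - {i}. D.P (transpose i j))"
    unfolding D.Vc_sum[OF sum] by simp
  finally show ?case by (simp only: \<Phi>_simps)
next
  case (same i j l)
  have "D.VE i l * D.VE j l - D.VE j l * D.VE i l = D.Vc i l * D.Vc j l - D.Vc j l * D.Vc i l"
    by (simp add: D.VE_def distrib_left distrib_right en.scl_left en.scl_right en.scale_right_distrib)
  moreover have "D.VE i l - D.VE j l = D.Vc i l - D.Vc j l" by (simp add: D.VE_def)
  ultimately show ?case using D.Vc_same[OF same] by (simp only: \<Phi>_simps)
next
  case (diff i j l m)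
  have "D.VE i l * D.VE j m - D.VE j m * D.VE i l = D.Vc i l * D.Vc j m - D.Vc j m * D.Vc i l"
    by (simp add: D.VE_def distrib_left distrib_right en.scl_left en.scl_right en.scale_right_distrib mult.commute)
  then show ?case using D.Vc_diff[OF diff] by (simp add: \<Phi>_simps)
qed

lemma rels_carrier: "{a \<ominus>\<^bsub>F\<^esub> b | a b. (a, b) \<in> B_rels n \<mu> (- t) \<gamma>} \<subseteq> carrier F"
  using fa.minus_closed by (auto simp: B_rels_iff)

lemma ideal_Irel: "ideal Irel F"
  unfolding rel_ideal_def by (rule fa.genideal_ideal[OF rels_carrier])

sublocale I: ideal Irel F by (rule ideal_Irel)

lemma Irel_carrier: "f \<in> Irel \<Longrightarrow> f \<in> carrier F"
  using I.a_subset by auto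

definition \<Psi> :: "(Bgen list \<Rightarrow> complex) \<Rightarrow> endo" where "\<Psi> f = \<Phi> (to_pm f)"

lemma \<Psi>_simps:
  "f \<in> carrier F \<Longrightarrow> h \<in> carrier F \<Longrightarrow> \<Psi> (f \<oplus>\<^bsub>F\<^esub> h) = \<Psi> f + \<Psi> h"
  "f \<in> carrier F \<Longrightarrow> h \<in> carrier F \<Longrightarrow> \<Psi> (f \<otimes>\<^bsub>F\<^esub> h) = \<Psi> f * \<Psi> h"
  "f \<in> carrier F \<Longrightarrow> h \<in> carrier F \<Longrightarrow> \<Psi> (f \<ominus>\<^bsub>F\<^esub> h) = \<Psi> f - \<Psi> h"
  "f \<in> carrier F \<Longrightarrow> \<Psi> (\<ominus>\<^bsub>F\<^esub> f) = - \<Psi> f"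
  "f \<in> carrier F \<Longrightarrow> \<Psi> (c \<odot>\<^bsub>F\<^esub> f) = escl c (\<Psi> f)"
  "\<Psi> \<one>\<^bsub>F\<^esub> = 1" "\<Psi> \<zero>\<^bsub>F\<^esub> = 0" "\<Psi> (fgen (GV i l)) = D.VE i l" "\<Psi> (fgen (GS \<sigma>)) = D.P \<sigma>"
  using \<Phi>_simps(2)[of 0] by (simp_all add: \<Psi>_def fa.\<iota>_simps to_pm_gens \<Phi>_simps)

text \<open>The elements of the free algebra killed by \<Psi> form an ideal that contains the
  generating differences, hence the ideal they generate.\<close>

lemma Irel_kill: "f \<in> Irel \<Longrightarrow> \<Psi> f = 0"
proof -
  have "ideal {f \<in> carrier F. \<Psi> f = 0} F"
  proof (rule idealI)
    show "ring F" by (rule fa.ring_axioms)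
    show "subgroup {f \<in> carrier F. \<Psi> f = 0} (add_monoid F)"
      by (rule fa.add.subgroupI) (auto simp: \<Psi>_simps fa.a_closed intro: exI[of _ "\<zero>\<^bsub>F\<^esub>"] simp flip: a_inv_def)
  qed (auto simp: \<Psi>_simps)
  then have "Irel \<subseteq> {f \<in> carrier F. \<Psi> f = 0}"
    unfolding rel_ideal_def
  proof (rule fa.genideal_minimal)
    show "{a \<ominus>\<^bsub>F\<^esub> b |a b. (a, b) \<in> B_rels n \<mu> (- t) \<gamma>} \<subseteq> {f \<in> carrier F. \<Psi> f = 0}"
    proof
      fix f assume "f \<in> {a \<ominus>\<^bsub>F\<^esub> b |a b. (a, b) \<in> B_rels n \<mu> (- t) \<gamma>}"
      then obtain a b where "f = a \<ominus>\<^bsub>F\<^esub> b" "a \<in> carrier F" "b \<in> carrier F" "\<Psi> a = \<Psi> b"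
        using rels_kill by (auto simp: B_rels_iff \<Psi>_def)
      then show "f \<in> {f \<in> carrier F. \<Psi> f = 0}" by (simp add: \<Psi>_simps fa.minus_closed)
    qed
  qed
  then show "f \<in> Irel \<Longrightarrow> \<Psi> f = 0" by auto
qed

definition Ip :: "(Bgen list \<Rightarrow>\<^sub>0 complex) set" where "Ip = to_pm ` Irel"

lemma Ip_carrier_mult:
  assumes "f \<in> carrier F" "a \<in> Ip"
  shows "to_pm f * a \<in> Ip" "a * to_pm f \<in> Ip"
proof -
  obtain h where h: "h \<in> Irel" "a = to_pm h" using assms(2) by (auto simp: Ip_def)
  have "to_pm f * a = to_pm (f \<otimes>\<^bsub>F\<^esub> h)" "a * to_pm f = to_pm (h \<otimes>\<^bsub>F\<^esub> f)"
    using h assms(1) Irel_carrier by (simp_all add: fa.\<iota>_mult)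
  then show "to_pm f * a \<in> Ip" "a * to_pm f \<in> Ip"
    using h assms(1) I.I_l_closed I.I_r_closed by (auto simp: Ip_def)
qed

lemma Ip_rel: "B_rels_pm n \<mu> (- t) \<gamma> a b \<Longrightarrow> Poly_Mapping.lookup a \<in> carrier F \<Longrightarrow> Poly_Mapping.lookup b \<in> carrier F \<Longrightarrow> a - b \<in> Ip"
proof -
  let ?a = "Poly_Mapping.lookup a" and ?b = "Poly_Mapping.lookup b"
  assume "B_rels_pm n \<mu> (- t) \<gamma> a b" "?a \<in> carrier F" "?b \<in> carrier F"
  then have "(?a, ?b) \<in> B_rels n \<mu> (- t) \<gamma>" and c: "?a \<in> carrier F" "?b \<in> carrier F" by (simp_all add: B_rels_iff)
  then have "?a \<ominus>\<^bsub>F\<^esub> ?b \<in> {a \<ominus>\<^bsub>F\<^esub> b | a b. (a, b) \<in> B_rels n \<mu> (- t) \<gamma>}" by blast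
  then have "?a \<ominus>\<^bsub>F\<^esub> ?b \<in> Irel"
    using fa.genideal_self[OF rels_carrier] unfolding rel_ideal_def by blast
  moreover have "to_pm (?a \<ominus>\<^bsub>F\<^esub> ?b) = a - b" using c by (simp add: fa.\<iota>_minus)
  ultimately show "a - b \<in> Ip" unfolding Ip_def by (metis imageI)
qed

lemma in_F: "Poly_Mapping.lookup p \<in> carrier F \<longleftrightarrow> Poly_Mapping.keys p \<subseteq> lists (B_gens n)"
  unfolding free_alg_carrier by (metis to_pm_lookup)

definition FP :: "(Bgen list \<Rightarrow>\<^sub>0 complex) set" where "FP = {p. Poly_Mapping.keys p \<subseteq> lists (B_gens n)}"

lemma FP_to_pm: "f \<in> carrier F \<Longrightarrow> to_pm f \<in> FP"
  by (auto simp: FP_def free_alg_carrier)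

lemma FP_closed: "p \<in> FP \<Longrightarrow> q \<in> FP \<Longrightarrow> p + q \<in> FP" "p \<in> FP \<Longrightarrow> q \<in> FP \<Longrightarrow> p - q \<in> FP"
  "p \<in> FP \<Longrightarrow> q \<in> FP \<Longrightarrow> p * q \<in> FP" "p \<in> FP \<Longrightarrow> pscale c p \<in> FP" "1 \<in> FP" "0 \<in> FP"
  "i \<in> {1..n} \<Longrightarrow> l \<in> {1..4} \<Longrightarrow> Vp i l \<in> FP" "\<sigma> permutes {1..n} \<Longrightarrow> gp \<sigma> \<in> FP"
  "(\<And>k. k \<in> K \<Longrightarrow> f k \<in> FP) \<Longrightarrow> sum f K \<in> FP"
proof -
  show add: "p \<in> FP \<Longrightarrow> q \<in> FP \<Longrightarrow> p + q \<in> FP" for p q unfolding FP_def using keys_add_lists[of p _ q] by simp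
  show sc: "p \<in> FP \<Longrightarrow> pscale c p \<in> FP" for p c unfolding FP_def using keys_pscale[of p] by simp
  show "p \<in> FP \<Longrightarrow> q \<in> FP \<Longrightarrow> p - q \<in> FP" using add[of p "pscale (- 1) q"] sc[of q "- 1"] by simp
  show "p \<in> FP \<Longrightarrow> q \<in> FP \<Longrightarrow> p * q \<in> FP" unfolding FP_def using keys_mult_lists[of p _ q] by simp
  show "1 \<in> FP" unfolding FP_def using single_one[symmetric, where ?'a = "Bgen list" and ?'b = complex] by (simp add: zero_list_def)
  show zero: "0 \<in> FP" by (simp add: FP_def)
  show "i \<in> {1..n} \<Longrightarrow> l \<in> {1..4} \<Longrightarrow> Vp i l \<in> FP" using FP_to_pm[OF gens_in_B(1)] by (simp only: to_pm_gens)
  show "\<sigma> permutes {1..n} \<Longrightarrow> gp \<sigma> \<in> FP" using FP_to_pm[OF gens_in_B(2)] by (simp only: to_pm_gens)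
  show "(\<And>k. k \<in> K \<Longrightarrow> f k \<in> FP) \<Longrightarrow> sum f K \<in> FP"
    by (induction K rule: infinite_finite_induct) (auto simp: add zero)
qed

lemma rel_in_Ip: "B_rels_pm n \<mu> (- t) \<gamma> a b \<Longrightarrow> a - b \<in> Ip"
proof -
  assume R: "B_rels_pm n \<mu> (- t) \<gamma> a b"
  have l: "(1::nat) \<in> {1..4}" "(2::nat) \<in> {1..4}" "(3::nat) \<in> {1..4}" "(4::nat) \<in> {1..4}" by auto
  from R have "a \<in> FP \<and> b \<in> FP"
    by cases (auto simp only: intro!: FP_closed l permutes_swap_id permutes_compose permutes_id)
  then show ?thesis using Ip_rel[OF R] unfolding in_F FP_def by blast
qed

sublocale G: gdaha_rel pscale n \<mu> \<gamma> "- t" Vp gp Ip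
proof unfold_locales
  show "pm.subspace Ip"
  proof (rule pm.subspaceI)
    show "0 \<in> Ip" unfolding Ip_def using I.zero_closed fa.\<iota>_zero[where S = "B_gens n"] by (metis imageI)
    fix x y c assume x: "x \<in> Ip"
    have "pscale c x = to_pm (c \<odot>\<^bsub>F\<^esub> \<one>\<^bsub>F\<^esub>) * x"
      by (simp add: fa.\<iota>_smult fa.\<iota>_one pm.scl_left)
    then show "pscale c x \<in> Ip" using Ip_carrier_mult(1)[OF fa.smult_in[OF fa.one_closed] x] by simp
    assume y: "y \<in> Ip"
    obtain f h where "x = to_pm f" "y = to_pm h" "f \<in> Irel" "h \<in> Irel" using x y by (auto simp: Ip_def)
    then have "x + y = to_pm (f \<oplus>\<^bsub>F\<^esub> h)" "f \<oplus>\<^bsub>F\<^esub> h \<in> Irel"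
      using fa.\<iota>_add[OF Irel_carrier Irel_carrier, of f h] I.a_closed[of f h] by auto
    then show "x + y \<in> Ip" unfolding Ip_def by blast
  qed
next
  fix a b assume ab: "a \<in> Ip" "b \<in> Ip"
  then obtain f where "f \<in> Irel" "a = to_pm f" by (auto simp: Ip_def)
  then show "a * b \<in> Ip" using Ip_carrier_mult(1)[OF Irel_carrier _] ab by auto
next
  fix i l :: nat and a assume "i \<in> {1..n}" "l \<in> {1..4}" "a \<in> Ip"
  then show "Vp i l * a \<in> Ip" "a * Vp i l \<in> Ip"
    using Ip_carrier_mult[OF gens_in_B(1)] unfolding to_pm_gens by blast+
next
  fix \<sigma> a assume "\<sigma> permutes {1..n}" "a \<in> Ip"
  then show "gp \<sigma> * a \<in> Ip" "a * gp \<sigma> \<in> Ip"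
    using Ip_carrier_mult[OF gens_in_B(2)] unfolding to_pm_gens by blast+
next
  show "gp id - 1 \<in> Ip" by (intro rel_in_Ip B_rels_pm.one)
next
  fix \<sigma> \<tau> assume "\<sigma> permutes {1..n}" "\<tau> permutes {1..n}"
  then show "gp \<sigma> * gp \<tau> - gp (\<sigma> \<circ> \<tau>) \<in> Ip" by (intro rel_in_Ip B_rels_pm.mult)
next
  fix i j l :: nat assume "i \<in> {1..n}" "j \<in> {1..n}" "i \<noteq> j" "l \<in> {1..4}"
  note ijl = this
  show "gp (transpose i j) * Vp i l - Vp j l * gp (transpose i j) \<in> Ip"
    by (rule rel_in_Ip[OF B_rels_pm.swap[OF ijl]])
  show "Vp i l * Vp j l - Vp j l * Vp i l - pscale (- t) ((Vp i l - Vp j l) * gp (transpose i j)) \<in> Ip"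
    by (rule rel_in_Ip[OF B_rels_pm.same[OF ijl]])
next
  fix i j k l :: nat assume "i \<in> {1..n}" "j \<in> {1..n}" "k \<in> {1..n}" "i \<noteq> j" "k \<noteq> i" "k \<noteq> j" "l \<in> {1..4}"
  then show "gp (transpose i j) * Vp k l - Vp k l * gp (transpose i j) \<in> Ip"
    by (intro rel_in_Ip B_rels_pm.far)
next
  fix k l :: nat assume "k \<in> {1..n}" "l \<in> {1..4}"
  then have "(Vp k l - pscale (\<gamma> l) 1) * (Vp k l - pscale (\<gamma> l + \<mu> l) 1) - 0 \<in> Ip"
    by (intro rel_in_Ip B_rels_pm.quad)
  then show "(Vp k l - pscale (\<gamma> l) 1) * (Vp k l - pscale (\<gamma> l + \<mu> l) 1) \<in> Ip" by simp
next
  fix i assume "i \<in> {1..n}"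
  then show "Vp i 1 + Vp i 2 + Vp i 3 + Vp i 4 - pscale (- t) (\<Sum>j\<in>{1..n} - {i}. gp (transpose i j)) \<in> Ip"
    by (intro rel_in_Ip B_rels_pm.sum)
next
  fix i j l m :: nat assume "i \<in> {1..n}" "j \<in> {1..n}" "i \<noteq> j" "l \<in> {1..4}" "m \<in> {1..4}" "l \<noteq> m"
  then have "Vp i l * Vp j m - Vp j m * Vp i l - 0 \<in> Ip"
    by (intro rel_in_Ip B_rels_pm.diff)
  then show "Vp i l * Vp j m - Vp j m * Vp i l \<in> Ip" by simp
qed

lemma single_ev: "G.ev w = Poly_Mapping.single w 1"
proof (induction w)
  case Nil
  then show ?case by (simp add: zero_list_def flip: single_one)
next
  case (Cons h w)
  have "G.gen_val h = Poly_Mapping.single [h] 1"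
    by (cases h) (simp_all only: G.gen_val.simps, simp_all only: Vp_def gp_def)
  then show ?case by (simp add: Cons mult_single plus_list_def)
qed

lemma FP_span: "p \<in> FP \<Longrightarrow> p \<in> pm.span (G.ev ` lists (B_gens n))"
proof -
  assume p: "p \<in> FP"
  have "(\<Sum>k\<in>Poly_Mapping.keys p. pscale (Poly_Mapping.lookup p k) (Poly_Mapping.single k 1)) \<in> pm.span (G.ev ` lists (B_gens n))"
    using p unfolding FP_def by (intro pm.span_sum pm.span_scale pm.span_base) (auto simp: single_ev[symmetric])
  then show ?thesis using poly_mapping_expand'[of p] by simp
qed

lemma \<Phi>_bas: "\<Phi> (G.bas b) = D.imgb b"
proof -
  obtain a y \<pi> where b: "b = (a, y, \<pi>)" by (cases b) auto
  have V: "\<Phi> \<circ> Vp i = D.VE i" for i by (auto simp: \<Phi>_simps)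
  have x: "\<Phi> (G.x i) = D.xE i" for i by (simp add: G.x_def D.xE_def \<Phi>_simps)
  show ?thesis
    by (simp add: b G.bas_def D.imgb_def G.Yy_def G.Xx_def \<Phi>_simps V x o_def del: upt_Suc)
qed

text \<open>Modulo the ideal, \<open>f\<close> is a combination of normal forms. Applying \<Psi>
  gives a vanishing combination of their images, and as these are independent, all coefficients
  vanish and only the part in the ideal is left.\<close>

lemma kernel:
  assumes f: "f \<in> carrier F" "\<Psi> f = 0"
  shows "f \<in> Irel"
proof -
  have "to_pm f \<in> pm.span (G.bas ` bas_idx n \<union> Ip)"
    by (rule G.bas_span[OF FP_span[OF FP_to_pm[OF f(1)]]])
  then obtain x i where xi: "to_pm f = x + i" "x \<in> pm.span (G.bas ` bas_idx n)" "i \<in> pm.span Ip"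
    unfolding pm.span_Un by auto
  have i: "i \<in> Ip" using xi(3) G.I_subspace pm.span_eq_iff by blast
  then obtain h where h: "h \<in> Irel" "i = to_pm h" by (auto simp: Ip_def)
  obtain T c where T: "finite T" "T \<subseteq> bas_idx n" "x = (\<Sum>b\<in>T. pscale (c b) (G.bas b))"
    using xi(2) by (rule pm.span_image_finite_sum)
  have "\<Phi> i = 0" using Irel_kill[OF h(1)] by (simp add: h(2) \<Psi>_def)
  then have "\<Phi> x = 0" using f(2) xi(1) by (simp add: \<Psi>_def \<Phi>_simps)
  then have "(\<Sum>b\<in>T. escl (c b) (D.imgb b)) = 0" by (simp add: T(3) \<Phi>_simps \<Phi>_bas)
  then have "c b = 0" if "b \<in> T" for b using D.imgb_independent[OF T(1,2)] that by blast
  then have "x = 0" by (simp add: T(3))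
  then have "to_pm f = to_pm h" using xi(1) h(2) by simp
  then show ?thesis using fa.\<iota>_eqD[OF _ f(1) Irel_carrier[OF h(1)]] h(1) by simp
qed

section \<open>The quotient algebra\<close>

abbreviation B :: "(complex, (Bgen list \<Rightarrow> complex) set) module" where "B \<equiv> B_alg n \<mu> (- t) \<gamma>"

definition q :: "(Bgen list \<Rightarrow> complex) \<Rightarrow> (Bgen list \<Rightarrow> complex) set" where "q f = Irel +>\<^bsub>F\<^esub> f"

lemma q_mem: "f \<in> carrier F \<Longrightarrow> f \<in> q f" "f \<in> carrier F \<Longrightarrow> h \<in> q f \<Longrightarrow> h \<in> carrier F \<and> \<Psi> h = \<Psi> f"
proof -
  show "f \<in> carrier F \<Longrightarrow> f \<in> q f" unfolding q_def by (rule I.a_rcos_self)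
  assume f: "f \<in> carrier F" "h \<in> q f"
  then obtain i where i: "i \<in> Irel" "h = i \<oplus>\<^bsub>F\<^esub> f" by (auto simp: q_def a_r_coset_def')
  show "h \<in> carrier F \<and> \<Psi> h = \<Psi> f"
    using i f Irel_carrier Irel_kill by (simp add: \<Psi>_simps fa.a_closed)
qed

text \<open>As the kernel is the ideal of relations, an equation between classes can be checked on
  images. The scalar action on the quotient and the generation by V_l and s_i are verified in this
  way.\<close>

lemma q_eq_iff: "f \<in> carrier F \<Longrightarrow> h \<in> carrier F \<Longrightarrow> q f = q h \<longleftrightarrow> \<Psi> f = \<Psi> h"
proof
  assume fh: "f \<in> carrier F" "h \<in> carrier F"
  show "q f = q h \<Longrightarrow> \<Psi> f = \<Psi> h" using q_mem fh by metis
  assume "\<Psi> f = \<Psi> h"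
  then have "\<Psi> (f \<ominus>\<^bsub>F\<^esub> h) = 0" using fh by (simp add: \<Psi>_simps)
  then have "f \<ominus>\<^bsub>F\<^esub> h \<in> Irel" using fh by (intro kernel fa.minus_closed)
  then show "q f = q h" unfolding q_def using fh fa.quotient_eq_iff_same_a_r_cos[OF ideal_Irel] by blast
qed

lemma B_carrier: "Z \<in> carrier B \<longleftrightarrow> (\<exists>f\<in>carrier F. Z = q f)"
  by (auto simp: B_alg_def presented_alg_def quot_alg_def ring.defs module.defs FactRing_def A_RCOSETS_def' q_def)

lemma B_ops:
  assumes "f \<in> carrier F" "h \<in> carrier F"
  shows "q f \<otimes>\<^bsub>B\<^esub> q h = q (f \<otimes>\<^bsub>F\<^esub> h)" "q f \<oplus>\<^bsub>B\<^esub> q h = q (f \<oplus>\<^bsub>F\<^esub> h)" "\<one>\<^bsub>B\<^esub> = q \<one>\<^bsub>F\<^esub>"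
    "c \<odot>\<^bsub>B\<^esub> q f = q (c \<odot>\<^bsub>F\<^esub> f)"
proof -
  show "q f \<otimes>\<^bsub>B\<^esub> q h = q (f \<otimes>\<^bsub>F\<^esub> h)"
    using I.rcoset_mult_add[OF assms]
    by (simp add: B_alg_def presented_alg_def quot_alg_def ring.defs module.defs FactRing_def q_def)
  show "q f \<oplus>\<^bsub>B\<^esub> q h = q (f \<oplus>\<^bsub>F\<^esub> h)"
    using I.a_rcos_sum[OF assms]
    by (simp add: B_alg_def presented_alg_def quot_alg_def ring.defs module.defs FactRing_def q_def)
  show "\<one>\<^bsub>B\<^esub> = q \<one>\<^bsub>F\<^esub>"
    by (simp add: B_alg_def presented_alg_def quot_alg_def ring.defs module.defs FactRing_def q_def)
  have "c \<odot>\<^bsub>B\<^esub> q f = (\<Union>x\<in>q f. q (c \<odot>\<^bsub>F\<^esub> x))"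
    by (simp add: B_alg_def presented_alg_def quot_alg_def ring.defs module.defs FactRing_def q_def)
  \<comment> \<open>The scalar action on cosets is a union over all representatives; the cosets
    united here all coincide.\<close>
  also have "\<dots> = (\<Union>x\<in>q f. q (c \<odot>\<^bsub>F\<^esub> f))"
  proof (rule SUP_cong[OF refl])
    fix x assume "x \<in> q f"
    then show "q (c \<odot>\<^bsub>F\<^esub> x) = q (c \<odot>\<^bsub>F\<^esub> f)"
      using q_mem(2)[OF assms(1)] assms(1) by (subst q_eq_iff) (auto simp: fa.smult_in \<Psi>_simps)
  qed
  also have "\<dots> = q (c \<odot>\<^bsub>F\<^esub> f)" using q_mem(1)[OF assms(1)] by blast
  finally show "c \<odot>\<^bsub>B\<^esub> q f = q (c \<odot>\<^bsub>F\<^esub> f)" .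
qed

end

section \<open>The image and the isomorphism\<close>

context gdaha_setup
begin

abbreviation T :: "nat \<Rightarrow> 'a" where "T \<equiv> T_elt n t0 u0 tn un A r X"
abbreviation H :: "(complex, 'a) module" where "H \<equiv> H_alg n t0 u0 tn un A r X"

lemma H_simps: "carrier H = alg_gen A (X ` {1..n} \<union> T ` {0..n})"
  "x \<otimes>\<^bsub>H\<^esub> y = x \<otimes> y" "x \<oplus>\<^bsub>H\<^esub> y = x \<oplus> y" "\<one>\<^bsub>H\<^esub> = \<one>" "c \<odot>\<^bsub>H\<^esub> x = c \<odot> x"
  by (simp_all add: H_alg_def)

lemma T_elt: "i \<le> n \<Longrightarrow> T i \<in> carrier A" "\<iota> (T 0) = D.T0" "\<iota> (T n) = D.Tn" "1 \<le> i \<Longrightarrow> i < n \<Longrightarrow> T i = r i"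
proof -
  show mid: "1 \<le> i \<Longrightarrow> i < n \<Longrightarrow> T i = r i" for i by (simp add: T_elt_def)
  let ?e = "\<lambda>a b i. a \<odot> \<one> \<oplus> (1/2) \<odot> (((a - b) \<odot> \<one> \<oplus> peval n A X (coroot n i)) \<otimes> (r i \<ominus> \<one>))"
  have e: "?e a b i \<in> carrier A" "\<iota> (?e a b i) = escl a 1 + escl (1/2) ((escl (a - b) 1 + pe (coroot n i)) * (re i - 1))"
    if "i \<le> n" for a b i
  proof -
    have c: "(a - b) \<odot> \<one> \<oplus> peval n A X (coroot n i) \<in> carrier A" "r i \<ominus> \<one> \<in> carrier A"
      using that peval_in smult_in_A by auto
    then have c': "((a - b) \<odot> \<one> \<oplus> peval n A X (coroot n i)) \<otimes> (r i \<ominus> \<one>) \<in> carrier A" by simp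
    show "?e a b i \<in> carrier A" using c' smult_in_A by simp
    show "\<iota> (?e a b i) = escl a 1 + escl (1/2) ((escl (a - b) 1 + pe (coroot n i)) * (re i - 1))"
      using c c' smult_in_A peval_in that by (simp add: rep.\<iota>_simps \<iota>_peval re_def)
  qed
  have T0: "T 0 = ?e t0 u0 0" and Tn: "T n = ?e tn un n" using n2 by (simp_all add: T_elt_def)
  show "i \<le> n \<Longrightarrow> T i \<in> carrier A"
    using mid[of i] T0 Tn e(1)[of 0 t0 u0] e(1)[of n tn un] in_A(1)[of i]
    by (cases "i = 0"; cases "i = n") auto
  have c: "pe (coroot n 0) = escl (1/2) 1 - Xe 1" "pe (coroot n n) = Xe n"
    using n2 pe_simps(1)[of 1] pe_simps(1)[of n] by (auto simp: coroot_def pe_diff pe_simps(4))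
  show "\<iota> (T 0) = D.T0"
    unfolding T0 e(2)[OF le0] c D.T0_def by (simp add: algebra_simps)
  show "\<iota> (T n) = D.Tn"
    unfolding Tn e(2)[OF order_refl] c D.Tn_def by simp
qed

lemma duals: "T0_dual n t0 u0 tn un A r X \<in> carrier A" "\<iota> (T0_dual n t0 u0 tn un A r X) = D.T0v"
  "Tn_dual n t0 u0 tn un A r X \<in> carrier A" "\<iota> (Tn_dual n t0 u0 tn un A r X) = D.Tnv"
proof -
  have c: "X 1 \<in> carrier A" "X n \<in> carrier A" "T 0 \<in> carrier A" "T n \<in> carrier A" "(1/2) \<odot> \<one> \<in> carrier A"
    using n2 T_elt(1) smult_in_A by auto
  show "T0_dual n t0 u0 tn un A r X \<in> carrier A" "Tn_dual n t0 u0 tn un A r X \<in> carrier A"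
    unfolding T0_dual_def Tn_dual_def using c by (simp_all del: One_nat_def)
  show "\<iota> (T0_dual n t0 u0 tn un A r X) = D.T0v" "\<iota> (Tn_dual n t0 u0 tn un A r X) = D.Tnv"
    unfolding T0_dual_def Tn_dual_def D.T0v_def D.Tnv_def using c T_elt(2,3)
    by (simp_all add: rep.\<iota>_simps Xe_def del: One_nat_def)
qed

lemma sandwich:
  assumes y: "y \<in> carrier A" "D.stab_comm n (\<iota> y)"
  shows "T_sandwich n A T y \<in> carrier A" "\<iota> (T_sandwich n A T y) = D.copy n (\<iota> y) 1"
proof -
  let ?l = "map T [1..<n] @ [y] @ map T (rev [1..<n])"
  have l: "set ?l \<subseteq> carrier A" using y T_elt(1) by auto
  show "T_sandwich n A T y \<in> carrier A" unfolding T_sandwich_def by (rule mprod_in_A[OF l])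
  have m: "map \<iota> (map T [1..<n]) = map re [1..<n]" "map \<iota> (map T (rev [1..<n])) = map re (rev [1..<n])"
    using T_elt(4) by (auto simp: re_def)
  have "\<iota> (T_sandwich n A T y) = prod_list (map \<iota> ?l)"
    unfolding T_sandwich_def by (rule rep.\<iota>_mprod[OF l])
  also have "\<dots> = D.rw [1..<n] * \<iota> y * D.rw (rev [1..<n])"
    by (simp only: map_append list.map prod_list.append prod_list.Cons prod_list.Nil m D.rw_def mult_1_right mult.assoc)
  finally show "\<iota> (T_sandwich n A T y) = D.copy n (\<iota> y) 1" using D.sandwich[OF y(2)] by simp
qed

lemma Xis: "Xi n t0 u0 tn un A r X \<in> carrier A" "\<iota> (Xi n t0 u0 tn un A r X) = D.Vc 1 3"
  "Xi_dual n t0 u0 tn un A r X \<in> carrier A" "\<iota> (Xi_dual n t0 u0 tn un A r X) = D.Vc 1 4"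
  using sandwich[of "T n"] sandwich[of "Tn_dual n t0 u0 tn un A r X"] T_elt(1,3) duals D.stab_Tn D.stab_Tnv
  by (simp_all add: Xi_def Xi_dual_def D.Vc_def D.TT_def D.base_def)

lemma V_images:
  "\<iota> (T 0 \<oplus> (\<gamma> 1 + t0) \<odot> \<one>) = D.VE 1 1"
  "\<iota> (T0_dual n t0 u0 tn un A r X \<oplus> (\<gamma> 2 + u0) \<odot> \<one>) = D.VE 1 2"
  "\<iota> (Xi n t0 u0 tn un A r X \<oplus> (\<gamma> 3 + tn) \<odot> \<one>) = D.VE 1 3"
  "\<iota> (Xi_dual n t0 u0 tn un A r X \<oplus> (\<gamma> 4 + un) \<odot> \<one>) = D.VE 1 4"
proof -
  have s: "c \<odot> \<one> \<in> carrier A" for c using smult_in_A by simp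
  have v: "D.Vc 1 1 = D.T0" "D.Vc 1 2 = D.T0v"
    by (simp_all add: D.Vc_def D.TT_def D.base_def D.copy_self del: One_nat_def)
  show "\<iota> (T 0 \<oplus> (\<gamma> 1 + t0) \<odot> \<one>) = D.VE 1 1" "\<iota> (T0_dual n t0 u0 tn un A r X \<oplus> (\<gamma> 2 + u0) \<odot> \<one>) = D.VE 1 2"
    using s T_elt(1)[of 0] T_elt(2) duals(1,2)
    by (simp_all add: rep.\<iota>_simps D.VE_def v D.par_def del: One_nat_def)
  show "\<iota> (Xi n t0 u0 tn un A r X \<oplus> (\<gamma> 3 + tn) \<odot> \<one>) = D.VE 1 3"
    "\<iota> (Xi_dual n t0 u0 tn un A r X \<oplus> (\<gamma> 4 + un) \<odot> \<one>) = D.VE 1 4"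
    using s Xis by (simp_all add: rep.\<iota>_simps D.VE_def D.par_def del: One_nat_def)
qed

lemma H_in_A: "x \<in> carrier H \<Longrightarrow> x \<in> carrier A"
  unfolding H_simps
proof (induction rule: alg_gen.induct)
  case (incl x)
  then show ?case using T_elt(1) by auto
qed (use smult_in_A in auto)

definition HE :: "endo set" where "HE = \<iota> ` carrier H"

lemma HE_closed: "1 \<in> HE" "a \<in> HE \<Longrightarrow> b \<in> HE \<Longrightarrow> a + b \<in> HE" "a \<in> HE \<Longrightarrow> b \<in> HE \<Longrightarrow> a * b \<in> HE" "a \<in> HE \<Longrightarrow> escl c a \<in> HE"
proof -
  show "1 \<in> HE" unfolding HE_def H_simps using alg_gen.one rep.\<iota>_one by (metis imageI)
  show "escl c a \<in> HE" if a: "a \<in> HE"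
  proof -
    obtain x where x: "a = \<iota> x" "x \<in> carrier H" using a by (auto simp: HE_def)
    then have "escl c a = \<iota> (c \<odot> x)" using H_in_A by (simp add: rep.\<iota>_smult)
    moreover have "c \<odot> x \<in> carrier H" using x(2) unfolding H_simps by (rule alg_gen.smult)
    ultimately show ?thesis by (auto simp: HE_def)
  qed
  assume "a \<in> HE" "b \<in> HE"
  then obtain x y where xy: "a = \<iota> x" "b = \<iota> y" "x \<in> carrier H" "y \<in> carrier H" by (auto simp: HE_def)
  have "a + b = \<iota> (x \<oplus> y)" "a * b = \<iota> (x \<otimes> y)" using xy H_in_A by (simp_all add: rep.\<iota>_simps)
  moreover have "x \<oplus> y \<in> carrier H" "x \<otimes> y \<in> carrier H"
    using xy(3,4) unfolding H_simps by (auto intro: alg_gen.add alg_gen.mult)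
  ultimately show "a + b \<in> HE" "a * b \<in> HE" by (auto simp: HE_def)
qed

lemma HE_minus: "a \<in> HE \<Longrightarrow> b \<in> HE \<Longrightarrow> a - b \<in> HE"
  using HE_closed(2)[OF _ HE_closed(4)[of b "- 1"], of a] by simp

lemma HE_gens: "1 \<le> j \<Longrightarrow> j \<le> n \<Longrightarrow> Xe j \<in> HE" "1 \<le> i \<Longrightarrow> i < n \<Longrightarrow> re i \<in> HE" "D.T0 \<in> HE" "D.Tn \<in> HE"
proof -
  have T: "\<iota> (T i) \<in> HE" if "i \<le> n" for i
    unfolding HE_def H_simps using that by (intro imageI alg_gen.incl) auto
  show "1 \<le> j \<Longrightarrow> j \<le> n \<Longrightarrow> Xe j \<in> HE"
    unfolding HE_def H_simps Xe_def by (intro imageI alg_gen.incl) auto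
  show "1 \<le> i \<Longrightarrow> i < n \<Longrightarrow> re i \<in> HE" using T[of i] T_elt(4)[of i] by (simp add: re_def)
  show "D.T0 \<in> HE" "D.Tn \<in> HE" using T[of 0] T[of n] T_elt(2,3) by simp_all
qed

lemma HE_P: "\<pi> permutes {1..n} \<Longrightarrow> D.P \<pi> \<in> HE"
proof -
  assume \<pi>: "\<pi> permutes {1..n}"
  have "set u \<subseteq> {1..<n} \<Longrightarrow> D.rw u \<in> HE" for u
  proof (induction u)
    case (Cons i u)
    then show ?case using HE_closed(3)[OF HE_gens(2)[of i], of "D.rw u"] by auto
  qed (simp add: HE_closed)
  then show ?thesis using perm_word[OF \<pi>] by (simp add: D.P_def)
qed

lemma HE_VE: "i \<in> {1..n} \<Longrightarrow> l \<in> {1..4} \<Longrightarrow> D.VE i l \<in> HE"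
proof -
  assume i: "i \<in> {1..n}" and l: "l \<in> {1..4}"
  have "D.T0v \<in> HE" "D.Tnv \<in> HE"
    unfolding D.T0v_def D.Tnv_def using n2 HE_minus[OF HE_closed(4)[OF HE_gens(1)[of n], of "- 1"] HE_gens(4)]
    by (auto intro!: HE_minus HE_closed HE_gens)
  then have "D.TT l \<in> HE" using l HE_gens(3,4) unfolding D.idx by (auto simp: D.TT_def)
  moreover have "transpose (D.base l) i permutes {1..n}" using i D.base_in by (intro permutes_swap_id)
  ultimately show ?thesis
    unfolding D.VE_def D.Vc_def D.copy_def D.conjP_def by (intro HE_closed HE_P permutes_inv)
qed

lemma FP_induct:
  assumes "p \<in> FP" and "Q 0" "Q 1" and add: "\<And>a b. a \<in> FP \<Longrightarrow> b \<in> FP \<Longrightarrow> Q a \<Longrightarrow> Q b \<Longrightarrow> Q (a + b)"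
    and mult: "\<And>a b. a \<in> FP \<Longrightarrow> b \<in> FP \<Longrightarrow> Q a \<Longrightarrow> Q b \<Longrightarrow> Q (a * b)"
    and sc: "\<And>c a. a \<in> FP \<Longrightarrow> Q a \<Longrightarrow> Q (pscale c a)"
    and gens: "\<And>i l. i \<in> {1..n} \<Longrightarrow> l \<in> {1..4} \<Longrightarrow> Q (Vp i l)" "\<And>\<sigma>. \<sigma> permutes {1..n} \<Longrightarrow> Q (gp \<sigma>)"
  shows "Q p"
proof -
  have word: "G.ev w \<in> FP \<and> Q (G.ev w)" if "w \<in> lists (B_gens n)" for w
    using that
  proof (induction w)
    case Nil
    then show ?case using assms(3) FP_closed(5) by simp
  next
    case (Cons h w)
    then have "G.gen_val h \<in> FP \<and> Q (G.gen_val h)"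
      using gens FP_closed(7,8) by (cases h) (auto simp: B_gens_def)
    then show ?case using Cons mult FP_closed(3) by auto
  qed
  have sum: "sum f K \<in> FP \<and> Q (sum f K)" if "finite K" "\<And>k. k \<in> K \<Longrightarrow> f k \<in> FP \<and> Q (f k)" for f and K :: "Bgen list set"
    using that
    by (induction K rule: finite_induct) (auto simp: assms(2) add FP_closed(1,6))
  have mono: "pscale (Poly_Mapping.lookup p k) (Poly_Mapping.single k 1) \<in> FP \<and>
      Q (pscale (Poly_Mapping.lookup p k) (Poly_Mapping.single k 1))" if k: "k \<in> Poly_Mapping.keys p" for k
  proof -
    have "k \<in> lists (B_gens n)" using k assms(1) unfolding FP_def by blast
    from word[OF this] show ?thesis unfolding single_ev using FP_closed(4) sc by blast
  qed
  let ?f = "\<lambda>k. pscale (Poly_Mapping.lookup p k) (Poly_Mapping.single k 1)"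
  have "Q (sum ?f (Poly_Mapping.keys p))" using sum[of "Poly_Mapping.keys p" ?f] mono finite_keys by blast
  then show ?thesis using poly_mapping_expand'[of p] by (simp only:)
qed

text \<open>For the inclusion of the image of H, \<open>T0\<close> and \<open>Tn\<close> are
  unshifted images of V_(1,1) and V_(n,3), the latter because the copy at its own base is the
  element itself. The first variable is \<open>T0 + T0v + 1/2\<close>, and the other variables
  follow from it by the reflections.\<close>

lemma \<Psi>_image: "\<Psi> ` carrier F = HE"
proof
  have "\<Phi> p \<in> HE" if "p \<in> FP" for p
    using that
  proof (rule FP_induct[where Q = "\<lambda>p. \<Phi> p \<in> HE"])
    show "\<Phi> 0 \<in> HE" using HE_closed(4)[OF HE_closed(1), of 0] by (simp add: \<Phi>_simps)
  qed (simp_all only: \<Phi>_simps HE_closed HE_VE HE_P)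
  then show "\<Psi> ` carrier F \<subseteq> HE" using FP_to_pm by (auto simp: \<Psi>_def)
  let ?Q = "\<Psi> ` carrier F"
  have Q: "a \<in> ?Q \<Longrightarrow> b \<in> ?Q \<Longrightarrow> a + b \<in> ?Q" "a \<in> ?Q \<Longrightarrow> b \<in> ?Q \<Longrightarrow> a - b \<in> ?Q" "a \<in> ?Q \<Longrightarrow> b \<in> ?Q \<Longrightarrow> a * b \<in> ?Q" "a \<in> ?Q \<Longrightarrow> escl c a \<in> ?Q" "1 \<in> ?Q" for a b c
  proof -
    show "escl c a \<in> ?Q" if a: "a \<in> ?Q"
    proof -
      obtain f where f: "a = \<Psi> f" "f \<in> carrier F" using a by blast
      have "escl c a = \<Psi> (c \<odot>\<^bsub>F\<^esub> f)" unfolding f(1) by (rule \<Psi>_simps(5)[OF f(2), symmetric])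
      moreover have "c \<odot>\<^bsub>F\<^esub> f \<in> carrier F" by (rule fa.smult_in[OF f(2)])
      ultimately show ?thesis by (simp only: imageI)
    qed
    show "1 \<in> ?Q" using fa.one_closed[where S = "B_gens n"] \<Psi>_simps(6) by (metis imageI)
    assume "a \<in> ?Q" "b \<in> ?Q"
    then obtain f h where fh: "a = \<Psi> f" "b = \<Psi> h" "f \<in> carrier F" "h \<in> carrier F" by auto
    show "a + b \<in> ?Q" "a - b \<in> ?Q" "a * b \<in> ?Q"
      using fh fa.a_closed[OF fh(3,4)] fa.minus_closed[OF fh(3,4)] fa.m_closed[OF fh(3,4)]
        \<Psi>_simps(1-3)[OF fh(3,4)] by (metis imageI)+
  qed
  have VQ: "D.VE i l \<in> ?Q" if "i \<in> {1..n}" "l \<in> {1..4}" for i l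
    using gens_in_B(1)[OF that] \<Psi>_simps(8) by (metis imageI)
  have PQ: "D.P \<sigma> \<in> ?Q" if "\<sigma> permutes {1..n}" for \<sigma>
    using gens_in_B(2)[OF that] \<Psi>_simps(9) by (metis imageI)
  have rQ: "re i \<in> ?Q" if "1 \<le> i" "i < n" for i
    using PQ[of "transpose i (Suc i)"] D.P_adj[OF that] that by (auto simp: permutes_swap_id)
  have VcQ: "D.Vc i l \<in> ?Q" if "i \<in> {1..n}" "l \<in> {1..4}" for i l
    using Q(2)[OF VQ[OF that] Q(4)[OF Q(5), of "\<gamma> l + D.par l"]] by (simp add: D.VE_def)
  have v: "D.Vc 1 1 = D.T0" "D.Vc 1 2 = D.T0v" "D.Vc n 3 = D.Tn"
    by (simp_all add: D.Vc_def D.TT_def D.base_def D.copy_self del: One_nat_def)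
  have TQ: "D.T0 \<in> ?Q" "D.T0v \<in> ?Q" "D.Tn \<in> ?Q"
    using VcQ[of 1 1] VcQ[of 1 2] VcQ[of n 3] n2 unfolding v by auto
  have X1: "Xe 1 \<in> ?Q"
  proof -
    have "Xe 1 = D.T0 + D.T0v + escl (1/2) 1" by (simp add: D.T0v_def)
    then show ?thesis using TQ Q by (auto simp only:)
  qed
  have XQ: "1 \<le> j \<Longrightarrow> j \<le> n \<Longrightarrow> Xe j \<in> ?Q" for j
  proof (induction j rule: dec_induct)
    case base
    show ?case by (rule X1)
  next
    case (step j)
    then have j: "1 \<le> j" "j < n" by auto
    \<comment> \<open>Solved for the next variable, the cross-relation gives a recursion that starts
      at \<open>Xe 1\<close>.\<close>
    have "re j * Xe j * re j = Xe (Suc j) - escl t (re j)"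
      using D.ri_Xi[OF j] D.rel_sq[of j] j by (simp add: left_diff_distrib mult.assoc en.scl_left)
    then have "Xe (Suc j) = re j * Xe j * re j + escl t (re j)" by simp
    moreover have "Xe j \<in> ?Q" using step j by simp
    ultimately show ?case using rQ[OF j] Q by (auto simp only:)
  qed
  have "\<iota> x \<in> ?Q" if "x \<in> alg_gen A (X ` {1..n} \<union> T ` {0..n})" for x
    using that
  proof (induction rule: alg_gen.induct)
    case one
    then show ?case using Q(5) by (simp only: rep.\<iota>_one)
  next
    case (incl x)
    then consider j where "j \<in> {1..n}" "x = X j" | i where "i \<le> n" "x = T i" by auto
    then show ?case
    proof cases
      case 1
      then show ?thesis using XQ[of j] by (simp add: Xe_def)
    next
      case 2
      then consider "i = 0" | "i = n" | "1 \<le> i" "i < n" by linarith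
      then show ?thesis
        using 2 TQ T_elt(2,3) T_elt(4)[of i] rQ[of i] by cases (simp_all add: re_def)
    qed
  next
    case (add x y)
    then show ?case using Q(1) H_in_A[unfolded H_simps] by (simp add: rep.\<iota>_simps)
  next
    case (mult x y)
    then show ?case using Q(3) H_in_A[unfolded H_simps] by (simp add: rep.\<iota>_simps)
  next
    case (smult x c)
    then show ?case using Q(4) H_in_A[unfolded H_simps] by (simp add: rep.\<iota>_simps)
  qed
  then show "HE \<subseteq> ?Q" unfolding HE_def H_simps by auto
qed

section \<open>The isomorphism, its values on generators and its uniqueness\<close>

definition \<phi> :: "(Bgen list \<Rightarrow> complex) set \<Rightarrow> 'a" where
  "\<phi> Z = inv_into (carrier H) \<iota> (\<Psi> (SOME f. f \<in> Z))"

lemma \<phi>_q: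
  assumes "f \<in> carrier F"
  shows "\<phi> (q f) \<in> carrier H" "\<iota> (\<phi> (q f)) = \<Psi> f"
proof -
  have "(SOME h. h \<in> q f) \<in> q f" using someI[of "\<lambda>h. h \<in> q f", OF q_mem(1)[OF assms]] .
  then have 1: "\<Psi> (SOME h. h \<in> q f) = \<Psi> f" using q_mem(2)[OF assms] by blast
  have "\<Psi> f \<in> \<iota> ` carrier H" using \<Psi>_image assms by (auto simp: HE_def)
  then show "\<phi> (q f) \<in> carrier H" "\<iota> (\<phi> (q f)) = \<Psi> f"
    unfolding \<phi>_def 1 by (auto intro: inv_into_into f_inv_into_f)
qed

text \<open>The value of \<phi> is pinned down by its image under the faithful representation; every
  homomorphism property and every assignment of the theorem is reduced to an equation there.\<close>

lemma \<phi>_eqI: "f \<in> carrier F \<Longrightarrow> y \<in> carrier A \<Longrightarrow> \<iota> y = \<Psi> f \<Longrightarrow> \<phi> (q f) = y"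
  using \<phi>_q[of f] H_in_A[of "\<phi> (q f)"] rep.\<iota>_eqD[of "\<phi> (q f)" y] by simp

lemma B_closed:
  "Z \<in> carrier B \<Longrightarrow> Y \<in> carrier B \<Longrightarrow> Z \<oplus>\<^bsub>B\<^esub> Y \<in> carrier B"
  "Z \<in> carrier B \<Longrightarrow> Y \<in> carrier B \<Longrightarrow> Z \<otimes>\<^bsub>B\<^esub> Y \<in> carrier B"
  "Z \<in> carrier B \<Longrightarrow> c \<odot>\<^bsub>B\<^esub> Z \<in> carrier B" "\<one>\<^bsub>B\<^esub> \<in> carrier B"
proof -
  show "Z \<in> carrier B \<Longrightarrow> c \<odot>\<^bsub>B\<^esub> Z \<in> carrier B" using B_ops(4) fa.smult_in unfolding B_carrier by metis
  show "\<one>\<^bsub>B\<^esub> \<in> carrier B" using B_ops(3) fa.one_closed unfolding B_carrier by metis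
  assume "Z \<in> carrier B" "Y \<in> carrier B"
  then obtain f h where "Z = q f" "Y = q h" "f \<in> carrier F" "h \<in> carrier F" by (auto simp: B_carrier)
  then show "Z \<oplus>\<^bsub>B\<^esub> Y \<in> carrier B" "Z \<otimes>\<^bsub>B\<^esub> Y \<in> carrier B"
    using B_ops(1,2)[of f h] fa.a_closed[of f "B_gens n" h] fa.m_closed[of f "B_gens n" h] unfolding B_carrier by auto
qed

lemma \<phi>_iso: "\<phi> \<in> alg_iso B H"
proof -
  have "\<phi> \<in> ring_hom B H"
  proof (rule ring_hom_memI)
    fix Z assume "Z \<in> carrier B"
    then obtain f where f: "Z = q f" "f \<in> carrier F" by (auto simp: B_carrier)
    then show "\<phi> Z \<in> carrier H" using \<phi>_q by simp
    fix Y assume "Y \<in> carrier B"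
    then obtain h where h: "Y = q h" "h \<in> carrier F" by (auto simp: B_carrier)
    have c: "\<phi> (q f) \<in> carrier A" "\<phi> (q h) \<in> carrier A" using \<phi>_q f h H_in_A by auto
    show "\<phi> (Z \<otimes>\<^bsub>B\<^esub> Y) = \<phi> Z \<otimes>\<^bsub>H\<^esub> \<phi> Y"
      unfolding f(1) h(1) B_ops(1)[OF f(2) h(2)] H_simps
      using f h c \<phi>_q by (intro \<phi>_eqI) (simp_all add: rep.\<iota>_simps \<Psi>_simps)
    show "\<phi> (Z \<oplus>\<^bsub>B\<^esub> Y) = \<phi> Z \<oplus>\<^bsub>H\<^esub> \<phi> Y"
      unfolding f(1) h(1) B_ops(2)[OF f(2) h(2)] H_simps
      using f h c \<phi>_q by (intro \<phi>_eqI) (simp_all add: rep.\<iota>_simps \<Psi>_simps)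
  next
    show "\<phi> \<one>\<^bsub>B\<^esub> = \<one>\<^bsub>H\<^esub>"
      unfolding B_ops(3)[OF fa.one_closed fa.one_closed] H_simps
      by (intro \<phi>_eqI) (simp_all add: rep.\<iota>_simps \<Psi>_simps)
  qed
  moreover have "\<phi> (c \<odot>\<^bsub>B\<^esub> Z) = c \<odot>\<^bsub>H\<^esub> \<phi> Z" if Z: "Z \<in> carrier B" for c Z
  proof -
    obtain f where f: "Z = q f" "f \<in> carrier F" using Z by (auto simp: B_carrier)
    then have "\<phi> (q f) \<in> carrier A" using \<phi>_q H_in_A by auto
    then show ?thesis
      unfolding f(1) B_ops(4)[OF f(2) f(2)] H_simps
      using f \<phi>_q smult_in_A by (intro \<phi>_eqI fa.smult_in) (simp_all add: rep.\<iota>_simps \<Psi>_simps)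
  qed
  moreover have "bij_betw \<phi> (carrier B) (carrier H)"
    unfolding bij_betw_def
  proof
    show "inj_on \<phi> (carrier B)"
    proof
      fix Z Y assume "Z \<in> carrier B" "Y \<in> carrier B" and eq: "\<phi> Z = \<phi> Y"
      then obtain f h where fh: "Z = q f" "Y = q h" "f \<in> carrier F" "h \<in> carrier F" by (auto simp: B_carrier)
      then have "\<Psi> f = \<Psi> h" using \<phi>_q(2) eq by metis
      then show "Z = Y" using q_eq_iff fh by simp
    qed
    show "\<phi> ` carrier B = carrier H"
    proof
      show "\<phi> ` carrier B \<subseteq> carrier H" using \<phi>_q by (auto simp: B_carrier)
      show "carrier H \<subseteq> \<phi> ` carrier B"
      proof
        fix y assume y: "y \<in> carrier H"
        then have "\<iota> y \<in> \<Psi> ` carrier F" unfolding \<Psi>_image HE_def by simp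
        then obtain f where f: "f \<in> carrier F" "\<iota> y = \<Psi> f" by auto
        then have "\<phi> (q f) = y" using y H_in_A by (intro \<phi>_eqI)
        then show "y \<in> \<phi> ` carrier B" using f B_carrier by blast
      qed
    qed
  qed
  ultimately show ?thesis unfolding alg_iso_def alg_hom_def by blast
qed

definition VB :: "nat \<Rightarrow> (Bgen list \<Rightarrow> complex) set" where "VB = B_V n \<mu> (- t) \<gamma> 1"
definition sB :: "nat \<Rightarrow> (Bgen list \<Rightarrow> complex) set" where "sB i = B_s n \<mu> (- t) \<gamma> i (i + 1)"

lemma B_gen_q: "VB l = q (fgen (GV 1 l))" "sB i = q (fgen (GS (transpose i (Suc i))))"
  by (simp_all add: VB_def sB_def B_V_def B_s_def presented_gen_def q_def)

lemma sB_in: "i \<in> {1..n-1} \<Longrightarrow> fgen (GS (transpose i (Suc i))) \<in> carrier F"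
  by (intro transpose_in_B) auto

lemma VB_in: "l \<in> {1..4} \<Longrightarrow> fgen (GV 1 l) \<in> carrier F"
  using n2 by (intro gens_in_B) auto

lemma \<phi>_sB: "i \<in> {1..n-1} \<Longrightarrow> \<phi> (sB i) = T i"
  unfolding B_gen_q using D.P_adj[of i] T_elt(1)[of i] T_elt(4)[of i]
  by (intro \<phi>_eqI sB_in) (auto simp: \<Psi>_simps re_def)

lemma \<phi>_VB:
  "\<phi> (VB 1) = T 0 \<oplus> (\<gamma> 1 + t0) \<odot> \<one>"
  "\<phi> (VB 2) = T0_dual n t0 u0 tn un A r X \<oplus> (\<gamma> 2 + u0) \<odot> \<one>"
  "\<phi> (VB 3) = Xi n t0 u0 tn un A r X \<oplus> (\<gamma> 3 + tn) \<odot> \<one>"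
  "\<phi> (VB 4) = Xi_dual n t0 u0 tn un A r X \<oplus> (\<gamma> 4 + un) \<odot> \<one>"
  unfolding B_gen_q using V_images T_elt(1)[of 0] duals(1) Xis(1,3) smult_in_A
  by (auto intro!: \<phi>_eqI VB_in simp: \<Psi>_simps simp del: One_nat_def)

definition gensB :: "(Bgen list \<Rightarrow> complex) set set" where "gensB = VB ` {1..4} \<union> sB ` {1..n-1}"

text \<open>Adjacent transpositions generate the symmetric group, and V_(i,l) is the conjugate of
  V_(1,l) by the transposition of 1 and i. Both identities between classes are read off from the
  images under \<Psi>.\<close>

lemma gensB_generate: "alg_gen B gensB = carrier B"
proof
  show "alg_gen B gensB \<subseteq> carrier B"
  proof
    fix Z assume "Z \<in> alg_gen B gensB"
    then show "Z \<in> carrier B"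
    proof (induction rule: alg_gen.induct)
      case (incl Z)
      then show ?case using VB_in sB_in unfolding gensB_def B_gen_q B_carrier by blast
    qed (auto intro: B_closed)
  qed
  have mult: "q (f \<otimes>\<^bsub>F\<^esub> h) \<in> alg_gen B gensB" if "f \<in> carrier F" "h \<in> carrier F" "q f \<in> alg_gen B gensB" "q h \<in> alg_gen B gensB" for f h
    using alg_gen.mult[OF that(3,4)] B_ops(1)[OF that(1,2)] by simp
  have id: "fgen (GS id) \<in> carrier F" by (intro gens_in_B permutes_id)
  have perm: "q (fgen (GS \<sigma>)) \<in> alg_gen B gensB" if "\<sigma> permutes {1..n}" for \<sigma>
    using that
  proof (induction rule: permutes_adjacent_induct)
    case id
    have "q (fgen (GS id)) = \<one>\<^bsub>B\<^esub>"
      unfolding B_ops(3)[OF fa.one_closed fa.one_closed]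
      by (subst q_eq_iff) (simp_all only: id \<open>fgen (GS id) \<in> carrier F\<close> fa.one_closed \<Psi>_simps D.P_id)
    then show ?case by (simp only: alg_gen.one)
  next
    case (swap i \<sigma>)
    let ?s = "transpose i (Suc i)"
    have s: "?s permutes {1..n}" using swap by (intro permutes_swap_id) auto
    have "q (fgen (GS (?s \<circ> \<sigma>))) = q (fgen (GS ?s) \<otimes>\<^bsub>F\<^esub> fgen (GS \<sigma>))"
      by (subst q_eq_iff) (simp_all only: gens_in_B s swap.hyps permutes_compose[OF _ s] fa.m_closed \<Psi>_simps D.P_mult)
    moreover have "q (fgen (GS ?s)) \<in> alg_gen B gensB"
      using swap.hyps B_gen_q(2)[of i] by (intro alg_gen.incl) (auto simp: gensB_def)
    ultimately show ?case using mult[OF gens_in_B(2)[OF s] gens_in_B(2)[OF swap.hyps(3)]] swap.IH by (simp only:)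
  qed
  have V: "q (fgen (GV i l)) \<in> alg_gen B gensB" if "i \<in> {1..n}" "l \<in> {1..4}" for i l
  proof -
    let ?s = "transpose 1 i"
    have s: "?s permutes {1..n}" using that n2 by (intro permutes_swap_id) auto
    have one: "(1::nat) \<in> {1..n}" using n2 by auto
    let ?sV = "fgen (GS ?s) \<otimes>\<^bsub>F\<^esub> fgen (GV 1 l)"
    have c: "?sV \<in> carrier F" "?sV \<otimes>\<^bsub>F\<^esub> fgen (GS ?s) \<in> carrier F"
      by (intro fa.m_closed gens_in_B s one that)+
    have "D.P ?s * D.VE 1 l * D.P ?s = D.VE i l * (D.P ?s * D.P ?s)"
      using P_VE[OF s one that(2)] by (simp add: mult.assoc)
    also have "D.P ?s * D.P ?s = 1" using D.P_mult[OF s s] by simp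
    finally have "\<Psi> (fgen (GV i l)) = \<Psi> (?sV \<otimes>\<^bsub>F\<^esub> fgen (GS ?s))"
      using c(1) gens_in_B(2)[OF s] gens_in_B(1)[OF one that(2)] by (simp add: \<Psi>_simps)
    then have "q (fgen (GV i l)) = q (?sV \<otimes>\<^bsub>F\<^esub> fgen (GS ?s))"
      using q_eq_iff[OF gens_in_B(1)[OF that] c(2)] by blast
    moreover have "q (fgen (GV 1 l)) \<in> alg_gen B gensB"
      unfolding B_gen_q(1)[symmetric] using that(2) by (intro alg_gen.incl) (auto simp: gensB_def)
    ultimately show ?thesis
      using mult[OF c(1) gens_in_B(2)[OF s] mult[OF gens_in_B(2)[OF s] gens_in_B(1)[OF one that(2)] perm[OF s]] perm[OF s]]
      by simp
  qed
  have all: "q (Poly_Mapping.lookup p) \<in> alg_gen B gensB" if "p \<in> FP" for p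
    using that
  proof (rule FP_induct[where Q = "\<lambda>p. q (Poly_Mapping.lookup p) \<in> alg_gen B gensB"])
    have one: "q (Poly_Mapping.lookup 1) = \<one>\<^bsub>B\<^esub>"
      using B_ops(3)[OF fa.one_closed fa.one_closed] by (simp only: free_alg_simps)
    then show "q (Poly_Mapping.lookup 1) \<in> alg_gen B gensB" by (simp only: alg_gen.one)
    have sc: "q (Poly_Mapping.lookup (pscale c a)) = c \<odot>\<^bsub>B\<^esub> q (Poly_Mapping.lookup a)" if "a \<in> FP" for a c
    proof -
      have "Poly_Mapping.lookup a \<in> carrier F" using that unfolding in_F FP_def by simp
      from B_ops(4)[OF this this, of c] show ?thesis by (simp only: free_alg_simps)
    qed
    show "q (Poly_Mapping.lookup (pscale c a)) \<in> alg_gen B gensB" if "a \<in> FP" "q (Poly_Mapping.lookup a) \<in> alg_gen B gensB" for c a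
      unfolding sc[OF that(1)] by (rule alg_gen.smult[OF that(2)])
    have "pscale 0 1 = (0 :: Bgen list \<Rightarrow>\<^sub>0 complex)" by simp
    then have "q (Poly_Mapping.lookup 0) = 0 \<odot>\<^bsub>B\<^esub> q (Poly_Mapping.lookup 1)"
      using sc[OF FP_closed(5), of 0] by (simp only:)
    then show "q (Poly_Mapping.lookup 0) \<in> alg_gen B gensB"
      by (simp only: one) (intro alg_gen.smult alg_gen.one)
    fix a b assume ab: "a \<in> FP" "b \<in> FP" "q (Poly_Mapping.lookup a) \<in> alg_gen B gensB" "q (Poly_Mapping.lookup b) \<in> alg_gen B gensB"
    then have c: "Poly_Mapping.lookup a \<in> carrier F" "Poly_Mapping.lookup b \<in> carrier F" unfolding in_F FP_def by auto
    show "q (Poly_Mapping.lookup (a * b)) \<in> alg_gen B gensB"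
      using mult[OF c ab(3,4)] by (simp only: free_alg_simps)
    show "q (Poly_Mapping.lookup (a + b)) \<in> alg_gen B gensB"
      using alg_gen.add[OF ab(3,4)] B_ops(2)[OF c] by (simp only: free_alg_simps)
  next
    fix i l :: nat assume "i \<in> {1..n}" "l \<in> {1..4}"
    then show "q (Poly_Mapping.lookup (Vp i l)) \<in> alg_gen B gensB"
      using V[of i l] by (simp only: Vp_def fgen_lookup)
  next
    fix \<sigma> assume "\<sigma> permutes {1..n}"
    then show "q (Poly_Mapping.lookup (gp \<sigma>)) \<in> alg_gen B gensB"
      using perm[of \<sigma>] by (simp only: gp_def fgen_lookup)
  qed
  show "carrier B \<subseteq> alg_gen B gensB"
  proof
    fix Z assume "Z \<in> carrier B"
    then obtain f where f: "Z = q f" "f \<in> carrier F" by (auto simp: B_carrier)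
    then show "Z \<in> alg_gen B gensB"
      using all[OF FP_to_pm[OF f(2)]] lookup_to_pm[of f "lists (B_gens n)"] by (simp add: free_alg_simps(1))
  qed
qed

lemma hom_unique:
  assumes \<psi>: "\<psi> \<in> alg_hom B H" and eq: "\<And>Z. Z \<in> gensB \<Longrightarrow> \<psi> Z = \<phi> Z" and Z: "Z \<in> carrier B"
  shows "\<psi> Z = \<phi> Z"
proof -
  have \<phi>: "\<phi> \<in> alg_hom B H" using \<phi>_iso by (simp add: alg_iso_def)
  have h: "h (a \<otimes>\<^bsub>B\<^esub> b) = h a \<otimes>\<^bsub>H\<^esub> h b" "h (a \<oplus>\<^bsub>B\<^esub> b) = h a \<oplus>\<^bsub>H\<^esub> h b" "h \<one>\<^bsub>B\<^esub> = \<one>\<^bsub>H\<^esub>"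
    "h (c \<odot>\<^bsub>B\<^esub> a) = c \<odot>\<^bsub>H\<^esub> h a"
    if "h \<in> alg_hom B H" "a \<in> alg_gen B gensB" "b \<in> alg_gen B gensB" for h a b c
    using that unfolding gensB_generate alg_hom_def
    by (auto simp: ring_hom_mult ring_hom_add ring_hom_one)
  have "Z \<in> alg_gen B gensB" using Z by (simp add: gensB_generate)
  then show ?thesis
  proof (induction rule: alg_gen.induct)
    case one
    show ?case using h(3)[OF \<psi> alg_gen.one alg_gen.one] h(3)[OF \<phi> alg_gen.one alg_gen.one] by simp
  next
    case (incl Z)
    then show ?case by (rule eq)
  next
    case (add x y)
    then show ?case using h(2)[OF \<psi> add.hyps] h(2)[OF \<phi> add.hyps] by simp
  next
    case (mult x y)
    then show ?case using h(1)[OF \<psi> mult.hyps] h(1)[OF \<phi> mult.hyps] by simp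
  next
    case (smult x c)
    then show ?case using h(4)[OF \<psi> smult.hyps smult.hyps] h(4)[OF \<phi> smult.hyps smult.hyps] by simp
  qed
qed

end

theorem theorem3p19:
  fixes n :: nat
    and t0 u0 t tn un :: complex
    and \<gamma> :: "nat \<Rightarrow> complex"
    and A :: "(complex, 'a) module"
    and r X :: "nat \<Rightarrow> 'a"
  assumes "n \<ge> 2"
    and "\<gamma> 1 + \<gamma> 2 + \<gamma> 3 + \<gamma> 4 = mu_par t0 u0 tn un 0"
    and "trig_daha A n (k_par n t0 u0 t tn un) r X"
  shows
    "let B = B_alg n (mu_par t0 u0 tn un) (- t) \<gamma>;
         V = B_V n (mu_par t0 u0 tn un) (- t) \<gamma> 1;
         s = (\<lambda>i. B_s n (mu_par t0 u0 tn un) (- t) \<gamma> i (i + 1));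
         H = H_alg n t0 u0 tn un A r X;
         T = T_elt n t0 u0 tn un A r X;
         assigns = (\<lambda>\<phi>.
             (\<forall>i\<in>{1..n-1}. \<phi> (s i) = T i)
           \<and> \<phi> (V 1) = T 0 \<oplus>\<^bsub>H\<^esub> (\<gamma> 1 + t0) \<odot>\<^bsub>H\<^esub> \<one>\<^bsub>H\<^esub>
           \<and> \<phi> (V 2) = T0_dual n t0 u0 tn un A r X \<oplus>\<^bsub>H\<^esub> (\<gamma> 2 + u0) \<odot>\<^bsub>H\<^esub> \<one>\<^bsub>H\<^esub>
           \<and> \<phi> (V 3) = Xi n t0 u0 tn un A r X \<oplus>\<^bsub>H\<^esub> (\<gamma> 3 + tn) \<odot>\<^bsub>H\<^esub> \<one>\<^bsub>H\<^esub>
           \<and> \<phi> (V 4) = Xi_dual n t0 u0 tn un A r X \<oplus>\<^bsub>H\<^esub> (\<gamma> 4 + un) \<odot>\<^bsub>H\<^esub> \<one>\<^bsub>H\<^esub>)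
     in alg_gen B (V ` {1..4} \<union> s ` {1..n-1}) = carrier B
      \<and> (\<exists>\<phi>\<in>alg_iso B H. assigns \<phi>
            \<and> (\<forall>\<psi>\<in>alg_hom B H. assigns \<psi> \<longrightarrow> (\<forall>x\<in>carrier B. \<psi> x = \<phi> x)))"
proof -
  interpret trig_daha A n "k_par n t0 u0 t tn un" r X by (rule assms(3))
  interpret S: gdaha_setup A n t0 u0 t tn un r X \<gamma>
    by unfold_locales (rule assms)+
  have idx: "l \<in> {1..4::nat} \<longleftrightarrow> l = 1 \<or> l = 2 \<or> l = 3 \<or> l = 4" for l by auto
  have 1: "alg_gen S.B (S.VB ` {1..4} \<union> S.sB ` {1..n-1}) = carrier S.B"
    using S.gensB_generate unfolding S.gensB_def .
  have 2: "\<psi> Z = S.\<phi> Z"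
    if "\<psi> \<in> alg_hom S.B S.H" "Z \<in> carrier S.B" "\<forall>i\<in>{1..n-1}. \<psi> (S.sB i) = S.T i"
      "\<psi> (S.VB 1) = S.\<phi> (S.VB 1)" "\<psi> (S.VB 2) = S.\<phi> (S.VB 2)" "\<psi> (S.VB 3) = S.\<phi> (S.VB 3)" "\<psi> (S.VB 4) = S.\<phi> (S.VB 4)"
    for \<psi> Z
  proof (rule S.hom_unique[OF that(1) _ that(2)])
    fix Z assume "Z \<in> S.gensB"
    then consider l where "l \<in> {1..4}" "Z = S.VB l" | i where "i \<in> {1..n-1}" "Z = S.sB i"
      unfolding S.gensB_def by blast
    then show "\<psi> Z = S.\<phi> Z"
    proof cases
      case 1
      then show ?thesis using that(4-7) unfolding idx by blast
    next
      case 2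
      then show ?thesis using that(3) S.\<phi>_sB by simp
    qed
  qed
  have sB: "S.sB = (\<lambda>i. B_s n (mu_par t0 u0 tn un) (- t) \<gamma> i (i + 1))"
    by (rule ext) (rule S.sB_def)
  let ?assigns = "\<lambda>\<psi>. (\<forall>i\<in>{1..n-1}. \<psi> (S.sB i) = S.T i)
      \<and> \<psi> (S.VB 1) = S.T 0 \<oplus>\<^bsub>A\<^esub> (\<gamma> 1 + t0) \<odot>\<^bsub>A\<^esub> \<one>\<^bsub>A\<^esub>
      \<and> \<psi> (S.VB 2) = T0_dual n t0 u0 tn un A r X \<oplus>\<^bsub>A\<^esub> (\<gamma> 2 + u0) \<odot>\<^bsub>A\<^esub> \<one>\<^bsub>A\<^esub>
      \<and> \<psi> (S.VB 3) = Xi n t0 u0 tn un A r X \<oplus>\<^bsub>A\<^esub> (\<gamma> 3 + tn) \<odot>\<^bsub>A\<^esub> \<one>\<^bsub>A\<^esub>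
      \<and> \<psi> (S.VB 4) = Xi_dual n t0 u0 tn un A r X \<oplus>\<^bsub>A\<^esub> (\<gamma> 4 + un) \<odot>\<^bsub>A\<^esub> \<one>\<^bsub>A\<^esub>"
  have 3: "?assigns S.\<phi>" by (intro conjI ballI S.\<phi>_VB S.\<phi>_sB)
  have 4: "\<forall>\<psi>\<in>alg_hom S.B S.H. ?assigns \<psi> \<longrightarrow> (\<forall>x\<in>carrier S.B. \<psi> x = S.\<phi> x)"
  proof (intro ballI impI)
    fix \<psi> x assume "\<psi> \<in> alg_hom S.B S.H" "?assigns \<psi>" "x \<in> carrier S.B"
    then show "\<psi> x = S.\<phi> x" by (elim conjE) (rule 2; simp only: S.\<phi>_VB)
  qed
  have "alg_gen S.B (S.VB ` {1..4} \<union> S.sB ` {1..n-1}) = carrier S.B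
      \<and> (\<exists>\<phi>\<in>alg_iso S.B S.H. ?assigns \<phi>
            \<and> (\<forall>\<psi>\<in>alg_hom S.B S.H. ?assigns \<psi> \<longrightarrow> (\<forall>x\<in>carrier S.B. \<psi> x = \<phi> x)))"
    by (intro conjI[OF 1] bexI[of _ S.\<phi>] conjI[OF 3 4] S.\<phi>_iso)
  then show ?thesis
    unfolding Let_def S.H_simps(3-5) S.VB_def sB .
qed

end
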